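(* Assume that $f\in L^\infty(\mathbb{T}^2)\cap H^{1}(\mathbb{T}^2)$. Then the global attractor $\mathcal{A}$ of the multivalued dynamical system $\{S(t)\}_{t\ge0}$ on $L^2(\mathbb{T}^2)$ generated by the vanishing viscosity solutions of the forced critical SQG equation with forcing $f$ is a bounded set of $H^{3/2}(\mathbb{T}^2)$.
   Context: All functions on $\mathbb{T}^2=(-\pi,\pi)^2$ are $2\pi$-periodic in both variables and have zero mean; $L^2,L^\infty,H^\sigma$ denote the corresponding spaces of such functions, and $C^\infty$ the smooth ones. $\mathbb{Z}^2_*=\mathbb{Z}^2\setminus\{0\}$, $\|\phi\|_{H^\sigma}^2=\sum_{k\in\mathbb{Z}^2_*}|k|^{2\sigma}|\widehat\phi_k|^2$, $\Lambda^\sigma=(-\Delta)^{\sigma/2}$ is the Fourier multiplier $|k|^\sigma$, $\Lambda=\Lambda^1$, and $\mathcal{R}^\perp=\nabla^\perp\Lambda^{-1}=(-\partial_{x_2}\Lambda^{-1},\partial_{x_1}\Lambda^{-1})$. $\langle\cdot,\cdot\rangle$ is the $L^2$ scalar product (or $H^{-\sigma}$–$H^{\sigma}$ duality). $C_w([0,T];L^2)$ denotes weakly continuous functions. Critical SQG equation, with time-independent mean-free force $f$: $\partial_t\theta+\mathbf{u}\cdot\nabla\theta+\Lambda\theta=f$, $\mathbf{u}=\mathcal{R}^\perp\theta$, $\theta(0)=\theta_0$. Weak solution: $\theta\in L^2_{loc}(0,\infty;H^{1/2})\cap C_w([0,\infty);L^2)$ (here $L^2_{loc}$ means $L^2(0,T;H^{1/2})$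 for every $T>0$) such that for all $\varphi\in C^\infty_0([0,\infty);C^\infty)$ and all $T>0$, $$-\int_0^T\langle\theta,\partial_t\varphi\rangle dt-\langle\theta_0,\varphi(0)\rangle+\langle\theta(T),\varphi(T)\rangle-\int_0^T\langle\theta,\mathbf{u}\cdot\nabla\varphi\rangle dt+\int_0^T\langle\Lambda^{1/2}\theta,\Lambda^{1/2}\varphi\rangle dt=\int_0^T\langle f,\varphi\rangle dt.$$ Vanishing viscosity solution: a weak solution $\theta$ for which there exist $\varepsilon_n\searrow0$ and solutions $\theta^{\varepsilon_n}$ on $[0,\infty)$ of $\partial_t\theta^{\varepsilon}-\varepsilon\Delta\theta^{\varepsilon}+\mathcal{R}^\perp\theta^{\varepsilon}\cdot\nabla\theta^{\varepsilon}+\Lambda\theta^{\varepsilon}=f$ with $\varepsilon=\varepsilon_n$ (understood in the usual energy sense, $\theta^\varepsilon\in C([0,\infty);L^2)\cap L^2(0,T;H^1)$ for all $T>0$) such that $\theta^{\varepsilon_n}\to\theta$ in $C_w([0,T];L^2)$ for every $T>0$ and $\theta^{\varepsilon_n}(0)\to\theta(0)$ strongly in $L^2$. $S(t)\theta_0=\{\theta(t):\theta\text{ is a vanishing viscosity solution with }\theta(0)=\theta_0\}$ for $\theta_0\in L^2$, and $S(t)B=\bigcup_{x\in B}S(t)x$. $\mathrm{dist}_{L^2}(A,B)=\sup_{x\in A}\inf_{y\in B}\|x-y\|_{L^2}$. The global attractor is the (unique) compact set $\mathcal{A}\subset L^2$ with $S(t)\mathcal{A}=\mathcal{A}$ for all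 $t\ge0$ and $\mathrm{dist}_{L^2}(S(t)B,\mathcal{A})\to0$ as $t\to\infty$ for every bounded nonempty $B\subset L^2$; it exists whenever $f\in L^\infty\cap H^{1/2}$. *)

theory Defs
  imports "HOL-Analysis.Analysis"
begin

section \<open>The Hilbert space of mean-free square-integrable functions on the torus\<close>

definition torus :: "(real \<times> real) set" where
  "torus = {-pi<..<pi} \<times> {-pi<..<pi}"

definition L2_fun :: "(real \<times> real \<Rightarrow> real) \<Rightarrow> bool" where
  "L2_fun g \<longleftrightarrow> g \<in> borel_measurable (lebesgue_on torus)
     \<and> integrable (lebesgue_on torus) (\<lambda>x. (g x)\<^sup>2)
     \<and> (LINT x|lebesgue_on torus. g x) = 0"

definition L2_eq :: "(real \<times> real \<Rightarrow> real) \<Rightarrow> (real \<times> real \<Rightarrow> real) \<Rightarrow> bool" where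
  "L2_eq g h \<longleftrightarrow> L2_fun g \<and> L2_fun h \<and> (AE x in lebesgue_on torus. g x = h x)"

lemma L2_fun_zero: "L2_fun (\<lambda>x. 0)"
  by (simp add: L2_fun_def)

lemma part_equivp_L2_eq: "part_equivp L2_eq"
proof (rule part_equivpI)
  show "\<exists>g. L2_eq g g"
    by (rule exI[of _ "\<lambda>x. 0"]) (simp add: L2_eq_def L2_fun_zero)
  show "symp L2_eq"
    by (auto simp: symp_def L2_eq_def elim: eventually_mono)
  show "transp L2_eq"
    unfolding transp_def L2_eq_def
  proof (intro allI impI conjI; elim conjE)
    fix f g h :: "real \<times> real \<Rightarrow> real"
    assume "AE x in lebesgue_on torus. f x = g x" "AE x in lebesgue_on torus. g x = h x"
    then show "AE x in lebesgue_on torus. f x = h x"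
      by eventually_elim simp
  qed
qed

text \<open>Only values on the open fundamental domain \<^const>\<open>torus\<close> enter, so a class stands
  for the periodic extension of its representatives.\<close>

quotient_type L2 = "real \<times> real \<Rightarrow> real" / partial: L2_eq
  by (rule part_equivp_L2_eq)

lemma finite_measure_torus: "finite_measure (lebesgue_on torus)"
proof
  have "torus \<in> lmeasurable"
    unfolding torus_def
    by (intro lmeasurable_open bounded_Times open_Times
        bounded_subset[OF bounded_closed_interval greaterThanLessThan_subseteq_atLeastAtMost_iff[THEN iffD2]]) auto
  then show "emeasure (lebesgue_on torus) (space (lebesgue_on torus)) \<noteq> \<infinity>"
    by (simp add: emeasure_restrict_space fmeasurableD fmeasurableD2 del: emeasure_completion)
qed

lemma L2_fun_measurable:
  "L2_fun g \<Longrightarrow> g \<in> borel_measurable (lebesgue_on torus)"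
  by (simp add: L2_fun_def)

lemma L2_fun_integrable:
  assumes "L2_fun g" shows "integrable (lebesgue_on torus) g"
  using assms unfolding L2_fun_def
  by (blast intro: finite_measure.square_integrable_imp_integrable[OF finite_measure_torus])

lemma L2_fun_mult_integrable:
  assumes "L2_fun g" "L2_fun h" shows "integrable (lebesgue_on torus) (\<lambda>x. g x * h x)"
proof (rule Bochner_Integration.integrable_bound)
  show "integrable (lebesgue_on torus) (\<lambda>x. (g x)\<^sup>2 + (h x)\<^sup>2)"
    using assms by (simp add: L2_fun_def)
  show "(\<lambda>x. g x * h x) \<in> borel_measurable (lebesgue_on torus)"
    by (intro borel_measurable_times L2_fun_measurable assms)
  have "\<bar>a * b\<bar> \<le> a\<^sup>2 + b\<^sup>2" for a b :: real
  proof -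
    have "2 * (\<bar>a\<bar> * \<bar>b\<bar>) \<le> a\<^sup>2 + b\<^sup>2"
      using sum_squares_bound[of "\<bar>a\<bar>" "\<bar>b\<bar>"] by (simp add: mult.assoc)
    moreover have "0 \<le> \<bar>a\<bar> * \<bar>b\<bar>" by simp
    ultimately show ?thesis unfolding abs_mult by linarith
  qed
  then show "AE x in lebesgue_on torus. norm (g x * h x) \<le> norm ((g x)\<^sup>2 + (h x)\<^sup>2)"
    by simp
qed

lemma L2_fun_add:
  assumes "L2_fun g" "L2_fun h" shows "L2_fun (\<lambda>x. g x + h x)"
proof -
  have "integrable (lebesgue_on torus) (\<lambda>x. (g x)\<^sup>2 + (h x)\<^sup>2 + 2 * (g x * h x))"
    using assms L2_fun_mult_integrable[OF assms] by (simp add: L2_fun_def)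
  then have "integrable (lebesgue_on torus) (\<lambda>x. (g x + h x)\<^sup>2)"
    by (simp add: power2_sum mult.assoc)
  with assms L2_fun_integrable[OF assms(1)] L2_fun_integrable[OF assms(2)] show ?thesis
    by (simp add: L2_fun_def)
qed

lemma L2_fun_scale:
  assumes "L2_fun g" shows "L2_fun (\<lambda>x. c * g x)"
  using assms borel_measurable_times[OF borel_measurable_const, of g "lebesgue_on torus" c]
  by (simp add: L2_fun_def power_mult_distrib)

instantiation L2 :: real_inner
begin

lift_definition zero_L2 :: L2 is "\<lambda>x. 0"
  by (simp add: L2_eq_def L2_fun_zero)

lift_definition plus_L2 :: "L2 \<Rightarrow> L2 \<Rightarrow> L2" is "\<lambda>g h x. g x + h x"
  by (auto simp: L2_eq_def L2_fun_add elim: eventually_elim2)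

lift_definition scaleR_L2 :: "real \<Rightarrow> L2 \<Rightarrow> L2" is "\<lambda>c g x. c * g x"
  by (auto simp: L2_eq_def L2_fun_scale elim: eventually_mono)

lift_definition inner_L2 :: "L2 \<Rightarrow> L2 \<Rightarrow> real"
  is "\<lambda>g h. LINT x|lebesgue_on torus. g x * h x"
proof -
  fix g g' h h' assume "L2_eq g g'" "L2_eq h h'"
  then have m: "L2_fun g" "L2_fun g'" "L2_fun h" "L2_fun h'"
    and "AE x in lebesgue_on torus. g x = g' x" "AE x in lebesgue_on torus. h x = h' x"
    by (auto simp: L2_eq_def)
  from this(5,6) have "AE x in lebesgue_on torus. g x * h x = g' x * h' x"
    by eventually_elim simp
  with m show "(LINT x|lebesgue_on torus. g x * h x) = (LINT x|lebesgue_on torus. g' x * h' x)"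
    by (intro integral_cong_AE borel_measurable_times L2_fun_measurable)
qed

definition uminus_L2 :: "L2 \<Rightarrow> L2" where "- a = (- 1) *\<^sub>R (a :: L2)"
definition minus_L2 :: "L2 \<Rightarrow> L2 \<Rightarrow> L2" where "a - b = a + - (b :: L2)"
definition norm_L2 :: "L2 \<Rightarrow> real" where "norm a = sqrt (inner a (a :: L2))"
definition sgn_L2 :: "L2 \<Rightarrow> L2" where "sgn a = inverse (norm a) *\<^sub>R (a :: L2)"
definition dist_L2 :: "L2 \<Rightarrow> L2 \<Rightarrow> real" where "dist a b = norm (a - (b :: L2))"
definition uniformity_L2 :: "(L2 \<times> L2) filter" where
  "uniformity = (INF e\<in>{0 <..}. principal {(a :: L2, b). dist a b < e})"
definition open_L2 :: "L2 set \<Rightarrow> bool" where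
  "open U \<longleftrightarrow> (\<forall>a\<in>U. \<forall>\<^sub>F (a' :: L2, b) in uniformity. a' = a \<longrightarrow> b \<in> U)"

instance
proof
  fix a b c :: L2 and r s :: real and U :: "L2 set"
  show "a + b + c = a + (b + c)"
    by transfer (auto simp: L2_eq_def L2_fun_add add.assoc)
  show "a + b = b + a"
    by transfer (auto simp: L2_eq_def L2_fun_add add.commute)
  show "0 + a = a"
    by transfer (auto simp: L2_eq_def)
  show "- a + a = 0"
    unfolding uminus_L2_def
    by transfer (auto simp: L2_eq_def L2_fun_zero)
  show "a - b = a + - b"
    by (simp add: minus_L2_def)
  show "r *\<^sub>R (a + b) = r *\<^sub>R a + r *\<^sub>R b"
    by transfer (auto simp: L2_eq_def L2_fun_add L2_fun_scale distrib_left)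
  show "(r + s) *\<^sub>R a = r *\<^sub>R a + s *\<^sub>R a"
    by transfer (auto simp: L2_eq_def L2_fun_add L2_fun_scale distrib_right)
  show "r *\<^sub>R s *\<^sub>R a = (r * s) *\<^sub>R a"
    by transfer (auto simp: L2_eq_def L2_fun_scale mult.assoc)
  show "1 *\<^sub>R a = a"
    by transfer (auto simp: L2_eq_def)
  show "dist a b = norm (a - b)" by (simp add: dist_L2_def)
  show "sgn a = inverse (norm a) *\<^sub>R a" by (simp add: sgn_L2_def)
  show "uniformity = (INF e\<in>{0 <..}. principal {(a, b :: L2). dist a b < e})"
    by (simp add: uniformity_L2_def)
  show "open U = (\<forall>a\<in>U. \<forall>\<^sub>F (a', b) in uniformity. a' = a \<longrightarrow> b \<in> U)"
    by (simp add: open_L2_def)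
  show "inner a b = inner b a"
    by transfer (simp add: mult.commute)
  show "inner (a + b) c = inner a c + inner b c"
    by transfer (simp add: L2_eq_def distrib_right L2_fun_mult_integrable)
  show "inner (r *\<^sub>R a) b = r * inner a b"
    by transfer (simp add: mult.assoc)
  show "0 \<le> inner a a"
    by transfer simp
  show "inner a a = 0 \<longleftrightarrow> a = 0"
  proof transfer
    fix g :: "real \<times> real \<Rightarrow> real" assume "L2_eq g g"
    then have g: "L2_fun g" by (simp add: L2_eq_def)
    have "(LINT x|lebesgue_on torus. g x * g x) = 0 \<longleftrightarrow> (AE x in lebesgue_on torus. g x * g x = 0)"
      by (rule integral_nonneg_eq_0_iff_AE) (use L2_fun_mult_integrable[OF g g] in auto)
    with g show "(LINT x|lebesgue_on torus. g x * g x) = 0 \<longleftrightarrow> L2_eq g (\<lambda>x. 0)"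
      by (simp add: L2_eq_def L2_fun_zero)
  qed
  show "norm a = sqrt (inner a a)" by (simp add: norm_L2_def)
qed

end

lemma L2_fun_rep: "L2_fun (rep_L2 a)"
  using Quotient3_rep_reflp[OF Quotient3_L2, of a] by (simp add: L2_eq_def)

lemma rep_abs_L2: "L2_fun g \<Longrightarrow> AE x in lebesgue_on torus. rep_L2 (abs_L2 g) x = g x"
  using rep_abs_rsp_left[OF Quotient3_L2, of g g] by (simp add: L2_eq_def)

definition Linfty :: "L2 set" where
  "Linfty = {a. \<exists>C. AE x in lebesgue_on torus. \<bar>rep_L2 a x\<bar> \<le> C}"


section \<open>Fourier coefficients, Sobolev spaces and Fourier multipliers\<close>

definition kabs :: "int \<times> int \<Rightarrow> real" where
  "kabs k = sqrt ((of_int (fst k))\<^sup>2 + (of_int (snd k))\<^sup>2)"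

text \<open>Normalised so that \<open>a = (\<Sum>k. fcoeff a k * exp (i k \<sqdot> x))\<close>.\<close>

definition fcoeff :: "L2 \<Rightarrow> int \<times> int \<Rightarrow> complex" where
  "fcoeff a k = (LINT x|lebesgue_on torus.
      complex_of_real (rep_L2 a x) * cis (- (of_int (fst k) * fst x + of_int (snd k) * snd x)))
      / complex_of_real ((2 * pi)\<^sup>2)"

definition sobolev :: "real \<Rightarrow> L2 set" where
  "sobolev \<sigma> = {a. (\<lambda>k. kabs k powr (2 * \<sigma>) * (cmod (fcoeff a k))\<^sup>2) summable_on (UNIV - {0})}"

definition sobolev_norm :: "real \<Rightarrow> L2 \<Rightarrow> real" where
  "sobolev_norm \<sigma> a =
     sqrt (\<Sum>\<^sub>\<infinity>k\<in>UNIV - {0}. kabs k powr (2 * \<sigma>) * (cmod (fcoeff a k))\<^sup>2)"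

text \<open>The description is proper whenever \<open>m\<close> has the symmetry \<open>m (- k) = cnj (m k)\<close> and
  \<open>(m k * fcoeff a k)\<close> is square-summable; otherwise the value is unspecified.\<close>

definition multiplier :: "(int \<times> int \<Rightarrow> complex) \<Rightarrow> L2 \<Rightarrow> L2" where
  "multiplier m a = (THE b. \<forall>k. k \<noteq> 0 \<longrightarrow> fcoeff b k = m k * fcoeff a k)"

definition Lam :: "real \<Rightarrow> L2 \<Rightarrow> L2" where
  "Lam \<sigma> = multiplier (\<lambda>k. complex_of_real (kabs k powr \<sigma>))"

definition D1 :: "L2 \<Rightarrow> L2" where
  "D1 = multiplier (\<lambda>k. \<i> * of_int (fst k))"

definition D2 :: "L2 \<Rightarrow> L2" where
  "D2 = multiplier (\<lambda>k. \<i> * of_int (snd k))"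

definition riesz_perp :: "L2 \<Rightarrow> L2 \<times> L2" where
  "riesz_perp a = (- D2 (Lam (- 1) a), D1 (Lam (- 1) a))"


section \<open>Functions of time\<close>

text \<open>Functions on \<open>[0,\<infinity>)\<close> are total functions whose values at negative times are irrelevant.\<close>

definition weakly_continuous_on :: "real set \<Rightarrow> (real \<Rightarrow> L2) \<Rightarrow> bool" where
  "weakly_continuous_on I \<theta> \<longleftrightarrow> (\<forall>g. continuous_on I (\<lambda>t. inner (\<theta> t) g))"

text \<open>Convergence in \<open>C\<^sub>w(I; L\<^sup>2)\<close>: uniform on \<open>I\<close> after pairing with each fixed \<open>g\<close>.\<close>

definition weakly_uniform_limit :: "real set \<Rightarrow> (nat \<Rightarrow> real \<Rightarrow> L2) \<Rightarrow> (real \<Rightarrow> L2) \<Rightarrow> bool" where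
  "weakly_uniform_limit I \<theta>s \<theta> \<longleftrightarrow>
     (\<forall>g. uniform_limit I (\<lambda>n t. inner (\<theta>s n t) g) (\<lambda>t. inner (\<theta> t) g) sequentially)"

text \<open>Membership in \<open>L\<^sup>2(0,T; H\<^sup>\<sigma>)\<close> for \<open>\<sigma> \<ge> 0\<close>.  By Pettis' theorem, for a function with values
  a.e. in the separable space \<open>H\<^sup>\<sigma>\<close>, weak measurability in \<open>L\<^sup>2\<close> is the same as strong
  measurability in \<open>H\<^sup>\<sigma>\<close>.\<close>

definition L2_time_sobolev :: "real \<Rightarrow> real \<Rightarrow> (real \<Rightarrow> L2) \<Rightarrow> bool" where
  "L2_time_sobolev T \<sigma> \<theta> \<longleftrightarrow>
     (\<forall>g. (\<lambda>t. inner (\<theta> t) g) \<in> borel_measurable (lebesgue_on {0<..<T}))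
     \<and> (AE t in lebesgue_on {0<..<T}. \<theta> t \<in> sobolev \<sigma>)
     \<and> integrable (lebesgue_on {0<..<T}) (\<lambda>t. (sobolev_norm \<sigma> (\<theta> t))\<^sup>2)"


section \<open>Test functions\<close>

text \<open>Space-time points are \<open>(t, x)\<close>.  Derivatives are taken within the closed half space
  \<open>t \<ge> 0\<close> (one-sided in time at \<open>t = 0\<close>), where the derivative within the set is unique.\<close>

definition spacetime :: "(real \<times> real \<times> real) set" where
  "spacetime = {0..} \<times> UNIV"

definition dir_deriv :: "real \<times> real \<times> real \<Rightarrow> (real \<times> real \<times> real \<Rightarrow> real)
    \<Rightarrow> real \<times> real \<times> real \<Rightarrow> real" where
  "dir_deriv v \<phi> z = frechet_derivative \<phi> (at z within spacetime) v"

primrec Ck :: "nat \<Rightarrow> (real \<times> real \<times> real \<Rightarrow> real) \<Rightarrow> bool" where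
  "Ck 0 \<phi> \<longleftrightarrow> continuous_on spacetime \<phi>"
| "Ck (Suc n) \<phi> \<longleftrightarrow> \<phi> differentiable_on spacetime \<and> (\<forall>v. Ck n (dir_deriv v \<phi>))"

text \<open>\<open>C\<^sub>0\<^sup>\<infinity>([0,\<infinity>); C\<^sup>\<infinity>)\<close>: a smooth map of time into the Frechet space of smooth periodic
  functions is the same as a jointly smooth function, periodic in space.  The support may
  contain \<open>t = 0\<close>.\<close>

definition test_function :: "(real \<times> real \<times> real \<Rightarrow> real) \<Rightarrow> bool" where
  "test_function \<phi> \<longleftrightarrow>
     (\<forall>n. Ck n \<phi>)
     \<and> (\<forall>t\<ge>0. \<forall>x y. \<phi> (t, x + 2 * pi, y) = \<phi> (t, x, y) \<and> \<phi> (t, x, y + 2 * pi) = \<phi> (t, x, y))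
     \<and> (\<forall>t\<ge>0. (LINT x|lebesgue_on torus. \<phi> (t, x)) = 0)
     \<and> (\<exists>R. \<forall>t\<ge>R. \<forall>x. \<phi> (t, x) = 0)"

definition slice :: "(real \<times> real \<times> real \<Rightarrow> real) \<Rightarrow> real \<Rightarrow> L2" where
  "slice \<phi> t = abs_L2 (\<lambda>x. \<phi> (t, x))"

abbreviation dt :: "(real \<times> real \<times> real \<Rightarrow> real) \<Rightarrow> real \<times> real \<times> real \<Rightarrow> real" where
  "dt \<equiv> dir_deriv (1, 0, 0)"

abbreviation dx1 :: "(real \<times> real \<times> real \<Rightarrow> real) \<Rightarrow> real \<times> real \<times> real \<Rightarrow> real" where
  "dx1 \<equiv> dir_deriv (0, 1, 0)"

abbreviation dx2 :: "(real \<times> real \<times> real \<Rightarrow> real) \<Rightarrow> real \<times> real \<times> real \<Rightarrow> real" where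
  "dx2 \<equiv> dir_deriv (0, 0, 1)"


section \<open>Weak and vanishing viscosity solutions\<close>

text \<open>\<open>\<langle>\<theta>(t), u(t) \<sqdot> \<nabla>\<phi>(t)\<rangle>\<close> with \<open>u = riesz_perp \<theta>\<close>.\<close>

definition transport_pairing :: "(real \<Rightarrow> L2) \<Rightarrow> (real \<times> real \<times> real \<Rightarrow> real) \<Rightarrow> real \<Rightarrow> real" where
  "transport_pairing \<theta> \<phi> t = (let u = riesz_perp (\<theta> t) in
     LINT x|lebesgue_on torus. rep_L2 (\<theta> t) x *
       (rep_L2 (fst u) x * dx1 \<phi> (t, x) + rep_L2 (snd u) x * dx2 \<phi> (t, x)))"

definition SQG_weak_lhs :: "L2 \<Rightarrow> (real \<Rightarrow> L2) \<Rightarrow> (real \<times> real \<times> real \<Rightarrow> real) \<Rightarrow> real \<Rightarrow> real" where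
  "SQG_weak_lhs \<theta>0 \<theta> \<phi> T =
     - (LINT t:{0..T}|lebesgue. inner (\<theta> t) (slice (dt \<phi>) t))
     - inner \<theta>0 (slice \<phi> 0) + inner (\<theta> T) (slice \<phi> T)
     - (LINT t:{0..T}|lebesgue. transport_pairing \<theta> \<phi> t)
     + (LINT t:{0..T}|lebesgue. inner (Lam (1/2) (\<theta> t)) (Lam (1/2) (slice \<phi> t)))"

definition weak_solution :: "L2 \<Rightarrow> L2 \<Rightarrow> (real \<Rightarrow> L2) \<Rightarrow> bool" where
  "weak_solution f \<theta>0 \<theta> \<longleftrightarrow>
     (\<forall>T>0. L2_time_sobolev T (1/2) \<theta>)
     \<and> weakly_continuous_on {0..} \<theta>
     \<and> (\<forall>\<phi> T. test_function \<phi> \<and> T > 0 \<longrightarrow>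
          SQG_weak_lhs \<theta>0 \<theta> \<phi> T = (LINT t:{0..T}|lebesgue. inner f (slice \<phi> t)))"

text \<open>In two dimensions a distributional solution in this class has \<open>\<partial>\<^sub>t \<theta> \<in> L\<^sup>2(0,T; H\<^sup>-\<^sup>1)\<close>
  and satisfies the energy equality, so the energy equality is not a separate requirement.\<close>

definition viscous_solution :: "real \<Rightarrow> L2 \<Rightarrow> (real \<Rightarrow> L2) \<Rightarrow> bool" where
  "viscous_solution \<epsilon> f \<theta> \<longleftrightarrow>
     continuous_on {0..} \<theta>
     \<and> (\<forall>T>0. L2_time_sobolev T 1 \<theta>)
     \<and> (\<forall>\<phi> T. test_function \<phi> \<and> T > 0 \<longrightarrow>
          SQG_weak_lhs (\<theta> 0) \<theta> \<phi> T
          + \<epsilon> * (LINT t:{0..T}|lebesgue. inner (D1 (\<theta> t)) (D1 (slice \<phi> t))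
                                      + inner (D2 (\<theta> t)) (D2 (slice \<phi> t)))
          = (LINT t:{0..T}|lebesgue. inner f (slice \<phi> t)))"

definition vanishing_viscosity_solution :: "L2 \<Rightarrow> L2 \<Rightarrow> (real \<Rightarrow> L2) \<Rightarrow> bool" where
  "vanishing_viscosity_solution f \<theta>0 \<theta> \<longleftrightarrow>
     weak_solution f \<theta>0 \<theta>
     \<and> (\<exists>\<epsilon> \<theta>s. decseq \<epsilon> \<and> (\<forall>n. \<epsilon> n > 0) \<and> \<epsilon> \<longlonglongrightarrow> 0
          \<and> (\<forall>n. viscous_solution (\<epsilon> n) f (\<theta>s n))
          \<and> (\<forall>T>0. weakly_uniform_limit {0..T} \<theta>s \<theta>)
          \<and> (\<lambda>n. \<theta>s n 0) \<longlonglongrightarrow> \<theta> 0)"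


section \<open>The multivalued dynamical system and its global attractor\<close>

definition SQG_flow :: "L2 \<Rightarrow> real \<Rightarrow> L2 set \<Rightarrow> L2 set" where
  "SQG_flow f t B =
     (\<Union>\<theta>0\<in>B. {\<theta> t | \<theta>. vanishing_viscosity_solution f \<theta>0 \<theta> \<and> \<theta> 0 = \<theta>0})"

text \<open>With values in \<^typ>\<open>ennreal\<close> the infimum over the empty set is \<open>\<infinity>\<close>, so the empty set
  attracts no nonempty set.\<close>

definition semidist :: "L2 set \<Rightarrow> L2 set \<Rightarrow> ennreal" where
  "semidist A B = (SUP x\<in>A. INF y\<in>B. ennreal (norm (x - y)))"

definition global_attractor :: "(real \<Rightarrow> L2 set \<Rightarrow> L2 set) \<Rightarrow> L2 set \<Rightarrow> bool" where
  "global_attractor S A \<longleftrightarrow>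
     compact A \<and> (\<forall>t\<ge>0. S t A = A)
     \<and> (\<forall>B. bounded B \<and> B \<noteq> {} \<longrightarrow> ((\<lambda>t. semidist (S t B) A) \<longlongrightarrow> 0) at_top)"

definition sobolev_bounded :: "real \<Rightarrow> L2 set \<Rightarrow> bool" where
  "sobolev_bounded \<sigma> A \<longleftrightarrow> A \<subseteq> sobolev \<sigma> \<and> (\<exists>C. \<forall>a\<in>A. sobolev_norm \<sigma> a \<le> C)"

end

theory Submission
  imports Defs "HOL-Probability.Probability" "HOL-Real_Asymp.Real_Asymp"
begin

text \<open>Since \<open>A = S(1) A\<close> is bounded in \<open>L\<^sup>2\<close> and finite sums of squared Fourier coefficients pass to weak
  limits, it suffices to bound \<open>\<Sum>\<^sub>k \<bar>k\<bar>\<^sup>3 \<bar>\<theta>\<^sub>k(1)\<bar>\<^sup>2\<close> for viscous solutions with \<open>\<parallel>\<theta>(0)\<parallel> \<le> R\<close>, uniformly in \<open>\<epsilon>\<close>.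

  For fixed \<open>\<epsilon>\<close> the Fourier coefficients solve a system of ordinary differential equations, and a parabolic
  bootstrap gives them a summable majorant. Hence the Fejer means of \<open>\<theta>\<close>, which are trigonometric
  polynomials, solve the equation up to an error that is small in \<open>l\<^sup>1\<close>, and the Fejer means of \<open>f\<close> are bounded
  by \<open>\<parallel>f\<parallel>\<^sub>\<infinity>\<close>.

  Write \<open>H\<^sub>s\<close> for the multiplier \<open>exp (- s\<^sup>2 \<bar>k\<bar>\<^sup>2)\<close>, an average of translations. Up to constants, \<open>\<Lambda>\<close> is the
  integral of \<open>(1 - H\<^sub>s) / s\<^sup>2\<close> and \<open>\<Lambda>\<^sup>-\<^sup>1\<close> that of \<open>H\<^sub>s\<close> over \<open>s > 0\<close>. At a maximum point of \<open>w\<close> with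
  value \<open>V\<close>, positivity of \<open>V - w\<close> bounds \<open>\<bar>\<nabla>H\<^sub>s w\<bar>\<close> by \<open>(V - H\<^sub>r w) / s\<close> with \<open>r = \<surd>2 s\<close>, so that the
  velocity of \<open>w\<close> is controlled by \<open>\<Lambda>w\<close> there. First-touch arguments then give an \<open>L\<^sup>\<infinity>\<close> bound \<open>M\<close>, and a
  Hoelder bound with an exponent proportional to \<open>1 / M\<close>. By the latter, the velocity produced by the scales
  \<open>s \<le> \<sigma>\<close> is small in \<open>L\<^sup>\<infinity>\<close>, and its contribution to the energy balance in \<open>H\<^sup>3\<^sup>/\<^sup>2\<close> is absorbed by the
  dissipation through \<open>\<parallel>\<nabla>g\<parallel>\<^sub>4\<^sup>2 \<le> 3 \<parallel>g\<parallel>\<^sub>\<infinity> \<parallel>\<nabla>\<^sup>2 g\<parallel>\<^sub>2\<close>; the contribution of the remaining, smooth velocity is of lower order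
  because transport is antisymmetric.\<close>

text \<open>The equation is critical: transport and dissipation both have order one, so neither
  dominates at small scales and smallness has to be produced. In the Hoelder estimate it comes from
  the exponent, because the gradient of the barrier carries a factor \<alpha>; in the energy
  estimate it comes from \<open>\<sigma> powr \<alpha>\<close>. Pointwise arguments need an equation
  that holds at every point for smooth functions. A sharp frequency cut-off would lose the sup bound
  of the force; the Fejer kernel is positive and keeps it. The price is a commutator in the
  nonlinearity, and the parabolic bootstrap serves to make it small. The constants of the bootstrap
  depend on \<epsilon> and on the solution, but they enter only the choice of \<open>n\<close>,
  never the final bound. Gaussians factor over the coordinates, so every kernel estimate reduces to
  one real variable, and no periodic kernel of \<Lambda> or its inverse has to be written down. All
  bounds start from the norm in \<open>L2\<close> alone; hence the powers of elapsed time in both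
  barriers and in the energy.\<close>

type_synonym coef = "int \<times> int \<Rightarrow> complex"

section \<open>Fourier analysis of mean-free square-integrable functions\<close>

abbreviation "TM \<equiv> lebesgue_on torus"
definition E :: "int \<times> int \<Rightarrow> real \<times> real \<Rightarrow> complex" where
  "E k x = cis (of_int (fst k) * fst x + of_int (snd k) * snd x)"

lemma E_0 [simp]: "E 0 x = 1" by (simp add: E_def)
lemma E_add: "E (k + j) x = E k x * E j x"
  by (simp add: E_def cis_mult algebra_simps)
lemma E_uminus: "E (- k) x = cnj (E k x)"
  by (simp add: E_def cis_cnj)
lemma norm_E [simp]: "cmod (E k x) = 1" by (simp add: E_def)
lemma E_shift: "E k (x + h) = E k x * E k h"
  by (simp add: E_def cis_mult algebra_simps)
lemma continuous_E [continuous_intros]: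
  "continuous_on S f \<Longrightarrow> continuous_on S (\<lambda>x. E k (f x))"
  unfolding E_def by (intro continuous_intros)

lemma torus_box: "torus = box (-pi, -pi) (pi, pi)"
  unfolding torus_def by (auto simp: box_def Basis_prod_def)
lemma torus_sets [measurable, simp]: "torus \<in> sets lebesgue"
  by (simp add: torus_box)
interpretation TM: finite_measure TM by (rule finite_measure_torus)

lemma borel_TM: "f \<in> borel_measurable borel \<Longrightarrow> f \<in> borel_measurable TM"
  by (intro measurable_restrict_space1 measurable_completion) simp

lemma continuous_TM: "continuous_on UNIV f \<Longrightarrow> f \<in> borel_measurable TM"
  by (intro borel_TM borel_measurable_continuous_onI)

lemma continuous_bounded_torus:
  fixes f :: "real \<times> real \<Rightarrow> 'a::real_normed_vector"
  assumes "continuous_on UNIV f" 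
  obtains B where "\<And>x. x \<in> torus \<Longrightarrow> norm (f x) \<le> B"
proof -
  have "compact (f ` cbox (-pi,-pi) (pi,pi))"
    by (intro compact_continuous_image continuous_on_subset[OF assms]) auto
  then obtain B where "\<forall>y\<in>f ` cbox (-pi,-pi) (pi,pi). norm y \<le> B"
    using compact_imp_bounded bounded_iff by metis
  then show ?thesis
    by (intro that[of B]) (auto simp: torus_box box_subset_cbox[THEN subsetD])
qed

lemma TM_integrable_continuous:
  fixes f :: "_ \<Rightarrow> 'a::{banach, second_countable_topology}"
  assumes "continuous_on UNIV f" shows "integrable TM f"
proof -
  obtain B where "\<And>x. x \<in> torus \<Longrightarrow> norm (f x) \<le> B"
    using continuous_bounded_torus[OF assms] by blast
  then show ?thesis
    by (intro TM.integrable_const_bound[of _ B] continuous_TM[OF assms]) auto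
qed

lemma TM_integral_iterated:
  fixes f :: "_ \<Rightarrow> 'a::euclidean_space"
  assumes "continuous_on UNIV f"
  shows "(LINT x|TM. f x) = integral {-pi..pi} (\<lambda>a. integral {-pi..pi} (\<lambda>b. f (a, b)))"
proof -
  have "(LINT x|TM. f x) = integral torus f"
    by (intro lebesgue_integral_eq_integral TM_integrable_continuous assms) simp
  also have "\<dots> = integral (cbox (-pi,-pi) (pi,pi)) f"
    unfolding torus_box by (rule integral_open_interval)
  also have "\<dots> = integral {-pi..pi} (\<lambda>a. integral {-pi..pi} (\<lambda>b. f (a, b)))"
    by (subst integral_prod_continuous) (auto intro: continuous_on_subset[OF assms])
  finally show ?thesis .
qed

lemma integral_cis_period:
  "integral {-pi..pi} (\<lambda>b. cis (of_int n * b)) = (if n = 0 then 2 * pi else 0)"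
proof (cases "n = 0")
  case False
  have "((\<lambda>b. cis (of_int n * b)) has_integral
     (cis (of_int n * pi) / (\<i> * of_int n) - cis (of_int n * (-pi)) / (\<i> * of_int n))) {-pi..pi}"
  proof (rule fundamental_theorem_of_calculus)
    fix x assume "x \<in> {-pi..pi}"
    have "((\<lambda>b. cis (of_int n * b) / (\<i> * of_int n)) has_vector_derivative
       (of_int n *\<^sub>R (\<i> * cis (of_int n * x)) / (\<i> * of_int n))) (at x within {-pi..pi})"
      unfolding has_vector_derivative_def
      using False by (auto intro!: derivative_eq_intros ext simp: scaleR_conv_of_real mult_ac)
    then show "((\<lambda>b. cis (of_int n * b) / (\<i> * of_int n)) has_vector_derivative cis (of_int n * x))
        (at x within {-pi..pi})" using False by (simp add: scaleR_conv_of_real)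
  qed simp
  moreover have "cis (of_int n * pi) = cis (of_int n * (-pi))"
    by (simp add: cis.code complex_eq_iff sin_times_pi_eq_0 mult.commute)
  ultimately show ?thesis using False by (simp add: integral_unique)
qed (simp add: scaleR_conv_of_real)

lemma integral_E: "(LINT x|TM. E k x) = (if k = 0 then (2 * pi)^2 else 0)"
proof -
  have "(LINT x|TM. E k x) = integral {-pi..pi} (\<lambda>a. integral {-pi..pi} (\<lambda>b. E k (a, b)))"
    by (intro TM_integral_iterated continuous_intros)
  also have "\<dots> = integral {-pi..pi} (\<lambda>a. cis (of_int (fst k) * a) * integral {-pi..pi} (\<lambda>b. cis (of_int (snd k) * b)))"
    unfolding E_def by (simp flip: cis_mult)
  also have "\<dots> = (if k = 0 then (2 * pi)^2 else 0)"
    by (simp only: integral_mult_left integral_cis_period)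
       (auto simp: prod_eq_iff power2_eq_square)
  finally show ?thesis .
qed

section \<open>Completeness of the characters \<open>E k\<close>\<close>

inductive trigp :: "(real \<times> real \<Rightarrow> complex) \<Rightarrow> bool" where
  E: "trigp (\<lambda>x. E k x)"
| scale: "trigp f \<Longrightarrow> trigp (\<lambda>x. c * f x)"
| add: "trigp f \<Longrightarrow> trigp g \<Longrightarrow> trigp (\<lambda>x. f x + g x)"

lemma trigp_const: "trigp (\<lambda>x. c)"
  using trigp.scale[OF trigp.E[of 0], of c] by simp

lemma trigp_mult: assumes "trigp f" "trigp g" shows "trigp (\<lambda>x. f x * g x)"
  using assms(1)
proof induction
  case (E k)
  from assms(2) show ?case
  proof induction
    case (E j)
    show ?case using trigp.E[of "k + j"] by (simp add: E_add)
  next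
    case (scale f c)
    from trigp.scale[OF this(2), of c] show ?case by (simp add: mult_ac)
  next
    case (add f g)
    from trigp.add[OF this(3,4)] show ?case by (simp add: distrib_left)
  qed
next
  case (scale f c)
  from trigp.scale[OF this(2), of c] show ?case by (simp add: mult_ac)
next
  case (add f g)
  from trigp.add[OF this(3,4)] show ?case by (simp add: distrib_right)
qed

lemma trigp_cos:
  "trigp (\<lambda>x. of_real (cos (fst x - a)))" "trigp (\<lambda>x. of_real (cos (snd x - a)))"
proof -
  have c: "of_real (cos (t - a)) = cis (-a) / 2 * cis t + cis a / 2 * cis (-t)" for t
    by (simp add: complex_eq_iff cos_diff field_simps)
  show "trigp (\<lambda>x. of_real (cos (fst x - a)))"
    unfolding c
    using trigp.add[OF trigp.scale[OF trigp.E[of "(1,0)"], of "cis (-a) / 2"]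
        trigp.scale[OF trigp.E[of "(-1,0)"], of "cis a / 2"]]
    by (simp add: E_def)
  show "trigp (\<lambda>x. of_real (cos (snd x - a)))"
    unfolding c
    using trigp.add[OF trigp.scale[OF trigp.E[of "(0,1)"], of "cis (-a) / 2"]
        trigp.scale[OF trigp.E[of "(0,-1)"], of "cis a / 2"]]
    by (simp add: E_def)
qed

text \<open>Lets Weierstrass approximation on the square [-1,1]^2 act through the map x -> (cos (x1
  - a), cos (x2 - b)), so that periodicity need not be handled separately. The shifts will be the
  centres of boxes.\<close>

lemma trigp_polynomial:
  assumes "real_polynomial_function p"
  shows "trigp (\<lambda>x. of_real (p (cos (fst x - a), cos (snd x - b))))"
  using assms
proof induction
  case (linear f)
  interpret bounded_linear f by fact
  have f: "f (cos t, cos u) = cos t * f (1, 0) + cos u * f (0, 1)" for t u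
  proof -
    have "f (cos t, cos u) = f (cos t *\<^sub>R (1, 0) + cos u *\<^sub>R (0, 1))" by simp
    then show ?thesis by (simp only: add scaleR real_scaleR_def)
  qed
  show ?case
    unfolding f of_real_add of_real_mult
    using trigp.add[OF trigp.scale[OF trigp_cos(1)[of a], of "of_real (f (1,0))"]
        trigp.scale[OF trigp_cos(2)[of b], of "of_real (f (0,1))"]]
    by (simp only: mult.commute)
next
  case (const c)
  show ?case by (rule trigp_const)
next
  case (add f g)
  from trigp.add[OF add.IH] show ?case by simp
next
  case (mult f g)
  from trigp_mult[OF mult.IH] show ?case by simp
qed

lemma TM_mult_integrable:
  fixes g :: "real \<times> real \<Rightarrow> 'a::{banach, real_normed_field, second_countable_topology}"
  assumes "integrable TM g" "continuous_on UNIV p" 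
  shows "integrable TM (\<lambda>x. g x * p x)"
proof -
  obtain B where B: "\<And>x. x \<in> torus \<Longrightarrow> norm (p x) \<le> B"
    using continuous_bounded_torus[OF assms(2)] by blast
  show ?thesis
  proof (rule Bochner_Integration.integrable_bound)
    show "integrable TM (\<lambda>x. B * norm (g x))" using assms(1) by simp
    show "(\<lambda>x. g x * p x) \<in> borel_measurable TM"
      using assms continuous_TM by (intro borel_measurable_times) auto
    show "AE x in TM. norm (g x * p x) \<le> norm (B * norm (g x))"
    proof (intro AE_I2)
      fix x assume "x \<in> space TM"
      with B[of x] have "norm (p x) \<le> B" by simp
      then have "norm (p x) * norm (g x) \<le> \<bar>B\<bar> * norm (g x)"
        by (intro mult_right_mono) auto
      then show "norm (g x * p x) \<le> norm (B * norm (g x))"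
        by (simp add: norm_mult abs_mult mult.commute)
    qed
  qed
qed

lemma trigp_orthogonal:
  fixes g :: "real \<times> real \<Rightarrow> real"
  assumes "integrable TM g" "\<And>k. (LINT x|TM. of_real (g x) * E k x) = 0" "trigp p"
  shows "integrable TM (\<lambda>x. of_real (g x) * p x) \<and> (LINT x|TM. of_real (g x) * p x) = 0"
  using assms(3)
proof induction
  case (E k)
  have "continuous_on UNIV (E k)" by (intro continuous_intros)
  then show ?case using assms by (simp add: TM_mult_integrable)
next
  case (scale f c)
  then show ?case by (simp add: mult.left_commute)
next
  case (add f g)
  then show ?case by (simp add: distrib_left)
qed

text \<open>A polynomial uniformly within \<open>e\<close> of \<phi> on [-1,1]^2 gives a
  trigonometric polynomial, against which \<open>g\<close> integrates to 0; what is left is at most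
  \<open>e\<close> times the integral of |g|.\<close>

lemma cos_continuous_orthogonal:
  fixes g :: "real \<times> real \<Rightarrow> real" and \<phi> :: "real \<times> real \<Rightarrow> real"
  assumes g: "integrable TM g" "\<And>k. (LINT x|TM. of_real (g x) * E k x) = 0"
    and \<phi>: "continuous_on UNIV \<phi>"
  shows "(LINT x|TM. g x * \<phi> (cos (fst x - a), cos (snd x - b))) = 0"
proof -
  define \<Phi> where "\<Phi> = (\<lambda>x. \<phi> (cos (fst x - a), cos (snd x - b)))"
  have c\<Phi>: "continuous_on UNIV \<Phi>"
    unfolding \<Phi>_def by (intro continuous_on_compose2[OF \<phi>] continuous_intros) auto
  have i\<Phi>: "integrable TM (\<lambda>x. g x * \<Phi> x)" by (rule TM_mult_integrable[OF g(1) c\<Phi>])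
  have *: "\<bar>LINT x|TM. g x * \<Phi> x\<bar> \<le> e * (LINT x|TM. \<bar>g x\<bar>)" if e: "e > 0" for e
  proof -
    have "\<exists>p. real_polynomial_function p \<and> (\<forall>y\<in>cbox (-1,-1) (1,1). \<bar>\<phi> y - p y\<bar> < e)"
      by (rule Stone_Weierstrass_real_polynomial_function[OF compact_cbox
            continuous_on_subset[OF \<phi> subset_UNIV] e]) fast
    then obtain p where p: "real_polynomial_function p"
        "\<And>y. y \<in> cbox (-1,-1) (1,1) \<Longrightarrow> \<bar>\<phi> y - p y\<bar> < e" by blast
    define P where "P = (\<lambda>x. p (cos (fst x - a), cos (snd x - b)))"
    have t: "trigp (\<lambda>x. of_real (P x))" unfolding P_def by (rule trigp_polynomial[OF p(1)])
    have iP: "integrable TM (\<lambda>x. g x * P x)"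
      using trigp_orthogonal[OF g t] unfolding of_real_mult[symmetric] complex_of_real_integrable_eq by (rule conjunct1)
    have zP: "(LINT x|TM. g x * P x) = 0"
      using trigp_orthogonal[OF g t, THEN conjunct2]
      unfolding of_real_mult[symmetric] integral_complex_of_real of_real_eq_0_iff .
    have "\<bar>LINT x|TM. g x * \<Phi> x\<bar> = \<bar>LINT x|TM. g x * \<Phi> x - g x * P x\<bar>"
      using zP i\<Phi> iP by simp
    also have "\<dots> \<le> (LINT x|TM. \<bar>g x * \<Phi> x - g x * P x\<bar>)" by (rule integral_abs_bound)
    also have "\<dots> \<le> (LINT x|TM. e * \<bar>g x\<bar>)"
    proof (rule integral_mono)
      fix x
      have "\<bar>\<Phi> x - P x\<bar> \<le> e" unfolding \<Phi>_def P_def by (intro less_imp_le p(2)) (simp add: cbox_Pair_eq)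
      then have "\<bar>g x\<bar> * \<bar>\<Phi> x - P x\<bar> \<le> \<bar>g x\<bar> * e" by (intro mult_left_mono) auto
      then show "\<bar>g x * \<Phi> x - g x * P x\<bar> \<le> e * \<bar>g x\<bar>"
        unfolding right_diff_distrib[symmetric] abs_mult mult.commute[of e] .
    next
      show "integrable TM (\<lambda>x. \<bar>g x * \<Phi> x - g x * P x\<bar>)"
        using i\<Phi> iP by (intro integrable_abs Bochner_Integration.integrable_diff)
      show "integrable TM (\<lambda>x. e * \<bar>g x\<bar>)" using g(1) by simp
    qed
    finally show ?thesis by simp
  qed
  have "\<bar>LINT x|TM. g x * \<Phi> x\<bar> \<le> e" if e: "e > 0" for e
  proof -
    define I where "I = (LINT x|TM. \<bar>g x\<bar>)"
    have I: "0 \<le> I" by (simp add: I_def)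
    then have "\<bar>LINT x|TM. g x * \<Phi> x\<bar> \<le> e / (I + 1) * I"
      using *[of "e / (I + 1)"] e unfolding I_def[symmetric] by simp
    also have "\<dots> \<le> e" using e I by (simp add: field_simps)
    finally show ?thesis .
  qed
  then have "\<bar>LINT x|TM. g x * \<Phi> x\<bar> \<le> 0" by (rule field_le_epsilon) simp
  then show ?thesis unfolding \<Phi>_def by simp
qed

text \<open>Superlevel sets of a shifted cosine are intervals modulo 2 pi. The condition
  \<open>\<bar>a\<bar> + r \<le> pi\<close> keeps the interval inside the fundamental domain, so no
  piece of it wraps around to the other side.\<close>

lemma cos_gt_iff:
  assumes "0 < r" "\<bar>a\<bar> + r \<le> pi" "\<bar>x\<bar> < pi"
  shows "cos (x - a) > cos r \<longleftrightarrow> \<bar>x - a\<bar> < r"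
proof (cases "\<bar>x - a\<bar> \<le> pi")
  case True
  have "cos r < cos \<bar>x - a\<bar> \<longleftrightarrow> \<bar>x - a\<bar> < r"
    by (rule cos_mono_less_eq) (use True assms in auto)
  then show ?thesis by simp
next
  case False
  have "cos r < cos (2 * pi - \<bar>x - a\<bar>) \<longleftrightarrow> 2 * pi - \<bar>x - a\<bar> < r"
    by (rule cos_mono_less_eq) (use False assms in auto)
  moreover have "\<not> 2 * pi - \<bar>x - a\<bar> < r" using assms by auto
  moreover have "cos (2 * pi - \<bar>x - a\<bar>) = cos (x - a)" by (simp add: cos_diff[of "2 * pi"])
  ultimately show ?thesis using False assms by auto
qed

text \<open>The ramps \<open>q n\<close> converge pointwise to the indicator of the positive reals;
  composed with the shifted cosines they converge to the indicator of the box by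
  \<open>cos_gt_iff\<close>, and |g| dominates.\<close>

lemma box_orthogonal:
  fixes g :: "real \<times> real \<Rightarrow> real"
  assumes g: "integrable TM g" "\<And>k. (LINT x|TM. of_real (g x) * E k x) = 0"
    and b: "0 < r" "\<bar>a\<bar> + r \<le> pi" "0 < s" "\<bar>b\<bar> + s \<le> pi"
  shows "(LINT x|TM. g x * indicator ({a-r<..<a+r} \<times> {b-s<..<b+s}) x) = 0"
proof -
  define q :: "nat \<Rightarrow> real \<Rightarrow> real" where "q = (\<lambda>n y. min 1 (max 0 (real n * y)))"
  define \<phi> where "\<phi> = (\<lambda>n y. q n (fst y - cos r) * q n (snd y - cos s))"
  have c\<phi>: "continuous_on UNIV (\<phi> n)" for n
    unfolding \<phi>_def q_def by (intro continuous_intros)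
  have ql: "(\<lambda>n. q n y) \<longlonglongrightarrow> (if y > 0 then 1 else 0)" for y
  proof (cases "y > 0")
    case True
    obtain N :: nat where "1 / y < real N" using reals_Archimedean2 by blast
    then have "q n y = 1" if "n \<ge> N" for n
    proof -
      have "1 < real N * y" using \<open>1 / y < real N\<close> True by (simp add: field_simps)
      also have "\<dots> \<le> real n * y" using that True by (intro mult_right_mono) auto
      finally show ?thesis by (simp add: q_def)
    qed
    then have "eventually (\<lambda>n. q n y = 1) sequentially" by (auto simp: eventually_sequentially)
    with True show ?thesis by (simp add: tendsto_eventually)
  next
    case False
    then have "q n y = 0" for n by (simp add: q_def mult_nonneg_nonpos)
    with False show ?thesis by simp
  qed
  have "(\<lambda>n. LINT x|TM. g x * \<phi> n (cos (fst x - a), cos (snd x - b)))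
      \<longlonglongrightarrow> (LINT x|TM. g x * indicator ({a-r<..<a+r} \<times> {b-s<..<b+s}) x)"
  proof (rule integral_dominated_convergence)
    show "integrable TM (\<lambda>x. \<bar>g x\<bar>)" using g by simp
    show "(\<lambda>x. g x * indicator ({a-r<..<a+r} \<times> {b-s<..<b+s}) x) \<in> borel_measurable TM"
      by (intro borel_measurable_times borel_measurable_integrable[OF g(1)]
          borel_TM borel_measurable_indicator borel_open open_Times) auto
    show "(\<lambda>x. g x * \<phi> n (cos (fst x - a), cos (snd x - b))) \<in> borel_measurable TM" for n
      by (intro borel_measurable_times borel_measurable_integrable[OF g(1)] continuous_TM continuous_on_compose2[OF c\<phi>] continuous_intros) auto
    show "AE x in TM. norm (g x * \<phi> n (cos (fst x - a), cos (snd x - b))) \<le> \<bar>g x\<bar>" for n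
    proof (intro AE_I2)
      fix x
      have "0 \<le> q n y" "q n y \<le> 1" for y by (auto simp: q_def)
      then have "\<bar>\<phi> n (cos (fst x - a), cos (snd x - b))\<bar> \<le> 1"
        unfolding \<phi>_def by (simp add: abs_mult mult_le_one)
      then show "norm (g x * \<phi> n (cos (fst x - a), cos (snd x - b))) \<le> \<bar>g x\<bar>"
        by (simp add: abs_mult mult_left_le)
    qed
    show "AE x in TM. (\<lambda>n. g x * \<phi> n (cos (fst x - a), cos (snd x - b)))
       \<longlonglongrightarrow> g x * indicator ({a-r<..<a+r} \<times> {b-s<..<b+s}) x"
    proof (intro AE_I2 tendsto_mult tendsto_const)
      fix x assume "x \<in> space TM"
      then have x: "\<bar>fst x\<bar> < pi" "\<bar>snd x\<bar> < pi" by (auto simp: torus_def)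
      have "(\<lambda>n. \<phi> n (cos (fst x - a), cos (snd x - b))) \<longlonglongrightarrow>
         (if cos (fst x - a) - cos r > 0 then 1 else 0 :: real) * (if cos (snd x - b) - cos s > 0 then 1 else 0)"
        unfolding \<phi>_def fst_conv snd_conv by (intro tendsto_mult ql)
      also have "(if cos (fst x - a) - cos r > 0 then 1 else 0 :: real) * (if cos (snd x - b) - cos s > 0 then 1 else 0)
         = indicator ({a-r<..<a+r} \<times> {b-s<..<b+s}) x"
        using cos_gt_iff[OF b(1,2) x(1)] cos_gt_iff[OF b(3,4) x(2)]
        by (cases x) (auto simp: indicator_def abs_less_iff)
      finally show "(\<lambda>n. \<phi> n (cos (fst x - a), cos (snd x - b))) \<longlonglongrightarrow> indicator ({a-r<..<a+r} \<times> {b-s<..<b+s}) x" .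
    qed
  qed
  then show ?thesis
    using cos_continuous_orthogonal[OF g c\<phi>] by (simp add: LIMSEQ_const_iff)
qed

text \<open>Dynkin's argument with boxes as intersection-stable generator. A box cut with the torus
  is again an open rectangle, which is rewritten by centre and half widths for
  \<open>box_orthogonal\<close>. Complements use the coefficient at frequency 0, the integral of
  \<open>g\<close> over the whole torus.\<close>

lemma zero_coefficients_borel:
  fixes g :: "real \<times> real \<Rightarrow> real"
  assumes g: "integrable TM g" "\<And>k. (LINT x|TM. of_real (g x) * E k x) = 0" and A: "A \<in> sets borel"
  shows "(LINT x:(A \<inter> torus)|TM. g x) = 0"
proof -
  define G where "G = range (\<lambda>(a, b). box a b :: (real \<times> real) set)"
  have sb: "B \<in> sets borel" if "B \<in> sigma_sets UNIV G" for B
    using that unfolding G_def borel_eq_box by simp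
  have st: "B \<inter> torus \<in> sets TM" if "B \<in> sets borel" for B
    using that by (auto simp: sets_restrict_space Int_commute)
  have si: "set_integrable TM B g" if "B \<in> sets TM" for B
    unfolding set_integrable_def using integrable_mult_indicator[OF that g(1)] .
  have "Int_stable G" unfolding G_def Int_stable_def by (auto simp: box_Int_box)
  moreover have "G \<subseteq> Pow UNIV" by simp
  moreover have "A \<in> sigma_sets UNIV G" using A unfolding borel_eq_box G_def by simp
  ultimately show ?thesis
  proof (induction rule: sigma_sets_induct_disjoint)
    case (basic B)
    then obtain a b where B: "B = box a b" unfolding G_def by auto
    define l u l' u' where "l = max (fst a) (-pi)" "u = min (fst b) pi"
      "l' = max (snd a) (-pi)" "u' = min (snd b) pi"
    have Bt: "B \<inter> torus = {l<..<u} \<times> {l'<..<u'}"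
      unfolding B torus_def l_u_l'_u'_def by (cases a; cases b) (auto simp: box_def Basis_prod_def)
    show ?case
    proof (cases "l < u \<and> l' < u'")
      case True
      define c r c' r' where "c = (l + u) / 2" "r = (u - l) / 2" "c' = (l' + u') / 2" "r' = (u' - l') / 2"
      have eq: "l = c - r" "u = c + r" "l' = c' - r'" "u' = c' + r'"
        by (auto simp: c_r_c'_r'_def field_simps)
      have b: "-pi \<le> l" "u \<le> pi" "-pi \<le> l'" "u' \<le> pi" by (auto simp: l_u_l'_u'_def)
      have "0 < r" "\<bar>c\<bar> + r \<le> pi" "0 < r'" "\<bar>c'\<bar> + r' \<le> pi"
        using True b unfolding eq by auto
      from box_orthogonal[OF g this] show ?thesis
        unfolding Bt set_lebesgue_integral_def eq by (simp add: mult.commute)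
    next
      case False
      then have "B \<inter> torus = {}" unfolding Bt by auto
      then show ?thesis by (simp add: set_lebesgue_integral_def)
    qed
  next
    case empty
    then show ?case by (simp add: set_lebesgue_integral_def)
  next
    case (compl B)
    have B: "B \<inter> torus \<in> sets TM" using sb st compl by auto
    have d: "(UNIV - B) \<inter> torus \<in> sets TM" using sb[OF compl(1)] st by auto
    have "(LINT x:((B \<inter> torus) \<union> ((UNIV - B) \<inter> torus))|TM. g x)
       = (LINT x:(B \<inter> torus)|TM. g x) + (LINT x:((UNIV - B) \<inter> torus)|TM. g x)"
      by (rule set_integral_Un) (auto intro: si B d)
    moreover have "(B \<inter> torus) \<union> ((UNIV - B) \<inter> torus) = torus" by auto
    moreover have "(LINT x:torus|TM. g x) = 0"
    proof -
      have "(LINT x:torus|TM. g x) = (LINT x|TM. g x)"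
        unfolding set_lebesgue_integral_def by (intro Bochner_Integration.integral_cong) auto
      also have "\<dots> = 0" using g(2)[of 0] by simp
      finally show ?thesis .
    qed
    ultimately show ?case using compl by simp
  next
    case (union B)
    have "(\<Union>i. B i) \<inter> torus = (\<Union>i. B i \<inter> torus)" by auto
    moreover have "(LINT x:(\<Union>i. B i \<inter> torus)|TM. g x) = (\<Sum>i. (LINT x:(B i \<inter> torus)|TM. g x))"
    proof (rule lebesgue_integral_countable_add)
      show m: "B i \<inter> torus \<in> sets TM" for i using union(2) sb st by auto
      show "set_integrable TM (\<Union>i. B i \<inter> torus) g" using m by (intro si sets.countable_UN) auto
      show "i \<noteq> j \<Longrightarrow> B i \<inter> torus \<inter> (B j \<inter> torus) = {}" for i j
        using union(1) unfolding disjoint_family_on_def by blast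
    qed
    ultimately show ?case using union by simp
  qed
qed

text \<open>A Lebesgue set differs from a Borel set by a null set, so \<open>g\<close> integrates to
  0 over every measurable set, and a density is determined by these integrals.\<close>

lemma zero_coefficients_AE:
  fixes g :: "real \<times> real \<Rightarrow> real"
  assumes g: "integrable TM g" "\<And>k. (LINT x|TM. of_real (g x) * E k x) = 0"
  shows "AE x in TM. g x = 0"
proof -
  have "AE x in TM. g x = (\<lambda>_. 0) x"
  proof (rule density_unique_real[OF g(1)])
    fix A assume "A \<in> sets TM"
    then have A: "A \<in> sets lebesgue" "A \<subseteq> torus"
      by (auto simp: sets_restrict_space_iff)
    from A(1) obtain S N N' where S: "A = S \<union> N" "N \<subseteq> N'" "N' \<in> null_sets lborel" "S \<in> sets lborel"
      by (rule sets_completionE)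
    have "AE x in lebesgue. x \<notin> N'" using S(3) by (intro AE_not_in null_sets_completionI)
    then have ae: "AE x in TM. x \<notin> N'"
      by (simp add: AE_restrict_space_iff) (auto elim: eventually_mono)
    have SS: "S \<inter> torus \<in> sets TM" using S(4) by (auto simp: sets_restrict_space Int_commute)
    have "(LINT x:A|TM. g x) = (LINT x:(S \<inter> torus)|TM. g x)"
      unfolding set_lebesgue_integral_def
    proof (rule integral_cong_AE)
      show "AE x in TM. indicat_real A x *\<^sub>R g x = indicat_real (S \<inter> torus) x *\<^sub>R g x"
        using ae AE_space by eventually_elim (use S(1,2) in \<open>auto simp: indicator_def\<close>)
    qed (use \<open>A \<in> sets TM\<close> SS g(1) in auto)
    also have "\<dots> = 0" using S(4) by (intro zero_coefficients_borel g) simp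
    finally show "(LINT x:A|TM. g x) = (LINT x:A|TM. 0)" by simp
  qed simp
  then show ?thesis by simp
qed

section \<open>Fourier coefficients on the quotient type, trigonometric polynomials, Bessel's
  inequality\<close>

lemma inner_abs_L2:
  assumes "L2_fun g" "L2_fun h"
  shows "inner (abs_L2 g) (abs_L2 h) = (LINT x|TM. g x * h x)"
  using assms by (intro inner_L2.abs_eq) (auto simp: L2_eq_def)

lemma abs_rep_L2 [simp]: "abs_L2 (rep_L2 a) = a"
  using Quotient3_abs_rep[OF Quotient3_L2] .

lemma inner_abs_L2_right:
  assumes "L2_fun h" shows "inner a (abs_L2 h) = (LINT x|TM. rep_L2 a x * h x)"
  using inner_abs_L2[OF L2_fun_rep assms, of a] by simp

lemma integral_rep_abs:
  fixes p :: "_ \<Rightarrow> 'a::{banach, real_normed_field, second_countable_topology}"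
  assumes "L2_fun g" "p \<in> borel_measurable TM"
  shows "(LINT x|TM. of_real (rep_L2 (abs_L2 g) x) * p x) = (LINT x|TM. of_real (g x) * p x)"
proof (rule integral_cong_AE)
  show "AE x in TM. of_real (rep_L2 (abs_L2 g) x) * p x = of_real (g x) * p x"
    using rep_abs_L2[OF assms(1)] by eventually_elim simp
  have "\<And>h. L2_fun h \<Longrightarrow> (\<lambda>x. of_real (h x) :: 'a) \<in> borel_measurable TM"
    by (rule measurable_compose[OF L2_fun_measurable]) auto
  then show "(\<lambda>x. of_real (rep_L2 (abs_L2 g) x) * p x) \<in> borel_measurable TM"
    "(\<lambda>x. of_real (g x) * p x) \<in> borel_measurable TM"
    using assms L2_fun_rep by (auto intro!: borel_measurable_times)
qed

definition fc :: "(real \<times> real \<Rightarrow> real) \<Rightarrow> coef" where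
  "fc g k = (LINT x|TM. of_real (g x) * E (- k) x) / (2 * pi)^2"

lemma E_cis: "E (- k) x = cis (- (of_int (fst k) * fst x + of_int (snd k) * snd x))"
  by (simp add: E_def)

lemma fcoeff_fc: "fcoeff a k = fc (rep_L2 a) k"
  unfolding fcoeff_def fc_def E_cis by simp

lemma measurable_E [measurable]: "E k \<in> borel_measurable TM"
  by (intro continuous_TM continuous_intros)

lemma fcoeff_abs: "L2_fun g \<Longrightarrow> fcoeff (abs_L2 g) k = fc g k"
  unfolding fcoeff_fc fc_def by (subst integral_rep_abs) auto

lemma L2_fun_E_integrable: "L2_fun g \<Longrightarrow> integrable TM (\<lambda>x. of_real (g x) * E k x)"
  by (intro TM_mult_integrable continuous_intros) (simp add: L2_fun_integrable)

lemma fc_uminus: "fc g (- k) = cnj (fc g k)"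
  unfolding fc_def by (simp flip: Bochner_Integration.integral_cnj add: E_uminus)

lemma fcoeff_uminus: "fcoeff a (- k) = cnj (fcoeff a k)"
  unfolding fcoeff_fc by (rule fc_uminus)

lemma fcoeff_0 [simp]: "fcoeff a 0 = 0"
proof -
  have "(LINT x|TM. complex_of_real (rep_L2 a x)) = 0" using L2_fun_rep[of a] by (simp add: L2_fun_def)
  then show ?thesis unfolding fcoeff_fc fc_def by simp
qed

lemma fc_add: "L2_fun g \<Longrightarrow> L2_fun h \<Longrightarrow> fc (\<lambda>x. g x + h x) k = fc g k + fc h k"
  unfolding fc_def by (simp add: L2_fun_E_integrable distrib_right add_divide_distrib)

lemma fc_scale: "fc (\<lambda>x. c * g x) k = of_real c * fc g k"
  unfolding fc_def by (simp add: mult.assoc)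

lemma fcoeff_add: "fcoeff (a + b) k = fcoeff a k + fcoeff b k"
proof -
  have "a + b = abs_L2 (\<lambda>x. rep_L2 a x + rep_L2 b x)"
    using plus_L2.abs_eq[of "rep_L2 a" "rep_L2 b"] L2_fun_rep by (simp add: L2_eq_def)
  then have "fcoeff (a + b) k = fc (\<lambda>x. rep_L2 a x + rep_L2 b x) k"
    by (simp only: fcoeff_abs L2_fun_add L2_fun_rep)
  then show ?thesis by (simp add: fc_add L2_fun_rep fcoeff_fc)
qed

lemma fcoeff_scaleR: "fcoeff (c *\<^sub>R a) k = of_real c * fcoeff a k"
proof -
  have "c *\<^sub>R a = abs_L2 (\<lambda>x. c * rep_L2 a x)"
    using scaleR_L2.abs_eq[of "rep_L2 a"] L2_fun_rep by (simp add: L2_eq_def)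
  then have "fcoeff (c *\<^sub>R a) k = fc (\<lambda>x. c * rep_L2 a x) k"
    by (simp only: fcoeff_abs L2_fun_scale L2_fun_rep)
  then show ?thesis by (simp add: fc_scale fcoeff_fc)
qed

lemma fcoeff_uminus_L2: "fcoeff (- a) k = - fcoeff a k"
  using fcoeff_scaleR[of "-1" a k] by simp

lemma fcoeff_minus: "fcoeff (a - b) k = fcoeff a k - fcoeff b k"
  using fcoeff_add[of a "- b" k] by (simp add: fcoeff_uminus_L2)

text \<open>Completeness of the characters in the form used from here on. It also makes the definite
  description in \<open>multiplier\<close> unambiguous.\<close>

lemma L2_eqI:
  assumes "\<And>k. k \<noteq> 0 \<Longrightarrow> fcoeff a k = fcoeff b k" shows "a = b"
proof -
  define d where "d = a - b"
  have z: "fcoeff d k = 0" for k using assms[of k] by (cases "k = 0") (auto simp: d_def fcoeff_minus)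
  have "(LINT x|TM. of_real (rep_L2 d x) * E k x) = 0" for k
    using z[of "- k"] by (simp add: fcoeff_fc fc_def)
  then have "AE x in TM. rep_L2 d x = 0"
    by (intro zero_coefficients_AE) (auto intro: L2_fun_integrable L2_fun_rep)
  then have "inner d d = 0"
    using inner_abs_L2_right[OF L2_fun_rep, of d d] L2_fun_rep[of d]
    by (simp add: integral_eq_zero_AE)
  then show ?thesis by (simp add: d_def)
qed

lemma multiplierI:
  assumes "\<And>k. k \<noteq> 0 \<Longrightarrow> fcoeff b k = m k * fcoeff a k" shows "multiplier m a = b"
  unfolding multiplier_def
proof (rule the_equality)
  show "\<forall>k. k \<noteq> 0 \<longrightarrow> fcoeff b k = m k * fcoeff a k" using assms by simp
next
  fix b' assume "\<forall>k. k \<noteq> 0 \<longrightarrow> fcoeff b' k = m k * fcoeff a k"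
  then show "b' = b" using assms by (intro L2_eqI) auto
qed

text \<open>The real part makes this a real function for arbitrary coefficients. When
  \<open>c\<close> has the symmetry \<open>symc\<close> and \<open>F\<close> is symmetric, the sum
  is already real and nothing is discarded (\<open>tp_sym\<close>).\<close>

definition tp :: "(int \<times> int) set \<Rightarrow> coef \<Rightarrow> real \<times> real \<Rightarrow> real" where
  "tp F c x = Re (\<Sum>k\<in>F. c k * E k x)"

lemma continuous_tp [continuous_intros]:
  "continuous_on S f \<Longrightarrow> continuous_on S (\<lambda>x. tp F c (f x))"
  unfolding tp_def by (intro continuous_intros)

lemma L2_fun_tp: assumes "0 \<notin> F" shows "L2_fun (tp F c)"
  unfolding L2_fun_def
proof (intro conjI)
  have c: "continuous_on UNIV (tp F c)" by (intro continuous_intros)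
  show "tp F c \<in> borel_measurable TM" by (rule continuous_TM[OF c])
  show "integrable TM (\<lambda>x. (tp F c x)^2)" by (intro TM_integrable_continuous continuous_intros)
  have i: "integrable TM (E k)" for k by (intro TM_integrable_continuous continuous_intros)
  have "(LINT x|TM. (\<Sum>k\<in>F. c k * E k x)) = (\<Sum>k\<in>F. c k * (LINT x|TM. E k x))"
    by (subst Bochner_Integration.integral_sum) (auto simp: i)
  also have "\<dots> = 0" using assms by (intro sum.neutral) (auto simp: integral_E)
  finally have *: "(LINT x|TM. (\<Sum>k\<in>F. c k * E k x)) = 0" .
  have "(LINT x|TM. tp F c x) = Re (LINT x|TM. (\<Sum>k\<in>F. c k * E k x))"
    unfolding tp_def by (intro integral_Re Bochner_Integration.integrable_sum integrable_mult_right i)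
  with * show "(LINT x|TM. tp F c x) = 0" by simp
qed

definition tpL :: "(int \<times> int) set \<Rightarrow> coef \<Rightarrow> L2" where
  "tpL F c = abs_L2 (tp F c)"

lemma inner_tpL:
  assumes "0 \<notin> F" shows "inner a (tpL F c) = (2 * pi)^2 * Re (\<Sum>k\<in>F. c k * cnj (fcoeff a k))"
proof -
  have i: "integrable TM (\<lambda>x. of_real (rep_L2 a x) * E k x)" for k by (rule L2_fun_E_integrable[OF L2_fun_rep])
  have *: "(LINT x|TM. of_real (rep_L2 a x) * E k x) = (2 * pi)^2 * cnj (fcoeff a k)" for k
    using fcoeff_uminus[of a k] by (simp add: fcoeff_fc fc_def)
  have "inner a (tpL F c) = (LINT x|TM. rep_L2 a x * tp F c x)"
    unfolding tpL_def by (rule inner_abs_L2_right[OF L2_fun_tp[OF assms]])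
  also have "\<dots> = (LINT x|TM. Re (\<Sum>k\<in>F. c k * (of_real (rep_L2 a x) * E k x)))"
    unfolding tp_def by (intro Bochner_Integration.integral_cong) (auto simp: sum_distrib_left algebra_simps)
  also have "\<dots> = Re (LINT x|TM. (\<Sum>k\<in>F. c k * (of_real (rep_L2 a x) * E k x)))"
    by (intro integral_Re Bochner_Integration.integrable_sum integrable_mult_right i)
  also have "\<dots> = Re (\<Sum>k\<in>F. c k * (LINT x|TM. of_real (rep_L2 a x) * E k x))"
    by (subst Bochner_Integration.integral_sum) (auto simp: i)
  also have "\<dots> = Re (of_real ((2 * pi)^2) * (\<Sum>k\<in>F. c k * cnj (fcoeff a k)))"
    unfolding * sum_distrib_left by (simp add: mult_ac)
  also have "\<dots> = (2 * pi)^2 * Re (\<Sum>k\<in>F. c k * cnj (fcoeff a k))" by simp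
  finally show ?thesis .
qed

definition symF :: "(int \<times> int) set \<Rightarrow> bool" where "symF F \<longleftrightarrow> finite F \<and> 0 \<notin> F \<and> uminus ` F = F"
definition symc :: "coef \<Rightarrow> bool" where "symc c \<longleftrightarrow> (\<forall>k. c (- k) = cnj (c k))"

lemma symcD: "symc c \<Longrightarrow> c (- k) = cnj (c k)" by (simp only: symc_def)

lemma sum_symF:
  assumes "symF F" shows "(\<Sum>k\<in>F. g (- k)) = (\<Sum>k\<in>F. g k)"
proof -
  have "(\<Sum>k\<in>F. g (- k)) = (\<Sum>k\<in>uminus ` F. g k)"
    by (subst sum.reindex) (auto simp: inj_on_def)
  then show ?thesis using assms by (simp add: symF_def)
qed

lemma tp_sym:
  assumes "symF F" "symc c" shows "of_real (tp F c x) = (\<Sum>k\<in>F. c k * E k x)"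
proof -
  have "cnj (\<Sum>k\<in>F. c k * E k x) = (\<Sum>k\<in>F. c (-k) * E (-k) x)"
    by (simp add: symcD[OF assms(2)] E_uminus)
  also have "\<dots> = (\<Sum>k\<in>F. c k * E k x)" by (rule sum_symF[OF assms(1)])
  finally show ?thesis unfolding tp_def by (metis Reals_cnj_iff of_real_Re)
qed

lemma fcoeff_tpL:
  assumes "symF F" "symc c" shows "fcoeff (tpL F c) k = (if k \<in> F then c k else 0)"
proof -
  have i: "integrable TM (E k)" for k by (intro TM_integrable_continuous continuous_intros)
  have f: "finite F" "0 \<notin> F" using assms(1) by (auto simp: symF_def)
  have "fcoeff (tpL F c) k = (LINT x|TM. (\<Sum>j\<in>F. c j * E (j - k) x)) / (2 * pi)^2"
    unfolding tpL_def fcoeff_abs[OF L2_fun_tp[OF f(2)]] fc_def tp_sym[OF assms] sum_distrib_right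
    by (simp add: E_add[symmetric] mult.assoc)
  also have "(LINT x|TM. (\<Sum>j\<in>F. c j * E (j - k) x)) = (\<Sum>j\<in>F. c j * (LINT x|TM. E (j - k) x))"
    by (subst Bochner_Integration.integral_sum) (auto simp: i)
  also have "\<dots> = (\<Sum>j\<in>F. if j = k then c j * (2 * pi)^2 else 0)"
    by (intro sum.cong) (auto simp: integral_E)
  also have "\<dots> = (if k \<in> F then c k * (2 * pi)^2 else 0)" using f by simp
  finally show ?thesis by simp
qed

lemma norm_tpL:
  assumes "symF F" "symc c" shows "(norm (tpL F c))^2 = (2 * pi)^2 * (\<Sum>k\<in>F. (cmod (c k))^2)"
proof -
  have "(norm (tpL F c))^2 = inner (tpL F c) (tpL F c)" by (simp add: power2_norm_eq_inner)
  also have "\<dots> = (2 * pi)^2 * Re (\<Sum>k\<in>F. c k * cnj (c k))"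
    using assms by (subst inner_tpL) (auto simp: symF_def fcoeff_tpL cong: sum.cong)
  finally show ?thesis by (simp add: complex_mult_cnj cmod_power2)
qed

text \<open>Expand the square norm of the difference between \<open>a\<close> and its partial sum
  over \<open>F\<close>; the symmetry of \<open>F\<close> is what makes that partial sum a real
  function with the right coefficients.\<close>

lemma bessel_sym:
  assumes "symF F" shows "(2 * pi)^2 * (\<Sum>k\<in>F. (cmod (fcoeff a k))^2) \<le> (norm a)^2"
proof -
  define S where "S = tpL F (fcoeff a)"
  have s: "symc (fcoeff a)" by (simp add: symc_def fcoeff_uminus)
  have n: "(norm S)^2 = (2 * pi)^2 * (\<Sum>k\<in>F. (cmod (fcoeff a k))^2)"
    unfolding S_def by (rule norm_tpL[OF assms s])
  have "inner a S = (2 * pi)^2 * (\<Sum>k\<in>F. (cmod (fcoeff a k))^2)"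
    unfolding S_def using assms by (subst inner_tpL) (auto simp: symF_def complex_mult_cnj cmod_power2)
  moreover have "0 \<le> (norm (a - S))^2" by simp
  moreover have "(norm (a - S))^2 = (norm a)^2 - 2 * inner a S + (norm S)^2"
    by (simp add: power2_norm_eq_inner inner_diff inner_commute)
  ultimately show ?thesis using n by simp
qed

definition Bx :: "nat \<Rightarrow> (int \<times> int) set" where "Bx n = {- int n..int n} \<times> {- int n..int n} - {0}"

lemma mem_Bx: "k \<in> Bx n \<longleftrightarrow> \<bar>fst k\<bar> \<le> int n \<and> \<bar>snd k\<bar> \<le> int n \<and> k \<noteq> 0"
  by (cases k) (auto simp: Bx_def)

lemma symF_Bx: "symF (Bx n)"
proof -
  have m: "- k \<in> Bx n" if "k \<in> Bx n" for k using that by (simp add: mem_Bx)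
  have "uminus ` Bx n = Bx n"
  proof (intro equalityI image_subsetI m subsetI)
    fix k assume "k \<in> Bx n"
    from m[OF this] show "k \<in> uminus ` Bx n" by (intro image_eqI[of _ _ "- k"]) simp_all
  qed
  then show ?thesis unfolding symF_def by (simp add: Bx_def)
qed

lemma Bx_mono: "m \<le> n \<Longrightarrow> Bx m \<subseteq> Bx n" by (auto simp: Bx_def)

lemma finite_subset_Bx:
  assumes "finite F" "0 \<notin> F" obtains n where "F \<subseteq> Bx n"
proof -
  define n where "n = (\<Sum>k\<in>F. nat \<bar>fst k\<bar> + nat \<bar>snd k\<bar>)"
  have "k \<in> Bx n" if k: "k \<in> F" for k
  proof -
    have "nat \<bar>fst k\<bar> + nat \<bar>snd k\<bar> \<le> n" unfolding n_def
      by (rule member_le_sum[OF k]) (auto simp: assms)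
    moreover have "k \<noteq> 0" using k assms by auto
    ultimately show ?thesis by (cases k) (auto simp: Bx_def)
  qed
  then show ?thesis by (intro that) auto
qed

lemma finite_Bx [simp]: "finite (Bx n)" by (simp add: Bx_def)
lemma zero_Bx [simp]: "0 \<notin> Bx n" by (simp add: Bx_def)

lemma bessel:
  assumes "finite F" shows "(2 * pi)^2 * (\<Sum>k\<in>F. (cmod (fcoeff a k))^2) \<le> (norm a)^2"
proof -
  obtain n where n: "F - {0} \<subseteq> Bx n" using finite_subset_Bx[of "F - {0}"] assms by auto
  have "(\<Sum>k\<in>F. (cmod (fcoeff a k))^2) = (\<Sum>k\<in>F - {0}. (cmod (fcoeff a k))^2)"
    using assms by (intro sum.mono_neutral_right) auto
  also have "\<dots> \<le> (\<Sum>k\<in>Bx n. (cmod (fcoeff a k))^2)" by (intro sum_mono2 n) auto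
  finally have "(2 * pi)^2 * (\<Sum>k\<in>F. (cmod (fcoeff a k))^2) \<le> (2 * pi)^2 * (\<Sum>k\<in>Bx n. (cmod (fcoeff a k))^2)"
    by (intro mult_left_mono) auto
  also have "\<dots> \<le> (norm a)^2" by (rule bessel_sym[OF symF_Bx])
  finally show ?thesis .
qed

lemma fcoeff_le_norm: "2 * pi * cmod (fcoeff a k) \<le> norm a"
proof -
  have "(2 * pi * cmod (fcoeff a k))^2 \<le> (norm a)^2"
    using bessel[of "{k}" a] by (simp add: power_mult_distrib)
  then show ?thesis by (rule power2_le_imp_le) simp
qed

section \<open>Completeness of \<open>L2\<close> and the Riesz-Fischer theorem\<close>

lemma sqrt_ineq_young: fixes h :: real shows "\<bar>h\<bar> \<le> (2 ^ i * h^2 + 1 / 2 ^ i) / 2"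
proof -
  have "0 \<le> (sqrt (2 ^ i) * \<bar>h\<bar> - 1 / sqrt (2 ^ i))^2" by simp
  also have "\<dots> = 2 ^ i * h^2 + 1 / 2 ^ i - 2 * \<bar>h\<bar>"
    by (simp add: power2_diff power_mult_distrib power_divide)
  finally show ?thesis by simp
qed

lemma norm_L2_integral: "(norm a)^2 = (LINT x|TM. (rep_L2 a x)^2)"
  using inner_abs_L2[OF L2_fun_rep L2_fun_rep, of a a]
  unfolding power2_norm_eq_inner by (simp add: power2_eq_square)

lemma rep_diff_AE: "AE x in TM. rep_L2 (a - b) x = rep_L2 a x - rep_L2 b x"
proof -
  have "(-1) *\<^sub>R b = abs_L2 (\<lambda>x. (-1) * rep_L2 b x)"
    using scaleR_L2.abs_eq[of "rep_L2 b" "-1"] L2_fun_rep by (simp add: L2_eq_def)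
  moreover have "abs_L2 (rep_L2 a) + abs_L2 (\<lambda>x. (-1) * rep_L2 b x) = abs_L2 (\<lambda>x. rep_L2 a x + (-1) * rep_L2 b x)"
    by (rule plus_L2.abs_eq) (use L2_fun_rep L2_fun_scale[OF L2_fun_rep, of "-1"] in \<open>simp_all add: L2_eq_def\<close>)
  moreover have "a - b = a + (-1) *\<^sub>R b" by simp
  ultimately have "a - b = abs_L2 (\<lambda>x. rep_L2 a x + (-1) * rep_L2 b x)" by (simp only: abs_rep_L2)
  moreover have "L2_fun (\<lambda>x. rep_L2 a x + (-1) * rep_L2 b x)"
    by (intro L2_fun_add L2_fun_scale L2_fun_rep)
  ultimately show ?thesis using rep_abs_L2 by fastforce
qed

lemma norm_diff_integral: "(norm (a - b))^2 = (LINT x|TM. (rep_L2 a x - rep_L2 b x)^2)"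
  unfolding norm_L2_integral
proof (rule integral_cong_AE)
  show "AE x in TM. (rep_L2 (a - b) x)^2 = (rep_L2 a x - rep_L2 b x)^2"
    using rep_diff_AE[of a b] by eventually_elim simp
qed (use L2_fun_measurable[OF L2_fun_rep] in measurable)

text \<open>The classical argument for a rapidly converging sequence: the increments are summable
  almost everywhere, so representatives converge pointwise, and Fatou's lemma upgrades this to
  convergence in norm. The limit must in addition be shown to be mean-free.\<close>

lemma L2_complete:
  fixes X :: "nat \<Rightarrow> L2"
  assumes X: "\<And>i. norm (X (Suc i) - X i) \<le> C / 2 ^ i"
  shows "\<exists>b. X \<longlonglongrightarrow> b"
proof -
  define g where "g = (\<lambda>i. rep_L2 (X i))"
  define h where "h = (\<lambda>i x. g (Suc i) x - g i x)"
  have C: "0 \<le> C" using order_trans[OF norm_ge_zero X[of 0]] by simp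
  have Lg: "L2_fun (g i)" for i by (simp add: g_def L2_fun_rep)
  have mg [measurable]: "g i \<in> borel_measurable TM" for i by (rule L2_fun_measurable[OF Lg])
  have mh [measurable]: "h i \<in> borel_measurable TM" for i unfolding h_def by measurable
  have ig: "integrable TM (g i)" for i by (rule L2_fun_integrable[OF Lg])
  have Ld: "integrable TM (\<lambda>x. (g i x - g j x)^2)" for i j
    using L2_fun_add[OF Lg L2_fun_scale[OF Lg], of i "-1" j] by (simp add: L2_fun_def)
  have ih2: "integrable TM (\<lambda>x. (h i x)^2)" for i unfolding h_def by (rule Ld)
  have ih: "integrable TM (h i)" for i unfolding h_def by (intro Bochner_Integration.integrable_diff ig)
  define mu where "mu = measure TM (space TM)"
  have mu: "0 \<le> mu" by (simp add: mu_def)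
  have intC: "(LINT x|TM. c) = c * mu" for c :: real by (simp add: mu_def)
  have nh: "(LINT x|TM. (h i x)^2) \<le> (C / 2 ^ i)^2" for i
    unfolding h_def g_def norm_diff_integral[symmetric] by (intro power_mono X) simp
  define K where "K = (C^2 + mu) / 2"
  \<comment> \<open>The weight \<open>2 ^ i\<close> in the Young inequality balances both terms at
    order \<open>1 / 2 ^ i\<close>, because the squared norm of \<open>h i\<close> is of order
    \<open>1 / 4 ^ i\<close>.\<close>
  have lh: "(LINT x|TM. \<bar>h i x\<bar>) \<le> K / 2 ^ i" for i
  proof -
    have "(LINT x|TM. \<bar>h i x\<bar>) \<le> (LINT x|TM. (2 ^ i * (h i x)^2 + 1 / 2 ^ i) / 2)"
      by (intro integral_mono sqrt_ineq_young) (use ih ih2 in auto)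
    also have "\<dots> = (2 ^ i * (LINT x|TM. (h i x)^2) + mu / 2 ^ i) / 2"
      using ih2 by (simp add: intC mu_def)
    also have "\<dots> \<le> (2 ^ i * (C / 2 ^ i)^2 + mu / 2 ^ i) / 2"
      by (intro divide_right_mono add_right_mono mult_left_mono nh) auto
    also have "\<dots> = K / 2 ^ i" unfolding K_def by (simp add: power2_eq_square field_simps)
    finally show ?thesis .
  qed
  have sK: "summable (\<lambda>i. K / 2 ^ i)"
    using summable_mult[OF summable_geometric[of "1/2::real"], of K] by (simp add: power_divide)
  have "(\<integral>\<^sup>+x. (\<Sum>i. ennreal \<bar>h i x\<bar>) \<partial>TM) = (\<Sum>i. (\<integral>\<^sup>+x. ennreal \<bar>h i x\<bar> \<partial>TM))"
    by (intro nn_integral_suminf) measurable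
  also have "\<dots> = (\<Sum>i. ennreal (LINT x|TM. \<bar>h i x\<bar>))"
    using ih by (intro suminf_cong nn_integral_eq_integral) auto
  also have "\<dots> \<noteq> \<infinity>"
    unfolding infinity_ennreal_def
  proof (rule ennreal_suminf_neq_top)
    show "summable (\<lambda>i. LINT x|TM. \<bar>h i x\<bar>)"
      by (rule summable_comparison_test'[OF sK, of 0]) (simp add: lh)
  qed simp
  finally have fin: "(\<integral>\<^sup>+x. (\<Sum>i. ennreal \<bar>h i x\<bar>) \<partial>TM) \<noteq> \<infinity>" .
  have "AE x in TM. (\<Sum>i. ennreal \<bar>h i x\<bar>) \<noteq> \<infinity>"
    by (rule nn_integral_noteq_infinite[OF _ fin]) measurable
  then have aes: "AE x in TM. summable (\<lambda>i. \<bar>h i x\<bar>)"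
  proof eventually_elim
    case (elim x)
    show ?case by (rule summable_suminf_not_top) (use elim in simp_all)
  qed
  \<comment> \<open>At points where the sequence diverges \<open>lim\<close> is an unspecified
    value; these points form a null set, and measurability of \<open>lim\<close> does not depend on
    them.\<close>
  define G where "G = (\<lambda>x. lim (\<lambda>i. g i x))"
  have mG [measurable]: "G \<in> borel_measurable TM" unfolding G_def by measurable
  have lim: "AE x in TM. (\<lambda>i. g i x) \<longlonglongrightarrow> G x"
    using aes
  proof eventually_elim
    case (elim x)
    have gs: "g 0 x + (\<Sum>i<n. h i x) = g n x" for n by (induction n) (auto simp: h_def)
    have "(\<lambda>n. g 0 x + (\<Sum>i<n. h i x)) \<longlonglongrightarrow> g 0 x + (\<Sum>i. h i x)"
      using summable_rabs_cancel[OF elim] by (intro tendsto_intros summable_LIMSEQ)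
    then have "(\<lambda>n. g n x) \<longlonglongrightarrow> g 0 x + (\<Sum>i. h i x)" unfolding gs .
    then show ?case unfolding G_def by (simp add: limI)
  qed
  have nX: "norm (X (i + n) - X i) \<le> 2 * C / 2 ^ i" for i n
  proof -
    have "norm (X (i + n) - X i) \<le> 2 * C / 2 ^ i - 2 * C / 2 ^ (i + n)"
    proof (induction n)
      case (Suc n)
      have "norm (X (i + Suc n) - X i) \<le> norm (X (Suc (i + n)) - X (i + n)) + norm (X (i + n) - X i)"
        using norm_triangle_ineq[of "X (Suc (i + n)) - X (i + n)" "X (i + n) - X i"] by simp
      also have "\<dots> \<le> C / 2 ^ (i + n) + (2 * C / 2 ^ i - 2 * C / 2 ^ (i + n))"
        by (intro add_mono X Suc)
      also have "\<dots> = 2 * C / 2 ^ i - 2 * C / 2 ^ (i + Suc n)" by (simp add: field_simps)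
      finally show ?case .
    qed simp
    also have "\<dots> \<le> 2 * C / 2 ^ i" using C by simp
    finally show ?thesis .
  qed
  \<comment> \<open>Fatou's lemma in \<open>n\<close> with \<open>i\<close> fixed: the distance
    bound \<open>nX\<close> from \<open>X i\<close> to the later members passes to the limit
    function.\<close>
  have fat: "(\<integral>\<^sup>+x. ennreal ((G x - g i x)^2) \<partial>TM) \<le> ennreal ((2 * C / 2 ^ i)^2)" for i
  proof -
    have "(\<integral>\<^sup>+x. ennreal ((G x - g i x)^2) \<partial>TM) = (\<integral>\<^sup>+x. liminf (\<lambda>n. ennreal ((g n x - g i x)^2)) \<partial>TM)"
    proof (rule nn_integral_cong_AE, use lim in eventually_elim)
      case (elim x)
      have "(\<lambda>n. ennreal ((g n x - g i x)^2)) \<longlonglongrightarrow> ennreal ((G x - g i x)^2)"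
        by (intro tendsto_intros elim)
      then show ?case by (intro lim_imp_Liminf[symmetric]) simp_all
    qed
    also have "\<dots> \<le> liminf (\<lambda>n. \<integral>\<^sup>+x. ennreal ((g n x - g i x)^2) \<partial>TM)"
      by (rule nn_integral_liminf) measurable
    also have "\<dots> \<le> ennreal ((2 * C / 2 ^ i)^2)"
    proof (rule Liminf_le)
      show "\<forall>\<^sub>F n in sequentially. (\<integral>\<^sup>+x. ennreal ((g n x - g i x)^2) \<partial>TM) \<le> ennreal ((2 * C / 2 ^ i)^2)"
        unfolding eventually_sequentially
      proof (intro exI[of _ i] allI impI)
        fix n assume "i \<le> n"
        then obtain m where n: "n = i + m" using le_Suc_ex by blast
        have "(\<integral>\<^sup>+x. ennreal ((g n x - g i x)^2) \<partial>TM) = ennreal (LINT x|TM. (g n x - g i x)^2)"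
          using Ld by (intro nn_integral_eq_integral) auto
        also have "(LINT x|TM. (g n x - g i x)^2) = (norm (X n - X i))^2"
          unfolding g_def norm_diff_integral ..
        also have "ennreal \<dots> \<le> ennreal ((2 * C / 2 ^ i)^2)"
          unfolding n by (intro ennreal_leI power_mono nX) simp
        finally show "(\<integral>\<^sup>+x. ennreal ((g n x - g i x)^2) \<partial>TM) \<le> ennreal ((2 * C / 2 ^ i)^2)" .
      qed
    qed simp
    finally show ?thesis .
  qed
  have iG2: "integrable TM (\<lambda>x. (G x - g i x)^2)" for i
  proof (rule integrableI_nonneg)
    show "(\<integral>\<^sup>+x. ennreal ((G x - g i x)^2) \<partial>TM) < \<infinity>"
      by (rule le_less_trans[OF fat]) simp
    show "(\<lambda>x. (G x - g i x)^2) \<in> borel_measurable TM" by measurable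
  qed simp
  have nG: "(LINT x|TM. (G x - g i x)^2) \<le> (2 * C / 2 ^ i)^2" for i
    using fat[of i] by (subst (asm) nn_integral_eq_integral[OF iG2]) auto
  have iG1: "integrable TM (\<lambda>x. G x - g i x)" for i
    by (rule TM.square_integrable_imp_integrable[OF _ iG2]) measurable
  have iG: "integrable TM G"
    using Bochner_Integration.integrable_add[OF iG1[of 0] ig[of 0]] by simp
  \<comment> \<open>The mean survives because the L1 distance from \<open>G\<close> to the mean-free
    \<open>g i\<close> is of order \<open>1 / 2 ^ i\<close>.\<close>
  have zG: "(LINT x|TM. G x) = 0"
  proof -
    have "\<bar>LINT x|TM. G x\<bar> \<le> (4 * C^2 + mu) / 2 * (1 / 2 ^ i)" for i
    proof -
      have "(LINT x|TM. g i x) = 0" using Lg by (simp add: L2_fun_def)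
      then have "\<bar>LINT x|TM. G x\<bar> = \<bar>LINT x|TM. G x - g i x\<bar>" using iG ig by simp
      also have "\<dots> \<le> (LINT x|TM. \<bar>G x - g i x\<bar>)" by (rule integral_abs_bound)
      also have "\<dots> \<le> (LINT x|TM. (2 ^ i * (G x - g i x)^2 + 1 / 2 ^ i) / 2)"
        by (intro integral_mono sqrt_ineq_young) (use iG1 iG2 in auto)
      also have "\<dots> = (2 ^ i * (LINT x|TM. (G x - g i x)^2) + mu / 2 ^ i) / 2"
        using iG2 by (simp add: intC mu_def)
      also have "\<dots> \<le> (2 ^ i * (2 * C / 2 ^ i)^2 + mu / 2 ^ i) / 2"
        by (intro divide_right_mono add_right_mono mult_left_mono nG) auto
      also have "\<dots> = (4 * C^2 + mu) / 2 * (1 / 2 ^ i)" by (simp add: power2_eq_square field_simps)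
      finally show ?thesis .
    qed
    moreover have "(\<lambda>i. (4 * C^2 + mu) / 2 * (1 / 2 ^ i)) \<longlonglongrightarrow> (4 * C^2 + mu) / 2 * 0"
      by (intro tendsto_mult tendsto_const) (simp add: LIMSEQ_inverse_realpow_zero flip: inverse_eq_divide)
    ultimately have "\<bar>LINT x|TM. G x\<bar> \<le> 0" by (intro LIMSEQ_le_const) auto
    then show ?thesis by simp
  qed
  have LG: "L2_fun G"
  proof -
    have "integrable TM (\<lambda>x. 2 * (G x - g 0 x)^2 + 2 * (g 0 x)^2)"
      using iG2[of 0] Lg[of 0] by (simp add: L2_fun_def)
    then have "integrable TM (\<lambda>x. (G x)^2)"
    proof (rule Bochner_Integration.integrable_bound)
      have "(a::real)^2 \<le> 2 * (a - b)^2 + 2 * b^2" for a b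
        using zero_le_power2[of "a - 2 * b"] by (simp add: power2_eq_square algebra_simps)
      then show "AE x in TM. norm ((G x)^2) \<le> norm (2 * (G x - g 0 x)^2 + 2 * (g 0 x)^2)" by simp
    qed measurable
    with zG show ?thesis by (simp add: L2_fun_def)
  qed
  define b where "b = abs_L2 G"
  have "norm (X i - b) \<le> 2 * C / 2 ^ i" for i
  proof -
    have "(norm (X i - b))^2 = (LINT x|TM. (G x - g i x)^2)"
      unfolding norm_diff_integral
    proof (rule integral_cong_AE)
      show "AE x in TM. (rep_L2 (X i) x - rep_L2 b x)^2 = (G x - g i x)^2"
        using rep_abs_L2[OF LG] unfolding b_def g_def by eventually_elim (simp add: power2_commute)
    qed (use L2_fun_measurable[OF L2_fun_rep] in measurable)
    also have "\<dots> \<le> (2 * C / 2 ^ i)^2" by (rule nG)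
    finally show ?thesis by (rule power2_le_imp_le) (use C in simp)
  qed
  moreover have "(\<lambda>i. 2 * C * (1 / 2 ^ i)) \<longlonglongrightarrow> 2 * C * 0"
    by (intro tendsto_mult tendsto_const) (simp add: LIMSEQ_inverse_realpow_zero flip: inverse_eq_divide)
  ultimately have "(\<lambda>i. X i - b) \<longlonglongrightarrow> 0"
    by (intro Lim_null_comparison[of "\<lambda>i. X i - b" "\<lambda>i. 2 * C * (1 / 2 ^ i)"]) auto
  then show ?thesis using Lim_null by blast
qed

declare split_paired_All [simp del] split_paired_Ex [simp del]

lemma nonneg_summableI:
  fixes f :: "'a \<Rightarrow> real"
  assumes "\<And>x. 0 \<le> f x" "\<And>F. finite F \<Longrightarrow> sum f F \<le> B" shows "f summable_on A"
  by (rule nonneg_bdd_above_summable_on) (use assms in \<open>auto intro!: bdd_aboveI2[of _ _ B]\<close>)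

lemma summable_tail:
  fixes f :: "'a \<Rightarrow> real"
  assumes "f summable_on UNIV" "\<And>x. 0 \<le> f x" "e > 0"
  obtains X where "finite X" "\<And>F. finite F \<Longrightarrow> F \<inter> X = {} \<Longrightarrow> sum f F \<le> e"
proof -
  have "(f has_sum infsum f UNIV) UNIV" using assms(1) by simp
  from has_sum_finite_approximation[OF this assms(3)]
  obtain X where X: "finite X" "dist (sum f X) (infsum f UNIV) \<le> e" by auto
  have "sum f F \<le> e" if "finite F" "F \<inter> X = {}" for F
  proof -
    have "sum f F + sum f X = sum f (F \<union> X)" using that X by (simp add: sum.union_disjoint)
    also have "\<dots> \<le> infsum f UNIV" using that X assms by (intro finite_sum_le_infsum) auto
    finally show ?thesis using X(2) by (simp add: dist_real_def)
  qed
  with X(1) that show ?thesis by blast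
qed

lemma summable_mult_le:
  fixes a b :: "'a \<Rightarrow> complex"
  assumes "(\<lambda>k. (cmod (a k))^2) summable_on UNIV" "(\<lambda>k. (cmod (b k))^2) summable_on UNIV"
  shows "(\<lambda>k. cmod (a k * b k)) summable_on UNIV"
proof (rule Infinite_Sum.abs_summable_on_comparison_test)
  show "(\<lambda>k. norm ((cmod (a k))^2 + (cmod (b k))^2)) summable_on UNIV"
    using summable_on_add[OF assms] by simp
  fix k
  have "2 * (cmod (a k) * cmod (b k)) \<le> (cmod (a k))^2 + (cmod (b k))^2"
    using sum_squares_bound[of "cmod (a k)" "cmod (b k)"] by simp
  moreover have "0 \<le> cmod (a k) * cmod (b k)" by simp
  ultimately show "norm (a k * b k) \<le> norm ((cmod (a k))^2 + (cmod (b k))^2)"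
    unfolding norm_mult real_norm_def by linarith
qed

lemma symF_Diff: "symF F \<Longrightarrow> symF G \<Longrightarrow> symF (F - G)"
  unfolding symF_def by (auto simp: image_set_diff inj_on_def)

lemma Bx_exhaust: "filterlim (\<lambda>n. insert 0 (Bx n)) (finite_subsets_at_top UNIV) sequentially"
  unfolding filterlim_finite_subsets_at_top
proof (intro allI impI)
  fix X :: "(int \<times> int) set" assume "finite X \<and> X \<subseteq> UNIV"
  then obtain n where n: "X - {0} \<subseteq> Bx n" using finite_subset_Bx[of "X - {0}"] by auto
  have "\<forall>m\<ge>n. finite (insert 0 (Bx m)) \<and> X \<subseteq> insert 0 (Bx m) \<and> insert 0 (Bx m) \<subseteq> UNIV"
    using n Bx_mono by fastforce
  then show "\<forall>\<^sub>F y in sequentially. finite (insert 0 (Bx y)) \<and> X \<subseteq> insert 0 (Bx y) \<and> insert 0 (Bx y) \<subseteq> UNIV"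
    unfolding eventually_sequentially by blast
qed

lemma has_sum_Bx:
  fixes f :: "int \<times> int \<Rightarrow> 'a::{topological_comm_monoid_add,t2_space}"
  assumes "(f has_sum S) UNIV" "f 0 = 0" shows "(\<lambda>n. sum f (Bx n)) \<longlonglongrightarrow> S"
proof -
  have "(\<lambda>n. sum f (insert 0 (Bx n))) \<longlonglongrightarrow> S"
    using assms(1) unfolding has_sum_def by (rule filterlim_compose[OF _ Bx_exhaust])
  then show ?thesis using assms(2) by simp
qed

text \<open>Since \<open>L2_complete\<close> wants geometrically small increments, it is applied to
  a subsequence of the sums over boxes; the Cauchy property carries the limit back to the whole
  sequence, and single coefficients are continuous in the norm.\<close>

theorem riesz_fischer:
  assumes d: "symc d" "d 0 = 0" "(\<lambda>k. (cmod (d k))^2) summable_on UNIV"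
  obtains b where "\<And>k. fcoeff b k = d k" "(\<lambda>n. tpL (Bx n) d) \<longlonglongrightarrow> b"
proof -
  define S where "S = (\<lambda>n. tpL (Bx n) d)"
  have diff: "(norm (S n - S m))^2 = (2 * pi)^2 * (\<Sum>k\<in>Bx n - Bx m. (cmod (d k))^2)" if "m \<le> n" for m n
  proof -
    have s: "symF (Bx n - Bx m)" by (intro symF_Diff symF_Bx)
    have "S n - S m = tpL (Bx n - Bx m) d"
      unfolding S_def using Bx_mono[OF that]
      by (intro L2_eqI) (auto simp: fcoeff_minus fcoeff_tpL[OF symF_Bx d(1)] fcoeff_tpL[OF s d(1)])
    then show ?thesis using norm_tpL[OF s d(1)] by simp
  qed
  have "\<exists>N. \<forall>n\<ge>N. \<forall>m\<ge>N. n \<ge> m \<longrightarrow> norm (S n - S m) \<le> e" if e: "e > 0" for e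
  proof -
    have "(e / (2 * pi))^2 > 0" using e by simp
    from summable_tail[OF d(3) _ this]
    obtain X where X: "finite X" "\<And>F. finite F \<Longrightarrow> F \<inter> X = {} \<Longrightarrow> (\<Sum>k\<in>F. (cmod (d k))^2) \<le> (e / (2 * pi))^2"
      by auto
    obtain N where N: "X - {0} \<subseteq> Bx N" using finite_subset_Bx[of "X - {0}"] X(1) by auto
    have "norm (S n - S m) \<le> e" if "n \<ge> m" "m \<ge> N" for n m
    proof -
      have "(Bx n - Bx m) \<inter> X = {}" using N Bx_mono[OF that(2)] by (auto simp: Bx_def)
      then have "(norm (S n - S m))^2 \<le> (2 * pi)^2 * (e / (2 * pi))^2"
        unfolding diff[OF that(1)] by (intro mult_left_mono X) auto
      also have "\<dots> = e^2" by (simp add: power_divide)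
      finally show ?thesis by (rule power2_le_imp_le) (use e in simp)
    qed
    then show ?thesis by blast
  qed
  then have "\<forall>i. \<exists>N. \<forall>n\<ge>N. \<forall>m\<ge>N. n \<ge> m \<longrightarrow> norm (S n - S m) \<le> 1 / 2 ^ i" by simp
  then obtain N where N: "\<And>i n m. n \<ge> m \<Longrightarrow> m \<ge> N i \<Longrightarrow> norm (S n - S m) \<le> 1 / 2 ^ i"
    by (metis order_trans)
  define M where "M = (\<lambda>i. i + (\<Sum>j\<le>i. N j))"
  have M: "N i \<le> M i" "i \<le> M i" "M i \<le> M (Suc i)" for i
    unfolding M_def using member_le_sum[of i "{..i}" N] by auto
  have "norm (S (M (Suc i)) - S (M i)) \<le> 1 / 2 ^ i" for i by (intro N M)
  from L2_complete[OF this] obtain b where b: "(\<lambda>i. S (M i)) \<longlonglongrightarrow> b" by blast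
  have "S \<longlonglongrightarrow> b"
  proof (rule LIMSEQ_I)
    fix r :: real assume r: "0 < r"
    then obtain i0 where i0: "\<And>i. i \<ge> i0 \<Longrightarrow> norm (S (M i) - b) < r / 2"
      using LIMSEQ_D[OF b, of "r / 2"] by auto
    obtain j where "(1/2) ^ j < r / 2" using real_arch_pow_inv[of "r / 2" "1 / 2"] r by auto
    define i where "i = max i0 j"
    have "1 / 2 ^ i \<le> (1/2::real) ^ j" unfolding i_def
      by (simp add: power_divide[symmetric] power_one_over[symmetric] power_decreasing)
    with \<open>(1/2) ^ j < r / 2\<close> have i: "1 / 2 ^ i < r / 2" by simp
    have "norm (S n - b) < r" if "n \<ge> M i" for n
    proof -
      have "norm (S n - b) \<le> norm (S n - S (M i)) + norm (S (M i) - b)"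
        using norm_triangle_ineq[of "S n - S (M i)" "S (M i) - b"] by simp
      moreover have "norm (S n - S (M i)) \<le> 1 / 2 ^ i" by (intro N that M)
      moreover have "norm (S (M i) - b) < r / 2" by (intro i0) (simp add: i_def)
      ultimately show ?thesis using i by linarith
    qed
    then show "\<exists>no. \<forall>n\<ge>no. norm (S n - b) < r" by blast
  qed
  moreover have "fcoeff b k = d k" for k
  proof -
    have "(\<lambda>n. fcoeff (S n) k) \<longlonglongrightarrow> fcoeff b k"
    proof (rule Lim_null[THEN iffD2], rule Lim_null_comparison)
      show "\<forall>\<^sub>F n in sequentially. norm (fcoeff (S n) k - fcoeff b k) \<le> norm (S n - b) / (2 * pi)"
        using fcoeff_le_norm[of "S n - b" k for n]
        by (intro always_eventually allI) (simp add: fcoeff_minus field_simps)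
      show "(\<lambda>n. norm (S n - b) / (2 * pi)) \<longlonglongrightarrow> 0"
        using \<open>S \<longlonglongrightarrow> b\<close> by (intro tendsto_divide_zero tendsto_norm_zero) (simp add: LIM_zero)
    qed
    moreover have "(\<lambda>n. fcoeff (S n) k) \<longlonglongrightarrow> d k"
    proof (rule tendsto_eventually)
      obtain n where "{k} - {0} \<subseteq> Bx n" using finite_subset_Bx[of "{k} - {0}"] by auto
      then have "fcoeff (S m) k = d k" if "m \<ge> n" for m
        using Bx_mono[OF that] d(2) unfolding S_def fcoeff_tpL[OF symF_Bx d(1)] by (cases "k = 0") auto
      then show "\<forall>\<^sub>F n in sequentially. fcoeff (S n) k = d k" unfolding eventually_sequentially by blast
    qed
    ultimately show ?thesis by (rule LIMSEQ_unique)
  qed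
  ultimately show ?thesis using that unfolding S_def by blast
qed

lemma symc_fcoeff: "symc (fcoeff a)" by (simp add: symc_def fcoeff_uminus)

lemma fcoeff_square_bound:
  assumes "finite F" shows "(\<Sum>k\<in>F. (cmod (fcoeff a k))^2) \<le> (norm a)^2 / (2 * pi)^2"
  using bessel[OF assms, of a] by (simp add: field_simps)

lemma fcoeff_summable: "(\<lambda>k. (cmod (fcoeff a k))^2) summable_on UNIV"
  by (rule nonneg_summableI[OF _ fcoeff_square_bound]) auto

text \<open>The limit supplied by \<open>riesz_fischer\<close> has the coefficients of
  \<open>a\<close>, hence equals \<open>a\<close>.\<close>

lemma partial_sums_tendsto: "(\<lambda>n. tpL (Bx n) (fcoeff a)) \<longlonglongrightarrow> a"
proof -
  obtain b where "\<And>k. fcoeff b k = fcoeff a k" "(\<lambda>n. tpL (Bx n) (fcoeff a)) \<longlonglongrightarrow> b"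
    using riesz_fischer[OF symc_fcoeff fcoeff_0 fcoeff_summable] by metis
  then show ?thesis using L2_eqI[of b a] by simp
qed

lemma parseval: "((\<lambda>k. (cmod (fcoeff a k))^2) has_sum (norm a)\<^sup>2 / (2 * pi)^2) UNIV"
proof -
  have "(\<lambda>n. (norm (tpL (Bx n) (fcoeff a)))^2 / (2 * pi)^2) \<longlonglongrightarrow> (norm a)^2 / (2 * pi)^2"
    by (intro tendsto_intros partial_sums_tendsto) simp
  then have "(\<lambda>n. \<Sum>k\<in>Bx n. (cmod (fcoeff a k))^2) \<longlonglongrightarrow> (norm a)^2 / (2 * pi)^2"
    by (simp add: norm_tpL[OF symF_Bx symc_fcoeff])
  moreover have h: "((\<lambda>k. (cmod (fcoeff a k))^2) has_sum (\<Sum>\<^sub>\<infinity>k. (cmod (fcoeff a k))^2)) UNIV"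
    using fcoeff_summable by simp
  ultimately have "(norm a)^2 / (2 * pi)^2 = (\<Sum>\<^sub>\<infinity>k. (cmod (fcoeff a k))^2)"
    using has_sum_Bx[OF h] by (intro LIMSEQ_unique) auto
  with h show ?thesis by simp
qed

section \<open>Products and Fourier multipliers\<close>

lemma Cauchy_Schwarz_integral:
  fixes f g :: "'a \<Rightarrow> real"
  assumes m [measurable]: "f \<in> borel_measurable M" "g \<in> borel_measurable M"
    and i: "integrable M (\<lambda>x. (f x)^2)" "integrable M (\<lambda>x. (g x)^2)"
  shows "(LINT x|M. \<bar>f x * g x\<bar>) \<le> sqrt (LINT x|M. (f x)^2) * sqrt (LINT x|M. (g x)^2)"
proof -
  have e2: "(ennreal \<bar>t\<bar>)^2 = ennreal (t^2)" for t by (simp add: ennreal_power)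
  have ifg: "integrable M (\<lambda>x. \<bar>f x * g x\<bar>)"
  proof (rule Bochner_Integration.integrable_bound)
    show "integrable M (\<lambda>x. (f x)^2 + (g x)^2)" using i by simp
    show "AE x in M. norm \<bar>f x * g x\<bar> \<le> norm ((f x)^2 + (g x)^2)"
    proof (intro AE_I2)
      fix x
      have "2 * (\<bar>f x\<bar> * \<bar>g x\<bar>) \<le> (f x)^2 + (g x)^2"
        using sum_squares_bound[of "\<bar>f x\<bar>" "\<bar>g x\<bar>"] by (simp add: mult.assoc)
      moreover have "0 \<le> \<bar>f x\<bar> * \<bar>g x\<bar>" by simp
      ultimately have "\<bar>f x\<bar> * \<bar>g x\<bar> \<le> (f x)^2 + (g x)^2" by linarith
      then show "norm \<bar>f x * g x\<bar> \<le> norm ((f x)^2 + (g x)^2)" by (simp add: abs_mult)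
    qed
  qed measurable
  have "(ennreal (LINT x|M. \<bar>f x * g x\<bar>))^2 = (\<integral>\<^sup>+x. ennreal \<bar>f x\<bar> * ennreal \<bar>g x\<bar> \<partial>M)^2"
    by (subst nn_integral_eq_integral[OF ifg, symmetric]) (auto simp: abs_mult ennreal_mult)
  also have "\<dots> \<le> (\<integral>\<^sup>+x. (ennreal \<bar>f x\<bar>)^2 \<partial>M) * (\<integral>\<^sup>+x. (ennreal \<bar>g x\<bar>)^2 \<partial>M)"
    by (rule Cauchy_Schwarz_nn_integral) measurable
  also have "\<dots> = ennreal ((LINT x|M. (f x)^2) * (LINT x|M. (g x)^2))"
    unfolding e2 using i by (simp add: nn_integral_eq_integral ennreal_mult)
  finally have "(LINT x|M. \<bar>f x * g x\<bar>)^2 \<le> (LINT x|M. (f x)^2) * (LINT x|M. (g x)^2)"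
    by (simp add: ennreal_power)
  then show ?thesis by (simp add: real_le_rsqrt flip: real_sqrt_mult)
qed

lemma norm_L2_sqrt: "norm a = sqrt (LINT x|TM. (rep_L2 a x)^2)"
  by (simp flip: norm_L2_integral)

lemma product_integrable: "integrable TM (\<lambda>x. of_real (rep_L2 a x * rep_L2 b x) * E k x)"
  by (intro TM_mult_integrable continuous_intros)
     (simp only: complex_of_real_integrable_eq L2_fun_mult_integrable L2_fun_rep)

text \<open>The Fourier coefficient of the pointwise product, which is merely integrable and need
  not be mean-free, so it is not of the form \<open>fcoeff\<close>.\<close>

definition pc :: "L2 \<Rightarrow> L2 \<Rightarrow> coef" where
  "pc a b k = (LINT x|TM. of_real (rep_L2 a x * rep_L2 b x) * E (- k) x) / (2 * pi)^2"

lemma pc_bound: "cmod (pc a b k) \<le> norm a * norm b / (2 * pi)^2"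
proof -
  have "cmod (LINT x|TM. of_real (rep_L2 a x * rep_L2 b x) * E (- k) x)
    \<le> (LINT x|TM. cmod (of_real (rep_L2 a x * rep_L2 b x) * E (- k) x))"
    by (rule integral_norm_bound)
  also have "\<dots> = (LINT x|TM. \<bar>rep_L2 a x * rep_L2 b x\<bar>)" by (simp add: norm_mult abs_mult)
  also have "\<dots> \<le> norm a * norm b"
    unfolding norm_L2_sqrt using L2_fun_rep by (intro Cauchy_Schwarz_integral) (auto simp: L2_fun_def)
  finally show ?thesis unfolding pc_def by (simp add: norm_divide divide_right_mono flip: of_real_power)
qed

lemma pc_minus: "pc (a - b) c k = pc a c k - pc b c k"
proof -
  have "(LINT x|TM. of_real (rep_L2 (a - b) x * rep_L2 c x) * E (- k) x)
    = (LINT x|TM. of_real (rep_L2 a x * rep_L2 c x) * E (- k) x - of_real (rep_L2 b x * rep_L2 c x) * E (- k) x)"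
  proof (rule integral_cong_AE)
    show "AE x in TM. of_real (rep_L2 (a - b) x * rep_L2 c x) * E (- k) x =
       of_real (rep_L2 a x * rep_L2 c x) * E (- k) x - of_real (rep_L2 b x * rep_L2 c x) * E (- k) x"
      using rep_diff_AE[of a b]
    proof eventually_elim
      case (elim x)
      show ?case unfolding elim by (simp add: algebra_simps)
    qed
  qed (intro borel_measurable_integrable Bochner_Integration.integrable_diff product_integrable)+
  then show ?thesis unfolding pc_def
    by (simp only: Bochner_Integration.integral_diff[OF product_integrable product_integrable] diff_divide_distrib)
qed

lemma pc_tpL:
  assumes "symF F" "symc d" shows "pc (tpL F d) b k = (\<Sum>j\<in>F. d j * fcoeff b (k - j))"
proof -
  have f: "0 \<notin> F" using assms(1) by (simp add: symF_def)
  have "(LINT x|TM. of_real (rep_L2 (tpL F d) x * rep_L2 b x) * E (- k) x) =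
    (LINT x|TM. of_real (rep_L2 (tpL F d) x) * (of_real (rep_L2 b x) * E (- k) x))"
    by (simp add: mult.assoc)
  also have "\<dots> = (LINT x|TM. of_real (tp F d x) * (of_real (rep_L2 b x) * E (- k) x))"
    unfolding tpL_def by (intro integral_rep_abs L2_fun_tp f) (auto intro!: borel_measurable_integrable L2_fun_E_integrable L2_fun_rep)
  finally have 1: "(LINT x|TM. of_real (rep_L2 (tpL F d) x * rep_L2 b x) * E (- k) x) =
    (LINT x|TM. of_real (tp F d x) * (of_real (rep_L2 b x) * E (- k) x))" .
  have eq: "E j x * E (- k) x = E (- (k - j)) x" for j x by (simp flip: E_add)
  have "(LINT x|TM. of_real (tp F d x) * (of_real (rep_L2 b x) * E (- k) x)) = (LINT x|TM. (\<Sum>j\<in>F. d j * (of_real (rep_L2 b x) * E (- (k - j)) x)))"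
    unfolding tp_sym[OF assms] sum_distrib_right
    by (intro Bochner_Integration.integral_cong sum.cong refl) (simp only: eq[symmetric] mult_ac)
  also have "\<dots> = (\<Sum>j\<in>F. d j * (LINT x|TM. of_real (rep_L2 b x) * E (- (k - j)) x))"
    by (subst Bochner_Integration.integral_sum) (simp_all add: L2_fun_E_integrable L2_fun_rep)
  finally show ?thesis unfolding pc_def 1 fcoeff_fc fc_def by (simp add: sum_divide_distrib)
qed

text \<open>The convolution formula is exact when the first factor is a trigonometric polynomial
  (\<open>pc_tpL\<close>), and \<open>pc_bound\<close> passes it to the limit. Absolute convergence
  identifies the limit along boxes with the unordered sum.\<close>

lemma pc_has_sum: "((\<lambda>j. fcoeff a j * fcoeff b (k - j)) has_sum pc a b k) UNIV"
proof -
  have "bij (\<lambda>j. k - j)" by (rule bij_betw_byWitness[of _ "\<lambda>j. k - j"]) auto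
  then have "(\<lambda>j. (cmod (fcoeff b (k - j)))^2) summable_on UNIV"
    using fcoeff_summable[of b] by (subst summable_on_reindex_bij_betw[of "\<lambda>j. k - j" UNIV UNIV])
  then have "(\<lambda>j. cmod (fcoeff a j * fcoeff b (k - j))) summable_on UNIV"
    by (rule summable_mult_le[OF fcoeff_summable])
  then have h: "((\<lambda>j. fcoeff a j * fcoeff b (k - j)) has_sum (\<Sum>\<^sub>\<infinity>j. fcoeff a j * fcoeff b (k - j))) UNIV"
    by (rule has_sum_infsum[OF Infinite_Sum.abs_summable_summable])
  have "(\<lambda>n. pc (tpL (Bx n) (fcoeff a)) b k) \<longlonglongrightarrow> pc a b k"
  proof (rule Lim_null[THEN iffD2], rule Lim_null_comparison)
    show "\<forall>\<^sub>F n in sequentially. norm (pc (tpL (Bx n) (fcoeff a)) b k - pc a b k)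
      \<le> norm (tpL (Bx n) (fcoeff a) - a) * norm b / (2 * pi)^2"
      using pc_bound[of "tpL (Bx n) (fcoeff a) - a" b k for n] by (simp add: pc_minus)
    show "(\<lambda>n. norm (tpL (Bx n) (fcoeff a) - a) * norm b / (2 * pi)^2) \<longlonglongrightarrow> 0"
      using partial_sums_tendsto[of a]
      by (intro tendsto_divide_zero tendsto_mult_left_zero tendsto_norm_zero) (simp add: LIM_zero)
  qed
  then have "(\<lambda>n. \<Sum>j\<in>Bx n. fcoeff a j * fcoeff b (k - j)) \<longlonglongrightarrow> pc a b k"
    by (simp add: pc_tpL[OF symF_Bx symc_fcoeff])
  with has_sum_Bx[OF h] have "pc a b k = (\<Sum>\<^sub>\<infinity>j. fcoeff a j * fcoeff b (k - j))"
    by (intro LIMSEQ_unique) auto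
  with h show ?thesis by simp
qed

lemma fcoeff_multiplier:
  assumes m: "\<And>k. m (- k) = cnj (m k)" and s: "(\<lambda>k. (cmod (m k * fcoeff a k))^2) summable_on UNIV"
  shows "fcoeff (multiplier m a) k = m k * fcoeff a k"
proof -
  have 1: "symc (\<lambda>k. m k * fcoeff a k)" by (simp add: symc_def m fcoeff_uminus)
  have 2: "m 0 * fcoeff a 0 = 0" by simp
  obtain b where b: "\<And>k. fcoeff b k = m k * fcoeff a k" using riesz_fischer[OF 1 2 s] by blast
  then have "multiplier m a = b" by (intro multiplierI) simp
  with b show ?thesis by simp
qed

lemma fcoeff_multiplier_bounded:
  assumes m: "\<And>k. m (- k) = cnj (m k)" and B: "\<And>k. k \<noteq> 0 \<Longrightarrow> cmod (m k) \<le> B"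
  shows "fcoeff (multiplier m a) k = m k * fcoeff a k"
proof (rule fcoeff_multiplier[of m, OF m], rule nonneg_summableI)
  fix F :: "(int \<times> int) set" assume F: "finite F"
  have "(\<Sum>k\<in>F. (cmod (m k * fcoeff a k))^2) \<le> (\<Sum>k\<in>F. B^2 * (cmod (fcoeff a k))^2)"
  proof (intro sum_mono)
    fix k show "(cmod (m k * fcoeff a k))^2 \<le> B^2 * (cmod (fcoeff a k))^2"
      using B[of k] by (cases "k = 0") (auto simp: norm_mult power_mult_distrib intro!: mult_right_mono power_mono)
  qed
  also have "\<dots> \<le> B^2 * ((norm a)^2 / (2 * pi)^2)"
    unfolding sum_distrib_left[symmetric] by (intro mult_left_mono fcoeff_square_bound F) auto
  finally show "(\<Sum>k\<in>F. (cmod (m k * fcoeff a k))^2) \<le> B^2 * ((norm a)^2 / (2 * pi)^2)" .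
qed simp

lemma fst_le_kabs: "\<bar>of_int (fst k)\<bar> \<le> kabs k" "\<bar>of_int (snd k)\<bar> \<le> kabs k"
  unfolding kabs_def by (auto intro!: real_le_rsqrt)

lemma kabs_ge_1: "k \<noteq> 0 \<Longrightarrow> 1 \<le> kabs k"
proof -
  assume "k \<noteq> 0"
  then have "1 \<le> \<bar>fst k\<bar> \<or> 1 \<le> \<bar>snd k\<bar>" by (auto simp: prod_eq_iff)
  then have "1 \<le> \<bar>real_of_int (fst k)\<bar> \<or> 1 \<le> \<bar>real_of_int (snd k)\<bar>" by linarith
  then show ?thesis using fst_le_kabs[of k] by linarith
qed

lemma kabs_nonneg [simp]: "0 \<le> kabs k" by (simp add: kabs_def)
lemma kabs_0 [simp]: "kabs 0 = 0" by (simp add: kabs_def)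
lemma kabs_uminus [simp]: "kabs (- k) = kabs k" by (simp add: kabs_def)
lemma kabs_pos: "k \<noteq> 0 \<Longrightarrow> 0 < kabs k" using kabs_ge_1[of k] by linarith
lemma kabs_eq_0 [simp]: "kabs k = 0 \<longleftrightarrow> k = 0" using kabs_pos[of k] by (cases "k = 0") auto
lemma kabs_squared: "(kabs k)^2 = (of_int (fst k))^2 + (of_int (snd k))^2"
  by (simp add: kabs_def)
lemma kabs_complex: "kabs k = cmod (Complex (of_int (fst k)) (of_int (snd k)))"
  by (simp add: kabs_def cmod_def)
lemma kabs_triangle: "kabs (k + j) \<le> kabs k + kabs j"
  unfolding kabs_complex using norm_triangle_ineq[of "Complex (of_int (fst k)) (of_int (snd k))" "Complex (of_int (fst j)) (of_int (snd j))"]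
  by (simp add: plus_complex.code)
lemma fcoeff_Lam_minus: "fcoeff (Lam (- 1) a) k = of_real (kabs k powr (- 1)) * fcoeff a k"
  unfolding Lam_def
proof (rule fcoeff_multiplier_bounded[where B = 1])
  fix k :: "int \<times> int" assume "k \<noteq> 0"
  then show "cmod (of_real (kabs k powr - 1)) \<le> 1" using kabs_ge_1[of k]
    by (simp add: powr_minus_divide norm_divide)
qed simp

text \<open>\<open>D1\<close> and \<open>D2\<close> are unbounded, but after
  \<open>Lam (- 1)\<close> their symbols have modulus at most 1. Hence the square-summability
  required by \<open>fcoeff_multiplier\<close> holds for every \<open>a\<close>.\<close>

lemma fcoeff_riesz:
  "fcoeff (fst (riesz_perp a)) k = - (\<i> * of_int (snd k) / of_real (kabs k)) * fcoeff a k"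
  "fcoeff (snd (riesz_perp a)) k = (\<i> * of_int (fst k) / of_real (kabs k)) * fcoeff a k"
proof -
  have s: "(\<lambda>k. (cmod (\<i> * of_int (p k) * fcoeff (Lam (- 1) a) k))^2) summable_on UNIV"
    if p: "\<And>k. \<bar>of_int (p k)\<bar> \<le> kabs k" for p
  proof (rule nonneg_summableI)
    fix F :: "(int \<times> int) set" assume F: "finite F"
    have "(\<Sum>k\<in>F. (cmod (\<i> * of_int (p k) * fcoeff (Lam (- 1) a) k))^2) \<le> (\<Sum>k\<in>F. (cmod (fcoeff a k))^2)"
    proof (intro sum_mono power_mono)
      fix k
      show "cmod (\<i> * of_int (p k) * fcoeff (Lam (- 1) a) k) \<le> cmod (fcoeff a k)"
      proof (cases "k = 0")
        case False
        have "cmod (\<i> * of_int (p k) * fcoeff (Lam (- 1) a) k) = \<bar>of_int (p k)\<bar> / kabs k * cmod (fcoeff a k)"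
          using kabs_pos[OF False] by (simp add: fcoeff_Lam_minus norm_mult norm_divide powr_minus_divide)
        also have "\<dots> \<le> 1 * cmod (fcoeff a k)"
          using kabs_pos[OF False] p[of k] by (intro mult_right_mono) auto
        finally show ?thesis by simp
      qed (simp add: fcoeff_Lam_minus)
    qed simp
    also have "\<dots> \<le> (norm a)^2 / (2 * pi)^2" by (rule fcoeff_square_bound[OF F])
    finally show "(\<Sum>k\<in>F. (cmod (\<i> * of_int (p k) * fcoeff (Lam (- 1) a) k))^2) \<le> (norm a)^2 / (2 * pi)^2" .
  qed simp
  \<comment> \<open>At \<open>k = 0\<close> both sides are 0, by the conventions for
    \<open>powr\<close> and for division by 0.\<close>
  have pw: "kabs k powr - 1 = 1 / kabs k" by (cases "k = 0") (auto simp: powr_minus_divide)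
  have "fcoeff (D2 (Lam (- 1) a)) k = \<i> * of_int (snd k) * fcoeff (Lam (- 1) a) k"
    unfolding D2_def by (rule fcoeff_multiplier[OF _ s]) (auto intro: fst_le_kabs)
  then show "fcoeff (fst (riesz_perp a)) k = - (\<i> * of_int (snd k) / of_real (kabs k)) * fcoeff a k"
    unfolding riesz_perp_def fst_conv fcoeff_uminus_L2 by (simp add: fcoeff_Lam_minus pw)
  have "fcoeff (D1 (Lam (- 1) a)) k = \<i> * of_int (fst k) * fcoeff (Lam (- 1) a) k"
    unfolding D1_def by (rule fcoeff_multiplier[OF _ s]) (auto intro: fst_le_kabs)
  then show "fcoeff (snd (riesz_perp a)) k = (\<i> * of_int (fst k) / of_real (kabs k)) * fcoeff a k"
    unfolding riesz_perp_def snd_conv by (simp add: fcoeff_Lam_minus pw)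
qed

section \<open>The Fourier system of a viscous solution\<close>

lemma poly_div_exp_tendsto: "((\<lambda>y. poly q y / exp y) \<longlongrightarrow> (0::real)) at_top"
proof -
  have "((\<lambda>y. \<Sum>i\<le>degree q. coeff q i * (y ^ i / exp y)) \<longlongrightarrow> (\<Sum>i\<le>degree q. coeff q i * 0)) at_top"
    by (intro tendsto_sum tendsto_mult tendsto_const tendsto_power_div_exp_0)
  moreover have "(\<Sum>i\<le>degree q. coeff q i * (y ^ i / exp y)) = poly q y / exp y" for y
    by (simp add: poly_altdef sum_divide_distrib)
  ultimately show ?thesis by simp
qed

text \<open>The standard smooth function that vanishes to infinite order at 0, with a polynomial in
  1/s as prefactor so that the family is closed under differentiation. As a function of time,
  \<open>flat q (R - t)\<close> vanishes from \<open>R\<close> on.\<close>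

definition flat :: "real poly \<Rightarrow> real \<Rightarrow> real" where
  "flat q s = (if s > 0 then poly q (1 / s) * exp (- (1 / s)) else 0)"

text \<open>In the variable y = 1/s one has d/ds = - y^2 d/dy, which sends q exp(-y) to y^2 (q - q')
  exp(-y).\<close>

definition dflat :: "real poly \<Rightarrow> real poly" where "dflat q = [:0, 0, 1:] * (q - pderiv q)"

text \<open>Only s = 0 needs an argument: from the right the difference quotient is again a
  polynomial in 1/s times exp(-1/s) and tends to 0, from the left it is 0.\<close>

lemma flat_has_derivative: "(flat q has_real_derivative flat (dflat q) s) (at s)"
proof -
  consider "s > 0" | "s = 0" | "s < 0" by linarith
  then show ?thesis
  proof cases
    case 1
    have "((\<lambda>s. poly q (1 / s) * exp (- (1 / s))) has_real_derivative flat (dflat q) s) (at s)"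
    proof -
      have i: "((\<lambda>s. 1 / s) has_real_derivative - (1 / s^2)) (at s)"
        using 1 by (auto intro!: derivative_eq_intros simp: power2_eq_square)
      have "((\<lambda>s. poly q (1 / s)) has_real_derivative poly (pderiv q) (1 / s) * (- (1 / s^2))) (at s)"
        by (rule DERIV_chain2[OF poly_DERIV i])
      moreover have "((\<lambda>s. exp (- (1 / s))) has_real_derivative exp (- (1 / s)) * (1 / s^2)) (at s)"
        using DERIV_chain2[OF DERIV_exp DERIV_minus[OF i]] by simp
      ultimately have "((\<lambda>s. poly q (1 / s) * exp (- (1 / s))) has_real_derivative
         poly (pderiv q) (1 / s) * (- (1 / s^2)) * exp (- (1 / s)) + exp (- (1 / s)) * (1 / s^2) * poly q (1 / s)) (at s)"
        by (rule DERIV_mult)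
      moreover have "poly (pderiv q) (1 / s) * (- (1 / s^2)) * exp (- (1 / s)) + exp (- (1 / s)) * (1 / s^2) * poly q (1 / s)
         = flat (dflat q) s"
      proof -
        have "flat (dflat q) s = (1 / s)^2 * (poly q (1/s) - poly (pderiv q) (1/s)) * exp (- (1/s))"
          using 1 by (simp add: flat_def dflat_def power2_eq_square)
        then show ?thesis by (simp only: power_divide) (simp add: algebra_simps)
      qed
      ultimately show ?thesis by (simp only:)
    qed
    moreover have ev: "eventually (\<lambda>s. poly q (1 / s) * exp (- (1 / s)) = flat q s) (nhds s)"
      using eventually_nhds_in_open[of "{0<..}" s] 1
      by (auto simp: flat_def elim!: eventually_mono)
    ultimately show ?thesis by (simp only: DERIV_cong_ev[OF refl ev refl])
  next
    case 3
    have "((\<lambda>s. 0) has_real_derivative flat (dflat q) s) (at s)"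
      using 3 unfolding flat_def by simp
    moreover have ev: "eventually (\<lambda>s. 0 = flat q s) (nhds s)"
      using eventually_nhds_in_open[of "{..<0}" s] 3
      by (auto simp: flat_def elim!: eventually_mono)
    ultimately show ?thesis by (simp only: DERIV_cong_ev[OF refl ev refl])
  next
    case 2
    have "((\<lambda>y. poly ([:0, 1:] * q) y / exp y) \<longlongrightarrow> 0) at_top" by (rule poly_div_exp_tendsto)
    then have "((\<lambda>h. poly ([:0, 1:] * q) (inverse h) / exp (inverse h)) \<longlongrightarrow> 0) (at_right 0)"
      by (rule filterlim_compose[OF _ filterlim_inverse_at_top_right])
    then have "((\<lambda>h. flat q h / h) \<longlongrightarrow> 0) (at_right 0)"
    proof (rule Lim_transform_eventually)
      show "\<forall>\<^sub>F h in at_right 0. poly ([:0, 1:] * q) (inverse h) / exp (inverse h) = flat q h / h"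
        using eventually_at_right_less[of "0::real"]
        by eventually_elim (simp add: flat_def exp_minus divide_inverse mult_ac)
    qed
    moreover have "((\<lambda>h. flat q h / h) \<longlongrightarrow> 0) (at_left 0)"
    proof (rule tendsto_eventually)
      show "\<forall>\<^sub>F h in at_left 0. flat q h / h = 0"
        using eventually_at_left_real[of "-1" "0::real"] by (auto simp: flat_def elim!: eventually_mono)
    qed
    ultimately have "((\<lambda>h. flat q h / h) \<longlongrightarrow> 0) (at 0)" by (simp add: filterlim_split_at)
    moreover have "flat q 0 = 0" "flat (dflat q) 0 = 0" by (simp_all add: flat_def)
    ultimately show ?thesis unfolding 2 DERIV_def by simp
  qed
qed

text \<open>A forward step along a coordinate never leaves the half space, even at time 0. This is
  the condition under which a derivative within a set is unique.\<close>

lemma spacetime_directions: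
  assumes "z \<in> spacetime" "i \<in> Basis" "e > 0"
  shows "\<exists>d. 0 < \<bar>d\<bar> \<and> \<bar>d\<bar> < e \<and> z + d *\<^sub>R i \<in> spacetime"
proof (intro exI conjI)
  show "z + (e / 2) *\<^sub>R i \<in> spacetime"
    using assms by (cases z) (auto simp: spacetime_def Basis_prod_def)
qed (use assms in auto)

lemma dir_derivI:
  assumes "(\<phi> has_derivative D) (at z within spacetime)" "z \<in> spacetime"
  shows "dir_deriv v \<phi> z = D v"
proof -
  have "(\<phi> has_derivative frechet_derivative \<phi> (at z within spacetime)) (at z within spacetime)"
    using assms(1) frechet_derivative_works differentiableI by blast
  then have "D = frechet_derivative \<phi> (at z within spacetime)"
    by (rule frechet_derivative_unique_within[OF assms(1)]) (intro spacetime_directions assms)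
  then show ?thesis by (simp add: dir_deriv_def)
qed

lemma has_derivative_spacetime_cong:
  assumes "\<And>z. z \<in> spacetime \<Longrightarrow> \<phi> z = \<psi> z" "z \<in> spacetime"
  shows "(\<phi> has_derivative D) (at z within spacetime) \<longleftrightarrow> (\<psi> has_derivative D) (at z within spacetime)"
  using has_derivative_transform[OF assms(2), of \<phi> \<psi> D] has_derivative_transform[OF assms(2), of \<psi> \<phi> D] assms(1)
  by metis

text \<open>Needed because explicit formulas for derivatives, such as \<open>dir_deriv_bas\<close>,
  are available on \<open>spacetime\<close> only.\<close>

lemma Ck_cong: "(\<And>z. z \<in> spacetime \<Longrightarrow> \<phi> z = \<psi> z) \<Longrightarrow> Ck n \<phi> \<longleftrightarrow> Ck n \<psi>"
proof (induction n arbitrary: \<phi> \<psi>)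
  case 0
  then show ?case by (auto intro: continuous_on_cong)
next
  case (Suc n)
  have "\<phi> differentiable_on spacetime \<longleftrightarrow> \<psi> differentiable_on spacetime"
    unfolding differentiable_on_def differentiable_def
    by (intro ball_cong refl ex_cong1 has_derivative_spacetime_cong Suc.prems)
  moreover have "Ck n (dir_deriv v \<phi>) \<longleftrightarrow> Ck n (dir_deriv v \<psi>)" for v
    by (rule Suc.IH) (simp add: dir_deriv_def frechet_derivative_def has_derivative_spacetime_cong[of \<phi> \<psi>] Suc.prems)
  ultimately show ?case by simp
qed

text \<open>A real plane wave with a flat time factor. Testing with these suffices to read off the
  equation of each Fourier coefficient, and directional derivatives stay in the span of the
  family.\<close>

definition bas :: "real \<Rightarrow> int \<times> int \<Rightarrow> real poly \<Rightarrow> complex \<Rightarrow> real \<times> real \<times> real \<Rightarrow> real" where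
  "bas R k q c z = flat q (R - fst z) * Re (c * E k (snd z))"

lemma bas_has_derivative:
  "(bas R k q c has_derivative (\<lambda>v. bas R k (- dflat q) (of_real (fst v) * c) z
     + bas R k q (\<i> * (of_int (fst k) * of_real (fst (snd v)) + of_int (snd k) * of_real (snd (snd v))) * c) z)) (at z within S)"
proof -
  have "((\<lambda>z. flat q (R - fst z)) has_derivative (\<lambda>v. - fst v * flat (dflat q) (R - fst z))) (at z within S)"
  proof -
    have "((\<lambda>z. R - fst z) has_derivative (\<lambda>v. - fst v)) (at z within S)"
      by (auto intro!: derivative_eq_intros)
    moreover have "(flat q has_derivative (\<lambda>x. x * flat (dflat q) (R - fst z))) (at (R - fst z))"
      using flat_has_derivative[of q "R - fst z"] by (simp add: has_field_derivative_def mult.commute[of _ "flat (dflat q) (R - fst z)"])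
    ultimately show ?thesis by (rule has_derivative_compose)
  qed
  moreover have "((\<lambda>z. Re (c * E k (snd z))) has_derivative (\<lambda>v. Re (\<i> * (of_int (fst k) * of_real (fst (snd v)) + of_int (snd k) * of_real (snd (snd v))) * c * E k (snd z)))) (at z within S)"
    unfolding E_def by (auto intro!: derivative_eq_intros simp: scaleR_conv_of_real algebra_simps)
  ultimately show ?thesis
    unfolding bas_def
    by (rule has_derivative_eq_rhs[OF has_derivative_mult]) (auto simp: algebra_simps flat_def)
qed

lemma dir_deriv_bas:
  assumes "z \<in> spacetime"
  shows "dir_deriv v (bas R k q c) z = bas R k (- dflat q) (of_real (fst v) * c) z
     + bas R k q (\<i> * (of_int (fst k) * of_real (fst (snd v)) + of_int (snd k) * of_real (snd (snd v))) * c) z"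
  by (rule dir_derivI[OF bas_has_derivative assms])

lemma Ck_add: "Ck n \<phi> \<Longrightarrow> Ck n \<psi> \<Longrightarrow> Ck n (\<lambda>z. \<phi> z + \<psi> z)"
proof (induction n arbitrary: \<phi> \<psi>)
  case 0
  then show ?case by (auto intro: continuous_intros)
next
  case (Suc n)
  have d: "dir_deriv v (\<lambda>z. \<phi> z + \<psi> z) z = dir_deriv v \<phi> z + dir_deriv v \<psi> z" if z: "z \<in> spacetime" for v z
  proof -
    obtain D D' where D: "(\<phi> has_derivative D) (at z within spacetime)" "(\<psi> has_derivative D') (at z within spacetime)"
      using Suc.prems z unfolding Ck.simps differentiable_on_def differentiable_def by meson
    from dir_derivI[OF has_derivative_add[OF D] z] dir_derivI[OF D(1) z] dir_derivI[OF D(2) z]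
    show ?thesis by simp
  qed
  have "Ck n (\<lambda>z. dir_deriv v \<phi> z + dir_deriv v \<psi> z)" for v
    using Suc by simp
  then have "Ck n (dir_deriv v (\<lambda>z. \<phi> z + \<psi> z))" for v
    using Ck_cong[of "dir_deriv v (\<lambda>z. \<phi> z + \<psi> z)" "\<lambda>z. dir_deriv v \<phi> z + dir_deriv v \<psi> z" n for v] d by simp
  then show ?case using Suc.prems by (simp add: differentiable_on_add)
qed

text \<open>A directional derivative is a sum of two members of the family with other
  \<open>q\<close> and \<open>c\<close>, so the induction has to run over all \<open>q\<close> and
  \<open>c\<close> at once.\<close>

lemma Ck_bas: "Ck n (bas R k q c)"
proof (induction n arbitrary: q c)
  case 0
  have "\<And>z. continuous (at z) (bas R k q c)" using has_derivative_continuous[OF bas_has_derivative] by blast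
  then show ?case by (simp add: continuous_at_imp_continuous_on)
next
  case (Suc n)
  have "bas R k q c differentiable_on spacetime"
    unfolding differentiable_on_def differentiable_def using bas_has_derivative by blast
  moreover have "Ck n (dir_deriv v (bas R k q c))" for v
    by (subst Ck_cong[OF dir_deriv_bas]) (assumption, rule Ck_add[OF Suc Suc])
  ultimately show ?case by simp
qed

lemma E_periodic: "E k (x + 2 * pi, y) = E k (x, y)" "E k (x, y + 2 * pi) = E k (x, y)"
proof -
  have "E k (x + 2 * pi, y) = E k (x, y) * cis (2 * pi * of_int (fst k))"
    "E k (x, y + 2 * pi) = E k (x, y) * cis (2 * pi * of_int (snd k))"
    by (simp_all add: E_def cis_mult algebra_simps)
  then show "E k (x + 2 * pi, y) = E k (x, y)" "E k (x, y + 2 * pi) = E k (x, y)"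
    by (simp_all add: cis_multiple_2pi)
qed

lemma tp_single: "tp {k} (\<lambda>_. c) x = Re (c * E k x)" by (simp add: tp_def)

lemma test_function_bas:
  assumes "k \<noteq> 0" shows "test_function (bas R k q c)"
  unfolding test_function_def
proof (intro conjI allI impI)
  show "Ck n (bas R k q c)" for n by (rule Ck_bas)
  show "bas R k q c (t, x + 2 * pi, y) = bas R k q c (t, x, y)" "bas R k q c (t, x, y + 2 * pi) = bas R k q c (t, x, y)" for t x y
    by (simp_all add: bas_def E_periodic)
  have "(LINT x|TM. tp {k} (\<lambda>_. c) x) = 0" using L2_fun_tp[of "{k}"] assms by (simp add: L2_fun_def)
  then show "(LINT x|TM. bas R k q c (t, x)) = 0" for t
    unfolding bas_def by (simp add: tp_single)
  show "\<exists>R'. \<forall>t\<ge>R'. \<forall>x. bas R k q c (t, x) = 0"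
    by (intro exI[of _ R]) (auto simp: bas_def flat_def)
qed

lemma slice_bas:
  assumes "k \<noteq> 0" shows "slice (bas R k q c) t = flat q (R - t) *\<^sub>R tpL {k} (\<lambda>_. c)"
  unfolding slice_def tpL_def
  using L2_fun_tp[of "{k}" "\<lambda>_. c"] assms
  by (subst scaleR_L2.abs_eq) (auto simp: L2_eq_def bas_def tp_single)

lemma slice_dt_bas:
  assumes "k \<noteq> 0" "t \<ge> 0" shows "slice (dt (bas R k q c)) t = (- flat (dflat q) (R - t)) *\<^sub>R tpL {k} (\<lambda>_. c)"
proof -
  have "slice (dt (bas R k q c)) t = slice (bas R k (- dflat q) c) t"
    unfolding slice_def using assms(2)
    by (intro arg_cong[where f = abs_L2] ext) (simp add: dir_deriv_bas spacetime_def bas_def)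
  also have "flat (- dflat q) (R - t) = - flat (dflat q) (R - t)" by (simp add: flat_def)
  then have "slice (bas R k (- dflat q) c) t = (- flat (dflat q) (R - t)) *\<^sub>R tpL {k} (\<lambda>_. c)"
    by (simp add: slice_bas[OF assms(1)])
  finally show ?thesis .
qed

text \<open>Taking the real part of the wave shares \<open>c\<close> equally between the frequencies
  \<open>k\<close> and \<open>- k\<close>.\<close>

lemma fcoeff_tpL_single:
  assumes "k \<noteq> 0"
  shows "fcoeff (tpL {k} (\<lambda>_. c)) j = (if j = k then c / 2 else 0) + (if j = - k then cnj c / 2 else 0)"
proof -
  define d where "d = (\<lambda>j. (if j = k then c / 2 else 0) + (if j = - k then cnj c / 2 else 0))"
  have kk: "k \<noteq> - k" using assms by (auto simp: prod_eq_iff)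
  have s: "symF {k, - k}" using assms by (auto simp: symF_def)
  have sd: "symc d" unfolding symc_def d_def by (auto simp: minus_equation_iff)
  have "tp {k, - k} d = tp {k} (\<lambda>_. c)"
    using kk by (intro ext) (auto simp: tp_def d_def E_uminus simp flip: complex_cnj_mult)
  then have "tpL {k} (\<lambda>_. c) = tpL {k, - k} d" by (simp add: tpL_def)
  then show ?thesis using fcoeff_tpL[OF s sd, of j] by (auto simp: d_def)
qed

lemma multiplier_single:
  assumes "k \<noteq> 0" "m (- k) = cnj (m k)"
  shows "multiplier m (r *\<^sub>R tpL {k} (\<lambda>_. c)) = r *\<^sub>R tpL {k} (\<lambda>_. m k * c)"
proof (rule multiplierI)
  fix j
  have kk: "k \<noteq> - k" using assms(1) by (auto simp: prod_eq_iff)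
  show "fcoeff (r *\<^sub>R tpL {k} (\<lambda>_. m k * c)) j = m j * fcoeff (r *\<^sub>R tpL {k} (\<lambda>_. c)) j"
    unfolding fcoeff_scaleR fcoeff_tpL_single[OF assms(1)]
    using kk assms(2) by (cases "j = k"; cases "j = - k") simp_all
qed

lemma inner_single:
  assumes "k \<noteq> 0" shows "inner a (r *\<^sub>R tpL {k} (\<lambda>_. c)) = (2 * pi)^2 * r * Re (c * cnj (fcoeff a k))"
  using assms by (simp add: inner_tpL)

text \<open>The coefficient of div (a u) with u = \<open>riesz_perp a\<close>. As u is divergence
  free this is the transport term, in a form that makes sense for every \<open>a\<close> in
  \<open>L2\<close>.\<close>

definition Nl :: "L2 \<Rightarrow> coef" where
  "Nl a k = \<i> * (of_int (fst k) * pc a (fst (riesz_perp a)) k + of_int (snd k) * pc a (snd (riesz_perp a)) k)"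

lemma pc_cnj: "(LINT x|TM. of_real (rep_L2 a x * rep_L2 b x) * E k x) = (2 * pi)^2 * cnj (pc a b k)"
  unfolding pc_def by (simp flip: Bochner_Integration.integral_cnj add: E_uminus)

lemma transport_bas:
  assumes "k \<noteq> 0" "t \<ge> 0"
  shows "transport_pairing \<theta> (bas R k q c) t = - (2 * pi)\<^sup>2 * flat q (R - t) * Re (c * cnj (Nl (\<theta> t) k))"
proof -
  define u1 u2 where "u1 = fst (riesz_perp (\<theta> t))" "u2 = snd (riesz_perp (\<theta> t))"
  note u = u1_u2_def
  define f1 f2 where "f1 = (\<lambda>x. of_real (rep_L2 (\<theta> t) x * rep_L2 u1 x) * E k x)"
    "f2 = (\<lambda>x. of_real (rep_L2 (\<theta> t) x * rep_L2 u2 x) * E k x)"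
  define a where "a = of_real (flat q (R - t)) * \<i> * c"
  have i: "integrable TM f1" "integrable TM f2" unfolding f1_f2_def by (rule product_integrable)+
  have "transport_pairing \<theta> (bas R k q c) t = (LINT x|TM. Re (a * (of_int (fst k) * f1 x + of_int (snd k) * f2 x)))"
    unfolding transport_pairing_def Let_def u[symmetric] f1_f2_def a_def using assms(2)
    by (intro Bochner_Integration.integral_cong)
       (simp_all add: dir_deriv_bas spacetime_def bas_def algebra_simps)
  also have "\<dots> = Re (LINT x|TM. a * (of_int (fst k) * f1 x + of_int (snd k) * f2 x))"
    by (intro integral_Re integrable_mult_right Bochner_Integration.integrable_add i)
  also have "(LINT x|TM. a * (of_int (fst k) * f1 x + of_int (snd k) * f2 x)) =
     a * (of_int (fst k) * (LINT x|TM. f1 x) + of_int (snd k) * (LINT x|TM. f2 x))"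
    using i by simp
  also have "\<dots> = of_real ((2 * pi)^2 * flat q (R - t)) * (- c * cnj (Nl (\<theta> t) k))"
    unfolding f1_f2_def pc_cnj Nl_def u a_def by (simp add: algebra_simps)
  finally show ?thesis by (simp del: of_real_mult)
qed

text \<open>The integrands of the weak formulation are controlled only at almost every time: where
  the solution is not regular enough, \<open>Lam (1/2)\<close>, \<open>D1\<close> and
  \<open>D2\<close> may return unspecified values. Completeness of Lebesgue measure makes such
  integrands measurable all the same.\<close>

lemma measurable_AE_lebesgue:
  fixes f g :: "'a::euclidean_space \<Rightarrow> real"
  assumes "f \<in> borel_measurable lebesgue" "AE x in lebesgue. f x = g x"
  shows "g \<in> borel_measurable lebesgue"
proof (rule measurableI)
  fix S :: "real set" assume S: "S \<in> sets borel"
  have "f -` S \<inter> space lebesgue \<in> sets lebesgue" using assms(1) S by (rule measurable_sets)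
  then show "g -` S \<inter> space lebesgue \<in> sets lebesgue"
    by (rule completion.in_sets_AE[rotated]) (use assms(2) in \<open>auto elim: eventually_mono\<close>)
qed simp

lemma set_integral_AE_lebesgue:
  fixes f g :: "'a::euclidean_space \<Rightarrow> real"
  assumes "AE x in lebesgue. x \<in> A \<longrightarrow> f x = g x" "set_integrable lebesgue A f"
  shows "set_lebesgue_integral lebesgue A g = set_lebesgue_integral lebesgue A f"
proof -
  have m: "(\<lambda>x. indicator A x *\<^sub>R f x) \<in> borel_measurable lebesgue"
    using assms(2) unfolding set_integrable_def by (rule borel_measurable_integrable)
  have ae: "AE x in lebesgue. indicator A x *\<^sub>R f x = indicator A x *\<^sub>R g x"
    using assms(1) by eventually_elim (auto simp: indicator_def)
  show ?thesis unfolding set_lebesgue_integral_def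
    using measurable_AE_lebesgue[OF m ae] m ae by (intro integral_cong_AE) auto
qed

lemma norm_L2_mono:
  assumes "\<And>k. cmod (fcoeff a k) \<le> cmod (fcoeff b k)" shows "norm a \<le> norm b"
proof -
  have "(norm a)^2 / (2 * pi)^2 \<le> (norm b)^2 / (2 * pi)^2"
    by (rule has_sum_mono[OF parseval parseval]) (simp add: assms power_mono)
  then have "(norm a)^2 \<le> (norm b)^2" by (simp add: divide_le_cancel)
  then show ?thesis by (rule power2_le_imp_le) simp
qed

lemma norm_riesz: "norm (fst (riesz_perp a)) \<le> norm a" "norm (snd (riesz_perp a)) \<le> norm a"
proof -
  have *: "cmod (c * of_int p / of_real (kabs k)) \<le> 1" if "\<bar>of_int p\<bar> \<le> kabs k" "cmod c = 1" for c p k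
    using that by (cases "k = 0") (auto simp: norm_mult norm_divide kabs_pos)
  have le: "cmod (m * z) \<le> cmod z" if "cmod m \<le> 1" for m z
    using mult_right_mono[OF that, of "cmod z"] by (simp add: norm_mult)
  show "norm (fst (riesz_perp a)) \<le> norm a"
    using *[OF fst_le_kabs(2), of "- \<i>"]
    by (intro norm_L2_mono) (simp only: fcoeff_riesz, intro le, simp)
  show "norm (snd (riesz_perp a)) \<le> norm a"
    using *[OF fst_le_kabs(1), of "\<i>"]
    by (intro norm_L2_mono) (simp only: fcoeff_riesz, intro le, simp)
qed

lemma riesz_minus:
  "fst (riesz_perp (a - b)) = fst (riesz_perp a) - fst (riesz_perp b)"
  "snd (riesz_perp (a - b)) = snd (riesz_perp a) - snd (riesz_perp b)"
  by (intro L2_eqI, simp only: fcoeff_riesz fcoeff_minus right_diff_distrib)+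

lemma pc_commute: "pc a b k = pc b a k"
  unfolding pc_def by (simp add: mult.commute)

lemma pc_minus_right: "pc a (b - c) k = pc a b k - pc a c k"
  using pc_minus[of b c a k] by (simp add: pc_commute)

text \<open>Together with \<open>tendsto_riesz\<close> this makes every
  \<open>Nl (\<theta> t) k\<close> continuous in time, so that the coefficients solve a differential
  equation at all times and not only almost everywhere.\<close>

lemma tendsto_pc:
  assumes "(a \<longlongrightarrow> a0) F" "(b \<longlongrightarrow> b0) F" shows "((\<lambda>x. pc (a x) (b x) k) \<longlongrightarrow> pc a0 b0 k) F"
proof (rule Lim_null[THEN iffD2], rule Lim_null_comparison)
  show "\<forall>\<^sub>F x in F. norm (pc (a x) (b x) k - pc a0 b0 k)
     \<le> norm (a x - a0) * norm (b x) / (2 * pi)^2 + norm a0 * norm (b x - b0) / (2 * pi)^2"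
  proof (intro always_eventually allI)
    fix x
    have "pc (a x) (b x) k - pc a0 b0 k = pc (a x - a0) (b x) k + pc a0 (b x - b0) k"
      by (simp add: pc_minus pc_minus_right)
    also have "norm \<dots> \<le> norm (pc (a x - a0) (b x) k) + norm (pc a0 (b x - b0) k)" by (rule norm_triangle_ineq)
    also have "\<dots> \<le> norm (a x - a0) * norm (b x) / (2 * pi)^2 + norm a0 * norm (b x - b0) / (2 * pi)^2"
      by (intro add_mono pc_bound)
    finally show "norm (pc (a x) (b x) k - pc a0 b0 k)
     \<le> norm (a x - a0) * norm (b x) / (2 * pi)^2 + norm a0 * norm (b x - b0) / (2 * pi)^2" .
  qed
  have "((\<lambda>x. norm (a x - a0) * norm (b x) / (2 * pi)^2 + norm a0 * norm (b x - b0) / (2 * pi)^2)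
    \<longlongrightarrow> norm (a0 - a0) * norm b0 / (2 * pi)^2 + norm a0 * norm (b0 - b0) / (2 * pi)^2) F"
    using assms by (intro tendsto_intros) simp_all
  then show "((\<lambda>x. norm (a x - a0) * norm (b x) / (2 * pi)^2 + norm a0 * norm (b x - b0) / (2 * pi)^2)
    \<longlongrightarrow> 0) F" by simp
qed

lemma tendsto_riesz:
  assumes "(a \<longlongrightarrow> a0) F"
  shows "((\<lambda>x. fst (riesz_perp (a x))) \<longlongrightarrow> fst (riesz_perp a0)) F"
    "((\<lambda>x. snd (riesz_perp (a x))) \<longlongrightarrow> snd (riesz_perp a0)) F"
proof -
  have 0: "((\<lambda>x. norm (a x - a0)) \<longlongrightarrow> 0) F" using assms by (intro tendsto_norm_zero) (simp add: LIM_zero)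
  show "((\<lambda>x. fst (riesz_perp (a x))) \<longlongrightarrow> fst (riesz_perp a0)) F"
    by (rule Lim_null[THEN iffD2], rule Lim_null_comparison[OF _ 0])
       (simp flip: riesz_minus add: norm_riesz)
  show "((\<lambda>x. snd (riesz_perp (a x))) \<longlongrightarrow> snd (riesz_perp a0)) F"
    by (rule Lim_null[THEN iffD2], rule Lim_null_comparison[OF _ 0])
       (simp flip: riesz_minus add: norm_riesz)
qed

lemma tendsto_fcoeff:
  assumes "(a \<longlongrightarrow> a0) F" shows "((\<lambda>x. fcoeff (a x) k) \<longlongrightarrow> fcoeff a0 k) F"
proof (rule Lim_null[THEN iffD2], rule Lim_null_comparison)
  show "\<forall>\<^sub>F x in F. norm (fcoeff (a x) k - fcoeff a0 k) \<le> norm (a x - a0) / (2 * pi)"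
    using fcoeff_le_norm[of "a x - a0" k for x] by (intro always_eventually allI) (simp add: fcoeff_minus field_simps)
  show "((\<lambda>x. norm (a x - a0) / (2 * pi)) \<longlongrightarrow> 0) F"
    using assms by (intro tendsto_divide_zero tendsto_norm_zero) (simp add: LIM_zero)
qed

lemma continuous_fcoeff: "continuous_on S \<theta> \<Longrightarrow> continuous_on S (\<lambda>t. fcoeff (\<theta> t) k)"
  unfolding continuous_on_def using tendsto_fcoeff by blast

lemma tendsto_Nl: "(a \<longlongrightarrow> a0) F \<Longrightarrow> ((\<lambda>x. Nl (a x) k) \<longlongrightarrow> Nl a0 k) F"
  unfolding Nl_def by (intro tendsto_intros tendsto_pc tendsto_riesz)

lemma continuous_Nl: "continuous_on S \<theta> \<Longrightarrow> continuous_on S (\<lambda>t. Nl (\<theta> t) k)"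
  unfolding continuous_on_def using tendsto_Nl by blast

text \<open>The planar cross product. Advection of frequency \<open>j\<close> by a perpendicular
  gradient of frequency \<open>k - j\<close> produces this factor, since the cross products of
  \<open>k\<close> and of \<open>k - j\<close> with \<open>j\<close> agree.\<close>

definition crs :: "int \<times> int \<Rightarrow> int \<times> int \<Rightarrow> real" where
  "crs k j = of_int (fst k * snd j - snd k * fst j)"

text \<open>The symbol of the nonlinearity. For \<open>k = j\<close> the quotient is
  \<open>0 / 0 = 0\<close>, in accordance with the vanishing mean of the velocity.\<close>

definition ker :: "int \<times> int \<Rightarrow> int \<times> int \<Rightarrow> real" where
  "ker k j = crs k j / kabs (k - j)"

lemma Nl_has_sum: "((\<lambda>j. - of_real (ker k j) * fcoeff a j * fcoeff a (k - j)) has_sum Nl a k) UNIV"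
proof -
  have "((\<lambda>j. \<i> * (of_int (fst k) * (fcoeff a j * fcoeff (fst (riesz_perp a)) (k - j))
      + of_int (snd k) * (fcoeff a j * fcoeff (snd (riesz_perp a)) (k - j)))) has_sum Nl a k) UNIV"
    unfolding Nl_def by (intro has_sum_cmult_right has_sum_add pc_has_sum)
  moreover have "\<i> * (of_int (fst k) * (fcoeff a j * fcoeff (fst (riesz_perp a)) (k - j))
      + of_int (snd k) * (fcoeff a j * fcoeff (snd (riesz_perp a)) (k - j)))
      = - of_real (ker k j) * fcoeff a j * fcoeff a (k - j)" for j
    unfolding fcoeff_riesz ker_def crs_def
    by (simp add: add_divide_distrib diff_divide_distrib algebra_simps)
  ultimately show ?thesis by simp
qed

lemma set_integral_continuous:
  fixes h h0 :: "real \<Rightarrow> real"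
  assumes "continuous_on {a..b} h0" "AE t in lebesgue. t \<in> {a..b} \<longrightarrow> h0 t = h t"
  shows "(LINT t:{a..b}|lebesgue. h t) = integral {a..b} h0"
proof -
  have "set_integrable lborel {a..b} h0" using assms(1) by (rule borel_integrable_atLeastAtMost')
  then have si: "set_integrable lebesgue {a..b} h0"
    unfolding set_integrable_def by (simp add: integrable_completion borel_measurable_integrable)
  show ?thesis
    using set_integral_AE_lebesgue[OF assms(2) si] set_lebesgue_integral_eq_integral(2)[OF si] by simp
qed

lemma sobolev_fcoeff_multiplier:
  assumes a: "a \<in> sobolev \<sigma>" and m: "\<And>k. m (- k) = cnj (m k)" "\<And>k. k \<noteq> 0 \<Longrightarrow> cmod (m k) \<le> kabs k powr \<sigma>"
  shows "fcoeff (multiplier m a) k = m k * fcoeff a k"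
proof (rule fcoeff_multiplier[of m, OF m(1)])
  have s: "(\<lambda>k. kabs k powr (2 * \<sigma>) * (cmod (fcoeff a k))^2) summable_on (UNIV - {0})"
    using a by (simp add: sobolev_def)
  have "(\<lambda>k. (cmod (m k * fcoeff a k))^2) summable_on (UNIV - {0})"
  proof (rule summable_on_comparison_test[OF s])
    fix k :: "int \<times> int" assume "k \<in> UNIV - {0}"
    then have k: "k \<noteq> 0" by simp
    have "(cmod (m k))^2 \<le> (kabs k powr \<sigma>)^2" by (intro power_mono m k) simp
    also have "\<dots> = kabs k powr (2 * \<sigma>)" by (simp add: power2_eq_square flip: powr_add)
    finally show "(cmod (m k * fcoeff a k))^2 \<le> kabs k powr (2 * \<sigma>) * (cmod (fcoeff a k))^2"
      by (simp add: norm_mult power_mult_distrib mult_right_mono)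
  qed simp
  then have "(\<lambda>k. (cmod (m k * fcoeff a k))^2) summable_on (insert 0 (UNIV - {0}))"
    by (subst summable_on_insert_iff)
  then show "(\<lambda>k. (cmod (m k * fcoeff a k))^2) summable_on UNIV" by (simp add: insert_absorb)
qed

lemma sobolev_mono:
  assumes "a \<in> sobolev s" "r \<le> s" shows "a \<in> sobolev r"
  unfolding sobolev_def
proof
  show "(\<lambda>k. kabs k powr (2 * r) * (cmod (fcoeff a k))^2) summable_on (UNIV - {0})"
  proof (rule summable_on_comparison_test)
    show "(\<lambda>k. kabs k powr (2 * s) * (cmod (fcoeff a k))^2) summable_on (UNIV - {0})"
      using assms by (simp add: sobolev_def)
    fix k :: "int \<times> int" assume "k \<in> UNIV - {0}"
    then show "kabs k powr (2 * r) * (cmod (fcoeff a k))^2 \<le> kabs k powr (2 * s) * (cmod (fcoeff a k))^2"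
      using assms(2) kabs_ge_1[of k] by (intro mult_right_mono powr_mono) auto
  qed simp
qed

lemma viscous_sobolev_AE:
  assumes "viscous_solution \<epsilon> f \<theta>" "T > 0"
  shows "AE t in lebesgue. t \<in> {0..T} \<longrightarrow> \<theta> t \<in> sobolev 1"
proof -
  have "AE t in lebesgue_on {0<..<T}. \<theta> t \<in> sobolev 1"
    using assms unfolding viscous_solution_def L2_time_sobolev_def by blast
  then have "AE t in lebesgue. t \<in> {0<..<T} \<longrightarrow> \<theta> t \<in> sobolev 1"
    by (subst (asm) AE_restrict_space_iff) auto
  moreover have "AE t in lebesgue. t \<noteq> (0::real)" "AE t in lebesgue. t \<noteq> T"
    by (intro AE_completion AE_lborel_singleton)+
  ultimately show ?thesis
    by eventually_elim auto
qed

text \<open>The weak formulation tested with one \<open>bas\<close> function. Every time integral is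
  rewritten with a continuous integrand that agrees with the original almost everywhere, after which
  the common factor \<open>(2 * pi)^2\<close> cancels.\<close>

lemma viscous_identity:
  assumes v: "viscous_solution \<epsilon> f \<theta>" and k: "k \<noteq> 0" and T: "0 < T"
    and w: "w = (\<lambda>t. flat [:1:] (R - t))" "w' = (\<lambda>t. - flat (dflat [:1:]) (R - t))"
    and y: "y = (\<lambda>t. Re (c * cnj (fcoeff (\<theta> t) k)))"
    and b: "\<beta> = (\<lambda>t. Re (c * cnj (fcoeff f k - Nl (\<theta> t) k - (kabs k + \<epsilon> * (kabs k)^2) * fcoeff (\<theta> t) k)))"
  shows "w T * y T = w 0 * y 0 + integral {0..T} (\<lambda>t. w' t * y t + w t * \<beta> t)"
proof -
  define \<phi> where "\<phi> = bas R k [:1:] c"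
  define N where "N = (\<lambda>t. Re (c * cnj (Nl (\<theta> t) k)))"
  define F where "F = Re (c * cnj (fcoeff f k))"
  define P where "P = (2 * pi)^2"
  have P: "P > 0" by (simp add: P_def)
  have c\<theta>: "continuous_on {0..T} \<theta>"
    using v unfolding viscous_solution_def by (auto intro: continuous_on_subset)
  have cflat: "continuous_on S (\<lambda>t. flat q (R - t))" for q S
  proof -
    have "isCont (flat q) s" for s by (rule DERIV_isCont[OF flat_has_derivative])
    then have c: "continuous_on UNIV (flat q)" by (simp add: continuous_at_imp_continuous_on)
    have "continuous_on S (\<lambda>t. R - t)" by (intro continuous_intros)
    then show ?thesis by (rule continuous_on_compose2[OF c]) simp
  qed
  have cw: "continuous_on {0..T} w" "continuous_on {0..T} w'"
    unfolding w by (intro continuous_intros cflat)+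
  have cy: "continuous_on {0..T} y" and cN: "continuous_on {0..T} N"
    unfolding y N_def by (intro continuous_intros continuous_fcoeff continuous_Nl c\<theta>)+
  have \<phi>: "test_function \<phi>" unfolding \<phi>_def by (rule test_function_bas[OF k])
  have sl: "slice \<phi> t = w t *\<^sub>R tpL {k} (\<lambda>_. c)" for t unfolding \<phi>_def w by (rule slice_bas[OF k])
  have I1: "(LINT t:{0..T}|lebesgue. inner (\<theta> t) (slice (dt \<phi>) t)) = integral {0..T} (\<lambda>t. P * (w' t * y t))"
    by (rule set_integral_continuous, (intro continuous_intros cw cy)[1])
       (auto simp: \<phi>_def slice_dt_bas[OF k] inner_single[OF k] w y P_def simp del: inner_scaleR_right)
  have I2: "(LINT t:{0..T}|lebesgue. transport_pairing \<theta> \<phi> t) = integral {0..T} (\<lambda>t. - (P * (w t * N t)))"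
    by (rule set_integral_continuous, (intro continuous_intros cw cN)[1])
       (auto simp: \<phi>_def transport_bas[OF k] w N_def P_def)
  have I5: "(LINT t:{0..T}|lebesgue. inner f (slice \<phi> t)) = integral {0..T} (\<lambda>t. P * (w t * F))"
    by (rule set_integral_continuous, (intro continuous_intros cw)[1])
       (auto simp: sl inner_single[OF k] F_def P_def simp del: inner_scaleR_right)
  \<comment> \<open>At such times the three multipliers act on coefficients as their symbols say;
    nothing is claimed about the remaining null set.\<close>
  have ae: "AE t in lebesgue. t \<in> {0..T} \<longrightarrow> \<theta> t \<in> sobolev 1" by (rule viscous_sobolev_AE[OF v T])
  have I3: "(LINT t:{0..T}|lebesgue. inner (Lam (1/2) (\<theta> t)) (Lam (1/2) (slice \<phi> t))) = integral {0..T} (\<lambda>t. P * (w t * (kabs k * y t)))"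
  proof (rule set_integral_continuous)
    show "AE t in lebesgue. t \<in> {0..T} \<longrightarrow> P * (w t * (kabs k * y t)) = inner (Lam (1/2) (\<theta> t)) (Lam (1/2) (slice \<phi> t))"
    proof (rule eventually_mono[OF ae], rule impI)
      fix t assume "t \<in> {0..T} \<longrightarrow> \<theta> t \<in> sobolev 1" "t \<in> {0..T}"
      then have "\<theta> t \<in> sobolev (1/2)" using sobolev_mono[of "\<theta> t" 1 "1/2"] by auto
      then have L: "fcoeff (Lam (1/2) (\<theta> t)) k = of_real (kabs k powr (1/2)) * fcoeff (\<theta> t) k"
        unfolding Lam_def by (rule sobolev_fcoeff_multiplier) auto
      have "Lam (1/2) (slice \<phi> t) = w t *\<^sub>R tpL {k} (\<lambda>_. of_real (kabs k powr (1/2)) * c)"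
        unfolding sl Lam_def by (rule multiplier_single[OF k]) simp
      then have "inner (Lam (1/2) (\<theta> t)) (Lam (1/2) (slice \<phi> t))
         = P * w t * Re (of_real (kabs k powr (1/2)) * c * cnj (of_real (kabs k powr (1/2)) * fcoeff (\<theta> t) k))"
        unfolding P_def by (simp only: inner_single[OF k] L)
      also have "of_real (kabs k powr (1/2)) * c * cnj (of_real (kabs k powr (1/2)) * fcoeff (\<theta> t) k)
          = of_real (kabs k powr (1/2) * kabs k powr (1/2)) * (c * cnj (fcoeff (\<theta> t) k))" by simp
      also have "kabs k powr (1/2) * kabs k powr (1/2) = kabs k" by (simp flip: powr_add)
      finally show "P * (w t * (kabs k * y t)) = inner (Lam (1/2) (\<theta> t)) (Lam (1/2) (slice \<phi> t))" by (simp add: y)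
    qed
  qed (intro continuous_intros cw cy)
  have I4: "(LINT t:{0..T}|lebesgue. inner (D1 (\<theta> t)) (D1 (slice \<phi> t)) + inner (D2 (\<theta> t)) (D2 (slice \<phi> t))) = integral {0..T} (\<lambda>t. P * (w t * ((kabs k)^2 * y t)))"
  proof (rule set_integral_continuous)
    show "AE t in lebesgue. t \<in> {0..T} \<longrightarrow> P * (w t * ((kabs k)^2 * y t)) = inner (D1 (\<theta> t)) (D1 (slice \<phi> t)) + inner (D2 (\<theta> t)) (D2 (slice \<phi> t))"
    proof (rule eventually_mono[OF ae], rule impI)
      fix t assume "t \<in> {0..T} \<longrightarrow> \<theta> t \<in> sobolev 1" "t \<in> {0..T}"
      then have th: "\<theta> t \<in> sobolev 1" by simp
      have D1: "fcoeff (D1 (\<theta> t)) k = (\<i> * of_int (fst k)) * fcoeff (\<theta> t) k"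
        unfolding D1_def by (rule sobolev_fcoeff_multiplier[OF th]) (auto simp: norm_mult fst_le_kabs)
      have D2: "fcoeff (D2 (\<theta> t)) k = (\<i> * of_int (snd k)) * fcoeff (\<theta> t) k"
        unfolding D2_def by (rule sobolev_fcoeff_multiplier[OF th]) (auto simp: norm_mult fst_le_kabs)
      have S1: "D1 (slice \<phi> t) = w t *\<^sub>R tpL {k} (\<lambda>_. (\<i> * of_int (fst k)) * c)"
        unfolding sl D1_def by (rule multiplier_single[OF k]) simp
      have S2: "D2 (slice \<phi> t) = w t *\<^sub>R tpL {k} (\<lambda>_. (\<i> * of_int (snd k)) * c)"
        unfolding sl D2_def by (rule multiplier_single[OF k]) simp
      have r: "Re ((\<i> * of_int p) * c * cnj ((\<i> * of_int p) * fcoeff (\<theta> t) k)) = (of_int p)^2 * y t" for p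
        unfolding y by (simp add: power2_eq_square algebra_simps)
      show "P * (w t * ((kabs k)^2 * y t)) = inner (D1 (\<theta> t)) (D1 (slice \<phi> t)) + inner (D2 (\<theta> t)) (D2 (slice \<phi> t))"
        unfolding S1 S2 inner_single[OF k] D1 D2 r kabs_squared
        by (simp add: P_def algebra_simps)
    qed
  qed (intro continuous_intros cw cy)
  have "SQG_weak_lhs (\<theta> 0) \<theta> \<phi> T
          + \<epsilon> * (LINT t:{0..T}|lebesgue. inner (D1 (\<theta> t)) (D1 (slice \<phi> t)) + inner (D2 (\<theta> t)) (D2 (slice \<phi> t)))
          = (LINT t:{0..T}|lebesgue. inner f (slice \<phi> t))"
    using v \<phi> T unfolding viscous_solution_def by blast
  then have eq: "- integral {0..T} (\<lambda>t. P * (w' t * y t)) - P * (w 0 * y 0) + P * (w T * y T)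
     - integral {0..T} (\<lambda>t. - (P * (w t * N t))) + integral {0..T} (\<lambda>t. P * (w t * (kabs k * y t)))
     + \<epsilon> * integral {0..T} (\<lambda>t. P * (w t * ((kabs k)^2 * y t))) = integral {0..T} (\<lambda>t. P * (w t * F))"
    unfolding SQG_weak_lhs_def I1 I2 I3 I4 I5
    by (simp add: sl inner_single[OF k] y P_def del: inner_scaleR_right)
  define IA IN IY IF where "IA = integral {0..T} (\<lambda>t. w' t * y t)" "IN = integral {0..T} (\<lambda>t. w t * N t)"
     "IY = integral {0..T} (\<lambda>t. w t * y t)" "IF = integral {0..T} (\<lambda>t. w t * F)"
  have h: "((\<lambda>t. w' t * y t) has_integral IA) {0..T}" "((\<lambda>t. w t * N t) has_integral IN) {0..T}"
     "((\<lambda>t. w t * y t) has_integral IY) {0..T}" "((\<lambda>t. w t * F) has_integral IF) {0..T}"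
    unfolding IA_IN_IY_IF_def
    by (intro integrable_integral integrable_continuous_real continuous_intros cw cy cN)+
  have hk: "((\<lambda>t. P * (w t * (q * y t))) has_integral P * (q * IY)) {0..T}" for q
    using has_integral_mult_right[OF has_integral_mult_right[OF h(3), of q], of P]
    by (simp only: mult.left_commute)
  note eq' = eq[unfolded integral_unique[OF has_integral_mult_right[OF h(1)]] integral_unique[OF hk]
      integral_unique[OF has_integral_mult_right[OF h(4)]]
      integral_unique[OF has_integral_neg[OF has_integral_mult_right[OF h(2)]]]]
  have "P * (w T * y T) = P * (w 0 * y 0 + (IA + (IF - IN - (kabs k + \<epsilon> * (kabs k)^2) * IY)))"
    using eq' by (simp add: algebra_simps)
  then have "w T * y T = w 0 * y 0 + (IA + (IF - IN - (kabs k + \<epsilon> * (kabs k)^2) * IY))"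
    using P by simp
  also have "IA + (IF - IN - (kabs k + \<epsilon> * (kabs k)^2) * IY)
     = integral {0..T} (\<lambda>t. w' t * y t + (w t * F - w t * N t - (kabs k + \<epsilon> * (kabs k)^2) * (w t * y t)))"
    by (rule integral_unique[symmetric], rule has_integral_add[OF h(1) has_integral_diff[OF has_integral_diff[OF h(4,2)] has_integral_mult_right[OF h(3)]]])
  also have "(\<lambda>t. w' t * y t + (w t * F - w t * N t - (kabs k + \<epsilon> * (kabs k)^2) * (w t * y t)))
     = (\<lambda>t. w' t * y t + w t * \<beta> t)"
  proof
    fix t
    have bt: "\<beta> t = F - N t - (kabs k + \<epsilon> * (kabs k)^2) * y t"
      unfolding b F_def N_def y by (simp add: algebra_simps)
    show "w' t * y t + (w t * F - w t * N t - (kabs k + \<epsilon> * (kabs k)^2) * (w t * y t)) = w' t * y t + w t * \<beta> t"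
      unfolding bt by (simp add: algebra_simps)
  qed
  finally show ?thesis .
qed

text \<open>\<open>viscous_identity\<close> shows that the product of \<open>w\<close> and
  \<open>y\<close> is an indefinite integral of a continuous function. Dividing by the positive
  factor \<open>w\<close> gives the derivative of \<open>y\<close>; the terms with \<open>w'\<close>
  cancel in the quotient rule.\<close>

lemma viscous_ode_real:
  assumes v: "viscous_solution \<epsilon> f \<theta>" and k: "k \<noteq> 0" and t: "0 \<le> t"
    and y: "y = (\<lambda>t. Re (c * cnj (fcoeff (\<theta> t) k)))"
    and b: "\<beta> = (\<lambda>t. Re (c * cnj (fcoeff f k - Nl (\<theta> t) k - (kabs k + \<epsilon> * (kabs k)^2) * fcoeff (\<theta> t) k)))"
  shows "(y has_real_derivative \<beta> t) (at t within {0..})"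
proof -
  \<comment> \<open>The flat factor vanishes from \<open>R\<close> on, so \<open>R = t + 2\<close>
    and \<open>T = t + 1\<close> keep it positive on the whole interval, with \<open>t\<close> away
    from its right end.\<close>
  define R where "R = t + 2"
  define w w' where "w = (\<lambda>t. flat [:1:] (R - t))" "w' = (\<lambda>t. - flat (dflat [:1:]) (R - t))"
  note ww = w_w'_def
  define T where "T = t + 1"
  have c\<theta>: "continuous_on {0..T} \<theta>"
    using v unfolding viscous_solution_def by (auto intro: continuous_on_subset)
  have df: "((\<lambda>t. flat q (R - t)) has_real_derivative - flat (dflat q) (R - s)) (at s within S)" for q s S
  proof -
    have "((\<lambda>t. R - t) has_real_derivative - 1) (at s within S)" by (auto intro!: derivative_eq_intros)
    from DERIV_chain2[OF flat_has_derivative this] show ?thesis by simp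
  qed
  have dw: "(w has_real_derivative w' s) (at s within S)" for s S unfolding ww by (rule df)
  have dw': "(w' has_real_derivative - (- flat (dflat (dflat [:1:])) (R - s))) (at s within S)" for s S
    unfolding ww by (rule DERIV_minus[OF df])
  have cw: "continuous_on {0..T} w" "continuous_on {0..T} w'"
    using DERIV_continuous[OF dw] DERIV_continuous[OF dw'] by (simp_all add: continuous_on_eq_continuous_within)
  have cy: "continuous_on {0..T} y" and cb: "continuous_on {0..T} \<beta>"
    unfolding y b by (intro continuous_intros continuous_fcoeff continuous_Nl c\<theta>)+
  define G where "G = (\<lambda>s. w 0 * y 0 + integral {0..s} (\<lambda>t. w' t * y t + w t * \<beta> t))"
  have Gy: "G s = w s * y s" if "s \<in> {0..T}" for s
  proof (cases "s = 0")
    case False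
    with that have "0 < s" by simp
    from viscous_identity[OF v k this ww(1) ww(2) y b] show ?thesis by (simp add: G_def)
  qed (simp add: G_def)
  have wpos: "w s > 0" if "s \<in> {0..T}" for s using that by (simp add: ww flat_def R_def T_def)
  have tT: "t \<in> {0..T}" using t by (simp add: T_def)
  have "((\<lambda>s. integral {0..s} (\<lambda>t. w' t * y t + w t * \<beta> t)) has_vector_derivative (w' t * y t + w t * \<beta> t)) (at t within {0..T})"
    by (rule integral_has_vector_derivative[OF _ tT]) (intro continuous_intros cw cy cb)
  then have "(G has_real_derivative (w' t * y t + w t * \<beta> t)) (at t within {0..T})"
    unfolding G_def has_real_derivative_iff_has_vector_derivative by (auto intro!: derivative_eq_intros)
  then have "((\<lambda>s. G s / w s) has_real_derivative ((w' t * y t + w t * \<beta> t) * w t - G t * w' t) / (w t * w t)) (at t within {0..T})"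
    by (intro DERIV_divide dw) (use wpos[OF tT] in auto)
  moreover have "((w' t * y t + w t * \<beta> t) * w t - G t * w' t) / (w t * w t) = \<beta> t"
    using wpos[OF tT] Gy[OF tT] by (simp add: field_simps)
  ultimately have d: "((\<lambda>s. G s / w s) has_real_derivative \<beta> t) (at t within {0..T})" by simp
  have "(y has_real_derivative \<beta> t) (at t within {0..T})"
    unfolding has_field_derivative_def
  proof (rule has_derivative_transform[OF tT _ d[unfolded has_field_derivative_def]])
    fix s assume "s \<in> {0..T}"
    then show "y s = G s / w s" using Gy wpos[of s] by simp
  qed
  moreover have "at t within {0..T} = at t within {0..}"
    by (rule at_within_nhd[of t "{..<T}"]) (auto simp: T_def)
  ultimately show ?thesis by simp
qed

text \<open>The choices \<open>1\<close> and \<open>\<i>\<close> for the amplitude \<open>c\<close>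
  of the test function give the real and the imaginary part.\<close>

lemma viscous_ode:
  assumes v: "viscous_solution \<epsilon> f \<theta>" and t: "0 \<le> t"
  shows "((\<lambda>t. fcoeff (\<theta> t) k) has_vector_derivative
    fcoeff f k - Nl (\<theta> t) k - (kabs k + \<epsilon> * (kabs k)^2) * fcoeff (\<theta> t) k) (at t within {0..})"
proof (cases "k = 0")
  case True
  then show ?thesis by (simp add: Nl_def)
next
  case False
  define z where "z = (\<lambda>t. fcoeff (\<theta> t) k)"
  define b where "b = (\<lambda>t. fcoeff f k - Nl (\<theta> t) k - (kabs k + \<epsilon> * (kabs k)^2) * fcoeff (\<theta> t) k)"
  have 1: "((\<lambda>t. Re (z t)) has_real_derivative Re (b t)) (at t within {0..})"
    using viscous_ode_real[OF v False t refl refl, of 1] by (simp add: z_def b_def)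
  have 2: "((\<lambda>t. Im (z t)) has_real_derivative Im (b t)) (at t within {0..})"
    using viscous_ode_real[OF v False t refl refl, of \<i>] by (simp add: z_def b_def)
  have "((\<lambda>t. of_real (Re (z t)) + \<i> * of_real (Im (z t))) has_vector_derivative of_real (Re (b t)) + \<i> * of_real (Im (b t))) (at t within {0..})"
    using 1 2 by (intro has_vector_derivative_add has_vector_derivative_mult_right has_vector_derivative_of_real)
  then have "(z has_vector_derivative b t) (at t within {0..})" by (simp only: complex_eq[symmetric])
  then show ?thesis unfolding z_def b_def .
qed

section \<open>Regularity of viscous solutions\<close>

lemma card_disc:
  assumes "j \<noteq> 0"
  shows "finite {i. kabs i \<le> kabs j}" "real (card {i. kabs i \<le> kabs j}) \<le> 9 * (kabs j)^2"
proof -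
  define n where "n = \<lfloor>kabs j\<rfloor>"
  have n: "of_int n \<le> kabs j" "1 \<le> n" using kabs_ge_1[OF assms] by (auto simp: n_def le_floor_iff)
  have s: "{i. kabs i \<le> kabs j} \<subseteq> {-n..n} \<times> {-n..n}"
  proof
    fix i assume "i \<in> {i. kabs i \<le> kabs j}"
    then have "of_int \<bar>fst i\<bar> \<le> kabs j" "of_int \<bar>snd i\<bar> \<le> kabs j" using fst_le_kabs[of i] by auto
    then have "\<bar>fst i\<bar> \<le> n" "\<bar>snd i\<bar> \<le> n" unfolding n_def le_floor_iff by auto
    then show "i \<in> {-n..n} \<times> {-n..n}" by (cases i) auto
  qed
  then show "finite {i. kabs i \<le> kabs j}" by (rule finite_subset) simp
  have "card {i. kabs i \<le> kabs j} \<le> card ({-n..n} \<times> {-n..n})" by (rule card_mono[OF _ s]) simp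
  also have "\<dots> = nat (2 * n + 1) * nat (2 * n + 1)" by (simp add: algebra_simps)
  finally have "real (card {i. kabs i \<le> kabs j}) \<le> real (nat (2 * n + 1) * nat (2 * n + 1))" by linarith
  also have "\<dots> = (2 * of_int n + 1)^2" using n(2) by (simp add: power2_eq_square)
  also have "\<dots> \<le> (3 * kabs j)^2" using n kabs_ge_1[OF assms] by (intro power_mono) auto
  finally show "real (card {i. kabs i \<le> kabs j}) \<le> 9 * (kabs j)^2" by (simp add: power_mult_distrib)
qed

lemma sum_CS_weight:
  fixes w b :: "'a \<Rightarrow> real"
  assumes "\<And>i. 0 \<le> w i"
  shows "(\<Sum>i\<in>I. w i * b i)^2 \<le> (\<Sum>i\<in>I. w i) * (\<Sum>i\<in>I. w i * (b i)^2)"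
proof -
  have "(\<Sum>i\<in>I. sqrt (w i) * (sqrt (w i) * b i))^2 \<le> (\<Sum>i\<in>I. (sqrt (w i))^2) * (\<Sum>i\<in>I. (sqrt (w i) * b i)^2)"
    by (rule Cauchy_Schwarz_ineq_sum)
  then show ?thesis using assms by (simp add: power_mult_distrib flip: mult.assoc)
qed

text \<open>The half of the convolution in which \<open>j\<close> is the larger frequency. On the
  finite set \<open>X\<close> the factor \<open>a\<close> is summable, which costs only the
  lower-order quantity \<open>y\<close>. Off \<open>X\<close> it is small in l2, which costs one
  extra power of |j|, hence \<open>x\<close>, but with the factor \<eta>. The second term can
  therefore be absorbed by dissipation.\<close>

lemma convolution_energy:
  fixes a b :: "int \<times> int \<Rightarrow> real"
  assumes a: "\<And>k. 0 \<le> a k" and b0: "b 0 = 0"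
    and X: "finite X" and tail: "\<And>F. finite F \<Longrightarrow> F \<inter> X = {} \<Longrightarrow> (\<Sum>k\<in>F. (a k)^2) \<le> \<eta>"
    and y: "\<And>F. finite F \<Longrightarrow> (\<Sum>k\<in>F. (b k)^2) \<le> y"
    and x: "\<And>F. finite F \<Longrightarrow> (\<Sum>k\<in>F. (kabs k * b k)^2) \<le> x"
    and A: "finite A" and J: "\<And>k. finite (J k)"
  shows "(\<Sum>k\<in>A. (\<Sum>j | j \<in> J k \<and> kabs (k - j) \<le> kabs j. b j * a (k - j))^2) \<le> 2 * (\<Sum>i\<in>X. a i)^2 * y + 18 * \<eta> * x"
proof -
  define P where "P = (\<lambda>k. {j \<in> J k. kabs (k - j) \<le> kabs j \<and> k - j \<in> X})"
  define R where "R = (\<lambda>k. {j \<in> J k. kabs (k - j) \<le> kabs j \<and> k - j \<notin> X})"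
  define U where "U = (\<Union>k\<in>A. J k)"
  have fin: "finite (P k)" "finite (R k)" "finite U" for k
    using J A by (auto simp: P_def R_def U_def)
  have \<eta>: "0 \<le> \<eta>" using tail[of "{}"] by simp
  have inj: "inj_on (\<lambda>(k, j). (k - j, j)) S" for S :: "((int \<times> int) \<times> (int \<times> int)) set"
    by (rule inj_onI) auto
  have split: "(\<Sum>j | j \<in> J k \<and> kabs (k - j) \<le> kabs j. b j * a (k - j))^2
     \<le> 2 * (\<Sum>j\<in>P k. a (k - j) * b j)^2 + 2 * (\<Sum>j\<in>R k. a (k - j) * b j)^2" for k
  proof -
    have "{j. j \<in> J k \<and> kabs (k - j) \<le> kabs j} = P k \<union> R k" "P k \<inter> R k = {}"
      by (auto simp: P_def R_def)
    then have "(\<Sum>j | j \<in> J k \<and> kabs (k - j) \<le> kabs j. b j * a (k - j))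
      = (\<Sum>j\<in>P k. a (k - j) * b j) + (\<Sum>j\<in>R k. a (k - j) * b j)"
      using fin by (simp add: sum.union_disjoint mult.commute)
    moreover have "(p + q)^2 \<le> 2 * p^2 + 2 * q^2" for p q :: real
      using zero_le_power2[of "p - q"] by (simp add: power2_eq_square algebra_simps)
    ultimately show ?thesis by simp
  qed
  \<comment> \<open>Low frequencies of \<open>a\<close>: Young's inequality for a convolution of l1
    with l2, in the form of Cauchy-Schwarz with weight \<open>a\<close>.\<close>
  have "(\<Sum>k\<in>A. (\<Sum>j\<in>P k. a (k - j) * b j)^2) \<le> (\<Sum>k\<in>A. (\<Sum>i\<in>X. a i) * (\<Sum>j\<in>P k. a (k - j) * (b j)^2))"
  proof (intro sum_mono)
    fix k
    have "(\<Sum>j\<in>P k. a (k - j)) = (\<Sum>i\<in>(\<lambda>j. k - j) ` P k. a i)"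
      by (subst sum.reindex) (auto simp: inj_on_def)
    also have "\<dots> \<le> (\<Sum>i\<in>X. a i)" using X a by (intro sum_mono2) (auto simp: P_def)
    finally have "(\<Sum>j\<in>P k. a (k - j)) * (\<Sum>j\<in>P k. a (k - j) * (b j)^2) \<le> (\<Sum>i\<in>X. a i) * (\<Sum>j\<in>P k. a (k - j) * (b j)^2)"
      using a by (intro mult_right_mono sum_nonneg) auto
    with sum_CS_weight[of "\<lambda>j. a (k - j)" b "P k"] a
    show "(\<Sum>j\<in>P k. a (k - j) * b j)^2 \<le> (\<Sum>i\<in>X. a i) * (\<Sum>j\<in>P k. a (k - j) * (b j)^2)" by simp
  qed
  also have "\<dots> = (\<Sum>i\<in>X. a i) * (\<Sum>(k, j)\<in>Sigma A P. a (k - j) * (b j)^2)"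
    using A fin by (simp add: sum_distrib_left[symmetric] sum.Sigma)
  also have "(\<Sum>(k, j)\<in>Sigma A P. a (k - j) * (b j)^2) = (\<Sum>(i, j)\<in>(\<lambda>(k, j). (k - j, j)) ` Sigma A P. a i * (b j)^2)"
    by (subst sum.reindex[OF inj]) (simp add: case_prod_unfold)
  also have "\<dots> \<le> (\<Sum>(i, j)\<in>X \<times> U. a i * (b j)^2)"
    using X fin a by (intro sum_mono2) (auto simp: P_def U_def)
  also have "\<dots> = (\<Sum>i\<in>X. a i) * (\<Sum>j\<in>U. (b j)^2)" by (simp add: sum_product sum.cartesian_product)
  also have "\<dots> \<le> (\<Sum>i\<in>X. a i) * y" using fin a by (intro mult_left_mono y sum_nonneg)
  finally have 1: "(\<Sum>k\<in>A. (\<Sum>j\<in>P k. a (k - j) * b j)^2) \<le> (\<Sum>i\<in>X. a i)^2 * y"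
    using a by (simp add: mult_left_mono sum_nonneg power2_eq_square mult.assoc)
  \<comment> \<open>High frequencies of \<open>a\<close>: after Cauchy-Schwarz each \<open>j\<close>
    is counted once for every admissible \<open>k - j\<close>, and these lie in a disc with at most
    9 |j|^2 lattice points.\<close>
  have "(\<Sum>k\<in>A. (\<Sum>j\<in>R k. a (k - j) * b j)^2) \<le> (\<Sum>k\<in>A. \<eta> * (\<Sum>j\<in>R k. (b j)^2))"
  proof (intro sum_mono)
    fix k
    have "(\<Sum>j\<in>R k. (a (k - j))^2) = (\<Sum>i\<in>(\<lambda>j. k - j) ` R k. (a i)^2)"
      by (subst sum.reindex) (auto simp: inj_on_def)
    also have "\<dots> \<le> \<eta>" using fin by (intro tail) (auto simp: R_def)
    finally have "(\<Sum>j\<in>R k. (a (k - j))^2) * (\<Sum>j\<in>R k. (b j)^2) \<le> \<eta> * (\<Sum>j\<in>R k. (b j)^2)"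
      by (intro mult_right_mono sum_nonneg) auto
    with Cauchy_Schwarz_ineq_sum[of "\<lambda>j. a (k - j)" b "R k"]
    show "(\<Sum>j\<in>R k. a (k - j) * b j)^2 \<le> \<eta> * (\<Sum>j\<in>R k. (b j)^2)" by simp
  qed
  also have "\<dots> = \<eta> * (\<Sum>(k, j)\<in>Sigma A R. (b j)^2)"
    using A fin by (simp add: sum_distrib_left[symmetric] sum.Sigma)
  also have "(\<Sum>(k, j)\<in>Sigma A R. (b j)^2) = (\<Sum>(i, j)\<in>(\<lambda>(k, j). (k - j, j)) ` Sigma A R. (b j)^2)"
    by (subst sum.reindex[OF inj]) (simp add: case_prod_unfold)
  also have "\<dots> = (\<Sum>p\<in>(\<lambda>(k, j). (k - j, j)) ` Sigma A R - UNIV \<times> {0}. (b (snd p))^2)"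
    unfolding case_prod_unfold
    using A fin by (intro sum.mono_neutral_right finite_imageI finite_SigmaI) (auto simp: b0)
  also have "\<dots> \<le> (\<Sum>p\<in>(SIGMA j:U - {0}. {i. kabs i \<le> kabs j}). (b (fst p))^2)"
  proof -
    have "(\<Sum>p\<in>(\<lambda>(k, j). (k - j, j)) ` Sigma A R - UNIV \<times> {0}. (b (snd p))^2)
      = (\<Sum>p\<in>prod.swap ` ((\<lambda>(k, j). (k - j, j)) ` Sigma A R - UNIV \<times> {0}). (b (fst p))^2)"
      by (subst sum.reindex) (auto simp: inj_on_def)
    also have "\<dots> \<le> (\<Sum>p\<in>(SIGMA j:U - {0}. {i. kabs i \<le> kabs j}). (b (fst p))^2)"
      using fin by (intro sum_mono2 finite_SigmaI card_disc(1)) (auto simp: R_def U_def)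
    finally show ?thesis .
  qed
  also have "\<dots> = (\<Sum>j\<in>U - {0}. real (card {i. kabs i \<le> kabs j}) * (b j)^2)"
    using fin by (subst sum.Sigma[symmetric, of _ _ "\<lambda>j i. (b j)^2", simplified case_prod_unfold]) (auto simp: card_disc(1))
  also have "\<dots> \<le> (\<Sum>j\<in>U - {0}. 9 * (kabs j * b j)^2)"
    by (intro sum_mono) (use card_disc(2) in \<open>auto simp: power_mult_distrib intro!: mult_right_mono simp flip: mult.assoc\<close>)
  also have "\<dots> \<le> 9 * x" using x[of "U - {0}"] fin by (simp add: sum_distrib_left[symmetric])
  finally have 2: "(\<Sum>k\<in>A. (\<Sum>j\<in>R k. a (k - j) * b j)^2) \<le> \<eta> * (9 * x)"
    using \<eta> by (simp add: mult_left_mono)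
  have "(\<Sum>k\<in>A. (\<Sum>j | j \<in> J k \<and> kabs (k - j) \<le> kabs j. b j * a (k - j))^2)
     \<le> (\<Sum>k\<in>A. 2 * (\<Sum>j\<in>P k. a (k - j) * b j)^2 + 2 * (\<Sum>j\<in>R k. a (k - j) * b j)^2)"
    by (intro sum_mono split)
  also have "\<dots> = 2 * (\<Sum>k\<in>A. (\<Sum>j\<in>P k. a (k - j) * b j)^2) + 2 * (\<Sum>k\<in>A. (\<Sum>j\<in>R k. a (k - j) * b j)^2)"
    by (simp add: sum.distrib sum_distrib_left)
  also have "\<dots> \<le> 2 * (\<Sum>i\<in>X. a i)^2 * y + 18 * \<eta> * x" using 1 2 by simp
  finally show ?thesis .
qed

text \<open>The weight \<open>m\<close> at most doubles when passing from the larger of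
  \<open>j\<close> and \<open>k - j\<close> to \<open>k\<close>, so it can be moved onto that
  factor. The two halves are exchanged by the reflection that sends \<open>j\<close> to
  \<open>k - j\<close>, whence the constants 32 and 288, sixteen times those of
  \<open>convolution_energy\<close>.\<close>

lemma truncated_convolution:
  fixes a :: "int \<times> int \<Rightarrow> real" and N :: real
  defines "m \<equiv> \<lambda>k. min (kabs k) N"
  assumes N: "0 \<le> N" and a: "\<And>k. 0 \<le> a k"
    and s: "\<And>k. (\<lambda>j. a j * a (k - j)) summable_on UNIV"
    and X: "finite X" and tail: "\<And>F. finite F \<Longrightarrow> F \<inter> X = {} \<Longrightarrow> (\<Sum>k\<in>F. (a k)^2) \<le> \<eta>"
    and y: "\<And>F. finite F \<Longrightarrow> (\<Sum>k\<in>F. (m k * a k)^2) \<le> y"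
    and x: "\<And>F. finite F \<Longrightarrow> (\<Sum>k\<in>F. (kabs k * (m k * a k))^2) \<le> x"
    and A: "finite A"
  shows "(\<Sum>k\<in>A. (m k * (\<Sum>\<^sub>\<infinity>j. a j * a (k - j)))^2) \<le> 32 * (\<Sum>i\<in>X. a i)^2 * y + 288 * \<eta> * x"
proof -
  define b where "b = (\<lambda>k. m k * a k)"
  have m: "0 \<le> m k" for k using N by (simp add: m_def)
  have m2: "m k \<le> 2 * m j" if "kabs (k - j) \<le> kabs j" for k j
    using kabs_triangle[of "k - j" j] that N by (auto simp: m_def min_def)
  have bnd: "(\<Sum>k\<in>A. (m k * (\<Sum>j\<in>G. a j * a (k - j)))^2) \<le> 32 * (\<Sum>i\<in>X. a i)^2 * y + 288 * \<eta> * x" if G: "finite G" for G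
  proof -
    define H where "H = (\<lambda>J k. \<Sum>j | j \<in> J \<and> kabs (k - j) \<le> kabs j. b j * a (k - j))"
    have H: "(\<Sum>k\<in>A. (H (J k) k)^2) \<le> 2 * (\<Sum>i\<in>X. a i)^2 * y + 18 * \<eta> * x" if "\<And>k. finite (J k)" for J
      unfolding H_def by (rule convolution_energy) (use a X tail y x A that N in \<open>auto simp: b_def m_def\<close>)
    have H0: "0 \<le> H J k" for J k unfolding H_def b_def using a m by (intro sum_nonneg mult_nonneg_nonneg) auto
    have "m k * (\<Sum>j\<in>G. a j * a (k - j)) \<le> 2 * H G k + 2 * H ((\<lambda>j. k - j) ` G) k" for k
    proof -
      let ?L = "{j \<in> G. kabs (k - j) \<le> kabs j}" and ?M = "{j \<in> G. \<not> kabs (k - j) \<le> kabs j}"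
      have "G = ?L \<union> ?M" "?L \<inter> ?M = {}" by auto
      then have "(\<Sum>j\<in>G. a j * a (k - j)) = (\<Sum>j\<in>?L. a j * a (k - j)) + (\<Sum>j\<in>?M. a j * a (k - j))"
        using G by (metis (no_types, lifting) finite_Un sum.union_disjoint)
      then have "m k * (\<Sum>j\<in>G. a j * a (k - j)) = (\<Sum>j\<in>?L. m k * (a j * a (k - j))) + (\<Sum>j\<in>?M. m k * (a j * a (k - j)))"
        by (simp add: distrib_left sum_distrib_left)
      also have "(\<Sum>j\<in>?L. m k * (a j * a (k - j))) \<le> (\<Sum>j\<in>?L. 2 * (b j * a (k - j)))"
      proof (intro sum_mono)
        fix j assume "j \<in> ?L"
        then have "m k * (a j * a (k - j)) \<le> (2 * m j) * (a j * a (k - j))" using a by (intro mult_right_mono m2) auto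
        then show "m k * (a j * a (k - j)) \<le> 2 * (b j * a (k - j))" by (simp add: b_def mult.assoc)
      qed
      also have "(\<Sum>j\<in>?L. 2 * (b j * a (k - j))) = 2 * H G k" by (simp add: H_def sum_distrib_left)
      also have "(\<Sum>j\<in>?M. m k * (a j * a (k - j))) \<le> (\<Sum>j\<in>?M. 2 * (b (k - j) * a j))"
      proof (intro sum_mono)
        fix j assume "j \<in> ?M"
        then have "m k * (a j * a (k - j)) \<le> (2 * m (k - j)) * (a j * a (k - j))" using a by (intro mult_right_mono m2) auto
        then show "m k * (a j * a (k - j)) \<le> 2 * (b (k - j) * a j)" by (simp add: b_def mult_ac)
      qed
      also have "\<dots> = (\<Sum>i\<in>(\<lambda>j. k - j) ` ?M. 2 * (b i * a (k - i)))"
        by (subst sum.reindex) (auto simp: inj_on_def)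
      also have "\<dots> \<le> (\<Sum>i | i \<in> (\<lambda>j. k - j) ` G \<and> kabs (k - i) \<le> kabs i. 2 * (b i * a (k - i)))"
        using G a m by (intro sum_mono2) (auto simp: b_def intro!: mult_nonneg_nonneg)
      also have "\<dots> = 2 * H ((\<lambda>j. k - j) ` G) k" by (simp add: H_def sum_distrib_left)
      finally show ?thesis by simp
    qed
    then have "(\<Sum>k\<in>A. (m k * (\<Sum>j\<in>G. a j * a (k - j)))^2) \<le> (\<Sum>k\<in>A. (2 * H G k + 2 * H ((\<lambda>j. k - j) ` G) k)^2)"
      using a m by (intro sum_mono power_mono) (auto intro!: mult_nonneg_nonneg sum_nonneg)
    also have "\<dots> \<le> (\<Sum>k\<in>A. 8 * (H G k)^2 + 8 * (H ((\<lambda>j. k - j) ` G) k)^2)"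
    proof (intro sum_mono)
      fix k
      show "(2 * H G k + 2 * H ((\<lambda>j. k - j) ` G) k)^2 \<le> 8 * (H G k)^2 + 8 * (H ((\<lambda>j. k - j) ` G) k)^2"
        using zero_le_power2[of "H G k - H ((\<lambda>j. k - j) ` G) k"] by (simp add: power2_eq_square algebra_simps)
    qed
    also have "\<dots> = 8 * (\<Sum>k\<in>A. (H G k)^2) + 8 * (\<Sum>k\<in>A. (H ((\<lambda>j. k - j) ` G) k)^2)"
      by (simp add: sum.distrib sum_distrib_left)
    also have "\<dots> \<le> 32 * (\<Sum>i\<in>X. a i)^2 * y + 288 * \<eta> * x"
      using H[of "\<lambda>_. G"] H[of "\<lambda>k. (\<lambda>j. k - j) ` G"] G by simp
    finally show ?thesis .
  qed
  have "((\<lambda>G. \<Sum>k\<in>A. (m k * (\<Sum>j\<in>G. a j * a (k - j)))^2) \<longlongrightarrow> (\<Sum>k\<in>A. (m k * (\<Sum>\<^sub>\<infinity>j. a j * a (k - j)))^2)) (finite_subsets_at_top UNIV)"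
    using has_sum_infsum[OF s] unfolding has_sum_def by (intro tendsto_intros)
  then show ?thesis
    by (rule tendsto_upperbound) (auto simp: eventually_finite_subsets_at_top intro!: bnd)
qed
text \<open>Lagrange's identity: cross product and scalar product have squares that add up to the
  product of the squared lengths.\<close>

lemma abs_crs: "\<bar>crs k j\<bar> \<le> kabs k * kabs j"
proof (rule power2_le_imp_le)
  have "(crs k j)^2 + (of_int (fst k) * of_int (fst j) + of_int (snd k) * of_int (snd j))^2 = (kabs k)^2 * (kabs j)^2"
    unfolding crs_def kabs_squared by (simp add: power2_eq_square algebra_simps)
  then show "\<bar>crs k j\<bar>\<^sup>2 \<le> (kabs k * kabs j)^2"
    by (simp add: power_mult_distrib) (metis le_add_same_cancel1 zero_le_power2)
qed simp

lemma crs_diff: "crs k j = crs (k - j) j" "crs k j = - crs k (k - j)" "crs k j = - crs j k"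
  by (simp_all add: crs_def algebra_simps)

text \<open>The cross product does not change when \<open>k\<close> is replaced by
  \<open>k - j\<close>, and only changes sign when \<open>j\<close> is. Either way the denominator
  cancels, so the derivative may be put on the output or on the factor with frequency
  \<open>j\<close>.\<close>

lemma abs_ker: "\<bar>ker k j\<bar> \<le> kabs j" "\<bar>ker k j\<bar> \<le> kabs k"
proof -
  have "\<bar>ker k j\<bar> \<le> kabs j \<and> \<bar>ker k j\<bar> \<le> kabs k"
  proof (cases "k = j")
    case False
    then have p: "0 < kabs (k - j)" by (intro kabs_pos) simp
    have "\<bar>crs k j\<bar> \<le> kabs (k - j) * kabs j" "\<bar>crs k j\<bar> \<le> kabs k * kabs (k - j)"
      using abs_crs[of "k - j" j] abs_crs[of k "k - j"] crs_diff(1,2)[of k j] by simp_all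
    with p show ?thesis by (simp add: ker_def field_simps)
  qed (simp add: ker_def)
  then show "\<bar>ker k j\<bar> \<le> kabs j" "\<bar>ker k j\<bar> \<le> kabs k" by auto
qed

lemma conv_summable:
  "(\<lambda>j. cmod (fcoeff a j) * cmod (fcoeff b (k - j))) summable_on UNIV"
proof -
  have "bij (\<lambda>j. k - j)" by (rule bij_betw_byWitness[of _ "\<lambda>j. k - j"]) auto
  then have "(\<lambda>j. (cmod (fcoeff b (k - j)))^2) summable_on UNIV"
    using fcoeff_summable[of b] by (subst summable_on_reindex_bij_betw[of "\<lambda>j. k - j" UNIV UNIV])
  from summable_mult_le[OF fcoeff_summable this, of a] show ?thesis by (simp add: norm_mult)
qed

text \<open>The self-convolution of the moduli of the coefficients, which dominates the nonlinearity
  up to one power of |k|.\<close>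

definition Qc :: "L2 \<Rightarrow> int \<times> int \<Rightarrow> real" where
  "Qc a k = (\<Sum>\<^sub>\<infinity>j. cmod (fcoeff a j) * cmod (fcoeff a (k - j)))"

lemma Nl_le_Qc: "cmod (Nl a k) \<le> kabs k * Qc a k"
proof -
  have s: "(\<lambda>j. kabs k * (cmod (fcoeff a j) * cmod (fcoeff a (k - j)))) summable_on UNIV"
    by (intro summable_on_cmult_right conv_summable)
  have "norm (\<Sum>\<^sub>\<infinity>j. - of_real (ker k j) * fcoeff a j * fcoeff a (k - j)) \<le> (\<Sum>\<^sub>\<infinity>j. kabs k * (cmod (fcoeff a j) * cmod (fcoeff a (k - j))))"
  proof (rule norm_infsum_le[OF has_sum_infsum has_sum_infsum[OF s]])
    show "(\<lambda>j. - of_real (ker k j) * fcoeff a j * fcoeff a (k - j)) summable_on UNIV"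
      using Nl_has_sum summable_on_def by blast
    fix j show "norm (- of_real (ker k j) * fcoeff a j * fcoeff a (k - j)) \<le> kabs k * (cmod (fcoeff a j) * cmod (fcoeff a (k - j)))"
      using abs_ker(2)[of k j] by (simp add: norm_mult mult.assoc mult_right_mono)
  qed
  then show ?thesis using infsumI[OF Nl_has_sum[of k a]]
    unfolding Qc_def by (simp add: infsum_cmult_right conv_summable)
qed

lemma Qc_le:
  assumes "\<And>G. finite G \<Longrightarrow> (\<Sum>j\<in>G. cmod (fcoeff a j) * cmod (fcoeff a (k - j))) \<le> B"
  shows "Qc a k \<le> B"
  unfolding Qc_def by (rule infsum_le_finite_sums[OF conv_summable assms])

text \<open>A continuous curve over a compact interval has compact, hence totally bounded, range.
  Finitely many centres supply the exceptional set, and the distance to the nearest centre is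
  controlled by Bessel's inequality.\<close>

lemma uniform_tail:
  fixes \<theta> :: "real \<Rightarrow> L2"
  assumes c: "continuous_on {0..T} \<theta>" and e: "0 < \<eta>"
  obtains X where "finite X" "\<And>t F. t \<in> {0..T} \<Longrightarrow> finite F \<Longrightarrow> F \<inter> X = {} \<Longrightarrow> (\<Sum>k\<in>F. (cmod (fcoeff (\<theta> t) k))^2) \<le> \<eta>"
proof -
  have "compact (\<theta> ` {0..T})" by (rule compact_continuous_image[OF c compact_Icc])
  moreover have "sqrt \<eta> > 0" using e by simp
  ultimately have "\<exists>D. finite D \<and> \<theta> ` {0..T} \<subseteq> (\<Union>a\<in>D. ball a (sqrt \<eta>))"
    unfolding compact_eq_totally_bounded by simp
  then obtain D where D: "finite D" "\<theta> ` {0..T} \<subseteq> (\<Union>a\<in>D. ball a (sqrt \<eta>))" by blast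
  have "\<forall>a. \<exists>X. finite X \<and> (\<forall>F. finite F \<longrightarrow> F \<inter> X = {} \<longrightarrow> (\<Sum>k\<in>F. (cmod (fcoeff a k))^2) \<le> \<eta> / 4)"
  proof
    fix a
    have e4: "\<eta> / 4 > 0" using e by simp
    obtain X where "finite X" "\<And>F. finite F \<Longrightarrow> F \<inter> X = {} \<Longrightarrow> (\<Sum>k\<in>F. (cmod (fcoeff a k))^2) \<le> \<eta> / 4"
      using summable_tail[OF fcoeff_summable[of a] zero_le_power2 e4] by metis
    then show "\<exists>X. finite X \<and> (\<forall>F. finite F \<longrightarrow> F \<inter> X = {} \<longrightarrow> (\<Sum>k\<in>F. (cmod (fcoeff a k))^2) \<le> \<eta> / 4)"
      by (intro exI[of _ X] conjI allI impI)
  qed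
  from choice[OF this] obtain X where "\<forall>a. finite (X a) \<and> (\<forall>F. finite F \<longrightarrow> F \<inter> X a = {} \<longrightarrow> (\<Sum>k\<in>F. (cmod (fcoeff a k))^2) \<le> \<eta> / 4)" ..
  then have X: "\<And>a. finite (X a)" "\<And>a F. finite F \<Longrightarrow> F \<inter> X a = {} \<Longrightarrow> (\<Sum>k\<in>F. (cmod (fcoeff a k))^2) \<le> \<eta> / 4"
    by simp_all
  show ?thesis
  proof (rule that)
    show "finite (\<Union>a\<in>D. X a)" using D X by auto
    fix t F assume t: "t \<in> {0..T}" and F: "finite F" "F \<inter> (\<Union>a\<in>D. X a) = {}"
    have "\<theta> t \<in> (\<Union>a\<in>D. ball a (sqrt \<eta>))" using D(2) t by blast
    then obtain a where a: "a \<in> D" "dist a (\<theta> t) < sqrt \<eta>" by (auto simp: mem_ball)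
    have "(cmod (fcoeff (\<theta> t) k))^2 \<le> 2 * (cmod (fcoeff a k))^2 + 2 * (cmod (fcoeff (\<theta> t - a) k))^2" for k
    proof -
      have "(cmod (fcoeff (\<theta> t) k))^2 \<le> (cmod (fcoeff a k) + cmod (fcoeff (\<theta> t - a) k))^2"
        using norm_triangle_ineq[of "fcoeff a k" "fcoeff (\<theta> t - a) k"] by (intro power_mono) (auto simp: fcoeff_minus)
      also have "\<dots> \<le> 2 * (cmod (fcoeff a k))^2 + 2 * (cmod (fcoeff (\<theta> t - a) k))^2"
        using zero_le_power2[of "cmod (fcoeff a k) - cmod (fcoeff (\<theta> t - a) k)"] by (simp add: power2_eq_square algebra_simps)
      finally show ?thesis .
    qed
    then have "(\<Sum>k\<in>F. (cmod (fcoeff (\<theta> t) k))^2) \<le> (\<Sum>k\<in>F. 2 * (cmod (fcoeff a k))^2 + 2 * (cmod (fcoeff (\<theta> t - a) k))^2)"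
      by (intro sum_mono)
    also have "\<dots> = 2 * (\<Sum>k\<in>F. (cmod (fcoeff a k))^2) + 2 * (\<Sum>k\<in>F. (cmod (fcoeff (\<theta> t - a) k))^2)"
      by (simp add: sum.distrib sum_distrib_left)
    also have "\<dots> \<le> 2 * (\<eta> / 4) + 2 * ((norm (\<theta> t - a))^2 / (2 * pi)^2)"
      using F a by (intro add_mono mult_left_mono X fcoeff_square_bound) auto
    also have "(norm (\<theta> t - a))^2 \<le> \<eta>"
    proof -
      have "norm (\<theta> t - a) \<le> sqrt \<eta>" using a by (simp add: dist_norm norm_minus_commute)
      then have "(norm (\<theta> t - a))^2 \<le> (sqrt \<eta>)^2" by (intro power_mono) auto
      then show ?thesis using e by simp
    qed
    then have "(norm (\<theta> t - a))^2 / (2 * pi)^2 \<le> \<eta> / 4"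
    proof -
      have "2^2 \<le> (2 * pi)^2" using pi_gt3 by (intro power_mono) auto
      then show ?thesis using \<open>(norm (\<theta> t - a))^2 \<le> \<eta>\<close> e by (intro frac_le) auto
    qed
    finally show "(\<Sum>k\<in>F. (cmod (fcoeff (\<theta> t) k))^2) \<le> \<eta>" by simp
  qed
qed

text \<open>Integrating factor: the derivative of
  \<open>exp (lam * (s - \<tau>)) *\<^sub>R z s\<close> is bounded by that of \<open>p\<close>, and
  comparing increments gives Duhamel's bound without an integral formula.\<close>

lemma damped_ode_bound:
  fixes z b :: "real \<Rightarrow> complex"
  assumes d: "\<And>s. s \<in> {\<tau>..t} \<Longrightarrow> (z has_vector_derivative b s - of_real lam * z s) (at s within {\<tau>..t})"
    and b: "\<And>s. s \<in> {\<tau>..t} \<Longrightarrow> cmod (b s) \<le> \<beta>" and lam: "0 < lam" and t: "\<tau> \<le> t"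
  shows "cmod (z t) \<le> exp (- lam * (t - \<tau>)) * cmod (z \<tau>) + \<beta> / lam"
proof (cases "\<tau> = t")
  case True
  have "0 \<le> \<beta>" using order_trans[OF norm_ge_zero b[of t]] t by simp
  then show ?thesis using True lam by simp
next
  case False
  define w where "w = (\<lambda>s. exp (lam * (s - \<tau>)) *\<^sub>R z s)"
  define p where "p = (\<lambda>s. \<beta> / lam * exp (lam * (s - \<tau>)))"
  have dw: "(w has_vector_derivative exp (lam * (s - \<tau>)) *\<^sub>R b s) (at s within {\<tau>..t})" if "s \<in> {\<tau>..t}" for s
  proof -
    have e: "((\<lambda>s. exp (lam * (s - \<tau>))) has_real_derivative exp (lam * (s - \<tau>)) * lam) (at s within {\<tau>..t})"
      by (auto intro!: derivative_eq_intros)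
    have "(w has_vector_derivative exp (lam * (s - \<tau>)) *\<^sub>R (b s - of_real lam * z s) + (exp (lam * (s - \<tau>)) * lam) *\<^sub>R z s) (at s within {\<tau>..t})"
      unfolding w_def by (rule has_vector_derivative_scaleR[OF e d[OF that]])
    then show ?thesis by (simp add: scaleR_conv_of_real algebra_simps)
  qed
  have dp: "(p has_vector_derivative \<beta> * exp (lam * (s - \<tau>))) (at s within {\<tau>..t})" for s
    unfolding p_def has_real_derivative_iff_has_vector_derivative[symmetric] using lam
    by (auto intro!: derivative_eq_intros)
  have "norm (w t - w \<tau>) \<le> p t - p \<tau>"
  proof (rule differentiable_bound_general[where f' = "\<lambda>s. exp (lam * (s - \<tau>)) *\<^sub>R b s" and \<phi>' = "\<lambda>s. \<beta> * exp (lam * (s - \<tau>))"])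
    show "\<tau> < t" using t False by simp
    show "continuous_on {\<tau>..t} w"
      by (simp add: continuous_on_eq_continuous_within has_vector_derivative_continuous[OF dw])
    show "continuous_on {\<tau>..t} p" unfolding p_def by (intro continuous_intros)
    fix s assume s: "\<tau> < s" "s < t"
    then have a: "at s within {\<tau>..t} = at s" by (intro at_within_interior) auto
    show "(w has_vector_derivative exp (lam * (s - \<tau>)) *\<^sub>R b s) (at s)" using dw[of s] s a by simp
    show "(p has_vector_derivative \<beta> * exp (lam * (s - \<tau>))) (at s)" using dp[of s] a by simp
    show "norm (exp (lam * (s - \<tau>)) *\<^sub>R b s) \<le> \<beta> * exp (lam * (s - \<tau>))" using b[of s] s by simp
  qed
  also have "p t - p \<tau> \<le> \<beta> / lam * exp (lam * (t - \<tau>))"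
  proof -
    have "0 \<le> \<beta>" using order_trans[OF norm_ge_zero b[of t]] t by simp
    then show ?thesis using lam by (simp add: p_def)
  qed
  finally have "norm (w t) \<le> norm (w \<tau>) + \<beta> / lam * exp (lam * (t - \<tau>))"
    using norm_triangle_ineq[of "w t - w \<tau>" "w \<tau>"] by simp
  then have le: "exp (lam * (t - \<tau>)) * cmod (z t) \<le> cmod (z \<tau>) + \<beta> / lam * exp (lam * (t - \<tau>))"
    by (simp add: w_def)
  define e where "e = exp (- lam * (t - \<tau>))"
  have e: "e * exp (lam * (t - \<tau>)) = 1" unfolding e_def by (simp flip: exp_add)
  have "cmod (z t) = e * (exp (lam * (t - \<tau>)) * cmod (z t))" using e by (simp flip: mult.assoc)
  also have "\<dots> \<le> e * (cmod (z \<tau>) + \<beta> / lam * exp (lam * (t - \<tau>)))"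
    using le by (intro mult_left_mono) (auto simp: e_def)
  also have "\<dots> = e * cmod (z \<tau>) + \<beta> / lam * (e * exp (lam * (t - \<tau>)))" by (simp only: distrib_left mult.left_commute)
  finally show ?thesis unfolding e by (simp add: e_def)
qed

text \<open>|k|^2 dominates the product of \<open>max 1 \<bar>k1\<bar>\<close> and
  \<open>max 1 \<bar>k2\<bar>\<close>, so the lattice sum is at most the square of a one-dimensional
  sum with exponent p/2 > 1. The term at 0 vanishes by the convention for
  \<open>powr\<close>.\<close>

lemma lattice_summable:
  assumes "2 < p" shows "(\<lambda>k. kabs k powr (- p)) summable_on UNIV"
proof -
  define q where "q = p / 2"
  define g where "g = (\<lambda>n::int. max 1 \<bar>of_int n :: real\<bar> powr (- q))"
  have q: "1 < q" using assms by (simp add: q_def)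
  have "summable (\<lambda>n. real n powr (- q))" using q by (simp add: summable_real_powr_iff)
  then have "(\<Sum>i<n. real i powr (- q)) \<le> (\<Sum>i. real i powr (- q))" for n
    by (rule sum_le_suminf) auto
  then obtain S where S: "\<And>n. (\<Sum>i<n. real i powr (- q)) \<le> S" by blast
  have S0: "0 \<le> S" using S[of 0] by simp
  have G: "(\<Sum>n=-int N..int N. g n) \<le> 1 + 2 * S" for N
  proof -
    have pos: "(\<Sum>n=1..int N. g n) \<le> S"
    proof -
      have "(\<Sum>n=1..int N. g n) = (\<Sum>i\<in>int ` {1..N}. g i)" by (simp add: image_int_atLeastAtMost)
      also have "\<dots> = (\<Sum>i\<in>{1..N}. g (int i))" by (subst sum.reindex) auto
      also have "\<dots> = (\<Sum>i\<in>{1..N}. real i powr (- q))" by (intro sum.cong) (auto simp: g_def max_def)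
      also have "\<dots> \<le> (\<Sum>i<Suc N. real i powr (- q))" by (intro sum_mono2) auto
      finally show ?thesis using S[of "Suc N"] by simp
    qed
    have "{-int N..int N} = {1..int N} \<union> {0} \<union> uminus ` {1..int N}" 
    proof (intro equalityI subsetI)
      fix x assume x: "x \<in> {-int N..int N}"
      show "x \<in> {1..int N} \<union> {0} \<union> uminus ` {1..int N}"
      proof (cases "x < 0")
        case True
        then have "x \<in> uminus ` {1..int N}" using x by (intro image_eqI[of _ _ "- x"]) auto
        then show ?thesis by blast
      qed (use x in auto)
    qed auto
    then have "(\<Sum>n=-int N..int N. g n) \<le> (\<Sum>n\<in>{1..int N} \<union> {0}. g n) + (\<Sum>n\<in>uminus ` {1..int N}. g n)"
      by (simp add: sum.union_disjoint)
    also have "(\<Sum>n\<in>uminus ` {1..int N}. g n) = (\<Sum>n=1..int N. g n)" by (subst sum.reindex) (auto simp: g_def)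
    also have "(\<Sum>n\<in>{1..int N} \<union> {0}. g n) = (\<Sum>n=1..int N. g n) + g 0" by (subst sum.union_disjoint) auto
    finally show ?thesis using pos by (simp add: g_def)
  qed
  have le: "kabs k powr (- p) \<le> g (fst k) * g (snd k)" for k
  proof (cases "k = 0")
    case False
    define x y where "x = max 1 \<bar>of_int (fst k) :: real\<bar>" "y = max 1 \<bar>of_int (snd k) :: real\<bar>"
    have xy: "1 \<le> x" "1 \<le> y" "x \<le> kabs k" "y \<le> kabs k"
      using fst_le_kabs[of k] kabs_ge_1[OF False] by (auto simp: x_y_def)
    have "x * y \<le> kabs k * kabs k" using xy by (intro mult_mono) auto
    then have "(x * y) powr q \<le> (kabs k * kabs k) powr q" using xy q by (intro powr_mono2) auto
    also have "\<dots> = kabs k powr p" using kabs_pos[OF False] by (simp add: powr_mult q_def flip: powr_add)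
    finally have "kabs k powr (- p) \<le> (x * y) powr (- q)"
      using xy kabs_pos[OF False] by (simp add: powr_minus le_imp_inverse_le)
    then show ?thesis using xy by (simp add: g_def x_y_def powr_mult)
  qed (simp add: g_def)
  have "(\<Sum>k\<in>F. kabs k powr (- p)) \<le> (1 + 2 * S)^2" if F: "finite F" for F
  proof -
    obtain n where n: "F - {0} \<subseteq> Bx n" using finite_subset_Bx[of "F - {0}"] F by auto
    have "(\<Sum>k\<in>F. kabs k powr (- p)) = (\<Sum>k\<in>F - {0}. kabs k powr (- p))"
      using F by (intro sum.mono_neutral_right) auto
    also have "\<dots> \<le> (\<Sum>k\<in>{-int n..int n} \<times> {-int n..int n}. kabs k powr (- p))"
      using n by (intro sum_mono2) (auto simp: Bx_def)
    also have "\<dots> \<le> (\<Sum>k\<in>{-int n..int n} \<times> {-int n..int n}. g (fst k) * g (snd k))" by (intro sum_mono le)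
    also have "\<dots> = (\<Sum>n=-int n..int n. g n) * (\<Sum>n=-int n..int n. g n)"
      by (simp add: sum_product sum.cartesian_product case_prod_unfold)
    also have "\<dots> \<le> (1 + 2 * S) * (1 + 2 * S)"
      using S0 by (intro mult_mono G) (auto intro!: sum_nonneg simp: g_def)
    finally show ?thesis by (simp add: power2_eq_square)
  qed
  then show ?thesis by (intro nonneg_summableI) auto
qed

section \<open>Parabolic regularity for fixed \<epsilon>\<close>

lemma sobolev1_sums:
  assumes "a \<in> sobolev 1" "finite F"
  shows "(\<Sum>k\<in>F. (kabs k * cmod (fcoeff a k))^2) \<le> (sobolev_norm 1 a)^2"
proof -
  have p: "kabs k powr 2 = (kabs k)^2" for k by (cases "k = 0") (auto simp: powr_numeral kabs_pos)
  have "(\<Sum>k\<in>F. (kabs k * cmod (fcoeff a k))^2) = (\<Sum>k\<in>F - {0}. kabs k powr (2 * 1) * (cmod (fcoeff a k))^2)"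
    using assms(2) by (intro sum.mono_neutral_cong_right) (auto simp: p power_mult_distrib)
  also have "\<dots> \<le> (\<Sum>\<^sub>\<infinity>k\<in>UNIV - {0}. kabs k powr (2 * 1) * (cmod (fcoeff a k))^2)"
    using assms by (intro finite_sum_le_infsum) (auto simp: sobolev_def)
  also have "\<dots> = (sobolev_norm 1 a)^2"
    unfolding sobolev_norm_def by (subst real_sqrt_pow2) (auto intro: infsum_nonneg)
  finally show ?thesis .
qed

lemma continuous_norm_bound:
  fixes \<theta> :: "real \<Rightarrow> L2"
  assumes "continuous_on {0..T} \<theta>" obtains M where "M \<ge> 0" "\<And>t. t \<in> {0..T} \<Longrightarrow> norm (\<theta> t) \<le> M"
proof -
  have "bounded (\<theta> ` {0..T})"
    by (rule compact_imp_bounded[OF compact_continuous_image[OF assms compact_Icc]])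
  then obtain M where "\<forall>x\<in>\<theta> ` {0..T}. norm x \<le> M" unfolding bounded_iff by blast
  then have M: "norm (\<theta> t) \<le> M" if "t \<in> {0..T}" for t using that by blast
  show ?thesis
  proof (rule that[of "max M 0"])
    show "norm (\<theta> t) \<le> max M 0" if "t \<in> {0..T}" for t using M[OF that] by simp
  qed simp
qed

lemma cmod_square_derivative:
  assumes "(z has_vector_derivative z') (at t within S)"
  shows "((\<lambda>t. (cmod (z t))^2) has_real_derivative 2 * inner (z t) z') (at t within S)"
proof -
  have "((\<lambda>t. inner (z t) (z t)) has_vector_derivative (inner (z t) z' + inner z' (z t))) (at t within S)"
    by (rule bounded_bilinear.has_vector_derivative[OF bounded_bilinear_inner assms assms])
  then show ?thesis unfolding power2_norm_eq_inner has_real_derivative_iff_has_vector_derivative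
    by (simp add: inner_commute)
qed

locale visc =
  fixes \<epsilon> :: real and f :: L2 and \<theta> :: "real \<Rightarrow> L2"
  assumes v: "viscous_solution \<epsilon> f \<theta>" and eps: "0 < \<epsilon>" and f1: "f \<in> sobolev 1"
begin

abbreviation c where "c t k \<equiv> fcoeff (\<theta> t) k"
definition rhs where "rhs t k = fcoeff f k - Nl (\<theta> t) k - (kabs k + \<epsilon> * (kabs k)^2) * c t k"

lemma cont: "0 \<le> a \<Longrightarrow> continuous_on {a..b} \<theta>"
  using v unfolding viscous_solution_def by (auto intro: continuous_on_subset)

lemma ode: "0 \<le> t \<Longrightarrow> ((\<lambda>t. c t k) has_vector_derivative rhs t k) (at t within {0..})"
  unfolding rhs_def by (rule viscous_ode[OF v])

lemma ode_within: "0 \<le> t \<Longrightarrow> S \<subseteq> {0..} \<Longrightarrow> ((\<lambda>t. c t k) has_vector_derivative rhs t k) (at t within S)"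
  by (rule has_vector_derivative_within_subset[OF ode])

lemma cont_rhs: "0 \<le> a \<Longrightarrow> continuous_on {a..b} (\<lambda>t. rhs t k)"
  unfolding rhs_def by (intro continuous_intros continuous_fcoeff continuous_Nl cont)

text \<open>Young's inequality spends \<epsilon>/2 of the viscous term 2 \<epsilon> |k|^2 |c|^2 on
  the nonlinearity; the contribution of \<Lambda> is nonnegative and is dropped.\<close>

lemma inner_rhs: "2 * inner (c t k) (rhs t k) \<le> (cmod (c t k))^2 + (cmod (fcoeff f k))^2
    + (2 / \<epsilon>) * (Qc (\<theta> t) k)^2 - (3 * \<epsilon> / 2) * (kabs k)^2 * (cmod (c t k))^2"
proof -
  have 1: "inner (c t k) (rhs t k) = inner (c t k) (fcoeff f k) - inner (c t k) (Nl (\<theta> t) k) - (kabs k + \<epsilon> * (kabs k)^2) * (cmod (c t k))^2"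
  proof -
    have "complex_of_real (kabs k) + complex_of_real \<epsilon> * (complex_of_real (kabs k))^2 = complex_of_real (kabs k + \<epsilon> * (kabs k)^2)" by simp
    then have r: "rhs t k = fcoeff f k - Nl (\<theta> t) k - (kabs k + \<epsilon> * (kabs k)^2) *\<^sub>R c t k"
      unfolding rhs_def by (simp only: scaleR_conv_of_real)
    show ?thesis unfolding r by (simp only: inner_diff_right inner_scaleR_right power2_norm_eq_inner)
  qed
  have 2: "inner (c t k) (fcoeff f k) \<le> cmod (c t k) * cmod (fcoeff f k)" by (rule norm_cauchy_schwarz)
  have 3: "- inner (c t k) (Nl (\<theta> t) k) \<le> cmod (c t k) * (kabs k * Qc (\<theta> t) k)"
  proof -
    have "- inner (c t k) (Nl (\<theta> t) k) \<le> cmod (c t k) * cmod (Nl (\<theta> t) k)"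
      using norm_cauchy_schwarz[of "- c t k" "Nl (\<theta> t) k"] by simp
    also have "\<dots> \<le> cmod (c t k) * (kabs k * Qc (\<theta> t) k)" by (intro mult_left_mono Nl_le_Qc) simp
    finally show ?thesis .
  qed
  have 4: "2 * (cmod (c t k) * cmod (fcoeff f k)) \<le> (cmod (c t k))^2 + (cmod (fcoeff f k))^2"
    using sum_squares_bound[of "cmod (c t k)" "cmod (fcoeff f k)"] by simp
  have 5: "2 * (cmod (c t k) * (kabs k * Qc (\<theta> t) k)) \<le> (\<epsilon> / 2) * ((kabs k)^2 * (cmod (c t k))^2) + (2 / \<epsilon>) * (Qc (\<theta> t) k)^2"
  proof -
    define p q where "p = sqrt (\<epsilon> / 2) * (kabs k * cmod (c t k))" "q = sqrt (2 / \<epsilon>) * Qc (\<theta> t) k"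
    have "sqrt (\<epsilon> / 2) * sqrt (2 / \<epsilon>) = 1" using eps by (simp flip: real_sqrt_mult)
    then have "p * q = kabs k * cmod (c t k) * Qc (\<theta> t) k"
      unfolding p_q_def by (metis (no_types, opaque_lifting) mult.assoc mult.left_commute mult.right_neutral)
    moreover have "p^2 = (\<epsilon> / 2) * ((kabs k)^2 * (cmod (c t k))^2)" "q^2 = (2 / \<epsilon>) * (Qc (\<theta> t) k)^2"
      using eps by (simp_all add: p_q_def power_mult_distrib)
    ultimately show ?thesis using sum_squares_bound[of p q] by (simp add: mult_ac)
  qed
  have 6: "0 \<le> kabs k * (cmod (c t k))^2" by simp
  have 7: "(kabs k + \<epsilon> * (kabs k)^2) * (cmod (c t k))^2 = kabs k * (cmod (c t k))^2 + \<epsilon> * ((kabs k)^2 * (cmod (c t k))^2)"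
    by (simp add: algebra_simps)
  have 8: "(3 * \<epsilon> / 2) * (kabs k)^2 * (cmod (c t k))^2 = 2 * (\<epsilon> * ((kabs k)^2 * (cmod (c t k))^2)) - (\<epsilon> / 2) * ((kabs k)^2 * (cmod (c t k))^2)"
    by (simp add: algebra_simps)
  show ?thesis using 1 2 3 4 5 6 unfolding 7 8 by linarith
qed

text \<open>Finiteness of the H1 norm is known only for almost every time, so the energy is first
  taken with the bounded weight \<open>min (kabs k) N\<close>. The top-order part of the
  nonlinearity has a small coefficient by \<open>uniform_tail\<close> and is absorbed by viscosity,
  with constants that do not depend on \<open>N\<close>.\<close>

lemma h1_bound:
  assumes \<tau>: "0 < \<tau>" "\<tau> \<le> T" and H: "\<theta> \<tau> \<in> sobolev 1"
  obtains Y where "0 \<le> Y" "\<And>t F. t \<in> {\<tau>..T} \<Longrightarrow> finite F \<Longrightarrow> (\<Sum>k\<in>F. (kabs k * cmod (c t k))^2) \<le> Y"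
proof -
  \<comment> \<open>Makes the top-order term 288 \<eta> x of \<open>truncated_convolution\<close>,
    multiplied by 2/\<epsilon>, equal to \<open>(\<epsilon> / 2) * x\<close>.\<close>
  define \<eta> where "\<eta> = \<epsilon>^2 / 1152"
  have \<eta>: "0 < \<eta>" using eps by (simp add: \<eta>_def)
  obtain X where X: "finite X" "\<And>t F. t \<in> {0..T} \<Longrightarrow> finite F \<Longrightarrow> F \<inter> X = {} \<Longrightarrow> (\<Sum>k\<in>F. (cmod (c t k))^2) \<le> \<eta>"
    using uniform_tail[OF cont[of 0 T] \<eta>] by auto
  obtain M where M: "0 \<le> M" "\<And>t. t \<in> {0..T} \<Longrightarrow> norm (\<theta> t) \<le> M"
    using continuous_norm_bound[OF cont[of 0 T]] by auto
  have cM: "cmod (c t k) \<le> M" if "t \<in> {0..T}" for t k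
  proof -
    have "1 * cmod (c t k) \<le> 2 * pi * cmod (c t k)" using pi_gt3 by (intro mult_right_mono) auto
    then show ?thesis using fcoeff_le_norm[of "\<theta> t" k] M(2)[OF that] by linarith
  qed
  define B where "B = real (card X) * M"
  have B: "(\<Sum>i\<in>X. cmod (c t i)) \<le> B" if "t \<in> {0..T}" for t
    unfolding B_def using cM[OF that] by (intro sum_bounded_above)
  \<comment> \<open>32 B^2 times 2/\<epsilon> from the convolution, plus 1 from the term |c|^2 in
    \<open>inner_rhs\<close>.\<close>
  define C1 where "C1 = 64 / \<epsilon> * B^2 + 1"
  have C1: "0 \<le> C1" using eps by (simp add: C1_def)
  define F2 where "F2 = (sobolev_norm 1 f)^2"
  define HH where "HH = (sobolev_norm 1 (\<theta> \<tau>))^2"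
  have main: "(\<Sum>k\<in>F. (min (kabs k) N * cmod (c t k))^2) \<le> exp (2 * C1 * T) * (HH + F2 * T)"
    if t: "t \<in> {\<tau>..T}" and F: "finite F" and N: "0 \<le> N" for t F N
  proof -
    define m where "m = (\<lambda>k. min (kabs k) N)"
    have m: "0 \<le> m k" "m k \<le> N" "m k \<le> kabs k" for k using N by (auto simp: m_def)
    define yK where "yK = (\<lambda>K s. \<Sum>k\<in>Bx K. (m k * cmod (c s k))^2)"
    define xK where "xK = (\<lambda>K s. \<Sum>k\<in>Bx K. (kabs k * (m k * cmod (c s k)))^2)"
    \<comment> \<open>The full sums are introduced as limits over boxes, which makes their
      measurability in time immediate.\<close>
    define y where "y = (\<lambda>s. lim (\<lambda>K. yK K s))"
    define x where "x = (\<lambda>s. lim (\<lambda>K. xK K s))"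
    have sub: "sum g F \<le> L" if g0: "g 0 = 0" and gp: "\<And>k. 0 \<le> g k" and gl: "(\<lambda>K. sum g (Bx K)) \<longlonglongrightarrow> L" and fF: "finite F" for g :: "int \<times> int \<Rightarrow> real" and F L
    proof -
      obtain n where n: "F - {0} \<subseteq> Bx n" using finite_subset_Bx[of "F - {0}"] fF by auto
      have "sum g F \<le> sum g (Bx K)" if "K \<ge> n" for K
      proof -
        have "sum g F = sum g (F - {0})" using g0 fF by (intro sum.mono_neutral_right) auto
        also have "\<dots> \<le> sum g (Bx K)" using n Bx_mono[OF that] gp by (intro sum_mono2) auto
        finally show ?thesis .
      qed
      then show ?thesis by (intro LIMSEQ_le_const[OF gl]) auto
    qed
    have conv: "(\<lambda>K. sum g (Bx K)) \<longlonglongrightarrow> lim (\<lambda>K. sum g (Bx K))"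
      if "\<And>k. 0 \<le> g k" "\<And>F. finite F \<Longrightarrow> sum g F \<le> L" for g :: "int \<times> int \<Rightarrow> real" and L
    proof -
      have "incseq (\<lambda>K. sum g (Bx K))" unfolding incseq_def
        using Bx_mono that(1) by (auto intro!: sum_mono2)
      then have "convergent (\<lambda>K. sum g (Bx K))"
        using incseq_convergent[of "\<lambda>K. sum g (Bx K)" L] that(2) by (metis convergent_def finite_Bx)
      then show ?thesis by (simp add: convergent_LIMSEQ_iff)
    qed
    have ybd: "(\<Sum>k\<in>F. (m k * cmod (c s k))^2) \<le> N^2 * M^2" if "s \<in> {0..T}" "finite F" for s F
    proof -
      have "(\<Sum>k\<in>F. (m k * cmod (c s k))^2) \<le> (\<Sum>k\<in>F. N^2 * (cmod (c s k))^2)"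
        unfolding power_mult_distrib using m by (intro sum_mono mult_right_mono power_mono) auto
      also have "\<dots> \<le> N^2 * ((norm (\<theta> s))^2 / (2 * pi)^2)"
        unfolding sum_distrib_left[symmetric] by (intro mult_left_mono fcoeff_square_bound that) auto
      also have "\<dots> \<le> N^2 * M^2"
      proof (intro mult_left_mono)
        have "1^2 \<le> (2 * pi)^2" using pi_gt3 by (intro power_mono) auto
        then have "(norm (\<theta> s))^2 / (2 * pi)^2 \<le> (norm (\<theta> s))^2 / 1" by (intro divide_left_mono) auto
        also have "\<dots> \<le> M^2" using M(2)[OF that(1)] by (simp add: power_mono)
        finally show "(norm (\<theta> s))^2 / (2 * pi)^2 \<le> M^2" .
      qed simp
      finally show ?thesis .
    qed
    have xbd: "(\<Sum>k\<in>F. (kabs k * (m k * cmod (c s k)))^2) \<le> N^2 * (sobolev_norm 1 (\<theta> s))^2"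
      if "\<theta> s \<in> sobolev 1" "finite F" for s F
    proof -
      have "(\<Sum>k\<in>F. (kabs k * (m k * cmod (c s k)))^2) \<le> (\<Sum>k\<in>F. N^2 * (kabs k * cmod (c s k))^2)"
      proof (intro sum_mono)
        fix k
        have "(kabs k * (m k * cmod (c s k)))^2 = (m k)^2 * (kabs k * cmod (c s k))^2"
          by (simp add: power_mult_distrib)
        also have "\<dots> \<le> N^2 * (kabs k * cmod (c s k))^2" using m by (intro mult_right_mono power_mono) auto
        finally show "(kabs k * (m k * cmod (c s k)))^2 \<le> N^2 * (kabs k * cmod (c s k))^2" .
      qed
      also have "\<dots> \<le> N^2 * (sobolev_norm 1 (\<theta> s))^2"
        unfolding sum_distrib_left[symmetric] by (intro mult_left_mono sobolev1_sums that) auto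
      finally show ?thesis .
    qed
    have ylim: "(\<lambda>K. yK K s) \<longlonglongrightarrow> y s" if "s \<in> {0..T}" for s
      unfolding y_def yK_def by (rule conv[OF _ ybd[OF that]]) auto
    have xlim: "(\<lambda>K. xK K s) \<longlonglongrightarrow> x s" if "\<theta> s \<in> sobolev 1" for s
      unfolding x_def xK_def by (rule conv[OF _ xbd[OF that]]) auto
    have ysum: "(\<Sum>k\<in>F. (m k * cmod (c s k))^2) \<le> y s" if "s \<in> {0..T}" "finite F" for s F
      by (rule sub[OF _ _ _ that(2)]) (use ylim[OF that(1)] in \<open>auto simp: yK_def\<close>)
    have xsum: "(\<Sum>k\<in>F. (kabs k * (m k * cmod (c s k)))^2) \<le> x s" if "\<theta> s \<in> sobolev 1" "finite F" for s F
      by (rule sub[OF _ _ _ that(2)]) (use xlim[OF that(1)] in \<open>auto simp: xK_def\<close>)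
    \<comment> \<open>The exponential rate is twice \<open>C1\<close>: one half offsets the growth,
      and the other is what the convergence from \<open>yK\<close> to \<open>y\<close> may
      consume.\<close>
    define zK where "zK = (\<lambda>K s. exp (- (2 * C1) * s) * yK K s)"
    define dy where "dy = (\<lambda>K s. \<Sum>k\<in>Bx K. (m k)^2 * (2 * inner (c s k) (rhs s k)))"
    define dz where "dz = (\<lambda>K s. exp (- (2 * C1) * s) * (dy K s - 2 * C1 * yK K s))"
    have dyK: "(yK K has_real_derivative dy K s) (at s within {\<tau>..t})" if "s \<in> {\<tau>..t}" for K s
      unfolding yK_def dy_def power_mult_distrib
      using that \<tau> by (intro DERIV_sum DERIV_cmult cmod_square_derivative ode_within) auto
    have dzK: "(zK K has_real_derivative dz K s) (at s within {\<tau>..t})" if "s \<in> {\<tau>..t}" for K s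
    proof -
      have e: "((\<lambda>s. exp (- (2 * C1) * s)) has_real_derivative exp (- (2 * C1) * s) * (- (2 * C1))) (at s within {\<tau>..t})"
        by (auto intro!: derivative_eq_intros)
      show ?thesis unfolding zK_def dz_def
        using DERIV_mult[OF e dyK[OF that], of K] by (simp add: algebra_simps)
    qed
    have tT: "\<tau> \<le> t" "t \<le> T" "0 \<le> \<tau>" using t \<tau> by auto
    have st: "s \<in> {0..T}" if "s \<in> {\<tau>..t}" for s using that tT by auto
    have c\<theta>: "continuous_on {\<tau>..t} \<theta>" by (rule cont[OF tT(3)])
    have cyK: "continuous_on {\<tau>..t} (yK K)" for K unfolding yK_def by (intro continuous_intros continuous_fcoeff c\<theta>)
    have cxK: "continuous_on {\<tau>..t} (xK K)" for K unfolding xK_def by (intro continuous_intros continuous_fcoeff c\<theta>)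
    have cdz: "continuous_on {\<tau>..t} (dz K)" for K
      unfolding dz_def dy_def by (intro continuous_intros continuous_fcoeff c\<theta> cyK cont_rhs tT)
    define L where "L = lebesgue_on {\<tau>..t}"
    have mc: "g \<in> borel_measurable L" if "continuous_on {\<tau>..t} g" for g :: "real \<Rightarrow> real"
      unfolding L_def by (intro continuous_imp_measurable_on_sets_lebesgue that) simp
    have fm: "finite_measure L" unfolding L_def by (rule finite_measure_lebesgue_on) simp
    interpret L: finite_measure L by (rule fm)
    have [measurable]: "yK K \<in> borel_measurable L" "xK K \<in> borel_measurable L" "dz K \<in> borel_measurable L" for K
      using cyK cxK cdz by (auto intro: mc)
    have [measurable]: "y \<in> borel_measurable L" "x \<in> borel_measurable L" unfolding y_def x_def by measurable
    have [measurable]: "(\<lambda>s. exp (- (2 * C1) * s)) \<in> borel_measurable L" by (intro mc continuous_intros)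
    have sp: "space L = {\<tau>..t}" by (simp add: L_def)
    have ae: "AE s in L. \<theta> s \<in> sobolev 1"
    proof -
      have "AE s in lebesgue. s \<in> {0..T} \<longrightarrow> \<theta> s \<in> sobolev 1"
        using viscous_sobolev_AE[OF v] \<tau> by simp
      then have "AE s in lebesgue. s \<in> {\<tau>..t} \<longrightarrow> \<theta> s \<in> sobolev 1"
        by eventually_elim (use st in blast)
      then show ?thesis unfolding L_def by (subst AE_restrict_space_iff) auto
    qed
    have isob: "integrable L (\<lambda>s. (sobolev_norm 1 (\<theta> s))^2)"
    proof -
      have "integrable (lebesgue_on {0<..<T+1}) (\<lambda>s. (sobolev_norm 1 (\<theta> s))^2)"
        using v \<tau> unfolding viscous_solution_def L2_time_sobolev_def by auto
      then have "set_integrable lebesgue {0<..<T+1} (\<lambda>s. (sobolev_norm 1 (\<theta> s))^2)"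
        unfolding set_integrable_def by (subst (asm) integrable_restrict_space) auto
      then have "set_integrable lebesgue {\<tau>..t} (\<lambda>s. (sobolev_norm 1 (\<theta> s))^2)"
        by (rule set_integrable_subset) (use \<tau> tT in auto)
      then show ?thesis unfolding L_def set_integrable_def by (subst integrable_restrict_space) auto
    qed
    \<comment> \<open>The nonlinearity is bounded by the full sums \<open>x\<close>,
      \<open>y\<close>, while differentiating a finite sum yields only the partial dissipation
      \<open>xK\<close>. Absorption is therefore impossible at finite \<open>K\<close>; it happens
      in the limit \<open>g\<close>, reached by dominated convergence.\<close>
    define gK where "gK = (\<lambda>K s. exp (- (2 * C1) * s) * ((\<epsilon> / 2) * x s - (3 * \<epsilon> / 2) * xK K s + C1 * (y s - 2 * yK K s) + F2))"
    define g where "g = (\<lambda>s. exp (- (2 * C1) * s) * ((\<epsilon> / 2) * x s - (3 * \<epsilon> / 2) * x s + C1 * (y s - 2 * y s) + F2))"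
    have [measurable]: "gK K \<in> borel_measurable L" "g \<in> borel_measurable L" for K unfolding gK_def g_def by measurable
    define Dm where "Dm = (\<lambda>s. 2 * \<epsilon> * (N^2 * (sobolev_norm 1 (\<theta> s))^2) + (3 * C1 * (N^2 * M^2) + F2))"
    have iD: "integrable L Dm" unfolding Dm_def using isob by simp
    have e1: "exp (- (2 * C1) * s) \<le> 1" if "s \<in> {\<tau>..t}" for s using that C1 tT by (simp add: mult_nonneg_nonneg)
    have F2: "0 \<le> F2" by (simp add: F2_def)
    have bnds: "0 \<le> yK K s" "yK K s \<le> N^2 * M^2" "0 \<le> y s" "y s \<le> N^2 * M^2" if "s \<in> {0..T}" for K s
    proof -
      show *: "0 \<le> yK K s" "yK K s \<le> N^2 * M^2" for K unfolding yK_def using ybd[OF that] by (auto intro: sum_nonneg)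
      show "0 \<le> y s" by (rule LIMSEQ_le_const[OF ylim[OF that]]) (use * in auto)
      show "y s \<le> N^2 * M^2" by (rule LIMSEQ_le_const2[OF ylim[OF that]]) (use * in auto)
    qed
    have bndx: "0 \<le> xK K s" "xK K s \<le> N^2 * (sobolev_norm 1 (\<theta> s))^2" "0 \<le> x s" "x s \<le> N^2 * (sobolev_norm 1 (\<theta> s))^2"
      if "\<theta> s \<in> sobolev 1" for K s
    proof -
      show *: "0 \<le> xK K s" "xK K s \<le> N^2 * (sobolev_norm 1 (\<theta> s))^2" for K unfolding xK_def using xbd[OF that] by (auto intro: sum_nonneg)
      show "0 \<le> x s" by (rule LIMSEQ_le_const[OF xlim[OF that]]) (use * in auto)
      show "x s \<le> N^2 * (sobolev_norm 1 (\<theta> s))^2" by (rule LIMSEQ_le_const2[OF xlim[OF that]]) (use * in auto)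
    qed
    have gKD: "AE s in L. norm (gK K s) \<le> Dm s" for K
      using ae AE_space
    proof eventually_elim
      case (elim s)
      then have s: "s \<in> {\<tau>..t}" "\<theta> s \<in> sobolev 1" by (auto simp: sp)
      note b = bnds(1,2)[OF st[OF s(1)], of K] bnds(3,4)[OF st[OF s(1)]] bndx(1,2)[OF s(2), of K] bndx(3,4)[OF s(2)]
      define V where "V = (\<epsilon> / 2) * x s - (3 * \<epsilon> / 2) * xK K s + C1 * (y s - 2 * yK K s) + F2"
      have p1: "0 \<le> (\<epsilon> / 2) * x s" "(\<epsilon> / 2) * x s \<le> (\<epsilon> / 2) * (N^2 * (sobolev_norm 1 (\<theta> s))^2)"
        "0 \<le> (3 * \<epsilon> / 2) * xK K s" "(3 * \<epsilon> / 2) * xK K s \<le> (3 * \<epsilon> / 2) * (N^2 * (sobolev_norm 1 (\<theta> s))^2)"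
        "0 \<le> C1 * y s" "C1 * y s \<le> C1 * (N^2 * M^2)" "0 \<le> C1 * yK K s" "C1 * yK K s \<le> C1 * (N^2 * M^2)"
        using b eps C1 by (auto intro!: mult_nonneg_nonneg mult_left_mono)
      then have "\<bar>V\<bar> \<le> Dm s" unfolding V_def Dm_def using F2 by (simp add: algebra_simps abs_le_iff)
      moreover have "norm (gK K s) = exp (- (2 * C1) * s) * \<bar>V\<bar>" by (simp add: gK_def V_def abs_mult)
      moreover have "exp (- (2 * C1) * s) * \<bar>V\<bar> \<le> 1 * \<bar>V\<bar>" by (intro mult_right_mono e1 s) simp
      ultimately show ?case by simp
    qed
    have ig: "integrable L (gK K)" for K
    proof (rule Bochner_Integration.integrable_bound[OF iD])
      show "AE s in L. norm (gK K s) \<le> norm (Dm s)" using gKD[of K] by eventually_elim auto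
    qed measurable
    have gl: "AE s in L. (\<lambda>K. gK K s) \<longlonglongrightarrow> g s"
      using ae AE_space
    proof eventually_elim
      case (elim s)
      then have s: "s \<in> {0..T}" "\<theta> s \<in> sobolev 1" using st by (auto simp: sp)
      show ?case unfolding gK_def g_def by (intro tendsto_intros ylim xlim s)
    qed
    have glim: "(\<lambda>K. LINT s|L. gK K s) \<longlonglongrightarrow> (LINT s|L. g s)"
      by (rule integral_dominated_convergence[OF _ _ iD gl gKD]) measurable
    have gle: "(LINT s|L. g s) \<le> F2 * T"
    proof -
      have "(LINT s|L. g s) \<le> (LINT s|L. F2)"
      proof (rule integral_mono_AE)
        show "integrable L g" by (rule integrable_dominated_convergence[OF _ _ iD gl gKD]) measurable
        show "AE s in L. g s \<le> F2"
          using ae AE_space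
        proof eventually_elim
          case (elim s)
          then have s: "s \<in> {\<tau>..t}" "\<theta> s \<in> sobolev 1" by (auto simp: sp)
          have "0 \<le> \<epsilon> * x s" "0 \<le> C1 * y s" using bnds[OF st[OF s(1)]] bndx[OF s(2)] eps C1 by auto
          then have "(\<epsilon> / 2) * x s - (3 * \<epsilon> / 2) * x s + C1 * (y s - 2 * y s) + F2 \<le> F2" by (simp add: algebra_simps)
          then have "g s \<le> exp (- (2 * C1) * s) * F2" unfolding g_def by (intro mult_left_mono) auto
          also have "\<dots> \<le> 1 * F2" by (intro mult_right_mono e1 s F2)
          finally show ?case by simp
        qed
      qed simp
      also have "\<dots> = F2 * (t - \<tau>)" using tT by (simp add: L_def measure_restrict_space)
      also have "\<dots> \<le> F2 * T" using tT F2 by (intro mult_left_mono) auto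
      finally show ?thesis .
    qed
    have step: "zK K t - zK K \<tau> \<le> (LINT s|L. gK K s)" for K
    proof -
      have idz: "integrable L (dz K)"
      proof -
        have "bounded (dz K ` {\<tau>..t})" by (rule compact_imp_bounded[OF compact_continuous_image[OF cdz compact_Icc]])
        then obtain b where b: "\<forall>x\<in>dz K ` {\<tau>..t}. norm x \<le> b" unfolding bounded_iff by blast
        have "AE s in L. norm (dz K s) \<le> b" using b by (intro AE_I2) (auto simp: sp)
        then show ?thesis by (rule L.integrable_const_bound) measurable
      qed
      have "(dz K has_integral (zK K t - zK K \<tau>)) {\<tau>..t}"
        by (rule fundamental_theorem_of_calculus[OF tT(1)])
           (use dzK in \<open>auto simp: has_real_derivative_iff_has_vector_derivative\<close>)
      then have "zK K t - zK K \<tau> = (LINT s|L. dz K s)"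
        using lebesgue_integral_eq_integral[of "{\<tau>..t}" "dz K"] idz by (simp add: L_def integral_unique)
      also have "\<dots> \<le> (LINT s|L. gK K s)"
      proof (rule integral_mono_AE[OF idz ig])
        show "AE s in L. dz K s \<le> gK K s"
          using ae AE_space
        proof eventually_elim
          case (elim s)
          then have s: "s \<in> {\<tau>..t}" "\<theta> s \<in> sobolev 1" by (auto simp: sp)
          note sT = st[OF s(1)]
          have "dy K s \<le> (\<Sum>k\<in>Bx K. (m k)^2 * ((cmod (c s k))^2 + (cmod (fcoeff f k))^2
            + (2 / \<epsilon>) * (Qc (\<theta> s) k)^2 - (3 * \<epsilon> / 2) * (kabs k)^2 * (cmod (c s k))^2))"
            unfolding dy_def by (intro sum_mono mult_left_mono inner_rhs) simp
          also have "\<dots> = yK K s + (\<Sum>k\<in>Bx K. (m k * cmod (fcoeff f k))^2) + (2 / \<epsilon>) * (\<Sum>k\<in>Bx K. (m k * Qc (\<theta> s) k)^2) - (3 * \<epsilon> / 2) * xK K s"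
            unfolding yK_def xK_def by (simp add: sum_distrib_left sum.distrib sum_subtractf power_mult_distrib algebra_simps)
          also have "(\<Sum>k\<in>Bx K. (m k * cmod (fcoeff f k))^2) \<le> F2"
          proof -
            have "(\<Sum>k\<in>Bx K. (m k * cmod (fcoeff f k))^2) \<le> (\<Sum>k\<in>Bx K. (kabs k * cmod (fcoeff f k))^2)"
              using m by (intro sum_mono power_mono mult_right_mono) auto
            also have "\<dots> \<le> F2" unfolding F2_def by (rule sobolev1_sums[OF f1]) simp
            finally show ?thesis .
          qed
          also have "(\<Sum>k\<in>Bx K. (m k * Qc (\<theta> s) k)^2) \<le> 32 * (\<Sum>i\<in>X. cmod (c s i))^2 * y s + 288 * \<eta> * x s"
            unfolding Qc_def m_def
            by (rule truncated_convolution[OF N _ conv_summable X(1) X(2)[OF sT]])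
               (use ysum[OF sT] xsum[OF s(2)] in \<open>auto simp: m_def\<close>)
          also have "32 * (\<Sum>i\<in>X. cmod (c s i))^2 * y s \<le> 32 * B^2 * y s"
            using bnds(3)[OF sT] B[OF sT] by (intro mult_right_mono mult_left_mono power_mono) (auto intro: sum_nonneg)
          finally have "dy K s \<le> yK K s + F2 + (2 / \<epsilon>) * (32 * B^2 * y s + 288 * \<eta> * x s) - (3 * \<epsilon> / 2) * xK K s"
            using eps by (simp add: mult_left_mono divide_right_mono)
          also have "\<dots> = yK K s + F2 + (C1 - 1) * y s + (\<epsilon> / 2) * x s - (3 * \<epsilon> / 2) * xK K s"
            using eps by (simp add: C1_def \<eta>_def power2_eq_square field_simps)
          also have "\<dots> \<le> F2 + C1 * y s + (\<epsilon> / 2) * x s - (3 * \<epsilon> / 2) * xK K s"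
            using ysum[OF sT, of "Bx K"] by (simp add: yK_def algebra_simps)
          finally have "dy K s - 2 * C1 * yK K s \<le> (\<epsilon> / 2) * x s - (3 * \<epsilon> / 2) * xK K s + C1 * (y s - 2 * yK K s) + F2"
            by (simp add: algebra_simps)
          then show ?case unfolding dz_def gK_def by (intro mult_left_mono) auto
        qed
      qed
      finally show ?thesis .
    qed
    have "(\<lambda>K. zK K t - zK K \<tau>) \<longlonglongrightarrow> exp (- (2 * C1) * t) * y t - exp (- (2 * C1) * \<tau>) * y \<tau>"
      unfolding zK_def by (intro tendsto_intros ylim) (use tT in auto)
    then have "exp (- (2 * C1) * t) * y t - exp (- (2 * C1) * \<tau>) * y \<tau> \<le> (LINT s|L. g s)"
      by (rule LIMSEQ_le[OF _ glim]) (use step in auto)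
    then have "exp (- (2 * C1) * t) * y t \<le> exp (- (2 * C1) * \<tau>) * y \<tau> + F2 * T" using gle by simp
    also have "exp (- (2 * C1) * \<tau>) * y \<tau> \<le> 1 * HH"
    proof (intro mult_mono e1)
      show "y \<tau> \<le> HH"
      proof (rule LIMSEQ_le_const2[OF ylim])
        have "yK K \<tau> \<le> (\<Sum>k\<in>Bx K. (kabs k * cmod (c \<tau> k))^2)" for K
          unfolding yK_def using m by (intro sum_mono power_mono mult_right_mono) auto
        also have "\<dots> K \<le> HH" for K unfolding HH_def by (rule sobolev1_sums[OF H]) simp
        finally show "\<exists>N. \<forall>n\<ge>N. yK n \<tau> \<le> HH" by blast
      qed (use tT in auto)
    qed (use tT bnds in auto)
    finally have "exp (- (2 * C1) * t) * y t \<le> HH + F2 * T" by simp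
    then have "exp (2 * C1 * t) * (exp (- (2 * C1) * t) * y t) \<le> exp (2 * C1 * t) * (HH + F2 * T)"
      by (intro mult_left_mono) auto
    then have "y t \<le> exp (2 * C1 * t) * (HH + F2 * T)" by (simp flip: mult.assoc exp_add)
    also have "\<dots> \<le> exp (2 * C1 * T) * (HH + F2 * T)"
      using tT C1 F2 by (intro mult_right_mono) (auto simp: HH_def mult_left_mono)
    finally show ?thesis using ysum[of t F] F t tT unfolding m_def by auto
  qed
  show ?thesis
  proof (rule that)
    show "0 \<le> exp (2 * C1 * T) * (HH + F2 * T)" using \<tau> by (simp add: HH_def F2_def)
    fix t F assume t: "t \<in> {\<tau>..T}" and F: "finite (F :: (int \<times> int) set)"
    \<comment> \<open>For a finite set of frequencies this \<open>N\<close> makes the truncation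
      inactive.\<close>
    define N where "N = (\<Sum>k\<in>F. kabs k)"
    have "kabs k \<le> N" if "k \<in> F" for k unfolding N_def by (rule member_le_sum[OF that]) (auto simp: F)
    then have "(\<Sum>k\<in>F. (kabs k * cmod (c t k))^2) = (\<Sum>k\<in>F. (min (kabs k) N * cmod (c t k))^2)"
      by (intro sum.cong) (auto simp: min_def)
    also have "\<dots> \<le> exp (2 * C1 * T) * (HH + F2 * T)" by (rule main[OF t F]) (auto simp: N_def intro: sum_nonneg)
    finally show "(\<Sum>k\<in>F. (kabs k * cmod (c t k))^2) \<le> exp (2 * C1 * T) * (HH + F2 * T)" .
  qed
qed
end

lemma exp_minus_le: "0 < x \<Longrightarrow> exp (- x) \<le> 2 / x^2" for x :: real
proof -
  assume x: "0 < x"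
  have "x^2 / 2 \<le> exp x" using exp_lower_Taylor_quadratic[of x] x by simp
  then have "1 / exp x \<le> 1 / (x^2 / 2)" using x by (intro divide_left_mono) auto
  then show ?thesis by (simp add: exp_minus field_simps)
qed

text \<open>The larger of |j| and |k - j| is at least |k|/2 and supplies the factor |k|^r. The
  exponent that remains on the smaller one is at least 5/2, which is summable over the
  lattice.\<close>

lemma conv_decay:
  fixes a :: "int \<times> int \<Rightarrow> real"
  assumes a: "\<And>k. 0 \<le> a k" "a 0 = 0" "\<And>k. k \<noteq> 0 \<Longrightarrow> a k \<le> A * kabs k powr (- q)" "0 \<le> A"
    and r: "0 \<le> r" "r \<le> q" "5/2 \<le> 2 * q - r"
    and Z: "\<And>F. finite F \<Longrightarrow> (\<Sum>k\<in>F. kabs k powr (- (5/2))) \<le> Z" and G: "finite G"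
  shows "kabs k powr r * (\<Sum>j\<in>G. a j * a (k - j)) \<le> 2 powr r * A^2 * (2 * Z)"
proof -
  have t: "kabs k powr r * (a j * a (k - j)) \<le> 2 powr r * A^2 * (kabs j powr (- (5/2)) + kabs (k - j) powr (- (5/2)))" for j
  proof (cases "j = 0 \<or> k - j = 0")
    case True
    then have z: "a j * a (k - j) = 0" using a(2) by auto
    show ?thesis unfolding z by (auto intro!: mult_nonneg_nonneg add_nonneg_nonneg)
  next
    case False
    define x y where "x = kabs j" "y = kabs (k - j)"
    have xy: "1 \<le> x" "1 \<le> y" using False kabs_ge_1 by (auto simp: x_y_def)
    have main: "(2 * p) powr r * (p powr (- q) * m powr (- q)) \<le> 2 powr r * m powr (- (5/2))" if "1 \<le> m" "m \<le> p" for p m :: real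
    proof -
      have "(2 * p) powr r * (p powr (- q) * m powr (- q)) = 2 powr r * (p powr (r - q) * m powr (- q))"
        using that by (simp add: powr_mult powr_diff powr_minus field_simps)
      also have "p powr (r - q) \<le> m powr (r - q)" using that r by (intro powr_mono2') auto
      also have "m powr (r - q) * m powr (- q) = m powr (r - 2 * q)" by (simp flip: powr_add)
      also have "\<dots> \<le> m powr (- (5/2))" using that r by (intro powr_mono) auto
      finally show ?thesis by (simp add: mult_left_mono mult_right_mono)
    qed
    have k: "kabs k \<le> x + y" using kabs_triangle[of j "k - j"] by (simp add: x_y_def)
    have "kabs k powr r * (x powr (- q) * y powr (- q)) \<le> 2 powr r * (x powr (- (5/2)) + y powr (- (5/2)))"
    proof (cases "x \<le> y")
      case True
      have "kabs k powr r * (x powr (- q) * y powr (- q)) \<le> (2 * y) powr r * (y powr (- q) * x powr (- q))"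
        unfolding mult.commute[of "x powr _"] using k True r by (intro mult_right_mono powr_mono2) auto
      also have "\<dots> \<le> 2 powr r * x powr (- (5/2))" using main[OF xy(1) True] .
      also have "\<dots> \<le> 2 powr r * (x powr (- (5/2)) + y powr (- (5/2)))" by (intro mult_left_mono) auto
      finally show ?thesis .
    next
      case False
      have "kabs k powr r * (x powr (- q) * y powr (- q)) \<le> (2 * x) powr r * (x powr (- q) * y powr (- q))"
        using k False r by (intro mult_right_mono powr_mono2) auto
      also have "\<dots> \<le> 2 powr r * y powr (- (5/2))" using main[OF xy(2)] False by simp
      also have "\<dots> \<le> 2 powr r * (x powr (- (5/2)) + y powr (- (5/2)))" by (intro mult_left_mono) auto
      finally show ?thesis .
    qed
    then have "A^2 * (kabs k powr r * (x powr (- q) * y powr (- q))) \<le> A^2 * (2 powr r * (x powr (- (5/2)) + y powr (- (5/2))))"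
      by (intro mult_left_mono) auto
    moreover have "a j * a (k - j) \<le> (A * x powr (- q)) * (A * y powr (- q))"
      using a False by (intro mult_mono) (auto simp: x_y_def)
    then have "kabs k powr r * (a j * a (k - j)) \<le> kabs k powr r * ((A * x powr (- q)) * (A * y powr (- q)))"
      by (intro mult_left_mono) auto
    ultimately show ?thesis by (simp add: x_y_def power2_eq_square mult_ac)
  qed
  have "kabs k powr r * (\<Sum>j\<in>G. a j * a (k - j)) \<le> (\<Sum>j\<in>G. 2 powr r * A^2 * (kabs j powr (- (5/2)) + kabs (k - j) powr (- (5/2))))"
    unfolding sum_distrib_left by (intro sum_mono t)
  also have "\<dots> = 2 powr r * A^2 * ((\<Sum>j\<in>G. kabs j powr (- (5/2))) + (\<Sum>j\<in>(\<lambda>j. k - j) ` G. kabs j powr (- (5/2))))"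
    by (subst sum.reindex) (auto simp: inj_on_def sum.distrib simp flip: sum_distrib_left)
  also have "\<dots> \<le> 2 powr r * A^2 * (Z + Z)" using G by (intro mult_left_mono add_mono Z) auto
  finally show ?thesis by simp
qed

context visc
begin

lemma f_le: "k \<noteq> 0 \<Longrightarrow> cmod (fcoeff f k) \<le> sobolev_norm 1 f * kabs k powr (- 1)"
proof -
  assume k: "k \<noteq> 0"
  have "(kabs k * cmod (fcoeff f k))^2 \<le> (sobolev_norm 1 f)^2" using sobolev1_sums[OF f1, of "{k}"] by simp
  moreover have "0 \<le> sobolev_norm 1 f" unfolding sobolev_norm_def by (auto intro!: infsum_nonneg)
  ultimately have "kabs k * cmod (fcoeff f k) \<le> sobolev_norm 1 f" by (rule power2_le_imp_le)
  then show ?thesis using kabs_pos[OF k] by (simp add: powr_minus field_simps)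
qed

text \<open>After an elapsed time of at least \<open>b - a\<close> the initial value has been damped
  by a Gaussian factor, which is traded for |k|^-4; the source gains |k|^-2 from the viscous
  rate.\<close>

lemma duhamel:
  assumes ab: "0 \<le> a" "a < b" "b \<le> T" and B: "\<And>s. s \<in> {a..T} \<Longrightarrow> cmod (Nl (\<theta> s) k) \<le> B"
    and M: "cmod (c a k) \<le> M" and k: "k \<noteq> 0" and t: "t \<in> {b..T}"
  shows "cmod (c t k) \<le> 2 * M / (\<epsilon> * (b - a))^2 * kabs k powr (- 4) + (B + cmod (fcoeff f k)) / \<epsilon> * kabs k powr (- 2)"
proof -
  define lam where "lam = kabs k + \<epsilon> * (kabs k)^2"
  have kp: "0 < kabs k" using kabs_pos[OF k] .
  have l: "\<epsilon> * (kabs k)^2 \<le> lam" "0 < \<epsilon> * (kabs k)^2" using kp eps by (auto simp: lam_def intro!: mult_pos_pos)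
  have B0: "0 \<le> B" using order_trans[OF norm_ge_zero B[of a]] ab by simp
  have "cmod (c t k) \<le> exp (- lam * (t - a)) * cmod (c a k) + (B + cmod (fcoeff f k)) / lam"
  proof (rule damped_ode_bound[where b = "\<lambda>s. fcoeff f k - Nl (\<theta> s) k"])
    fix s assume s: "s \<in> {a..t}"
    have "complex_of_real lam = complex_of_real (kabs k) + complex_of_real \<epsilon> * (complex_of_real (kabs k))^2"
      by (simp add: lam_def)
    then show "((\<lambda>s. c s k) has_vector_derivative fcoeff f k - Nl (\<theta> s) k - of_real lam * c s k) (at s within {a..t})"
      using ode_within[of s "{a..t}" k] s ab unfolding rhs_def by auto
    show "cmod (fcoeff f k - Nl (\<theta> s) k) \<le> B + cmod (fcoeff f k)"
      using norm_triangle_ineq4[of "fcoeff f k" "Nl (\<theta> s) k"] B[of s] s t ab by auto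
  qed (use l t ab in auto)
  also have "exp (- lam * (t - a)) * cmod (c a k) \<le> 2 / (\<epsilon> * (kabs k)^2 * (b - a))^2 * M"
  proof (intro mult_mono M)
    have "\<epsilon> * (kabs k)^2 * (b - a) \<le> lam * (t - a)" using l t ab by (intro mult_mono) auto
    then have "exp (- lam * (t - a)) \<le> exp (- (\<epsilon> * (kabs k)^2 * (b - a)))" by simp
    also have "\<dots> \<le> 2 / (\<epsilon> * (kabs k)^2 * (b - a))^2" using l ab by (intro exp_minus_le) auto
    finally show "exp (- lam * (t - a)) \<le> 2 / (\<epsilon> * (kabs k)^2 * (b - a))^2" .
  qed auto
  also have "2 / (\<epsilon> * (kabs k)^2 * (b - a))^2 * M = 2 * M / (\<epsilon> * (b - a))^2 * kabs k powr (- 4)"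
  proof -
    have "kabs k powr (- 4) = 1 / (kabs k) ^ 4" using kp by (simp add: powr_minus_divide)
    moreover have "(\<epsilon> * (kabs k)^2 * (b - a))^2 = (kabs k)^4 * (\<epsilon> * (b - a))^2"
      by (simp only: power2_eq_square power4_eq_xxxx mult_ac)
    ultimately show ?thesis by simp
  qed
  also have "(B + cmod (fcoeff f k)) / lam \<le> (B + cmod (fcoeff f k)) / (\<epsilon> * (kabs k)^2)"
    using l B0 by (intro divide_left_mono) auto
  also have "\<dots> = (B + cmod (fcoeff f k)) / \<epsilon> * kabs k powr (- 2)"
    using kp by (simp add: powr_minus_divide)
  finally show ?thesis by simp
qed

text \<open>Each round feeds the known decay into the nonlinearity and gains two powers by
  \<open>duhamel\<close>: bounded \<open>Nl\<close> gives |k|^-2, then |k|^-(5/2), then |k|^-(7/2).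
  The last two conclusions are the ones that the Fejer commutator will need.\<close>

lemma regularity:
  assumes b: "0 < b" "b \<le> T"
  obtains S A where "\<And>k. 0 \<le> S k" "S 0 = 0" "\<And>t k. t \<in> {b..T} \<Longrightarrow> cmod (c t k) \<le> S k"
    "\<And>k. S k * (kabs k)^3 \<le> A" "(\<lambda>k. kabs k powr (5/4) * S k) summable_on UNIV"
proof -
  have T: "0 < T" using b by simp
  obtain M where M: "0 \<le> M" "\<And>t. t \<in> {0..T} \<Longrightarrow> norm (\<theta> t) \<le> M"
    using continuous_norm_bound[OF cont[of 0 T]] by auto
  have cM: "cmod (c t k) \<le> M" if "t \<in> {0..T}" for t k
  proof -
    have "1 * cmod (c t k) \<le> 2 * pi * cmod (c t k)" using pi_gt3 by (intro mult_right_mono) auto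
    then show ?thesis using fcoeff_le_norm[of "\<theta> t" k] M(2)[OF that] by linarith
  qed
  have cM2: "(\<Sum>k\<in>F. (cmod (c t k))^2) \<le> M^2" if "t \<in> {0..T}" "finite F" for t F
  proof -
    have "1^2 \<le> (2 * pi)^2" using pi_gt3 by (intro power_mono) auto
    then have "(norm (\<theta> t))^2 / (2 * pi)^2 \<le> (norm (\<theta> t))^2 / 1" by (intro divide_left_mono) auto
    also have "\<dots> \<le> M^2" using M(2)[OF that(1)] by (simp add: power_mono)
    finally show ?thesis using fcoeff_square_bound[OF that(2), of "\<theta> t"] by linarith
  qed
  \<comment> \<open>Almost every time is good, hence some time in every interval of positive
    length.\<close>
  obtain \<tau> where \<tau>: "0 < \<tau>" "\<tau> < b / 4" "\<theta> \<tau> \<in> sobolev 1"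
  proof -
    have ae: "AE t in lebesgue. t \<in> {0..T} \<longrightarrow> \<theta> t \<in> sobolev 1" by (rule viscous_sobolev_AE[OF v T])
    have "\<exists>t. 0 < t \<and> t < b / 4 \<and> \<theta> t \<in> sobolev 1"
    proof (rule ccontr)
      assume n: "\<not> ?thesis"
      from ae have "AE t in lebesgue. t \<notin> {0<..<b/4}"
      proof eventually_elim
        case (elim t)
        then show ?case using n b by auto
      qed
      then have "{0<..<b/4} \<in> null_sets lebesgue" by (subst (asm) AE_iff_null_sets[symmetric]) auto
      then have "emeasure lebesgue {0<..<b/4} = 0" by (rule null_setsD1)
      then show False using b by simp
    qed
    then show ?thesis using that by blast
  qed
  obtain Y where Y: "0 \<le> Y" "\<And>t F. t \<in> {\<tau>..T} \<Longrightarrow> finite F \<Longrightarrow> (\<Sum>k\<in>F. (kabs k * cmod (c t k))^2) \<le> Y"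
    using h1_bound[of \<tau> T] \<tau> b by auto
  have "(\<lambda>k. kabs k powr (- (5/2))) summable_on UNIV" by (rule lattice_summable) simp
  then obtain Z where Z: "\<And>F. finite F \<Longrightarrow> (\<Sum>k\<in>F. kabs k powr (- (5/2))) \<le> Z"
    using finite_sum_le_infsum[of "\<lambda>k. kabs k powr (- (5/2))" UNIV] by (metis UNIV_I powr_ge_zero subsetI)
  have Z0: "0 \<le> Z" using Z[of "{}"] by simp
  define F1 where "F1 = sobolev_norm 1 f"
  have F1: "0 \<le> F1" unfolding F1_def sobolev_norm_def by (auto intro!: infsum_nonneg)
  have fle: "cmod (fcoeff f k) \<le> F1 * kabs k powr (- 1)" if "k \<noteq> 0" for k unfolding F1_def by (rule f_le[OF that])
  \<comment> \<open>One quarter of the available time for reaching an H1 state and one for each of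
    the three rounds.\<close>
  define e where "e = b / 4"
  have e: "0 < e" "\<tau> < e" "4 * e = b" using \<tau> b by (auto simp: e_def)
  define A0 where "A0 = 2 * M / (\<epsilon> * e)^2"
  have A0: "0 \<le> A0" using M by (simp add: A0_def)
  have duh: "cmod (c t k) \<le> A0 * kabs k powr (- 4) + (B + cmod (fcoeff f k)) / \<epsilon> * kabs k powr (- 2)"
    if "0 \<le> a" "a + e \<le> t" "t \<le> T" "k \<noteq> 0" "\<And>s. s \<in> {a..T} \<Longrightarrow> cmod (Nl (\<theta> s) k) \<le> B" for a t k B
    using duhamel[of a "a + e" T k B M t] that e cM[of a k] by (auto simp: A0_def)
  have pm: "kabs k powr x \<le> kabs k powr y" if "x \<le> y" "k \<noteq> 0" for x y k
    using that kabs_ge_1[of k] by (intro powr_mono) auto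
  \<comment> \<open>The factor |k| is distributed by the triangle inequality onto one of the two
    factors, which is then bounded in H1 and the other in \<open>L2\<close>.\<close>
  have Nl1: "cmod (Nl (\<theta> s) k) \<le> 2 * (sqrt Y * M)" if s: "s \<in> {\<tau>..T}" and k: "k \<noteq> 0" for s k
  proof -
    have sT: "s \<in> {0..T}" using s \<tau> by auto
    have CS: "(\<Sum>j\<in>G. (kabs j * cmod (c s j)) * cmod (c s (k - j))) \<le> sqrt Y * M" if G: "finite G" for G
    proof -
      have "(\<Sum>j\<in>G. (cmod (c s (k - j)))^2) = (\<Sum>j\<in>(\<lambda>j. k - j) ` G. (cmod (c s j))^2)"
        by (subst sum.reindex) (auto simp: inj_on_def)
      also have "\<dots> \<le> M^2" using G by (intro cM2 sT) simp
      finally have "(\<Sum>j\<in>G. (kabs j * cmod (c s j))^2) * (\<Sum>j\<in>G. (cmod (c s (k - j)))^2) \<le> Y * M^2"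
        using Y(2)[OF s G] Y(1) by (intro mult_mono) (auto intro: sum_nonneg)
      then have "(\<Sum>j\<in>G. (kabs j * cmod (c s j)) * cmod (c s (k - j)))^2 \<le> (sqrt Y * M)^2"
        using Cauchy_Schwarz_ineq_sum[of "\<lambda>j. kabs j * cmod (c s j)" "\<lambda>j. cmod (c s (k - j))" G] Y(1)
        by (simp add: power_mult_distrib)
      then show ?thesis by (rule power2_le_imp_le) (use Y(1) M(1) in simp)
    qed
    have "Qc (\<theta> s) k \<le> 2 * (sqrt Y * M) / kabs k"
    proof (rule Qc_le)
      fix G :: "(int \<times> int) set" assume G: "finite G"
      have "kabs k * (\<Sum>j\<in>G. cmod (c s j) * cmod (c s (k - j)))
        \<le> (\<Sum>j\<in>G. (kabs j * cmod (c s j)) * cmod (c s (k - j)) + (kabs (k - j) * cmod (c s (k - j))) * cmod (c s j))"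
        unfolding sum_distrib_left
      proof (intro sum_mono)
        fix j
        have "kabs k * (cmod (c s j) * cmod (c s (k - j))) \<le> (kabs j + kabs (k - j)) * (cmod (c s j) * cmod (c s (k - j)))"
          using kabs_triangle[of j "k - j"] by (intro mult_right_mono) auto
        then show "kabs k * (cmod (c s j) * cmod (c s (k - j))) \<le> (kabs j * cmod (c s j)) * cmod (c s (k - j)) + (kabs (k - j) * cmod (c s (k - j))) * cmod (c s j)"
          by (simp add: algebra_simps)
      qed
      also have "\<dots> = (\<Sum>j\<in>G. (kabs j * cmod (c s j)) * cmod (c s (k - j))) + (\<Sum>j\<in>(\<lambda>j. k - j) ` G. (kabs j * cmod (c s j)) * cmod (c s (k - j)))"
        by (subst sum.reindex) (auto simp: inj_on_def sum.distrib)
      also have "\<dots> \<le> sqrt Y * M + sqrt Y * M" using G by (intro add_mono CS) auto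
      finally show "(\<Sum>j\<in>G. cmod (c s j) * cmod (c s (k - j))) \<le> 2 * (sqrt Y * M) / kabs k"
        using kabs_pos[OF k] by (simp add: field_simps)
    qed
    then have "kabs k * Qc (\<theta> s) k \<le> 2 * (sqrt Y * M)" using kabs_pos[OF k] by (simp add: field_simps)
    then show ?thesis using Nl_le_Qc[of "\<theta> s" k] by linarith
  qed
  have Nl2: "cmod (Nl (\<theta> s) k) \<le> 16 * A^2 * Z * kabs k powr (1 - r)"
    if "0 \<le> A" "\<And>k. k \<noteq> 0 \<Longrightarrow> cmod (c s k) \<le> A * kabs k powr (- q)" "0 \<le> r" "r \<le> q" "5/2 \<le> 2 * q - r" "r \<le> 3" "k \<noteq> 0" for A s q r k
  proof -
    have "Qc (\<theta> s) k \<le> 16 * A^2 * Z * kabs k powr (- r)"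
    proof (rule Qc_le)
      fix G :: "(int \<times> int) set" assume G: "finite G"
      have "kabs k powr r * (\<Sum>j\<in>G. cmod (c s j) * cmod (c s (k - j))) \<le> 2 powr r * A^2 * (2 * Z)"
        by (rule conv_decay[where q = q]) (use that Z G in auto)
      also have "\<dots> \<le> 2 powr 3 * A^2 * (2 * Z)"
        using that Z0 by (intro mult_right_mono powr_mono) auto
      finally have "kabs k powr r * (\<Sum>j\<in>G. cmod (c s j) * cmod (c s (k - j))) \<le> 16 * A^2 * Z" by simp
      then have le: "kabs k powr r * (\<Sum>j\<in>G. cmod (c s j) * cmod (c s (k - j))) \<le> 16 * A^2 * Z" .
      show "(\<Sum>j\<in>G. cmod (c s j) * cmod (c s (k - j))) \<le> 16 * A^2 * Z * kabs k powr (- r)"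
      proof -
        have i: "kabs k powr (- r) * kabs k powr r = 1" using that(7) by (simp flip: powr_add)
        have "(\<Sum>j\<in>G. cmod (c s j) * cmod (c s (k - j))) = kabs k powr (- r) * (kabs k powr r * (\<Sum>j\<in>G. cmod (c s j) * cmod (c s (k - j))))"
          using i by (simp flip: mult.assoc)
        also have "\<dots> \<le> kabs k powr (- r) * (16 * A^2 * Z)" by (intro mult_left_mono le) simp
        finally show ?thesis by (simp only: mult.commute)
      qed
    qed
    then have "kabs k * Qc (\<theta> s) k \<le> kabs k * (16 * A^2 * Z * kabs k powr (- r))" by (intro mult_left_mono) auto
    also have "\<dots> = 16 * A^2 * Z * kabs k powr (1 - r)"
      using kabs_pos[OF that(7)] by (simp add: powr_diff powr_minus field_simps)
    finally show ?thesis using Nl_le_Qc[of "\<theta> s" k] by linarith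
  qed
  define A1 where "A1 = A0 + (2 * (sqrt Y * M) + F1) / \<epsilon>"
  have A1: "0 \<le> A1" using A0 Y M F1 eps by (simp add: A1_def)
  have d1: "cmod (c t k) \<le> A1 * kabs k powr (- 2)" if "t \<in> {2 * e..T}" "k \<noteq> 0" for t k
  proof -
    have "cmod (c t k) \<le> A0 * kabs k powr (- 4) + (2 * (sqrt Y * M) + cmod (fcoeff f k)) / \<epsilon> * kabs k powr (- 2)"
      by (rule duh[of e]) (use that e Nl1 in auto)
    also have "\<dots> \<le> A0 * kabs k powr (- 2) + (2 * (sqrt Y * M) + F1) / \<epsilon> * kabs k powr (- 2)"
    proof (intro add_mono mult_left_mono mult_right_mono divide_right_mono pm A0)
      have "F1 * kabs k powr (- 1) \<le> F1 * kabs k powr 0" using that F1 by (intro mult_left_mono pm) auto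
      then show "cmod (fcoeff f k) \<le> F1" using fle[OF that(2)] that(2) by simp
    qed (use that eps Y(1) M(1) in auto)
    finally show ?thesis by (simp add: A1_def algebra_simps)
  qed
  define A2 where "A2 = A0 + (16 * A1^2 * Z + F1) / \<epsilon>"
  have A2: "0 \<le> A2" using A0 Z0 F1 eps by (simp add: A2_def)
  have d2: "cmod (c t k) \<le> A2 * kabs k powr (- (5/2))" if "t \<in> {3 * e..T}" "k \<noteq> 0" for t k
  proof -
    have "cmod (c t k) \<le> A0 * kabs k powr (- 4) + (16 * A1^2 * Z * kabs k powr (1 - 3/2) + cmod (fcoeff f k)) / \<epsilon> * kabs k powr (- 2)"
    proof (rule duh[of "2 * e"])
      fix s assume "s \<in> {2 * e..T}"
      then show "cmod (Nl (\<theta> s) k) \<le> 16 * A1^2 * Z * kabs k powr (1 - 3/2)"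
        by (intro Nl2[where q = 2] A1 d1 that) auto
    qed (use that e in auto)
    also have "\<dots> \<le> A0 * kabs k powr (- (5/2)) + (16 * A1^2 * Z * kabs k powr (- (1/2)) + F1 * kabs k powr (- (1/2))) / \<epsilon> * kabs k powr (- 2)"
    proof (intro add_mono mult_left_mono mult_right_mono divide_right_mono pm A0)
      have "F1 * kabs k powr (- 1) \<le> F1 * kabs k powr (- (1/2))" using that F1 by (intro mult_left_mono pm) auto
      then show "cmod (fcoeff f k) \<le> F1 * kabs k powr (- (1/2))" using fle[OF that(2)] by simp
    qed (use that eps Z0 in auto)
    also have "\<dots> = A0 * kabs k powr (- (5/2)) + (16 * A1^2 * Z + F1) / \<epsilon> * (kabs k powr (- (1/2)) * kabs k powr (- 2))"
      by (simp add: field_simps)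
    also have "kabs k powr (- (1/2)) * kabs k powr (- 2) = kabs k powr (- (5/2))" by (simp flip: powr_add)
    finally show ?thesis by (simp add: A2_def algebra_simps)
  qed
  define A3 where "A3 = A0 + 16 * A2^2 * Z / \<epsilon>"
  have A3: "0 \<le> A3" using A0 Z0 eps by (simp add: A3_def)
  \<comment> \<open>The force term stays as it is. Replacing it by its pointwise bound |k|^-1 would
    leave |k|^-(7/4) after multiplication by |k|^(5/4), which is not summable in two
    dimensions.\<close>
  define S where "S = (\<lambda>k. A3 * kabs k powr (- (7/2)) + cmod (fcoeff f k) / \<epsilon> * kabs k powr (- 2))"
  have S0: "0 \<le> S k" for k using A3 eps by (simp add: S_def)
  have d3: "cmod (c t k) \<le> S k" if "t \<in> {b..T}" "k \<noteq> 0" for t k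
  proof -
    have "cmod (c t k) \<le> A0 * kabs k powr (- 4) + (16 * A2^2 * Z * kabs k powr (1 - 5/2) + cmod (fcoeff f k)) / \<epsilon> * kabs k powr (- 2)"
    proof (rule duh[of "3 * e"])
      fix s assume "s \<in> {3 * e..T}"
      then show "cmod (Nl (\<theta> s) k) \<le> 16 * A2^2 * Z * kabs k powr (1 - 5/2)"
        by (intro Nl2[where q = "5/2"] A2 d2 that) auto
    qed (use that e in auto)
    also have "\<dots> = A0 * kabs k powr (- 4) + 16 * A2^2 * Z / \<epsilon> * (kabs k powr (1 - 5/2) * kabs k powr (- 2)) + cmod (fcoeff f k) / \<epsilon> * kabs k powr (- 2)"
      using eps by (simp add: field_simps)
    also have "kabs k powr (1 - 5/2) * kabs k powr (- 2) = kabs k powr (- (7/2))" by (simp flip: powr_add)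
    also have "A0 * kabs k powr (- 4) \<le> A0 * kabs k powr (- (7/2))" using that A0 by (intro mult_left_mono pm) auto
    finally show ?thesis by (simp add: S_def A3_def algebra_simps)
  qed
  show ?thesis
  proof (rule that[of S])
    show "0 \<le> S k" for k by (rule S0)
    show "S 0 = 0" by (simp add: S_def)
    show "cmod (c t k) \<le> S k" if "t \<in> {b..T}" for t k
      using d3[OF that] S0 by (cases "k = 0") auto
    show "S k * (kabs k)^3 \<le> A3 + F1 / \<epsilon>" for k
    proof (cases "k = 0")
      case False
      have "S k \<le> A3 * kabs k powr (- 3) + F1 * kabs k powr (- 1) / \<epsilon> * kabs k powr (- 2)"
        unfolding S_def using False A3 eps
        by (intro add_mono mult_left_mono mult_right_mono divide_right_mono pm fle) auto
      also have "\<dots> = (A3 + F1 / \<epsilon>) * kabs k powr (- 3)"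
      proof -
        have "kabs k powr (- 1) * kabs k powr (- 2) = kabs k powr (- 3)" unfolding powr_add[symmetric] by simp
        then have "F1 * kabs k powr (- 1) / \<epsilon> * kabs k powr (- 2) = F1 / \<epsilon> * kabs k powr (- 3)"
          by (metis (no_types, opaque_lifting) mult.assoc times_divide_eq_left)
        then show ?thesis by (simp add: distrib_right)
      qed
      finally have "S k * (kabs k)^3 \<le> (A3 + F1 / \<epsilon>) * kabs k powr (- 3) * (kabs k)^3"
        by (intro mult_right_mono) auto
      also have "\<dots> = A3 + F1 / \<epsilon>" using False by (simp add: powr_minus_divide)
      finally show ?thesis .
    qed (use A3 F1 eps in auto)
    have 1: "(\<lambda>k. A3 * kabs k powr (- (9/4))) summable_on UNIV"
      by (intro summable_on_cmult_right lattice_summable) simp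
    have 2: "(\<lambda>k. 1 / \<epsilon> * ((kabs k * cmod (fcoeff f k))^2 + kabs k powr (- (7/2)))) summable_on UNIV"
    proof (intro summable_on_cmult_right summable_on_add lattice_summable)
      show "(\<lambda>k. (kabs k * cmod (fcoeff f k))^2) summable_on UNIV"
        by (rule nonneg_summableI[OF _ sobolev1_sums[OF f1]]) auto
    qed simp
    show "(\<lambda>k. kabs k powr (5/4) * S k) summable_on UNIV"
    proof (rule summable_on_comparison_test[OF summable_on_add[OF 1 2]])
      fix k :: "int \<times> int"
      have "kabs k powr (5/4) * S k = A3 * (kabs k powr (5/4) * kabs k powr (- (7/2))) + 1 / \<epsilon> * (cmod (fcoeff f k) * (kabs k powr (5/4) * kabs k powr (- 2)))"
        unfolding S_def by (simp add: algebra_simps)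
      also have "kabs k powr (5/4) * kabs k powr (- (7/2)) = kabs k powr (- (9/4))" by (simp flip: powr_add)
      also have "kabs k powr (5/4) * kabs k powr (- 2) = kabs k powr (- (3/4))" by (simp flip: powr_add)
      \<comment> \<open>Cauchy-Schwarz split: |k| |f_k| is square-summable because f is in H1, and
        |k|^-(7/4) is square-summable because 7/2 > 2.\<close>
      also have "cmod (fcoeff f k) * kabs k powr (- (3/4)) \<le> (kabs k * cmod (fcoeff f k))^2 + kabs k powr (- (7/2))"
      proof (cases "k = 0")
        case False
        have kp: "0 < kabs k" using kabs_pos[OF False] .
        define p q where "p = kabs k * cmod (fcoeff f k)" "q = kabs k powr (- (7/4))"
        have "p * q = cmod (fcoeff f k) * kabs k powr (- (3/4))"
        proof -
          have "kabs k powr 1 * kabs k powr (- (7/4)) = kabs k powr (- (3/4))" unfolding powr_add[symmetric] by simp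
          moreover have "kabs k powr 1 = kabs k" by simp
          ultimately have "kabs k * kabs k powr (- (7/4)) = kabs k powr (- (3/4))" by metis
          then show ?thesis unfolding p_q_def by (metis mult.commute mult.left_commute)
        qed
        moreover have "q^2 = kabs k powr (- (7/2))" by (simp add: p_q_def power2_eq_square flip: powr_add)
        moreover have "p * q \<le> p^2 + q^2"
        proof -
          have "0 \<le> p * q" by (simp add: p_q_def)
          then show ?thesis using sum_squares_bound[of p q] by linarith
        qed
        ultimately show ?thesis unfolding p_q_def(1)[symmetric] by linarith
      qed simp
      finally show "kabs k powr (5/4) * S k \<le> A3 * kabs k powr (- (9/4)) + 1 / \<epsilon> * ((kabs k * cmod (fcoeff f k))^2 + kabs k powr (- (7/2)))"
        using eps by (simp add: divide_right_mono)
    qed (use S0 in simp)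
  qed
qed
end

section \<open>Gaussian smoothing of trigonometric polynomials\<close>

abbreviation nd :: "real \<Rightarrow> real" where "nd \<equiv> std_normal_density"

lemma nd_pos: "0 < nd z" by (simp add: normal_density_pos)
lemma nd_integrable: "integrable lborel nd" using integrable_std_normal_moment[of 0] by simp
lemma nd_continuous: "continuous_on S nd"
  unfolding std_normal_density_def by (intro continuous_intros) auto
lemma nd_measurable [measurable]: "nd \<in> borel_measurable borel"
  by (intro borel_measurable_continuous_onI nd_continuous)

lemma nd_integrable_bounded:
  fixes g :: "real \<Rightarrow> 'a::{banach, second_countable_topology}"
  assumes m: "g \<in> borel_measurable borel" and b: "\<And>z. norm (g z) \<le> B * (1 + z^2)"
  shows "integrable lborel (\<lambda>z. nd z *\<^sub>R g z)"
proof (rule Bochner_Integration.integrable_bound)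
  show "integrable lborel (\<lambda>z. B * (nd z + nd z * z^2))"
    using nd_integrable integrable_std_normal_moment[of 2] by simp
  show "AE z in lborel. norm (nd z *\<^sub>R g z) \<le> norm (B * (nd z + nd z * z^2))"
  proof (intro AE_I2)
    fix z
    have "norm (nd z *\<^sub>R g z) = nd z * norm (g z)" using nd_pos[of z] by simp
    also have "\<dots> \<le> nd z * (B * (1 + z^2))" using nd_pos[of z] by (intro mult_left_mono b) simp
    also have "\<dots> \<le> norm (B * (nd z + nd z * z^2))" by (simp add: algebra_simps)
    finally show "norm (nd z *\<^sub>R g z) \<le> norm (B * (nd z + nd z * z^2))" .
  qed
qed (use m in measurable)

lemma integral_nd: "(LINT z|lborel. nd z) = 1"
  using integral_std_normal_moment_even[of 0] by simp
lemma integral_nd_square: "(LINT z|lborel. nd z * z^2) = 1"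
  using integral_std_normal_moment_even[of 1] by simp

lemma nd_cis_integrable: "integrable lborel (\<lambda>z. nd z *\<^sub>R cis (a * z))"
  "integrable lborel (\<lambda>z. nd z *\<^sub>R (z *\<^sub>R cis (a * z)))"
proof -
  have c: "(\<lambda>z. cis (a * z)) \<in> borel_measurable borel"
    by (intro borel_measurable_continuous_onI continuous_intros)
  show "integrable lborel (\<lambda>z. nd z *\<^sub>R cis (a * z))"
    by (rule nd_integrable_bounded[OF c, of 1]) simp
  show "integrable lborel (\<lambda>z. nd z *\<^sub>R (z *\<^sub>R cis (a * z)))"
  proof (rule nd_integrable_bounded[where B = 1])
    fix z :: real
    have "\<bar>z\<bar> \<le> 1 + z^2" using sum_squares_bound[of "\<bar>z\<bar>" 1] by (simp add: abs_if split: if_splits)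
    then show "norm (z *\<^sub>R cis (a * z)) \<le> 1 * (1 + z^2)" by simp
  qed (use c in measurable)
qed

lemma integral_nd_cis: "(LINT z|lborel. nd z *\<^sub>R cis (a * z)) = of_real (exp (- (a^2) / 2))"
proof -
  have "char std_normal_distribution a = (LINT z|lborel. nd z *\<^sub>R cis (a * z))"
    unfolding char_def
    by (subst integral_density) (auto simp: normal_density_nonneg cis_conv_exp intro!: borel_measurable_continuous_onI continuous_intros)
  then show ?thesis by (simp add: char_std_normal_distribution)
qed

lemma tendsto_nd: "(nd \<longlongrightarrow> 0) at_top" "(nd \<longlongrightarrow> 0) at_bot"
  unfolding std_normal_density_def by real_asymp+

text \<open>Integration by parts: \<open>nd\<close> has derivative \<open>- z * nd z\<close>, so the
  integral of the derivative of \<open>nd z *\<^sub>R cis (a * z)\<close>, which is 0, relates this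
  moment to the characteristic function.\<close>

lemma integral_nd_z_cis: "(LINT z|lborel. nd z *\<^sub>R (z *\<^sub>R cis (a * z))) = \<i> * of_real a * of_real (exp (- (a^2) / 2))"
proof -
  define F where "F = (\<lambda>z. nd z *\<^sub>R cis (a * z))"
  define f where "f = (\<lambda>z. (\<i> * of_real a) * (nd z *\<^sub>R cis (a * z)) - nd z *\<^sub>R (z *\<^sub>R cis (a * z)))"
  have dn: "(nd has_real_derivative - z * nd z) (at z)" for z
    unfolding std_normal_density_def
    by (auto intro!: derivative_eq_intros simp: field_simps)
  have dF: "(F has_vector_derivative f z) (at z)" for z
  proof -
    have "((\<lambda>z. cis (a * z)) has_vector_derivative (a *\<^sub>R (\<i> * cis (a * z)))) (at z)"
      unfolding has_vector_derivative_def
      by (auto intro!: derivative_eq_intros simp: scaleR_conv_of_real mult_ac)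
    from has_vector_derivative_scaleR[OF dn this] show ?thesis
      unfolding F_def f_def by (simp add: scaleR_conv_of_real algebra_simps)
  qed
  have nF: "norm (F z) = nd z" for z unfolding F_def using nd_pos[of z] by simp
  have intf: "integrable lborel f" unfolding f_def
    by (intro Bochner_Integration.integrable_diff integrable_mult_right nd_cis_integrable)
  have "(LBINT z=-\<infinity>..\<infinity>. f z) = 0 - 0"
  proof (rule interval_integral_FTC_integrable)
    show "(F has_vector_derivative f z) (at z)" for z by (rule dF)
    show "isCont f z" for z unfolding f_def
    proof -
      have "isCont nd z" using nd_continuous[of UNIV] by (simp add: continuous_on_eq_continuous_at)
      moreover have "isCont (\<lambda>z. cis (a * z)) z"
        using continuous_on_cis[of UNIV "\<lambda>z. a * z"] by (simp add: continuous_on_eq_continuous_at continuous_on_mult_left)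
      ultimately show "isCont (\<lambda>z. (\<i> * of_real a) * (nd z *\<^sub>R cis (a * z)) - nd z *\<^sub>R (z *\<^sub>R cis (a * z))) z"
        by (intro continuous_intros)
    qed
    show "set_integrable lborel (einterval (-\<infinity>) \<infinity>) f" using intf by (simp add: set_integrable_def)
    show "((F \<circ> real_of_ereal) \<longlongrightarrow> 0) (at_right (-\<infinity>))"
      unfolding ereal_tendsto_simps
      by (rule tendsto_norm_zero_cancel) (simp add: nF tendsto_nd)
    show "((F \<circ> real_of_ereal) \<longlongrightarrow> 0) (at_left \<infinity>)"
      unfolding ereal_tendsto_simps
      by (rule tendsto_norm_zero_cancel) (simp add: nF tendsto_nd)
  qed simp
  then have "(LINT z|lborel. f z) = 0"
    by (simp add: interval_lebesgue_integral_def set_lebesgue_integral_def)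
  then have "(\<i> * of_real a) * (LINT z|lborel. nd z *\<^sub>R cis (a * z)) = (LINT z|lborel. nd z *\<^sub>R (z *\<^sub>R cis (a * z)))"
    unfolding f_def Bochner_Integration.integral_diff[OF integrable_mult_right[OF nd_cis_integrable(1)] nd_cis_integrable(2)]
      integral_mult_right_zero by simp
  then show ?thesis by (simp only: integral_nd_cis)
qed

definition tr :: "'j set \<Rightarrow> ('j \<Rightarrow> real) \<Rightarrow> ('j \<Rightarrow> complex) \<Rightarrow> real \<Rightarrow> real" where
  "tr J \<omega> a y = Re (\<Sum>j\<in>J. a j * cis (\<omega> j * y))"

lemma tr_measurable: "(\<lambda>z. tr J \<omega> a (y + r * z)) \<in> borel_measurable borel"
  unfolding tr_def by (intro borel_measurable_continuous_onI continuous_intros)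
lemma tr_bound: "\<bar>tr J \<omega> a y\<bar> \<le> (\<Sum>j\<in>J. cmod (a j))"
proof -
  have "\<bar>tr J \<omega> a y\<bar> \<le> cmod (\<Sum>j\<in>J. a j * cis (\<omega> j * y))" unfolding tr_def by (rule abs_Re_le_cmod)
  also have "\<dots> \<le> (\<Sum>j\<in>J. cmod (a j))" by (rule order_trans[OF norm_sum]) (simp add: norm_mult)
  finally show ?thesis .
qed

lemma tr_nd_integrable: "integrable lborel (\<lambda>z. nd z * tr J \<omega> a (y + r * z))"
  "integrable lborel (\<lambda>z. nd z * (z * tr J \<omega> a (y + r * z)))"
  "integrable lborel (\<lambda>z. nd (z / sqrt 2) * tr J \<omega> a (y + r * z))"
proof -
  have B: "0 \<le> (\<Sum>j\<in>J. cmod (a j))" by (rule sum_nonneg) simp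
  have 1: "integrable lborel (\<lambda>z. nd z *\<^sub>R tr J \<omega> a (y + r * z))" for r
  proof (rule nd_integrable_bounded[OF tr_measurable])
    fix z :: real
    show "norm (tr J \<omega> a (y + r * z)) \<le> (\<Sum>j\<in>J. cmod (a j)) * (1 + z^2)"
      using tr_bound[of J \<omega> a "y + r * z"] B mult_left_mono[of 1 "1 + z^2" "\<Sum>j\<in>J. cmod (a j)"] by simp
  qed
  then show "integrable lborel (\<lambda>z. nd z * tr J \<omega> a (y + r * z))" by simp
  have "integrable lborel (\<lambda>z. nd z *\<^sub>R (z * tr J \<omega> a (y + r * z)))"
  proof (rule nd_integrable_bounded)
    show "(\<lambda>z. z * tr J \<omega> a (y + r * z)) \<in> borel_measurable borel" using tr_measurable by measurable
    fix z :: real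
    have "\<bar>z\<bar> \<le> 1 + z^2" using sum_squares_bound[of "\<bar>z\<bar>" 1] by (simp add: abs_if split: if_splits)
    then show "norm (z * tr J \<omega> a (y + r * z)) \<le> (\<Sum>j\<in>J. cmod (a j)) * (1 + z^2)"
      using tr_bound[of J \<omega> a "y + r * z"] B unfolding real_norm_def abs_mult mult.commute[of "\<bar>z\<bar>"] by (intro mult_mono) auto
  qed
  then show "integrable lborel (\<lambda>z. nd z * (z * tr J \<omega> a (y + r * z)))" by simp
  have "integrable lborel (\<lambda>w. nd w * tr J \<omega> a (y + (r * sqrt 2) * w))" using 1 by simp
  from lborel_integrable_real_affine[OF this, of "1 / sqrt 2" 0]
  show "integrable lborel (\<lambda>z. nd (z / sqrt 2) * tr J \<omega> a (y + r * z))" by simp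
qed

lemma tr_shift: "cis (\<omega> j * (y + sqrt 2 * s * z)) = cis (\<omega> j * y) * cis ((\<omega> j * sqrt 2 * s) * z)"
  by (simp add: cis_mult algebra_simps)

lemma Re_of_real_mult: "Re (of_real r * z) = r * Re z" by simp

text \<open>The characteristic function of the normal law at \<open>sqrt 2 * s * \<omega> j\<close>
  is the multiplier \<open>exp (- (s * \<omega> j)\<^sup>2)\<close>; this is the origin of the
  factor \<open>sqrt 2\<close> in the translation.\<close>

lemma tr_gauss: "tr J \<omega> (\<lambda>j. of_real (exp (- (s * \<omega> j)\<^sup>2)) * a j) y = (LINT z|lborel. nd z * tr J \<omega> a (y + sqrt 2 * s * z))"
proof -
  have i: "integrable lborel (\<lambda>z. \<Sum>j\<in>J. (a j * cis (\<omega> j * y)) * (nd z *\<^sub>R cis ((\<omega> j * sqrt 2 * s) * z)))"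
    by (intro Bochner_Integration.integrable_sum integrable_mult_right nd_cis_integrable)
  have "(LINT z|lborel. nd z * tr J \<omega> a (y + sqrt 2 * s * z))
     = (LINT z|lborel. Re (\<Sum>j\<in>J. (a j * cis (\<omega> j * y)) * (nd z *\<^sub>R cis ((\<omega> j * sqrt 2 * s) * z))))"
    unfolding tr_def tr_shift
    by (intro Bochner_Integration.integral_cong refl)
       (simp only: Re_of_real_mult[symmetric] sum_distrib_left scaleR_conv_of_real mult_ac)
  also have "\<dots> = Re (LINT z|lborel. (\<Sum>j\<in>J. (a j * cis (\<omega> j * y)) * (nd z *\<^sub>R cis ((\<omega> j * sqrt 2 * s) * z))))"
    by (intro integral_Re i)
  also have "(LINT z|lborel. (\<Sum>j\<in>J. (a j * cis (\<omega> j * y)) * (nd z *\<^sub>R cis ((\<omega> j * sqrt 2 * s) * z))))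
    = (\<Sum>j\<in>J. (a j * cis (\<omega> j * y)) * of_real (exp (- (\<omega> j * sqrt 2 * s)\<^sup>2 / 2)))"
    unfolding Bochner_Integration.integral_sum[OF integrable_mult_right[OF nd_cis_integrable(1)]] integral_mult_right_zero integral_nd_cis ..
  also have "Re \<dots> = tr J \<omega> (\<lambda>j. of_real (exp (- (s * \<omega> j)\<^sup>2)) * a j) y"
    unfolding tr_def by (intro arg_cong[where f = Re] sum.cong refl) (simp add: power_mult_distrib mult_ac)
  finally show ?thesis by simp
qed

text \<open>Puts the derivative on the Gaussian density, where it becomes a factor \<open>z\<close>,
  so no regularity of \<open>tr\<close> enters later bounds.\<close>

lemma tr_gauss_deriv:
  assumes "0 < s"
  shows "tr J \<omega> (\<lambda>j. \<i> * of_real (\<omega> j) * (of_real (exp (- (s * \<omega> j)\<^sup>2)) * a j)) y = 1 / (sqrt 2 * s) * (LINT z|lborel. nd z * (z * tr J \<omega> a (y + sqrt 2 * s * z)))"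
proof -
  have i: "integrable lborel (\<lambda>z. \<Sum>j\<in>J. (a j * cis (\<omega> j * y)) * (nd z *\<^sub>R (z *\<^sub>R cis ((\<omega> j * sqrt 2 * s) * z))))"
    by (intro Bochner_Integration.integrable_sum integrable_mult_right nd_cis_integrable)
  have "(LINT z|lborel. nd z * (z * tr J \<omega> a (y + sqrt 2 * s * z)))
     = (LINT z|lborel. Re (\<Sum>j\<in>J. (a j * cis (\<omega> j * y)) * (nd z *\<^sub>R (z *\<^sub>R cis ((\<omega> j * sqrt 2 * s) * z)))))"
    unfolding tr_def tr_shift
    by (intro Bochner_Integration.integral_cong refl)
       (simp only: Re_of_real_mult[symmetric] sum_distrib_left scaleR_conv_of_real mult_ac)
  also have "\<dots> = Re (LINT z|lborel. (\<Sum>j\<in>J. (a j * cis (\<omega> j * y)) * (nd z *\<^sub>R (z *\<^sub>R cis ((\<omega> j * sqrt 2 * s) * z)))))"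
    by (intro integral_Re i)
  also have "(LINT z|lborel. (\<Sum>j\<in>J. (a j * cis (\<omega> j * y)) * (nd z *\<^sub>R (z *\<^sub>R cis ((\<omega> j * sqrt 2 * s) * z)))))
    = (\<Sum>j\<in>J. (a j * cis (\<omega> j * y)) * (\<i> * of_real (\<omega> j * sqrt 2 * s) * of_real (exp (- (\<omega> j * sqrt 2 * s)\<^sup>2 / 2))))"
    unfolding Bochner_Integration.integral_sum[OF integrable_mult_right[OF nd_cis_integrable(2)]] integral_mult_right_zero integral_nd_z_cis ..
  also have "\<dots> = of_real (sqrt 2 * s) * (\<Sum>j\<in>J. \<i> * of_real (\<omega> j) * (of_real (exp (- (s * \<omega> j)\<^sup>2)) * a j) * cis (\<omega> j * y))"
    unfolding sum_distrib_left by (intro sum.cong refl) (simp add: power_mult_distrib mult_ac)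
  also have "Re \<dots> = sqrt 2 * s * tr J \<omega> (\<lambda>j. \<i> * of_real (\<omega> j) * (of_real (exp (- (s * \<omega> j)\<^sup>2)) * a j)) y"
    unfolding tr_def by simp
  finally show ?thesis using assms by simp
qed

lemma tr_gauss_nonneg:
  assumes "\<And>y. 0 \<le> tr J \<omega> a y" shows "0 \<le> tr J \<omega> (\<lambda>j. of_real (exp (- (s * \<omega> j)\<^sup>2)) * a j) y"
  unfolding tr_gauss using assms nd_pos by (intro Bochner_Integration.integral_nonneg) (simp add: less_imp_le)

text \<open>The factor |z| is absorbed by half of the Gaussian exponent, since |z| \<le> 1 + z^2/4
  \<le> exp (z^2/4). Hence the kernel of the derivative is dominated by a wider positive
  kernel.\<close>

lemma nd_compare: "nd z \<le> nd (z / sqrt 2)" "\<bar>z\<bar> * nd z \<le> nd (z / sqrt 2)"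
proof -
  have e: "nd z = nd (z / sqrt 2) * exp (- z\<^sup>2 / 4)"
    unfolding std_normal_density_def by (simp add: power_divide flip: exp_add)
  have "exp (- z\<^sup>2 / 4) \<le> 1" by simp
  then show "nd z \<le> nd (z / sqrt 2)" unfolding e using nd_pos[of "z / sqrt 2"] by (simp add: mult_left_le)
  have "\<bar>z\<bar> \<le> 1 + z^2 / 4" using zero_le_power2[of "\<bar>z\<bar> / 2 - 1"] by (simp add: power2_diff power_divide)
  also have "\<dots> \<le> exp (z^2 / 4)" by (rule exp_ge_add_one_self)
  finally have "\<bar>z\<bar> * exp (- z\<^sup>2 / 4) \<le> exp (z^2 / 4) * exp (- z\<^sup>2 / 4)" by (intro mult_right_mono) auto
  also have "\<dots> = 1" by (simp flip: exp_add)
  finally show "\<bar>z\<bar> * nd z \<le> nd (z / sqrt 2)"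
    unfolding e using nd_pos[of "z / sqrt 2"] by (simp add: mult.left_commute mult_left_le)
qed

text \<open>The density \<open>nd (z / sqrt 2)\<close> has total mass \<open>sqrt 2\<close>, and its
  width turns scale \<open>s\<close> into \<open>sqrt 2 * s\<close>.\<close>

lemma tr_gauss_wide: "(LINT z|lborel. nd (z / sqrt 2) * tr J \<omega> a (y + sqrt 2 * s * z))
    = sqrt 2 * tr J \<omega> (\<lambda>j. of_real (exp (- (sqrt 2 * s * \<omega> j)\<^sup>2)) * a j) y"
proof -
  have "(LINT z|lborel. nd (z / sqrt 2) * tr J \<omega> a (y + sqrt 2 * s * z))
    = \<bar>sqrt 2\<bar> *\<^sub>R (LINT w|lborel. nd ((0 + sqrt 2 * w) / sqrt 2) * tr J \<omega> a (y + sqrt 2 * s * (0 + sqrt 2 * w)))"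
    by (rule lborel_integral_real_affine) simp
  also have "\<dots> = sqrt 2 * (LINT w|lborel. nd w * tr J \<omega> a (y + sqrt 2 * (sqrt 2 * s) * w))" by (simp add: mult_ac)
  finally show ?thesis by (simp only: tr_gauss)
qed

lemma tr_gauss_double:
  assumes "\<And>y. 0 \<le> tr J \<omega> a y"
  shows "tr J \<omega> (\<lambda>j. of_real (exp (- (s * \<omega> j)\<^sup>2)) * a j) y \<le> sqrt 2 * tr J \<omega> (\<lambda>j. of_real (exp (- (sqrt 2 * s * \<omega> j)\<^sup>2)) * a j) y"
  unfolding tr_gauss_wide[symmetric] tr_gauss[of J \<omega> s]
  using assms by (intro integral_mono tr_nd_integrable mult_right_mono nd_compare)

lemma tr_gauss_deriv_bound:
  assumes "\<And>y. 0 \<le> tr J \<omega> a y" "0 < s"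
  shows "\<bar>tr J \<omega> (\<lambda>j. \<i> * of_real (\<omega> j) * (of_real (exp (- (s * \<omega> j)\<^sup>2)) * a j)) y\<bar> \<le> 1 / s * tr J \<omega> (\<lambda>j. of_real (exp (- (sqrt 2 * s * \<omega> j)\<^sup>2)) * a j) y"
proof -
  have "\<bar>LINT z|lborel. nd z * (z * tr J \<omega> a (y + sqrt 2 * s * z))\<bar> \<le> (LINT z|lborel. \<bar>nd z * (z * tr J \<omega> a (y + sqrt 2 * s * z))\<bar>)"
    by (rule integral_abs_bound)
  also have "\<dots> \<le> (LINT z|lborel. nd (z / sqrt 2) * tr J \<omega> a (y + sqrt 2 * s * z))"
  proof (rule integral_mono)
    fix z
    have "\<bar>nd z * (z * tr J \<omega> a (y + sqrt 2 * s * z))\<bar> = (\<bar>z\<bar> * nd z) * tr J \<omega> a (y + sqrt 2 * s * z)"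
      using assms(1)[of "y + sqrt 2 * s * z"] nd_pos[of z] by (simp add: abs_mult)
    also have "\<dots> \<le> nd (z / sqrt 2) * tr J \<omega> a (y + sqrt 2 * s * z)" by (intro mult_right_mono nd_compare assms)
    finally show "\<bar>nd z * (z * tr J \<omega> a (y + sqrt 2 * s * z))\<bar> \<le> nd (z / sqrt 2) * tr J \<omega> a (y + sqrt 2 * s * z)" .
  qed (intro integrable_abs tr_nd_integrable)+
  finally have "\<bar>LINT z|lborel. nd z * (z * tr J \<omega> a (y + sqrt 2 * s * z))\<bar> \<le> sqrt 2 * tr J \<omega> (\<lambda>j. of_real (exp (- (sqrt 2 * s * \<omega> j)\<^sup>2)) * a j) y"
    unfolding tr_gauss_wide .
  then have "1 / (sqrt 2 * s) * \<bar>LINT z|lborel. nd z * (z * tr J \<omega> a (y + sqrt 2 * s * z))\<bar>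
     \<le> 1 / (sqrt 2 * s) * (sqrt 2 * tr J \<omega> (\<lambda>j. of_real (exp (- (sqrt 2 * s * \<omega> j)\<^sup>2)) * a j) y)"
    using assms(2) by (intro mult_left_mono) auto
  also have "\<dots> = 1 / s * tr J \<omega> (\<lambda>j. of_real (exp (- (sqrt 2 * s * \<omega> j)\<^sup>2)) * a j) y" using assms(2) by simp
  finally show ?thesis
    unfolding tr_gauss_deriv[OF assms(2)] abs_mult using assms(2) by simp
qed

text \<open>The kernel of the derivative is odd, so the value at the centre can be subtracted for
  free; the Hoelder bound then meets the moment of |z|^(1 + \<alpha>), which is at most that of 1 +
  z^2.\<close>

lemma tr_gauss_deriv_holder:
  assumes h: "\<And>y z. \<bar>tr J \<omega> a z - tr J \<omega> a y\<bar> \<le> B * \<bar>z - y\<bar> powr \<alpha>" and s: "0 < s" and al: "0 < \<alpha>" "\<alpha> \<le> 1"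
  shows "\<bar>tr J \<omega> (\<lambda>j. \<i> * of_real (\<omega> j) * (of_real (exp (- (s * \<omega> j)\<^sup>2)) * a j)) y\<bar> \<le> 2 * B * s powr (\<alpha> - 1)"
proof -
  define r where "r = sqrt 2 * s"
  have r: "0 < r" "s \<le> r" using s by (auto simp: r_def)
  have B: "0 \<le> B" using h[of 1 0] by simp
  have z0: "(LINT z|lborel. nd z * z) = 0" using integral_std_normal_moment_odd[of 0] by simp
  have iz: "integrable lborel (\<lambda>z. nd z * z)" using integrable_std_normal_moment[of 1] by simp
  have iz': "integrable lborel (\<lambda>z. nd z * (z * tr J \<omega> a y))"
    using integrable_mult_left[OF iz, of "tr J \<omega> a y"] by (simp add: mult.assoc)
  have zK: "(LINT z|lborel. nd z * (z * tr J \<omega> a y)) = 0"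
    unfolding mult.assoc[symmetric] integral_mult_left_zero z0 by simp
  have e: "(LINT z|lborel. nd z * (z * tr J \<omega> a (y + r * z))) = (LINT z|lborel. nd z * (z * tr J \<omega> a (y + r * z)) - nd z * (z * tr J \<omega> a y))"
    unfolding Bochner_Integration.integral_diff[OF tr_nd_integrable(2) iz'] zK by (rule diff_zero[symmetric])
  have "\<bar>LINT z|lborel. nd z * (z * tr J \<omega> a (y + r * z))\<bar> \<le> (LINT z|lborel. \<bar>nd z * (z * tr J \<omega> a (y + r * z)) - nd z * (z * tr J \<omega> a y)\<bar>)"
    unfolding e by (rule integral_abs_bound)
  also have "\<dots> \<le> (LINT z|lborel. B * r powr \<alpha> * (nd z + nd z * z^2))"
  proof (rule integral_mono)
    fix z :: real
    have "\<bar>nd z * (z * tr J \<omega> a (y + r * z)) - nd z * (z * tr J \<omega> a y)\<bar> = nd z * (\<bar>z\<bar> * \<bar>tr J \<omega> a (y + r * z) - tr J \<omega> a y\<bar>)"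
      using nd_pos[of z] by (simp add: abs_mult flip: right_diff_distrib)
    also have "\<dots> \<le> nd z * (\<bar>z\<bar> * (B * \<bar>r * z\<bar> powr \<alpha>))"
      using h[of "y + r * z" y] nd_pos[of z] by (intro mult_left_mono) auto
    also have "\<dots> = B * r powr \<alpha> * (nd z * (\<bar>z\<bar> * \<bar>z\<bar> powr \<alpha>))" using r by (simp add: abs_mult powr_mult mult_ac)
    also have "\<bar>z\<bar> * \<bar>z\<bar> powr \<alpha> \<le> 1 + z^2"
    proof (cases "\<bar>z\<bar> \<le> 1")
      case True
      then have "\<bar>z\<bar> powr \<alpha> \<le> 1" using al by (intro powr_le1) auto
      then have "\<bar>z\<bar> * \<bar>z\<bar> powr \<alpha> \<le> 1 * 1" using True by (intro mult_mono) auto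
      then show ?thesis using zero_le_power2[of z] by linarith
    next
      case False
      then have "\<bar>z\<bar> powr \<alpha> \<le> \<bar>z\<bar> powr 1" using al by (intro powr_mono) auto
      then have "\<bar>z\<bar> * \<bar>z\<bar> powr \<alpha> \<le> \<bar>z\<bar> * \<bar>z\<bar>" using False by (intro mult_left_mono) auto
      then show ?thesis by (simp add: power2_eq_square flip: abs_mult)
    qed
    finally show "\<bar>nd z * (z * tr J \<omega> a (y + r * z)) - nd z * (z * tr J \<omega> a y)\<bar> \<le> B * r powr \<alpha> * (nd z + nd z * z^2)"
      using B nd_pos[of z] by (simp add: mult_left_mono distrib_left)
  qed (intro integrable_abs Bochner_Integration.integrable_diff Bochner_Integration.integrable_add integrable_mult_right
      tr_nd_integrable(2) iz' nd_integrable integrable_std_normal_moment[of 2])+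
  also have "\<dots> = 2 * B * r powr \<alpha>"
    using nd_integrable integrable_std_normal_moment[of 2] by (simp add: integral_nd integral_nd_square)
  finally have "1 / r * \<bar>LINT z|lborel. nd z * (z * tr J \<omega> a (y + r * z))\<bar> \<le> 1 / r * (2 * B * r powr \<alpha>)"
    using r by (intro mult_left_mono) auto
  also have "\<dots> = 2 * B * r powr (\<alpha> - 1)" using r by (simp add: powr_diff)
  also have "\<dots> \<le> 2 * B * s powr (\<alpha> - 1)" using r s al B by (intro mult_left_mono powr_mono2') auto
  finally show ?thesis
    unfolding tr_gauss_deriv[OF s] abs_mult r_def using s by simp
qed

section \<open>Gaussian averages in the plane; a Boolean selects the coordinate, \<open>True\<close>
  the first\<close>

definition ax :: "bool \<Rightarrow> 'a \<times> 'a \<Rightarrow> 'a" where "ax p x = (if p then fst x else snd x)"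
definition ks :: "bool \<Rightarrow> int \<times> int \<Rightarrow> real" where "ks p k = of_int (ax p k)"
definition place :: "bool \<Rightarrow> 'a \<times> 'a \<Rightarrow> 'a \<Rightarrow> 'a \<times> 'a" where "place p x y = (if p then (y, snd x) else (fst x, y))"
definition h1 :: "bool \<Rightarrow> real \<Rightarrow> coef \<Rightarrow> coef" where
  "h1 p s c k = of_real (exp (- (s * ks p k)\<^sup>2)) * c k"
definition dd :: "bool \<Rightarrow> coef \<Rightarrow> coef" where
  "dd p c k = \<i> * of_real (ks p k) * c k"
definition hc :: "real \<Rightarrow> coef \<Rightarrow> coef" where
  "hc s c k = of_real (exp (- (s * kabs k)\<^sup>2)) * c k"
definition sh :: "real \<times> real \<Rightarrow> coef \<Rightarrow> coef" where
  "sh h c k = c k * (E k h - 1)"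

lemma ks_0 [simp]: "ks p 0 = 0" by (simp add: ks_def ax_def)
lemma abs_ks: "\<bar>ks p k\<bar> \<le> kabs k" unfolding ks_def ax_def using fst_le_kabs[of k] by auto
lemma ks_squares: "(kabs k)^2 = (ks p k)^2 + (ks (\<not> p) k)^2"
  unfolding kabs_squared ks_def ax_def by auto

text \<open>The Gaussian of |k| factors over the coordinates, which reduces the plane to two
  applications of the one-dimensional results.\<close>

lemma hc_h1: "hc s c = h1 p s (h1 (\<not> p) s c)"
proof
  fix k
  have "exp (- (s * kabs k)\<^sup>2) = exp (- (s * ks p k)\<^sup>2) * exp (- (s * ks (\<not> p) k)\<^sup>2)"
    unfolding power_mult_distrib ks_squares[of k p] by (simp add: algebra_simps flip: exp_add)
  then show "hc s c k = h1 p s (h1 (\<not> p) s c) k" unfolding hc_def h1_def by (simp only: of_real_mult mult.assoc)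
qed

lemma h1_commute: "h1 p s (h1 q r c) = h1 q r (h1 p s c)"
  unfolding h1_def by (simp only: mult.left_commute)
lemma dd_hc: "dd p (hc s c) = hc s (dd p c)"
  unfolding hc_def dd_def by (simp only: mult_ac)
lemma dd_sh: "dd p (sh h c) = sh h (dd p c)"
  unfolding sh_def dd_def by (simp only: mult_ac)
lemma hc_sh: "hc s (sh h c) = sh h (hc s c)"
  unfolding sh_def hc_def by (simp only: mult_ac)
lemma h1_sh: "h1 p s (sh h c) = sh h (h1 p s c)"
  unfolding sh_def h1_def by (simp only: mult_ac)
lemma dd_dd: "dd p (dd q c) = dd q (dd p c)"
  unfolding dd_def by (simp only: mult_ac)
lemma hc_hc: "hc (s / sqrt 2) (hc (s / sqrt 2) c) = hc s c"
proof
  fix k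
  have "exp (- (s / sqrt 2 * kabs k)\<^sup>2) * exp (- (s / sqrt 2 * kabs k)\<^sup>2) = exp (- (s * kabs k)\<^sup>2)"
    unfolding power_mult_distrib power_divide by (simp add: algebra_simps flip: exp_add)
  then show "hc (s / sqrt 2) (hc (s / sqrt 2) c) k = hc s c k"
    unfolding hc_def by (simp only: mult.assoc[symmetric] of_real_mult[symmetric])
qed

lemma tp_cong: "(\<And>k. k \<in> F \<Longrightarrow> b k = c k) \<Longrightarrow> tp F b x = tp F c x"
  unfolding tp_def by simp
lemma tp_uminus: "tp F (\<lambda>k. - c k) x = - tp F c x"
  unfolding tp_def by (simp add: sum_negf)
lemma tp_add: "tp F (\<lambda>k. b k + c k) x = tp F b x + tp F c x"
  unfolding tp_def by (simp add: sum.distrib distrib_right)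
lemma tp_diff: "tp F (\<lambda>k. b k - c k) x = tp F b x - tp F c x"
  unfolding tp_def by (simp add: sum_subtractf left_diff_distrib)
lemma tp_scale: "tp F (\<lambda>k. of_real r * c k) x = r * tp F c x"
  unfolding tp_def by (simp add: sum_distrib_left mult.assoc)
lemma tp_sh: "tp F (sh h c) x = tp F c (x + h) - tp F c x"
proof -
  have "(\<Sum>k\<in>F. sh h c k * E k x) = (\<Sum>k\<in>F. c k * E k (x + h)) - (\<Sum>k\<in>F. c k * E k x)"
    unfolding sum_subtractf[symmetric] by (intro sum.cong refl) (simp add: sh_def E_shift algebra_simps)
  then show ?thesis unfolding tp_def by simp
qed

lemma tp_bound: "\<bar>tp F c x\<bar> \<le> (\<Sum>k\<in>F. cmod (c k))"
proof -
  have "\<bar>tp F c x\<bar> \<le> cmod (\<Sum>k\<in>F. c k * E k x)" unfolding tp_def by (rule abs_Re_le_cmod)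
  also have "\<dots> \<le> (\<Sum>k\<in>F. cmod (c k))" by (rule order_trans[OF norm_sum]) (simp add: norm_mult)
  finally show ?thesis .
qed

lemma tp_place: "tp F c (place p x y) = tr F (ks p) (\<lambda>k. c k * cis (ks (\<not> p) k * ax (\<not> p) x)) y"
  unfolding tp_def tr_def E_def place_def ks_def ax_def
  by (cases p) (simp_all add: cis_mult mult.assoc add.commute)
lemma place_self: "place p x (ax p x) = x" by (simp add: place_def ax_def)
lemma tp_tr: "tp F c x = tr F (ks p) (\<lambda>k. c k * cis (ks (\<not> p) k * ax (\<not> p) x)) (ax p x)"
  unfolding tp_place[symmetric] place_self ..
lemma tp_tr_h1: "tp F (h1 p s c) x = tr F (ks p) (\<lambda>k. of_real (exp (- (s * ks p k)\<^sup>2)) * (c k * cis (ks (\<not> p) k * ax (\<not> p) x))) (ax p x)"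
  unfolding tp_tr[of F _ x p] h1_def by (simp only: mult.assoc)
lemma tp_tr_dd_h1: "tp F (dd p (h1 p s c)) x = tr F (ks p) (\<lambda>k. \<i> * of_real (ks p k) * (of_real (exp (- (s * ks p k)\<^sup>2)) * (c k * cis (ks (\<not> p) k * ax (\<not> p) x)))) (ax p x)"
  unfolding tp_tr[of F _ x p] dd_def h1_def by (simp only: mult.assoc)

lemma h1_nonneg: "(\<And>x. 0 \<le> tp F c x) \<Longrightarrow> 0 \<le> tp F (h1 p s c) x"
  unfolding tp_tr_h1 by (rule tr_gauss_nonneg) (simp flip: tp_place)
lemma h1_double: "(\<And>x. 0 \<le> tp F c x) \<Longrightarrow> tp F (h1 p s c) x \<le> sqrt 2 * tp F (h1 p (sqrt 2 * s) c) x"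
  unfolding tp_tr_h1 by (rule tr_gauss_double) (simp flip: tp_place)
lemma h1_deriv: "(\<And>x. 0 \<le> tp F c x) \<Longrightarrow> 0 < s \<Longrightarrow> \<bar>tp F (dd p (h1 p s c)) x\<bar> \<le> 1 / s * tp F (h1 p (sqrt 2 * s) c) x"
  unfolding tp_tr_h1 tp_tr_dd_h1 by (rule tr_gauss_deriv_bound) (simp_all flip: tp_place)

text \<open>The derivative bound in direction \<open>p\<close> widens that factor from
  \<open>s\<close> to \<open>sqrt 2 * s\<close>; the other factor is widened too, at the cost of
  \<open>sqrt 2\<close>, so that a full Gaussian stands on the right.\<close>

lemma hc_nonneg:
  assumes "\<And>x. 0 \<le> tp F c x"
  shows "0 \<le> tp F (hc s c) x" "0 < s \<Longrightarrow> \<bar>tp F (dd p (hc s c)) x\<bar> \<le> sqrt 2 / s * tp F (hc (sqrt 2 * s) c) x"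
proof -
  show "0 \<le> tp F (hc s c) x" unfolding hc_h1[of s c True] by (intro h1_nonneg assms)
  assume s: "0 < s"
  have "\<bar>tp F (dd p (hc s c)) x\<bar> \<le> 1 / s * tp F (h1 p (sqrt 2 * s) (h1 (\<not> p) s c)) x"
    unfolding hc_h1[of s c p] by (rule h1_deriv[OF h1_nonneg[OF assms] s])
  also have "h1 p (sqrt 2 * s) (h1 (\<not> p) s c) = h1 (\<not> p) s (h1 p (sqrt 2 * s) c)" by (rule h1_commute)
  also have "1 / s * tp F (h1 (\<not> p) s (h1 p (sqrt 2 * s) c)) x \<le> 1 / s * (sqrt 2 * tp F (h1 (\<not> p) (sqrt 2 * s) (h1 p (sqrt 2 * s) c)) x)"
    using s by (intro mult_left_mono h1_double h1_nonneg assms) auto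
  also have "\<dots> = sqrt 2 / s * tp F (hc (sqrt 2 * s) c) x"
    unfolding hc_h1[of "sqrt 2 * s" c p] h1_commute[of p] by simp
  finally show "\<bar>tp F (dd p (hc s c)) x\<bar> \<le> sqrt 2 / s * tp F (hc (sqrt 2 * s) c) x" .
qed

text \<open>Encodes the function V - w as one more coefficient family, with \<open>V\<close> at
  frequency 0, so that the positivity lemmas, which hold for any frequency set, apply to it.\<close>

lemma tp_const:
  assumes "finite F" "0 \<notin> F"
  shows "tp (insert 0 F) ((\<lambda>k. - c k)(0 := of_real V)) x = V - tp F c x"
proof -
  have "tp (insert 0 F) ((\<lambda>k. - c k)(0 := of_real V)) x = V + tp F ((\<lambda>k. - c k)(0 := of_real V)) x"
    unfolding tp_def using assms by simp
  also have "tp F ((\<lambda>k. - c k)(0 := of_real V)) x = tp F (\<lambda>k. - c k) x"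
    using assms by (intro tp_cong) auto
  finally show ?thesis by (simp only: tp_uminus diff_conv_add_uminus)
qed

text \<open>Positivity for V - w: the average fixes the constant \<open>V\<close> and the derivative
  kills it.\<close>

lemma hc_upper:
  assumes F: "finite F" "0 \<notin> F" and le: "\<And>x. tp F c x \<le> V"
  shows "tp F (hc s c) x \<le> V" "0 < s \<Longrightarrow> \<bar>tp F (dd p (hc s c)) x\<bar> \<le> sqrt 2 / s * (V - tp F (hc (sqrt 2 * s) c) x)"
proof -
  let ?b = "(\<lambda>k. - c k)(0 := of_real V)"
  have nn: "0 \<le> tp (insert 0 F) ?b y" for y unfolding tp_const[OF F] using le[of y] by simp
  have h: "hc s ?b = (\<lambda>k. - hc s c k)(0 := of_real V)" for s
    by (rule ext) (simp add: hc_def)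
  have d: "dd p (hc s ?b) = (\<lambda>k. - dd p (hc s c) k)(0 := of_real 0)" for s
    by (rule ext) (simp add: hc_def dd_def)
  show "tp F (hc s c) x \<le> V" using hc_nonneg(1)[OF nn, of s x] unfolding h tp_const[OF F] by simp
  show "0 < s \<Longrightarrow> \<bar>tp F (dd p (hc s c)) x\<bar> \<le> sqrt 2 / s * (V - tp F (hc (sqrt 2 * s) c) x)"
    using hc_nonneg(2)[OF nn, of s p x] unfolding d unfolding h tp_const[OF F] by simp
qed

text \<open>Applying \<open>hc_upper\<close> to \<open>c\<close> and to its negative gives the sup
  bound, and V - w \<le> 2 M together with \<open>sqrt 2 * 2 \<le> 3\<close> gives the first
  derivative.\<close>

lemma hc_abs:
  assumes F: "finite F" "0 \<notin> F" and le: "\<And>x. \<bar>tp F c x\<bar> \<le> M"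
  shows "\<bar>tp F (hc s c) x\<bar> \<le> M" "0 < s \<Longrightarrow> \<bar>tp F (dd p (hc s c)) x\<bar> \<le> 3 * M / s"
    "0 < s \<Longrightarrow> \<bar>tp F (dd q (dd p (hc s c))) x\<bar> \<le> 18 * M / s^2"
proof -
  have u: "tp F c x \<le> M" "tp F (\<lambda>k. - c k) x \<le> M" for x using le[of x] by (simp_all add: tp_uminus)
  have n: "hc s (\<lambda>k. - c k) = (\<lambda>k. - hc s c k)" for s by (rule ext) (simp add: hc_def)
  have M: "0 \<le> M" using le[of 0] by linarith
  show a: "\<bar>tp F (hc s c) x\<bar> \<le> M" for s x
    using hc_upper(1)[OF F u(1), of s x] hc_upper(1)[OF F u(2), of s x] by (simp add: n tp_uminus)
  have b: "\<bar>tp G (dd p (hc s b)) x\<bar> \<le> sqrt 2 * 2 * M' / s"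
    if G: "finite G" "0 \<notin> G" and le: "\<And>x. tp G b x \<le> M'" and a: "\<And>s x. \<bar>tp G (hc s b) x\<bar> \<le> M'" and s: "0 < s" for G b s x p M'
  proof -
    have "\<bar>tp G (dd p (hc s b)) x\<bar> \<le> sqrt 2 / s * (M' - tp G (hc (sqrt 2 * s) b) x)"
      using hc_upper(2)[OF G le s] .
    also have "\<dots> \<le> sqrt 2 / s * (2 * M')"
      using s a[of "sqrt 2 * s" x] by (intro mult_left_mono) auto
    finally show ?thesis by simp
  qed
  have q: "sqrt 2 * 2 \<le> (3::real)" by (rule power2_le_imp_le) (simp_all add: power_mult_distrib)
  have q': "sqrt 2 * 2 * M \<le> 3 * M" using q M by (rule mult_right_mono)
  show "0 < s \<Longrightarrow> \<bar>tp F (dd p (hc s c)) x\<bar> \<le> 3 * M / s"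
    using b[OF F u(1) a, of s p x] q' by (meson divide_right_mono less_imp_le order_trans)
  assume s: "0 < s"
  \<comment> \<open>Two averages of scale \<open>s / sqrt 2\<close> compose to one of scale
    \<open>s\<close>, so each can carry one derivative: 3 times 3 over r^2 is 18 over s^2.\<close>
  define r where "r = s / sqrt 2"
  have r: "0 < r" and r2: "s^2 = 2 * r^2" using s by (auto simp: r_def power_divide)
  define M' where "M' = 3 * M / r"
  have b': "\<bar>tp F (dd p (hc r c)) x\<bar> \<le> M'" for x unfolding M'_def
    using b[OF F u(1) a, of r p x] q' r by (meson divide_right_mono less_imp_le order_trans)
  have M': "0 \<le> M'" using M r by (simp add: M'_def)
  have a': "\<bar>tp F (hc t (dd p (hc r c))) x\<bar> \<le> M'" for t x
  proof -
    have "tp F (dd p (hc r c)) x \<le> M'" "tp F (\<lambda>k. - dd p (hc r c) k) x \<le> M'" for x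
      using b'[of x] by (simp_all add: tp_uminus)
    note w = this
    have n: "hc t (\<lambda>k. - dd p (hc r c) k) = (\<lambda>k. - hc t (dd p (hc r c)) k)" by (rule ext) (simp add: hc_def)
    show ?thesis using hc_upper(1)[OF F w(1), of t x] hc_upper(1)[OF F w(2), of t x] by (simp add: n tp_uminus)
  qed
  have "\<bar>tp F (dd q (hc r (dd p (hc r c)))) x\<bar> \<le> sqrt 2 * 2 * M' / r"
    using b[OF F _ a' r] b' by (meson abs_le_D1)
  also have "\<dots> \<le> 3 * M' / r" using mult_right_mono[OF q M'] r by (intro divide_right_mono) auto
  also have "\<dots> = 18 * M / s^2" unfolding M'_def r2 using r by (simp add: field_simps power2_eq_square)
  also have "dd q (hc r (dd p (hc r c))) = dd q (dd p (hc s c))"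
    unfolding dd_hc[of p] r_def hc_hc ..
  finally show "\<bar>tp F (dd q (dd p (hc s c))) x\<bar> \<le> 18 * M / s^2" .
qed

lemma tp_has_derivative: "(tp F c has_derivative (\<lambda>h. fst h * tp F (dd True c) x + snd h * tp F (dd False c) x)) (at x)"
proof -
  have E: "((\<lambda>x. E k x) has_derivative (\<lambda>h. (fst h * ks True k + snd h * ks False k) *\<^sub>R (\<i> * E k x))) (at x)" for k
    unfolding E_def ks_def ax_def
    by (auto intro!: derivative_eq_intros simp: algebra_simps)
  have "((\<lambda>x. \<Sum>k\<in>F. c k * E k x) has_derivative (\<lambda>h. \<Sum>k\<in>F. c k * ((fst h * ks True k + snd h * ks False k) *\<^sub>R (\<i> * E k x)))) (at x)"
    by (intro has_derivative_sum has_derivative_mult_right E)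
  from bounded_linear.has_derivative[OF bounded_linear_Re this]
  show ?thesis unfolding tp_def
    by (rule has_derivative_eq_rhs)
      (simp add: fun_eq_iff dd_def sum_distrib_left scaleR_conv_of_real algebra_simps flip: sum.distrib)
qed

lemma tp_deriv_line: "((\<lambda>s. tp F c (x + s *\<^sub>R h)) has_real_derivative fst h * tp F (dd True c) (x + s *\<^sub>R h) + snd h * tp F (dd False c) (x + s *\<^sub>R h)) (at s)"
proof -
  have "((\<lambda>s. x + s *\<^sub>R h) has_derivative (\<lambda>r. r *\<^sub>R h)) (at s)" by (auto intro!: derivative_eq_intros)
  from has_derivative_compose[OF this tp_has_derivative] show ?thesis
    unfolding has_field_derivative_def by (rule has_derivative_eq_rhs) (auto simp: fun_eq_iff algebra_simps)
qed

lemma tp_mean_value: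
  assumes "\<And>p y. \<bar>tp F (dd p c) y\<bar> \<le> L" shows "\<bar>tp F (sh h c) x\<bar> \<le> 2 * L * norm h"
proof -
  have "\<exists>z::real. z > 0 \<and> z < 1 \<and> tp F c (x + 1 *\<^sub>R h) - tp F c (x + 0 *\<^sub>R h) = (1 - 0) * (fst h * tp F (dd True c) (x + z *\<^sub>R h) + snd h * tp F (dd False c) (x + z *\<^sub>R h))"
    by (rule MVT2) (auto intro: tp_deriv_line)
  then obtain z where "tp F (sh h c) x = fst h * tp F (dd True c) (x + z *\<^sub>R h) + snd h * tp F (dd False c) (x + z *\<^sub>R h)"
    unfolding tp_sh by auto
  then have "\<bar>tp F (sh h c) x\<bar> \<le> \<bar>fst h\<bar> * \<bar>tp F (dd True c) (x + z *\<^sub>R h)\<bar> + \<bar>snd h\<bar> * \<bar>tp F (dd False c) (x + z *\<^sub>R h)\<bar>"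
    unfolding abs_mult[symmetric] by linarith
  also have "\<dots> \<le> norm h * L + norm h * L"
    using norm_fst_le[of "fst h" "snd h"] norm_snd_le[of "snd h" "fst h"] by (intro add_mono mult_mono assms) auto
  finally show ?thesis by simp
qed

lemma hc_shift_bounds:
  assumes F: "finite F" "0 \<notin> F" and le: "\<And>x. \<bar>tp F c x\<bar> \<le> M" and s: "0 < s"
  shows "\<bar>tp F (hc s (sh h c)) x\<bar> \<le> 6 * M * norm h / s" "\<bar>tp F (dd p (hc s (sh h c))) x\<bar> \<le> 36 * M * norm h / s^2"
proof -
  show "\<bar>tp F (hc s (sh h c)) x\<bar> \<le> 6 * M * norm h / s" unfolding hc_sh
    using tp_mean_value[OF hc_abs(2)[OF F le s]] by simp
  show "\<bar>tp F (dd p (hc s (sh h c))) x\<bar> \<le> 36 * M * norm h / s^2" unfolding hc_sh dd_sh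
    using tp_mean_value[OF hc_abs(3)[OF F le s]] by simp
qed

text \<open>Averaging in the other coordinate does not enlarge the Hoelder constant, by positivity
  applied to increments; what remains is the one-dimensional bound along direction
  \<open>p\<close>.\<close>

lemma hc_holder:
  assumes F: "finite F" "0 \<notin> F" and h: "\<And>x h. \<bar>tp F (sh h c) x\<bar> \<le> B * norm h powr \<alpha>" and s: "0 < s" and al: "0 < \<alpha>" "\<alpha> \<le> 1"
  shows "\<bar>tp F (dd p (hc s c)) x\<bar> \<le> 2 * B * s powr (\<alpha> - 1)"
proof -
  define b where "b = h1 (\<not> p) s c"
  have hb: "\<bar>tp F (sh h b) x\<bar> \<le> B * norm h powr \<alpha>" for x h
  proof -
    have u: "tp F (sh h c) x \<le> B * norm h powr \<alpha>" "tp F (\<lambda>k. - sh h c k) x \<le> B * norm h powr \<alpha>" for x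
      using h[of h x] by (simp_all add: tp_uminus)
    have 1: "tp F (h1 q s c') x \<le> V" if le: "\<And>x. tp F c' x \<le> V" for c' V q
    proof -
      let ?b = "(\<lambda>k. - c' k)(0 := of_real V)"
      have "0 \<le> tp (insert 0 F) (h1 q s ?b) x" by (rule h1_nonneg) (simp add: tp_const[OF F] le)
      also have "h1 q s ?b = (\<lambda>k. - h1 q s c' k)(0 := of_real V)" by (rule ext) (simp add: h1_def)
      finally show ?thesis unfolding tp_const[OF F] by simp
    qed
    have n: "h1 q s (\<lambda>k. - sh h c k) = (\<lambda>k. - h1 q s (sh h c) k)" for q by (rule ext) (simp add: h1_def)
    show ?thesis unfolding b_def h1_sh[symmetric] using 1[OF u(1), of "\<not> p"] 1[OF u(2), of "\<not> p"] by (simp add: n tp_uminus)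
  qed
  have d: "place p x z - place p x y = (if p then (z - y, 0) else (0, z - y))" for y z by (simp add: place_def)
  have n: "norm (place p x z - place p x y) = \<bar>z - y\<bar>" for y z unfolding d by (simp add: norm_Pair)
  have "\<bar>tr F (ks p) (\<lambda>k. b k * cis (ks (\<not> p) k * ax (\<not> p) x)) z - tr F (ks p) (\<lambda>k. b k * cis (ks (\<not> p) k * ax (\<not> p) x)) y\<bar> \<le> B * \<bar>z - y\<bar> powr \<alpha>" for y z
    using hb[of "place p x z - place p x y" "place p x y"] unfolding tp_sh n tp_place[symmetric] by simp
  from tr_gauss_deriv_holder[OF this s al, of "ax p x"] show ?thesis
    unfolding hc_h1[of s c p] b_def[symmetric] tp_tr_dd_h1 .
qed

section \<open>Powers of \<Lambda> as superpositions over scales\<close>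

abbreviation pos_ind :: "real \<Rightarrow> real" where "pos_ind \<equiv> indicator {0<..}"

lemma pos_ind_scale: "0 < r \<Longrightarrow> pos_ind (r * s) = pos_ind s"
  by (auto simp: indicator_def zero_less_mult_iff)

lemma has_bochner_integral_scale:
  fixes g :: "real \<Rightarrow> real"
  assumes "has_bochner_integral lborel (\<lambda>s. pos_ind s * g s) I" "0 < r"
  shows "has_bochner_integral lborel (\<lambda>s. pos_ind s * g (r * s)) (I / r)"
  using lborel_has_bochner_integral_real_affine_iff[of r "\<lambda>s. pos_ind s * g s" I 0] assms
  by (simp add: pos_ind_scale divide_inverse_commute)

lemma gauss_half: "has_bochner_integral lborel (\<lambda>s. pos_ind s * exp (- s\<^sup>2)) (sqrt pi / 2)"
proof -
  have m: "(\<lambda>x::real. exp (- x\<^sup>2)) \<in> borel_measurable borel" by (intro borel_measurable_continuous_onI continuous_intros)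
  have "AE s in lborel. indicator {0..} s *\<^sub>R exp (- s\<^sup>2) = pos_ind s * exp (- s\<^sup>2)"
    using AE_lborel_singleton[of 0] by eventually_elim (auto simp: indicator_def)
  then show ?thesis using gaussian_moment_0 m
    by (subst (asm) has_bochner_integral_cong_AE[where g = "\<lambda>s. pos_ind s * exp (- s\<^sup>2)"]) measurable
qed

lemma gauss_scale: "0 < r \<Longrightarrow> has_bochner_integral lborel (\<lambda>s. pos_ind s * exp (- (s * r)\<^sup>2)) (sqrt pi / 2 / r)"
  using has_bochner_integral_scale[OF gauss_half, of r] by (simp add: mult.commute)

text \<open>The symbol at |k| = r obtained by integrating the Gaussian multipliers over the scales
  in \<open>S\<close>. For all positive scales it is 1/r up to a constant (\<open>mS_full\<close>),
  so subsets of scales split the inverse of \<Lambda>.\<close>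

definition mS :: "real set \<Rightarrow> real \<Rightarrow> real" where
  "mS S r = (LINT s|lborel. indicator S s * exp (- (s * r)\<^sup>2))"

lemma mS_integral:
  assumes "S \<subseteq> {0<..}" "S \<in> sets borel" "0 < r"
  shows "has_bochner_integral lborel (\<lambda>s. indicator S s * exp (- (s * r)\<^sup>2)) (mS S r)"
proof -
  have "integrable lborel (\<lambda>s. indicator S s *\<^sub>R (pos_ind s * exp (- (s * r)\<^sup>2)))"
    using gauss_scale[OF assms(3)] assms(2) by (intro integrable_mult_indicator) (auto simp: has_bochner_integral_iff)
  also have "(\<lambda>s. indicator S s *\<^sub>R (pos_ind s * exp (- (s * r)\<^sup>2))) = (\<lambda>s. indicator S s * exp (- (s * r)\<^sup>2))"
    using assms(1) by (auto simp: indicator_def fun_eq_iff)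
  finally show ?thesis unfolding mS_def by (rule has_bochner_integral_integrable)
qed

lemma mS_full: "0 < r \<Longrightarrow> mS {0<..} r = sqrt pi / 2 / r"
  using gauss_scale unfolding mS_def by (simp add: has_bochner_integral_iff)

lemma cauchy_integrable: "integrable lborel (\<lambda>s::real. pos_ind s * inverse (1 + s^2))"
  using integrable_mult_indicator[of "{0<..}" lborel "\<lambda>s::real. inverse (1 + s^2)"] integrable_inverse_1_plus_square
  by (simp add: set_integrable_def)

text \<open>Normalising constants of the comparison integral (\<open>cI\<close>) and of the
  representation of \<Lambda> (\<open>k0\<close>). Later arguments rely on their signs, not on their
  values.\<close>

definition cI :: real where "cI = (LINT s|lborel. pos_ind s * inverse (1 + s^2))"
definition k0 :: real where "k0 = (LINT s|lborel. pos_ind s * ((1 - exp (- s\<^sup>2)) / s^2))"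

lemma cI_nonneg: "0 \<le> cI" unfolding cI_def by (rule Bochner_Integration.integral_nonneg) simp

lemma cauchy_scale:
  assumes "0 < r" shows "has_bochner_integral lborel (\<lambda>s. pos_ind s * (1 / (r^2 + s^2))) (cI / r)"
proof -
  have "has_bochner_integral lborel (\<lambda>s. pos_ind s * inverse (1 + (1 / r * s)^2)) (cI / (1 / r))"
    using cauchy_integrable assms unfolding cI_def
    by (intro has_bochner_integral_scale has_bochner_integral_integrable) auto
  then have "has_bochner_integral lborel (\<lambda>s. (1 / r^2) * (pos_ind s * inverse (1 + (1 / r * s)^2))) ((1 / r^2) * (cI / (1 / r)))"
    by (rule has_bochner_integral_mult_right)
  also have "(\<lambda>s. (1 / r^2) * (pos_ind s * inverse (1 + (1 / r * s)^2))) = (\<lambda>s. pos_ind s * (1 / (r^2 + s^2)))"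
  proof
    fix s
    have "(1 / r^2) * inverse (1 + (1 / r * s)^2) = 1 / (r^2 * (1 + (1 / r * s)^2))" by (simp add: divide_inverse)
    also have "r^2 * (1 + (1 / r * s)^2) = r^2 + s^2" using assms by (simp add: power_divide algebra_simps)
    finally show "(1 / r^2) * (pos_ind s * inverse (1 + (1 / r * s)^2)) = pos_ind s * (1 / (r^2 + s^2))" by (simp add: mult.left_commute)
  qed
  also have "(1 / r^2) * (cI / (1 / r)) = cI / r" using assms by (simp add: power2_eq_square)
  finally show ?thesis .
qed

lemma k0_integrable: "integrable lborel (\<lambda>s::real. pos_ind s * ((1 - exp (- s\<^sup>2)) / s^2))"
proof (rule Bochner_Integration.integrable_bound)
  show "integrable lborel (\<lambda>s::real. 2 * (pos_ind s * inverse (1 + s^2)))"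
    by (intro integrable_mult_right cauchy_integrable)
  show "AE s in lborel. norm (pos_ind s * ((1 - exp (- s\<^sup>2)) / s^2)) \<le> norm (2 * (pos_ind s * inverse (1 + s^2)))"
  proof (intro AE_I2)
    fix s :: real
    have e: "0 \<le> 1 - exp (- s\<^sup>2)" "1 - exp (- s\<^sup>2) \<le> 1" "1 - exp (- s\<^sup>2) \<le> s^2" using exp_ge_add_one_self[of "- s\<^sup>2"] by auto
    then have "(1 - exp (- s\<^sup>2)) * (1 + s^2) \<le> 2 * s^2"
      using mult_right_mono[OF e(2), of "s^2"] unfolding distrib_left by simp
    then have "(1 - exp (- s\<^sup>2)) / s^2 \<le> 2 * inverse (1 + s^2)" if "s > 0"
      using that by (simp add: divide_simps add_pos_nonneg mult.commute)
    then show "norm (pos_ind s * ((1 - exp (- s\<^sup>2)) / s^2)) \<le> norm (2 * (pos_ind s * inverse (1 + s^2)))"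
      using e(1) by (auto simp: indicator_def)
  qed
qed measurable

lemma k0_pos: "0 < k0"
proof -
  let ?a = "(1 - exp (-1)) / 4 :: real"
  have "(LINT s|lborel. ?a * indicator {1..2::real} s) \<le> k0" unfolding k0_def
  proof (rule integral_mono[OF _ k0_integrable])
    fix s :: real
    show "?a * indicator {1..2} s \<le> pos_ind s * ((1 - exp (- s\<^sup>2)) / s^2)"
    proof (cases "s \<in> {1..2}")
      case True
      then have "1 \<le> s^2" "s^2 \<le> 4" using power_mono[of 1 s 2] power_mono[of s 2 2] by auto
      then have "?a \<le> (1 - exp (- s\<^sup>2)) / s^2" by (intro frac_le) auto
      then show ?thesis using True by (simp add: indicator_def)
    qed (auto simp: indicator_def)
  qed simp
  moreover have "(LINT s|lborel. ?a * indicator {1..2::real} s) = ?a" by simp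
  ultimately have "?a \<le> k0" by metis
  then show ?thesis by (rule less_le_trans[rotated]) simp
qed

lemma k0_scale:
  assumes "0 < r" shows "has_bochner_integral lborel (\<lambda>s. pos_ind s * ((1 - exp (- (s * r)\<^sup>2)) / s^2)) (r * k0)"
proof -
  have "has_bochner_integral lborel (\<lambda>s. pos_ind s * ((1 - exp (- (r * s)\<^sup>2)) / (r * s)^2)) (k0 / r)"
    using k0_integrable assms unfolding k0_def
    by (intro has_bochner_integral_scale[where g = "\<lambda>s. (1 - exp (- s\<^sup>2)) / s^2"] has_bochner_integral_integrable) auto
  then have "has_bochner_integral lborel (\<lambda>s. r^2 * (pos_ind s * ((1 - exp (- (r * s)\<^sup>2)) / (r * s)^2))) (r^2 * (k0 / r))"
    by (rule has_bochner_integral_mult_right)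
  moreover have "(\<lambda>s. r^2 * (pos_ind s * ((1 - exp (- (r * s)\<^sup>2)) / (r * s)^2))) = (\<lambda>s. pos_ind s * ((1 - exp (- (s * r)\<^sup>2)) / s^2))"
    using assms by (simp add: fun_eq_iff power_mult_distrib mult.commute)
  ultimately show ?thesis using assms by (simp add: power2_eq_square)
qed

lemma tp_hc: "tp F (hc s b) x = (\<Sum>k\<in>F. exp (- (s * kabs k)\<^sup>2) * Re (b k * E k x))"
  unfolding tp_def hc_def Re_sum by (intro sum.cong refl) (simp only: mult.assoc Re_of_real_mult)

lemma tp_hc_integral:
  assumes "0 \<notin> F" "S \<subseteq> {0<..}" "S \<in> sets borel"
  shows "has_bochner_integral lborel (\<lambda>s. indicator S s * tp F (hc s b) x) (tp F (\<lambda>k. of_real (mS S (kabs k)) * b k) x)"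
proof -
  have "has_bochner_integral lborel (\<lambda>s. \<Sum>k\<in>F. Re (b k * E k x) * (indicator S s * exp (- (s * kabs k)\<^sup>2))) (\<Sum>k\<in>F. Re (b k * E k x) * mS S (kabs k))"
    using assms by (intro has_bochner_integral_sum has_bochner_integral_mult_right mS_integral kabs_pos) auto
  moreover have "(\<Sum>k\<in>F. Re (b k * E k x) * mS S (kabs k)) = tp F (\<lambda>k. of_real (mS S (kabs k)) * b k) x"
    unfolding tp_def Re_sum by (intro sum.cong refl) (simp only: mult.assoc Re_of_real_mult mult.commute[of "mS S _"])
  moreover have "(\<lambda>s. \<Sum>k\<in>F. Re (b k * E k x) * (indicator S s * exp (- (s * kabs k)\<^sup>2))) = (\<lambda>s. indicator S s * tp F (hc s b) x)"
    unfolding tp_hc sum_distrib_left by (intro ext sum.cong refl) (simp only: mult_ac)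
  ultimately show ?thesis by simp
qed

definition lam :: "coef \<Rightarrow> coef" where "lam c k = of_real (kabs k) * c k"
definition rz :: "bool \<Rightarrow> coef \<Rightarrow> coef" where
  "rz p c k = of_real (1 / kabs k) * dd p c k"

text \<open>The dilation \<open>r\<close> is there for the value \<open>sqrt 2\<close>, because
  \<open>hc_upper\<close> bounds the gradient at scale \<open>s\<close> by the average at scale
  \<open>sqrt 2 * s\<close>.\<close>

lemma lam_integral:
  assumes "0 \<notin> F" "0 < r"
  shows "has_bochner_integral lborel (\<lambda>s. pos_ind s * ((tp F c x - tp F (hc (r * s) c) x) / s^2)) (r * k0 * tp F (lam c) x)"
proof -
  have "has_bochner_integral lborel (\<lambda>s. \<Sum>k\<in>F. Re (c k * E k x) * (pos_ind s * ((1 - exp (- (s * (r * kabs k))\<^sup>2)) / s^2))) (\<Sum>k\<in>F. Re (c k * E k x) * (r * kabs k * k0))"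
    using assms by (intro has_bochner_integral_sum has_bochner_integral_mult_right k0_scale mult_pos_pos kabs_pos) auto
  moreover have "(\<Sum>k\<in>F. Re (c k * E k x) * (r * kabs k * k0)) = r * k0 * tp F (lam c) x"
    unfolding tp_def lam_def Re_sum sum_distrib_left by (intro sum.cong refl) (simp only: mult.assoc Re_of_real_mult, simp)
  moreover have "(\<Sum>k\<in>F. Re (c k * E k x) * (pos_ind s * ((1 - exp (- (s * (r * kabs k))\<^sup>2)) / s^2))) = pos_ind s * ((tp F c x - tp F (hc (r * s) c) x) / s^2)" for s
  proof -
    have "tp F c x - tp F (hc (r * s) c) x = (\<Sum>k\<in>F. Re (c k * E k x) * (1 - exp (- (s * (r * kabs k))\<^sup>2)))"
      unfolding tp_hc unfolding tp_def Re_sum sum_subtractf[symmetric]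
      by (intro sum.cong refl) (simp only: right_diff_distrib mult.left_commute[of s r] mult.assoc mult.commute[of _ "exp _"] mult_1_right)
    then show ?thesis by (simp only: sum_divide_distrib sum_distrib_left times_divide_eq_right mult.left_commute)
  qed
  ultimately show ?thesis by simp
qed

text \<open>All values of the integrand of \<open>lam_integral\<close> are nonnegative at a maximum
  point. On [s0, 2 s0] the integrand is at least V/2 divided by (2 s0)^2, and the interval has
  length s0.\<close>

lemma touch_lam:
  assumes F: "finite F" "0 \<notin> F" and le: "\<And>y. tp F w y \<le> V" and eq: "tp F w x = V" and s0: "0 < s0"
    and small: "\<And>s. s0 \<le> s \<Longrightarrow> tp F (hc s w) x \<le> V / 2" and V: "0 \<le> V"
  shows "V / (8 * s0) \<le> k0 * tp F (lam w) x"
proof -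
  note hb = lam_integral[OF F(2) zero_less_one, of w x, simplified, unfolded has_bochner_integral_iff]
  have "(LINT s|lborel. V / (8 * s0^2) * indicator {s0..2 * s0} s) \<le> (LINT s|lborel. pos_ind s * ((tp F w x - tp F (hc s w) x) / s^2))"
  proof (rule integral_mono)
    fix s
    show "V / (8 * s0^2) * indicator {s0..2 * s0} s \<le> pos_ind s * ((tp F w x - tp F (hc s w) x) / s^2)"
    proof (cases "s \<in> {s0..2 * s0}")
      case True
      then have "s^2 \<le> (2 * s0)^2" using s0 by (intro power_mono) auto
      then have "V / 2 / (4 * s0^2) \<le> (tp F w x - tp F (hc s w) x) / s^2"
        using True s0 small[of s] V by (intro frac_le) (auto simp: eq power_mult_distrib)
      then show ?thesis using True s0 by (simp add: indicator_def)
    next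
      case False
      then have "indicator {s0..2 * s0} s = (0::real)" by simp
      then show ?thesis using hc_upper(1)[OF F le, of s x] by (simp add: eq)
    qed
  next
    show "integrable lborel (\<lambda>s. V / (8 * s0^2) * indicator {s0..2 * s0} s)" by (intro integrable_mult_right integrable_real_indicator) (auto simp: emeasure_lborel_Icc_eq)
  qed (use hb in auto)
  also have "\<dots> = k0 * tp F (lam w) x" using hb by simp
  finally show ?thesis using s0 by (simp add: power2_eq_square)
qed

text \<open>Scales below \<open>\<sigma>\<close> are controlled by positivity (\<open>hc_upper\<close>), larger ones by the assumed decay.\<close>

lemma touch_riesz:
  assumes F: "finite F" "0 \<notin> F" and le: "\<And>y. tp F w y \<le> V" and eq: "tp F w x = V"
    and D: "\<And>s. 0 < s \<Longrightarrow> \<bar>tp F (dd p (hc s w)) x\<bar> \<le> D / s^2" and sg: "0 < \<sigma>"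
  shows "sqrt pi / 2 * \<bar>tp F (rz p w) x\<bar> \<le> 2 * k0 * \<sigma> * tp F (lam w) x + 2 * cI * D / \<sigma>"
proof -
  have D0: "0 \<le> D" using D[of 1] by simp
  have f: "tp F (\<lambda>k. of_real (mS {0<..} (kabs k)) * dd p w k) x = tp F (\<lambda>k. of_real (sqrt pi / 2) * rz p w k) x"
    unfolding rz_def using F(2) by (intro tp_cong) (metis divide_inverse inverse_eq_divide kabs_pos mS_full mult.assoc of_real_mult)
  have hb1: "has_bochner_integral lborel (\<lambda>s. pos_ind s * tp F (dd p (hc s w)) x) (sqrt pi / 2 * tp F (rz p w) x)"
    using tp_hc_integral[OF F(2), of "{0<..}" "dd p w" x] unfolding f tp_scale dd_hc by simp
  \<comment> \<open>\<open>2 * D / (\<sigma>^2 + s^2)\<close> dominates \<open>D / s^2\<close> for s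
    \<ge> \<sigma> and, unlike it, is integrable over all positive scales.\<close>
  have hb2: "has_bochner_integral lborel (\<lambda>s. sqrt 2 * \<sigma> * (pos_ind s * ((tp F w x - tp F (hc (sqrt 2 * s) w) x) / s^2)) + 2 * D * (pos_ind s * (1 / (\<sigma>^2 + s^2))))
      (sqrt 2 * \<sigma> * (sqrt 2 * k0 * tp F (lam w) x) + 2 * D * (cI / \<sigma>))"
    by (intro has_bochner_integral_add has_bochner_integral_mult_right lam_integral cauchy_scale F sg) simp
  have "\<bar>sqrt pi / 2 * tp F (rz p w) x\<bar> \<le> (LINT s|lborel. \<bar>pos_ind s * tp F (dd p (hc s w)) x\<bar>)"
    using hb1 integral_abs_bound unfolding has_bochner_integral_iff by metis
  also have "\<dots> \<le> (LINT s|lborel. sqrt 2 * \<sigma> * (pos_ind s * ((tp F w x - tp F (hc (sqrt 2 * s) w) x) / s^2)) + 2 * D * (pos_ind s * (1 / (\<sigma>^2 + s^2))))"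
  proof (rule integral_mono)
    show "integrable lborel (\<lambda>s. \<bar>pos_ind s * tp F (dd p (hc s w)) x\<bar>)" using hb1 by (simp add: has_bochner_integral_iff integrable_abs)
    show "integrable lborel (\<lambda>s. sqrt 2 * \<sigma> * (pos_ind s * ((tp F w x - tp F (hc (sqrt 2 * s) w) x) / s^2)) + 2 * D * (pos_ind s * (1 / (\<sigma>^2 + s^2))))"
      using hb2 unfolding has_bochner_integral_iff by (rule conjunct1)
    fix s :: real
    have up: "tp F (hc (sqrt 2 * s) w) x \<le> V" by (rule hc_upper(1)[OF F le])
    have "\<bar>tp F (dd p (hc s w)) x\<bar> \<le> sqrt 2 * \<sigma> * ((V - tp F (hc (sqrt 2 * s) w) x) / s^2) + 2 * D * (1 / (\<sigma>^2 + s^2))" if s: "0 < s"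
    proof (cases "s \<le> \<sigma>")
      case True
      have "\<bar>tp F (dd p (hc s w)) x\<bar> \<le> sqrt 2 / s * (V - tp F (hc (sqrt 2 * s) w) x)" by (rule hc_upper(2)[OF F le s])
      also have "\<dots> = sqrt 2 * s * ((V - tp F (hc (sqrt 2 * s) w) x) / s^2)" using s by (simp add: power2_eq_square)
      also have "\<dots> \<le> sqrt 2 * \<sigma> * ((V - tp F (hc (sqrt 2 * s) w) x) / s^2)"
        using True up by (intro mult_right_mono) auto
      finally show ?thesis using D0 by (smt (verit) divide_nonneg_nonneg mult_nonneg_nonneg zero_le_power2)
    next
      case False
      then have "\<sigma>^2 \<le> s^2" using sg by (intro power_mono) auto
      then have "1 / s^2 \<le> 2 * (1 / (\<sigma>^2 + s^2))" using s sg by (simp add: divide_simps add_pos_pos)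
      from mult_left_mono[OF this D0] D[OF s]
      have "\<bar>tp F (dd p (hc s w)) x\<bar> \<le> 2 * D * (1 / (\<sigma>^2 + s^2))" by (simp add: mult.commute)
      moreover have "0 \<le> sqrt 2 * \<sigma> * ((V - tp F (hc (sqrt 2 * s) w) x) / s^2)" using sg up by (intro mult_nonneg_nonneg) auto
      ultimately show ?thesis by linarith
    qed
    then show "\<bar>pos_ind s * tp F (dd p (hc s w)) x\<bar> \<le> sqrt 2 * \<sigma> * (pos_ind s * ((tp F w x - tp F (hc (sqrt 2 * s) w) x) / s^2)) + 2 * D * (pos_ind s * (1 / (\<sigma>^2 + s^2)))"
      by (cases "0 < s") (simp_all add: eq)
  qed
  also have "\<dots> = sqrt 2 * \<sigma> * (sqrt 2 * k0 * tp F (lam w) x) + 2 * D * (cI / \<sigma>)"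
    using hb2 unfolding has_bochner_integral_iff by (rule conjunct2)
  also have "sqrt 2 * \<sigma> * (sqrt 2 * k0 * tp F (lam w) x) = (sqrt 2 * sqrt 2) * (k0 * \<sigma> * tp F (lam w) x)" by (simp only: mult_ac)
  finally show ?thesis by (simp add: abs_mult algebra_simps)
qed

section \<open>Maximum principles\<close>

definition supp_in :: "nat \<Rightarrow> coef \<Rightarrow> bool" where
  "supp_in n c \<longleftrightarrow> (\<forall>k. k \<notin> Bx n \<longrightarrow> c k = 0)"

lemma supp_inD: "supp_in n c \<Longrightarrow> k \<notin> Bx n \<Longrightarrow> c k = 0" unfolding supp_in_def by blast

lemma Bx_add: "i \<in> Bx n \<Longrightarrow> j \<in> Bx n \<Longrightarrow> i + j \<in> insert 0 (Bx (2 * n))"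
  unfolding mem_Bx insert_iff by auto

lemma sum_translate_Bx:
  assumes "supp_in n a" "j \<in> Bx n"
  shows "(\<Sum>k\<in>insert 0 (Bx (2 * n)). a (k - j) * E k x) = (\<Sum>i\<in>Bx (2 * n). a i * E i x) * E j x"
proof -
  have "(\<Sum>k\<in>insert 0 (Bx (2 * n)). a (k - j) * E k x) = (\<Sum>k\<in>(\<lambda>i. i + j) ` Bx n. a (k - j) * E k x)"
  proof (rule sum.mono_neutral_right)
    show "(\<lambda>i. i + j) ` Bx n \<subseteq> insert 0 (Bx (2 * n))" using Bx_add assms(2) by blast
    show "\<forall>k\<in>insert 0 (Bx (2 * n)) - (\<lambda>i. i + j) ` Bx n. a (k - j) * E k x = 0"
    proof
      fix k assume "k \<in> insert 0 (Bx (2 * n)) - (\<lambda>i. i + j) ` Bx n"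
      then have "k - j \<notin> Bx n" by (metis Diff_iff diff_add_cancel imageI)
      then show "a (k - j) * E k x = 0" using supp_inD[OF assms(1)] by simp
    qed
  qed simp
  also have "\<dots> = (\<Sum>i\<in>Bx n. a i * E i x) * E j x"
    by (subst sum.reindex) (simp_all add: E_add sum_distrib_right mult.assoc inj_on_def)
  also have "(\<Sum>i\<in>Bx n. a i * E i x) = (\<Sum>i\<in>Bx (2 * n). a i * E i x)"
    by (rule sum.mono_neutral_left) (use supp_inD[OF assms(1)] Bx_mono[of n "2 * n"] in auto)
  finally show ?thesis .
qed

text \<open>With both factors supported in \<open>Bx n\<close> every frequency of the product lies
  in \<open>Bx (2 * n)\<close> or is 0, so finite sums over this fixed set represent the product
  exactly.\<close>

lemma tp_mult:
  assumes "supp_in n a" "supp_in n b" "symc a" "symc b"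
  shows "tp (Bx (2 * n)) a x * tp (Bx (2 * n)) b x = tp (insert 0 (Bx (2 * n))) (\<lambda>k. \<Sum>j\<in>Bx (2 * n). a (k - j) * b j) x"
proof -
  let ?F = "Bx (2 * n)"
  have "(\<Sum>k\<in>insert 0 ?F. (\<Sum>j\<in>?F. a (k - j) * b j) * E k x) = (\<Sum>j\<in>?F. b j * (\<Sum>k\<in>insert 0 ?F. a (k - j) * E k x))"
    unfolding sum_distrib_left sum_distrib_right by (subst sum.swap) (simp only: mult_ac)
  also have "\<dots> = (\<Sum>j\<in>?F. (\<Sum>i\<in>?F. a i * E i x) * (b j * E j x))"
  proof (rule sum.cong[OF refl])
    fix j
    show "b j * (\<Sum>k\<in>insert 0 ?F. a (k - j) * E k x) = (\<Sum>i\<in>?F. a i * E i x) * (b j * E j x)"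
    proof (cases "j \<in> Bx n")
      case True
      then show ?thesis unfolding sum_translate_Bx[OF assms(1) True] by (simp only: mult_ac)
    qed (simp add: supp_inD[OF assms(2)])
  qed
  also have "\<dots> = of_real (tp ?F a x * tp ?F b x)"
    unfolding sum_distrib_left[symmetric] of_real_mult tp_sym[OF symF_Bx assms(3)] tp_sym[OF symF_Bx assms(4)] ..
  finally have "tp (insert 0 ?F) (\<lambda>k. \<Sum>j\<in>?F. a (k - j) * b j) x = Re (of_real (tp ?F a x * tp ?F b x))"
    unfolding tp_def[of "insert 0 ?F"] by (rule arg_cong)
  then show ?thesis by simp
qed

text \<open>The Fourier coefficients of \<open>\<nabla>\<^sup>\<bottom>\<phi> \<sqdot> \<nabla>c\<close> for a stream function \<open>\<phi>\<close>.\<close>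

definition nlb :: "(int \<times> int) set \<Rightarrow> coef \<Rightarrow> coef \<Rightarrow> coef" where
  "nlb F \<phi> c k = (\<Sum>j\<in>F. - of_real (crs k j) * \<phi> (k - j) * c j)"

lemma symc_dd: "symc c \<Longrightarrow> symc (dd p c)" unfolding symc_def dd_def ks_def ax_def by simp
lemma symc_real: "symc c \<Longrightarrow> (\<And>k. r (- k) = r k) \<Longrightarrow> symc (\<lambda>k. of_real (r k) * c k)" unfolding symc_def by simp
lemma supp_dd: "supp_in n c \<Longrightarrow> supp_in n (dd p c)" unfolding supp_in_def dd_def by simp
lemma supp_mult: "supp_in n c \<Longrightarrow> supp_in n (\<lambda>k. r k * c k)" unfolding supp_in_def by simp

lemma tp_nlb:
  assumes s: "supp_in n \<phi>" "supp_in n c" "symc \<phi>" "symc c"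
  shows "tp (Bx (2 * n)) (nlb (Bx (2 * n)) \<phi> c) x = tp (Bx (2 * n)) (dd True \<phi>) x * tp (Bx (2 * n)) (dd False c) x
    - tp (Bx (2 * n)) (dd False \<phi>) x * tp (Bx (2 * n)) (dd True c) x"
proof -
  let ?F = "Bx (2 * n)"
  have "nlb ?F \<phi> c k = (\<Sum>j\<in>?F. dd True \<phi> (k - j) * dd False c j) - (\<Sum>j\<in>?F. dd False \<phi> (k - j) * dd True c j)" for k
    unfolding nlb_def sum_subtractf[symmetric]
    by (intro sum.cong refl) (simp add: dd_def ks_def ax_def crs_def algebra_simps)
  then have "tp ?F (dd True \<phi>) x * tp ?F (dd False c) x - tp ?F (dd False \<phi>) x * tp ?F (dd True c) x = tp (insert 0 ?F) (nlb ?F \<phi> c) x"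
    unfolding tp_mult[OF supp_dd supp_dd symc_dd symc_dd, OF s(1,2,3,4)] tp_diff[symmetric] by (intro tp_cong) (rule sym)
  also have "\<dots> = Re (nlb ?F \<phi> c 0) + tp ?F (nlb ?F \<phi> c) x" unfolding tp_def by simp
  also have "nlb ?F \<phi> c 0 = 0" unfolding nlb_def by (simp add: crs_def)
  finally show ?thesis by simp
qed

text \<open>Lets touching arguments work on a compact square although the inequality at the touching
  point is needed at all points of the plane.\<close>

lemma E_reduce:
  fixes x :: "real \<times> real"
  obtains y where "y \<in> cbox (-pi, -pi) (pi, pi)" "\<And>k. E k y = E k x"
proof -
  define m where "m = (\<lambda>z::real. \<lfloor>(z + pi) / (2 * pi)\<rfloor>)"
  have m: "- pi \<le> z - 2 * pi * of_int (m z)" "z - 2 * pi * of_int (m z) \<le> pi" for z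
  proof -
    have z: "z = 2 * pi * ((z + pi) / (2 * pi)) - pi" by simp
    have "2 * pi * of_int (m z) \<le> 2 * pi * ((z + pi) / (2 * pi))" "2 * pi * ((z + pi) / (2 * pi)) \<le> 2 * pi * (of_int (m z) + 1)"
      using floor_correct[of "(z + pi) / (2 * pi)"] unfolding m_def by (intro mult_left_mono; simp)+
    then show "- pi \<le> z - 2 * pi * of_int (m z)" "z - 2 * pi * of_int (m z) \<le> pi" using z unfolding distrib_left by linarith+
  qed
  define y where "y = (fst x - 2 * pi * of_int (m (fst x)), snd x - 2 * pi * of_int (m (snd x)))"
  have "E k y = E k x" for k
  proof -
    have "E k x = E k y * cis (2 * pi * of_int (fst k * m (fst x) + snd k * m (snd x)))"
      unfolding E_def y_def by (simp add: cis_mult algebra_simps)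
    then show ?thesis by (simp add: cis_multiple_2pi)
  qed
  moreover have "y \<in> cbox (-pi, -pi) (pi, pi)" unfolding y_def using m by (simp add: cbox_Pair_eq)
  ultimately show ?thesis using that by blast
qed

lemma max_grad:
  assumes "\<And>y. tp F w y \<le> tp F w x" shows "tp F (dd p w) x = 0"
proof -
  define h :: "real \<times> real" where "h = (if p then (1, 0) else (0, 1))"
  have "((\<lambda>s. tp F w (x + s *\<^sub>R h)) has_real_derivative tp F (dd p w) x) (at 0)"
    using tp_deriv_line[of F w x h 0] by (cases p) (simp_all add: h_def flip: zero_prod_def)
  then show ?thesis by (rule DERIV_local_max[of _ _ _ 1]) (use assms in auto)
qed

lemma max_laplacian:
  assumes F: "finite F" "0 \<notin> F" and le: "\<And>y. tp F w y \<le> tp F w x" shows "0 \<le> tp F (lam (lam w)) x"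
proof (rule tendsto_lowerbound)
  have l: "((\<lambda>s. (1 - exp (- (s * r)\<^sup>2)) / s^2) \<longlongrightarrow> r^2) (at_right 0)" if "0 < r" for r :: real
    using that by real_asymp
  have "((\<lambda>s. \<Sum>k\<in>F. Re (w k * E k x) * ((1 - exp (- (s * kabs k)\<^sup>2)) / s^2)) \<longlongrightarrow> (\<Sum>k\<in>F. Re (w k * E k x) * (kabs k)^2)) (at_right 0)"
    using F by (intro tendsto_sum tendsto_mult tendsto_const l kabs_pos) auto
  also have "(\<Sum>k\<in>F. Re (w k * E k x) * (kabs k)^2) = tp F (lam (lam w)) x"
    unfolding tp_def lam_def Re_sum by (intro sum.cong refl) (simp only: mult.assoc Re_of_real_mult, simp add: power2_eq_square)
  finally show "((\<lambda>s. \<Sum>k\<in>F. Re (w k * E k x) * ((1 - exp (- (s * kabs k)\<^sup>2)) / s^2)) \<longlongrightarrow> tp F (lam (lam w)) x) (at_right 0)" .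
  show "\<forall>\<^sub>F s in at_right 0. 0 \<le> (\<Sum>k\<in>F. Re (w k * E k x) * ((1 - exp (- (s * kabs k)\<^sup>2)) / s^2))"
  proof (rule always_eventually, rule allI)
    fix s
    have "(\<Sum>k\<in>F. Re (w k * E k x) * ((1 - exp (- (s * kabs k)\<^sup>2)) / s^2)) = (tp F w x - tp F (hc s w) x) / s^2"
      unfolding tp_hc unfolding tp_def Re_sum sum_subtractf[symmetric] sum_divide_distrib
      by (intro sum.cong refl) (simp only: times_divide_eq_right right_diff_distrib mult.commute[of _ "exp _"] mult_1_right)
    then show "0 \<le> (\<Sum>k\<in>F. Re (w k * E k x) * ((1 - exp (- (s * kabs k)\<^sup>2)) / s^2))"
      using hc_upper(1)[OF F le, of s x] by simp
  qed
qed simp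

text \<open>The set where \<open>G\<close> is nonnegative is compact, so it has a point with least
  time. There \<open>G\<close> vanishes and is maximal in space, while a negative time derivative
  would make it positive slightly earlier.\<close>

lemma first_touch:
  fixes G :: "real \<Rightarrow> 'q::metric_space \<Rightarrow> real"
  assumes Q: "compact Q" and cont: "continuous_on ({a..b} \<times> Q) (\<lambda>z. G (fst z) (snd z))"
    and init: "\<And>q. q \<in> Q \<Longrightarrow> G a q < 0"
    and der: "\<And>t q. a < t \<Longrightarrow> t \<le> b \<Longrightarrow> q \<in> Q \<Longrightarrow> G t q = 0 \<Longrightarrow> (\<And>q'. q' \<in> Q \<Longrightarrow> G t q' \<le> 0)
      \<Longrightarrow> \<exists>D<0. ((\<lambda>t. G t q) has_real_derivative D) (at t within {a..b})"
    and t: "t \<in> {a..b}" and q: "q \<in> Q"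
  shows "G t q < 0"
proof (rule ccontr)
  assume "\<not> G t q < 0"
  define T where "T = {z \<in> {a..b} \<times> Q. 0 \<le> G (fst z) (snd z)}"
  have "closedin (top_of_set ({a..b} \<times> Q)) T"
    unfolding T_def using continuous_closedin_preimage[OF cont closed_atLeast[of 0]]
    by (simp add: vimage_def Int_def conj_commute)
  then have T: "compact T" by (rule closedin_compact[OF compact_Times[OF compact_Icc Q]])
  have "(t, q) \<in> T" using \<open>\<not> G t q < 0\<close> t q by (simp add: T_def)
  then obtain z where z: "z \<in> T" "\<And>y. y \<in> T \<Longrightarrow> fst z \<le> fst y"
    using continuous_attains_inf[OF T, of fst] continuous_on_fst[OF continuous_on_id] by blast
  obtain t0 q0 where zz: "z = (t0, q0)" by (cases z)
  have t0: "t0 \<in> {a..b}" "q0 \<in> Q" "0 \<le> G t0 q0" using z(1) unfolding T_def zz by auto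
  have "t0 \<noteq> a" using init[OF t0(2)] t0(3) by auto
  then have a: "a < t0" using t0(1) by auto
  have before: "G s q' < 0" if "a \<le> s" "s < t0" "q' \<in> Q" for s q'
    using z(2)[of "(s, q')"] that t0(1) unfolding T_def zz by force
  have le: "G t0 q' \<le> 0" if q': "q' \<in> Q" for q'
  proof -
    have "continuous_on {a..t0} (\<lambda>s. G (fst (s, q')) (snd (s, q')))"
      using t0(1) q' by (intro continuous_on_compose2[OF cont, of _ "\<lambda>s. (s, q')"] continuous_intros) auto
    then have "continuous_on {a..t0} (\<lambda>s. G s q')" by simp
    from continuous_on_Icc_at_leftD[OF this a] have "((\<lambda>s. G s q') \<longlongrightarrow> G t0 q') (at_left t0)" .
    then show ?thesis
    proof (rule tendsto_upperbound)
      show "\<forall>\<^sub>F s in at_left t0. G s q' \<le> 0"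
        using eventually_at_left_real[OF a]
        by (rule eventually_mono) (meson before[OF _ _ q'] greaterThanLessThan_iff less_imp_le)
    qed simp
  qed
  have "G t0 q0 = 0" using le[OF t0(2)] t0(3) by simp
  then obtain D where D: "D < 0" "((\<lambda>t. G t q0) has_real_derivative D) (at t0 within {a..b})"
    using der[OF a _ t0(2) _ le] t0(1) by auto
  from has_real_derivative_neg_dec_left[OF D(2,1)] obtain d where
    d: "d > 0" "\<And>h. h > 0 \<Longrightarrow> t0 - h \<in> {a..b} \<Longrightarrow> h < d \<Longrightarrow> G t0 q0 < G (t0 - h) q0" by blast
  \<comment> \<open>A backward step within the range of the derivative's sign and still inside the
    time interval.\<close>
  define h where "h = min d (t0 - a) / 2"
  have h: "h > 0" "h < d" "a \<le> t0 - h" "t0 - h < t0" using d(1) a by (auto simp: h_def min_def field_simps)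
  have "G t0 q0 < G (t0 - h) q0" using d(2)[of h] h t0(1) by auto
  then show False using before[OF h(3,4) t0(2)] t0(3) by linarith
qed

section \<open>The regularised equation and its sup and Hoelder bounds\<close>

definition st :: "coef \<Rightarrow> coef" where "st c k = of_real (1 / kabs k) * c k"

lemma symc_st: "symc c \<Longrightarrow> symc (st c)" unfolding st_def by (rule symc_real) simp_all
lemma supp_st: "supp_in n c \<Longrightarrow> supp_in n (st c)" unfolding st_def by (rule supp_mult)
lemma dd_st: "dd p (st c) = rz p c" unfolding st_def dd_def rz_def by (simp only: mult_ac)
lemma rz_sh: "rz p (sh h c) = sh h (rz p c)" unfolding rz_def sh_def dd_def by (simp only: mult_ac)
lemma lam_sh: "lam (sh h c) = sh h (lam c)" unfolding lam_def sh_def by (simp only: mult_ac)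

text \<open>The equation is posed on \<open>Bx (2 * n)\<close>, where products of functions
  supported in \<open>Bx n\<close> live; the excess frequencies can be left to the error
  \<open>g\<close>. The error is normalised by 1, and neither \<open>n\<close> nor \<epsilon>
  appears in the bounds below for sup norm, Hoelder norm and energy.\<close>

locale evol_base =
  fixes n :: nat and a b \<epsilon> \<Phi> :: real and c g :: "real \<Rightarrow> coef" and fh :: "coef"
  assumes ab: "a < b" and eps: "0 \<le> \<epsilon>"
    and symc: "\<And>t. symc (c t)" and supp: "\<And>t. supp_in n (c t)"
    and ode: "\<And>t k. t \<in> {a..b} \<Longrightarrow> k \<in> Bx (2 * n) \<Longrightarrow> ((\<lambda>t. c t k) has_vector_derivative
        (fh k + g t k - nlb (Bx (2 * n)) (st (c t)) (c t) k - of_real (kabs k + \<epsilon> * (kabs k)^2) * c t k)) (at t within {a..b})"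
    and force: "\<And>x. \<bar>tp (Bx (2 * n)) fh x\<bar> \<le> \<Phi>"
    and err: "\<And>t. t \<in> {a..b} \<Longrightarrow> (\<Sum>k\<in>Bx (2 * n). cmod (g t k)) \<le> 1"
begin

abbreviation "F \<equiv> Bx (2 * n)"

lemma evol_base_sub:
  assumes "a \<le> a'" "a' < b" shows "evol_base n a' b \<epsilon> \<Phi> c g fh"
proof unfold_locales
  fix t k assume t: "t \<in> {a'..b}" "k \<in> F"
  then have "t \<in> {a..b}" "{a'..b} \<subseteq> {a..b}" using \<open>a \<le> a'\<close> by auto
  from has_vector_derivative_within_subset[OF ode[OF this(1) t(2)] this(2)]
  show "((\<lambda>t. c t k) has_vector_derivative
        (fh k + g t k - nlb F (st (c t)) (c t) k - of_real (kabs k + \<epsilon> * (kabs k)^2) * c t k)) (at t within {a'..b})" .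
qed (use assms eps symc supp force err in auto)

lemma err_tp: "t \<in> {a..b} \<Longrightarrow> \<bar>tp F (g t) x\<bar> \<le> 1" using tp_bound[of F "g t" x] err[of t] by linarith

lemma phi_nonneg: "0 \<le> \<Phi>" using force[of 0] by linarith

lemma deriv:
  assumes "t \<in> {a..b}"
  shows "((\<lambda>t. tp F (c t) x) has_real_derivative tp F fh x + tp F (g t) x
    - (tp F (rz True (c t)) x * tp F (dd False (c t)) x - tp F (rz False (c t)) x * tp F (dd True (c t)) x)
    - tp F (lam (c t)) x - \<epsilon> * tp F (lam (lam (c t))) x) (at t within {a..b})"
proof -
  let ?r = "\<lambda>k. fh k + g t k - nlb F (st (c t)) (c t) k - of_real (kabs k + \<epsilon> * (kabs k)^2) * c t k"
  have "((\<lambda>t. \<Sum>k\<in>F. c t k * E k x) has_vector_derivative (\<Sum>k\<in>F. ?r k * E k x)) (at t within {a..b})"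
    by (intro has_vector_derivative_sum has_vector_derivative_mult_left ode assms)
  from bounded_linear.has_vector_derivative[OF bounded_linear_Re this]
  have d: "((\<lambda>t. tp F (c t) x) has_real_derivative tp F ?r x) (at t within {a..b})"
    unfolding has_real_derivative_iff_has_vector_derivative tp_def .
  have "?r = (\<lambda>k. fh k + g t k - nlb F (st (c t)) (c t) k - (lam (c t) k + of_real \<epsilon> * lam (lam (c t)) k))"
    by (simp add: fun_eq_iff lam_def power2_eq_square algebra_simps)
  then have "tp F ?r x = tp F fh x + tp F (g t) x - tp F (nlb F (st (c t)) (c t)) x - (tp F (lam (c t)) x + \<epsilon> * tp F (lam (lam (c t))) x)"
    by (simp only: tp_add tp_diff tp_scale)
  also have "tp F (nlb F (st (c t)) (c t)) x = tp F (rz True (c t)) x * tp F (dd False (c t)) x - tp F (rz False (c t)) x * tp F (dd True (c t)) x"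
    unfolding dd_st[symmetric]    by (intro tp_nlb supp_st symc_st supp symc)
  finally show ?thesis using d by (simp only: diff_diff_eq add.assoc)
qed

lemma cont_coeff: "k \<in> F \<Longrightarrow> continuous_on {a..b} (\<lambda>t. c t k)"
  by (rule continuous_on_vector_derivative) (rule ode)

lemma cont_tp: "continuous_on ({a..b} \<times> S) (\<lambda>z. tp F (c (fst z)) (h (snd z)))" if "continuous_on S h"
  unfolding tp_def
proof (intro continuous_intros)
  fix k assume "k \<in> F"
  show "continuous_on ({a..b} \<times> S) (\<lambda>z. c (fst z) k)"
    by (rule continuous_on_compose2[OF cont_coeff[OF \<open>k \<in> F\<close>] continuous_on_fst[OF continuous_on_id]]) auto
  show "continuous_on ({a..b} \<times> S) (\<lambda>z. h (snd z))"
    by (rule continuous_on_compose2[OF that continuous_on_snd[OF continuous_on_id]]) auto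
qed

end

locale evol = evol_base +
  fixes L :: real
  assumes l2: "\<And>t. t \<in> {a..b} \<Longrightarrow> (\<Sum>k\<in>Bx (2 * n). (cmod (c t k))^2) \<le> L^2" and L: "0 < L"

lemma (in evol) evol_sub:
  assumes "a \<le> a'" "a' < b" shows "evol n a' b \<epsilon> \<Phi> c g fh L"
  using evol_base_sub[OF assms] l2 L assms(1) unfolding evol_def evol_axioms_def by auto

definition Z4 :: real where "Z4 = sqrt (\<Sum>\<^sub>\<infinity>k\<in>UNIV. kabs k powr (- 4))"

lemma Z4_sum: "(\<Sum>k\<in>F. kabs k powr (- 4)) \<le> Z4^2" if "finite F"
proof -
  have "(\<Sum>k\<in>F. kabs k powr (- 4)) \<le> (\<Sum>\<^sub>\<infinity>k\<in>UNIV. kabs k powr (- 4))"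
    using that by (intro finite_sum_le_infsum lattice_summable) auto
  moreover have "0 \<le> (\<Sum>\<^sub>\<infinity>k\<in>UNIV. kabs k powr (- 4))" by (rule infsum_nonneg) simp
  ultimately show ?thesis by (simp add: Z4_def)
qed

lemma Z4_pos: "0 < Z4"
proof -
  have "1 \<le> Z4^2" using Z4_sum[of "{(1, 0)}"] by (simp add: kabs_def)
  moreover have "0 \<le> Z4" unfolding Z4_def by (simp add: infsum_nonneg)
  ultimately show ?thesis by (metis le_less not_one_le_zero zero_power2)
qed

text \<open>The Gaussian multiplier is at most 1/(s |k|)^2, and |k|^-2 is square-summable, so
  Cauchy-Schwarz yields a pointwise bound from \<open>L2\<close>.\<close>

lemma hc_L2_bound:
  assumes F: "finite F" "0 \<notin> F" and l2: "(\<Sum>k\<in>F. (cmod (c k))^2) \<le> L^2" and L: "0 \<le> L" and s: "0 < s"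
  shows "\<bar>tp F (hc s c) x\<bar> \<le> L * Z4 / s^2"
proof -
  have "\<bar>tp F (hc s c) x\<bar> \<le> (\<Sum>k\<in>F. cmod (hc s c k))" by (rule tp_bound)
  also have "\<dots> \<le> (\<Sum>k\<in>F. (1 / (kabs k)^2 * cmod (c k)) / s^2)"
  proof (rule sum_mono)
    fix k assume "k \<in> F"
    then have k: "0 < kabs k" using F by (intro kabs_pos) auto
    have "(s * kabs k)^2 \<le> exp ((s * kabs k)^2)" using exp_ge_add_one_self[of "(s * kabs k)^2"] by linarith
    then have "inverse (exp ((s * kabs k)^2)) \<le> inverse ((s * kabs k)^2)"
      using k s by (intro le_imp_inverse_le) (auto intro: zero_less_power)
    then have "exp (- (s * kabs k)\<^sup>2) \<le> 1 / (kabs k)^2 / s^2"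
      by (simp add: exp_minus power_mult_distrib divide_inverse mult.commute)
    from mult_right_mono[OF this norm_ge_zero[of "c k"]]
    show "cmod (hc s c k) \<le> (1 / (kabs k)^2 * cmod (c k)) / s^2" by (simp add: hc_def norm_mult)
  qed
  also have "\<dots> = (\<Sum>k\<in>F. 1 / (kabs k)^2 * cmod (c k)) / s^2" by (simp only: sum_divide_distrib)
  also have "(\<Sum>k\<in>F. 1 / (kabs k)^2 * cmod (c k)) \<le> Z4 * L"
  proof (rule power2_le_imp_le)
    have "(\<Sum>k\<in>F. 1 / (kabs k)^2 * cmod (c k))^2 \<le> (\<Sum>k\<in>F. (1 / (kabs k)^2)^2) * (\<Sum>k\<in>F. (cmod (c k))^2)"
      by (rule Cauchy_Schwarz_ineq_sum)
    also have "(\<Sum>k\<in>F. (1 / (kabs k)^2)^2) = (\<Sum>k\<in>F. kabs k powr (- 4))"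
    proof (rule sum.cong[OF refl])
      fix k assume "k \<in> F"
      then have "0 < kabs k" using F by (intro kabs_pos) auto
      then show "(1 / (kabs k)^2)^2 = kabs k powr (- 4)" by (simp add: powr_minus power_divide divide_inverse power_inverse flip: power_mult)
    qed
    also have "\<dots> * (\<Sum>k\<in>F. (cmod (c k))^2) \<le> Z4^2 * L^2"
      by (intro mult_mono Z4_sum F l2 sum_nonneg) auto
    finally show "(\<Sum>k\<in>F. 1 / (kabs k)^2 * cmod (c k))^2 \<le> (Z4 * L)^2" by (simp only: power_mult_distrib)
  qed (use L Z4_pos in simp)
  finally show ?thesis using s by (simp add: divide_right_mono mult.commute)
qed

lemma scaled_ops:
  "lam (\<lambda>k. of_real s * c k) = (\<lambda>k. of_real s * lam c k)" "dd p (\<lambda>k. of_real s * c k) = (\<lambda>k. of_real s * dd p c k)"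
  unfolding lam_def dd_def by (simp_all only: mult_ac)

text \<open>The last summand makes the touching scale so small that dissipation beats the growth of
  the barrier; the first two make the rest exceed force and error.\<close>

definition Kinf :: "real \<Rightarrow> real \<Rightarrow> real" where "Kinf \<Phi> L = 1 + \<Phi> + 2 * (L * Z4) * (24 * k0)^2"

definition hol_A :: real where "hol_A = 4 / sqrt pi"
text \<open>The 2 in the denominator yields \<alpha> \<le> 1/2. The other summand is sized for the
  third claim of \<open>hol_alpha\<close>: the part of the transport term that dissipation does not
  absorb proportionally is a quarter of the lower bound for the dissipation.\<close>

definition hol_alpha :: "real \<Rightarrow> real" where "hol_alpha M = 1 / (M * (2 + 288 * 384 * hol_A^2 * k0^2 * cI))"
text \<open>Three demands: more than 2 M rules out touching at |h| = 1, more than 2 \<Phi> + 2 beats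
  force and error, and 768 k0 M makes the quadratic dissipation dominate the time derivative of the
  barrier.\<close>

definition hol_B :: "real \<Rightarrow> real \<Rightarrow> real" where "hol_B \<Phi> M = 768 * k0 * M + 2 * \<Phi> + 3 + 2 * M"

lemma hol_A_pos: "0 < hol_A" by (simp add: hol_A_def)

lemma hol_alpha:
  assumes "1 \<le> M"
  shows "0 < hol_alpha M" "hol_alpha M \<le> 1 / 2" "288 * hol_A^2 * k0 * cI * (hol_alpha M)^2 * M \<le> 1 / (384 * k0 * M)"
proof -
  define C where "C = 288 * 384 * hol_A^2 * k0^2 * cI"
  have C: "0 \<le> C" using cI_nonneg by (simp add: C_def)
  have al: "hol_alpha M = 1 / (M * (2 + C))" by (simp add: hol_alpha_def C_def)
  show "0 < hol_alpha M" unfolding al using C assms by simp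
  have "2 \<le> M * (2 + C)" using mult_mono[of 1 M 2 "2 + C"] assms C by simp
  then show "hol_alpha M \<le> 1 / 2" unfolding al by (intro divide_left_mono) auto
  have "C * (hol_alpha M)^2 * M^2 = C / (2 + C)^2"
    unfolding al using assms C by (simp add: power_divide power_mult_distrib)
  also have "\<dots> \<le> 1" using C by (subst divide_le_eq_1_pos) (simp_all add: power2_sum add_pos_nonneg)
  finally have "(288 * hol_A^2 * k0 * cI * (hol_alpha M)^2 * M) * (384 * k0 * M) \<le> 1"
    unfolding C_def by (simp add: power2_eq_square mult_ac)
  then show "288 * hol_A^2 * k0 * cI * (hol_alpha M)^2 * M \<le> 1 / (384 * k0 * M)"
    using assms k0_pos by (subst pos_le_divide_eq) auto
qed

text \<open>Barrier K/(t - a)^2 from above and, with sign -1, from below. At a touching point the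
  gradient vanishes and with it the transport term. Averages at scales beyond a multiple of t - a
  are at most half the maximum by the \<open>L2\<close> bound, so dissipation is of order V/(t - a),
  just like the loss from the time weight.\<close>

lemma (in evol) linf:
  assumes b: "b \<le> a + 1" and t: "a < t" "t \<le> b"
  shows "\<bar>tp F (c t) x\<bar> \<le> Kinf \<Phi> L / (t - a)^2"
proof -
  define K where "K = Kinf \<Phi> L"
  have K: "1 + \<Phi> \<le> K" "2 * (L * Z4) * (24 * k0)^2 < K" "0 < K"
    using phi_nonneg L Z4_pos by (auto simp: K_def Kinf_def add_pos_nonneg)
  \<comment> \<open>Chosen so that the bound \<open>L * Z4 / (\<tau> * r)^2\<close> on averages
    equals V/2 when V = K/\<tau>^2.\<close>
  define r where "r = sqrt (2 * (L * Z4) / K)"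
  have r: "0 < r" "r^2 = 2 * (L * Z4) / K" using K L Z4_pos by (auto simp: r_def)
  have "(24 * k0 * r)^2 < 1^2" using K by (simp add: power_mult_distrib r(2) field_simps)
  then have r24: "24 * k0 * r < 1" by (rule power_less_imp_less_base) simp
  have main: "s * tp F (c t) x < K / (t - a)^2" if s: "\<bar>s\<bar> = 1" for s x
  proof -
    define G where "G = (\<lambda>t x. (t - a)^2 * (s * tp F (c t) x) - K)"
    obtain y where y: "y \<in> cbox (-pi, -pi) (pi, pi)" "\<And>k. E k y = E k x" using E_reduce[of x] by blast
    have "G t y < 0"
    proof (rule first_touch[where G = G and Q = "cbox (-pi, -pi) (pi, pi)" and a = a and b = b])
      show "continuous_on ({a..b} \<times> cbox (-pi, -pi) (pi, pi)) (\<lambda>z. G (fst z) (snd z))"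
        unfolding G_def by (intro continuous_intros cont_tp)
      show "G a q < 0" for q using K by (simp add: G_def)
      fix t q assume t: "a < t" "t \<le> b" and q: "q \<in> cbox (-pi, -pi) (pi, pi)" and 0: "G t q = 0"
        and le: "\<And>q'. q' \<in> cbox (-pi, -pi) (pi, pi) \<Longrightarrow> G t q' \<le> 0"
      define \<tau> where "\<tau> = t - a"
      have tau: "0 < \<tau>" "\<tau> \<le> 1" using t b by (auto simp: \<tau>_def)
      define V where "V = K / \<tau>^2"
      have V: "0 < V" using K tau by (simp add: V_def)
      define w where "w = (\<lambda>k. of_real s * c t k)"
      have w: "tp F w z = s * tp F (c t) z" for z unfolding w_def by (rule tp_scale)
      have wq: "tp F w q = V" using 0 tau unfolding G_def w V_def \<tau>_def[symmetric] by (simp add: field_simps)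
      have wle: "tp F w z \<le> V" for z
      proof -
        obtain z' where z': "z' \<in> cbox (-pi, -pi) (pi, pi)" "\<And>k. E k z' = E k z" using E_reduce[of z] by blast
        have "tp F w z' \<le> V" using le[OF z'(1)] tau unfolding G_def w V_def \<tau>_def[symmetric] by (simp add: field_simps)
        then show ?thesis unfolding tp_def z'(2) .
      qed
      have grad: "tp F (dd p (c t)) q = 0" for p
        using max_grad[of F w q p] wle wq s unfolding w_def scaled_ops tp_scale by auto
      have lap: "0 \<le> s * tp F (lam (lam (c t))) q"
        using max_laplacian[OF finite_Bx zero_Bx, of "2 * n" w q] wle wq unfolding w_def scaled_ops tp_scale by simp
      have wl2: "(\<Sum>k\<in>F. (cmod (w k))^2) \<le> L^2"
        using l2[of t] t s by (simp add: w_def norm_mult)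
      have s0: "0 < \<tau> * r" using tau r by simp
      have "V / (8 * (\<tau> * r)) \<le> k0 * tp F (lam w) q"
      proof (rule touch_lam[OF finite_Bx zero_Bx wle wq s0 _ less_imp_le[OF V]])
        fix u assume u: "\<tau> * r \<le> u"
        have "tp F (hc u w) q \<le> L * Z4 / u^2"
          using hc_L2_bound[OF finite_Bx zero_Bx wl2 _, of u q] L u s0 by simp
        also have "\<dots> \<le> L * Z4 / (\<tau> * r)^2"
          using L Z4_pos tau(1) r(1) less_le_trans[OF s0 u] by (intro divide_left_mono power_mono[OF u] mult_pos_pos zero_less_power) auto
        also have "\<dots> = V / 2" unfolding power_mult_distrib r(2) V_def using K L Z4_pos tau by (simp add: field_simps)
        finally show "tp F (hc u w) q \<le> V / 2" .
      qed
      also have "tp F (lam w) q = s * tp F (lam (c t)) q" unfolding w_def scaled_ops tp_scale ..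
      finally have Lam: "V / (8 * (\<tau> * r)) \<le> k0 * (s * tp F (lam (c t)) q)" .
      \<comment> \<open>The dissipation becomes 3 V/\<tau>: two units pay for the derivative of the
        time weight, the third for force and error.\<close>
      have "V / (8 * (\<tau> * r)) = (V / \<tau>) * (1 / (8 * r))" by simp
      moreover have "3 * k0 \<le> 1 / (8 * r)" using r24 r by (simp add: field_simps)
      ultimately have "(V / \<tau>) * (3 * k0) < V / (8 * (\<tau> * r)) \<or> (V / \<tau>) * (3 * k0) = V / (8 * (\<tau> * r))"
        using mult_left_mono[of "3 * k0" "1 / (8 * r)" "V / \<tau>"] V tau by auto
      then have "k0 * (3 * (V / \<tau>)) \<le> k0 * (s * tp F (lam (c t)) q)" using Lam by (auto simp: mult_ac)
      then have Lam3: "3 * (V / \<tau>) \<le> s * tp F (lam (c t)) q" unfolding mult_le_cancel_left_pos[OF k0_pos] .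
      let ?D = "tp F fh q + tp F (g t) q - tp F (lam (c t)) q - \<epsilon> * tp F (lam (lam (c t))) q"
      have d: "((\<lambda>t. tp F (c t) q) has_real_derivative ?D) (at t within {a..b})"
        using deriv[of t q] t by (simp add: grad)
      have "s * tp F fh q \<le> \<Phi>" "s * tp F (g t) q \<le> 1"
        using force[of q] err_tp[of t q] t s by (auto simp: abs_if split: if_splits)
      moreover have "s * ?D = s * tp F fh q + s * tp F (g t) q - s * tp F (lam (c t)) q - \<epsilon> * (s * tp F (lam (lam (c t))) q)"
        by (simp add: algebra_simps)
      moreover have "0 \<le> \<epsilon> * (s * tp F (lam (lam (c t))) q)" using eps lap by simp
      ultimately have sD: "s * ?D \<le> \<Phi> + 1 - 3 * (V / \<tau>)" using Lam3 by linarith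
      have "2 * \<tau> * V + \<tau>^2 * (s * ?D) \<le> 2 * \<tau> * V + \<tau>^2 * (\<Phi> + 1 - 3 * (V / \<tau>))"
        using sD by (intro add_left_mono mult_left_mono) auto
      also have "\<dots> = \<tau>^2 * (\<Phi> + 1) - \<tau> * V" using tau by (simp add: power2_eq_square algebra_simps)
      also have "\<dots> < 0"
      proof -
        have "\<tau>^2 * (\<Phi> + 1) \<le> 1 * (\<Phi> + 1)"
          using tau phi_nonneg by (intro mult_right_mono power_le_one) auto
        also have "\<dots> < K" unfolding K_def Kinf_def using L Z4_pos k0_pos by simp
        also have "K \<le> K / \<tau>" using K tau by (simp add: pos_le_divide_eq mult_left_le)
        also have "K / \<tau> = \<tau> * V" using tau by (simp add: V_def power2_eq_square)
        finally show ?thesis by simp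
      qed
      finally have neg: "2 * \<tau> * V + \<tau>^2 * (s * ?D) < 0" .
      have "((\<lambda>t. G t q) has_real_derivative 2 * \<tau> * V + \<tau>^2 * (s * ?D)) (at t within {a..b})"
        unfolding G_def wq[symmetric] w \<tau>_def
        by (rule derivative_eq_intros d refl)+ (simp add: algebra_simps)
      then show "\<exists>D<0. ((\<lambda>t. G t q) has_real_derivative D) (at t within {a..b})" using neg by blast
    qed (use t y compact_cbox in auto)
    then have "(t - a)^2 * (s * tp F (c t) y) < K" by (simp add: G_def)
    moreover have "tp F (c t) y = tp F (c t) x" unfolding tp_def y(2) ..
    ultimately show ?thesis using t by (simp add: pos_less_divide_eq mult.commute)
  qed
  show ?thesis using main[of 1 x] main[of "-1" x] unfolding K_def by (simp add: abs_le_iff less_imp_le)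
qed

lemma norm_powr: "norm h powr \<alpha> = ((fst h)^2 + (snd h)^2) powr (\<alpha> / 2)" for h :: "real \<times> real"
  unfolding norm_prod_def by (simp add: powr_half_sqrt[symmetric] powr_powr)

lemma norm_powr_deriv:
  fixes h :: "real \<times> real"
  assumes "h \<noteq> 0"
  shows "((\<lambda>s. norm (h + s *\<^sub>R (if p then (1, 0) else (0, 1))) powr \<alpha>) has_real_derivative \<alpha> * norm h powr \<alpha> * (ax p h / (norm h)^2)) (at 0)"
proof -
  have pos: "0 < (fst h)^2 + (snd h)^2" using assms by (metis prod_eq_iff sum_power2_gt_zero_iff zero_prod_def fst_zero snd_zero)
  have n2: "(norm h)^2 = (fst h)^2 + (snd h)^2" by (simp add: norm_prod_def)
  have "((\<lambda>s. ((fst h + s * (if p then 1 else 0))^2 + (snd h + s * (if p then 0 else 1))^2) powr (\<alpha> / 2)) has_real_derivative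
     (\<alpha> / 2) * ((fst h)^2 + (snd h)^2) powr (\<alpha> / 2 - 1) * (2 * ax p h)) (at 0)"
    using pos by (cases p) (auto intro!: derivative_eq_intros simp: ax_def)
  also have "(\<alpha> / 2) * ((fst h)^2 + (snd h)^2) powr (\<alpha> / 2 - 1) * (2 * ax p h) = \<alpha> * norm h powr \<alpha> * (ax p h / (norm h)^2)"
  proof -
    have "(\<alpha> / 2) * S powr (\<alpha> / 2 - 1) * (2 * y) = \<alpha> * S powr (\<alpha> / 2) * (y / S)" if "0 < S" for S y :: real
      using that by (simp add: powr_diff)
    then show ?thesis unfolding norm_powr n2 using pos by blast
  qed
  finally show ?thesis unfolding norm_powr by (cases p) (simp_all add: if_distrib)
qed

text \<open>At a first touching point the increment has vanishing gradient in \<open>x\<close>, and its gradient in \<open>h\<close> is that of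
  \<open>B \<bar>h\<bar>\<^sup>\<alpha>\<close>; so the transport term reduces to the velocity increment times \<open>\<alpha> V / \<bar>h\<bar>\<close>.\<close>

lemma (in evol) holder_annulus:
  assumes M: "1 \<le> M" "\<And>t x. t \<in> {a..b} \<Longrightarrow> \<bar>tp F (c t) x\<bar> \<le> M" and b: "b \<le> a + 1" and t: "a < t" "t \<le> b"
    and r0: "0 < r0" "r0 < 1" and lip: "\<And>t x h. t \<in> {a..b} \<Longrightarrow> norm h = r0 \<Longrightarrow> tp F (sh h (c t)) x < hol_B \<Phi> M * r0 powr hol_alpha M"
    and h: "r0 \<le> norm h" "norm h \<le> 1"
  shows "(t - a) * tp F (sh h (c t)) x < hol_B \<Phi> M * norm h powr hol_alpha M"
proof -
  define \<alpha> where "\<alpha> = hol_alpha M"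
  define B where "B = hol_B \<Phi> M"
  note al = hol_alpha[OF M(1), folded \<alpha>_def]
  have B: "768 * k0 * M \<le> B" "2 * \<Phi> + 2 < B" "2 * M < B" "0 < B"
    using k0_pos M(1) phi_nonneg unfolding B_def hol_B_def by (auto simp: add_pos_nonneg add_nonneg_pos)
  define Q where "Q = cbox (-pi, -pi) (pi, pi) \<times> {h :: real \<times> real. r0 \<le> norm h \<and> norm h \<le> 1}"
  define G where "G = (\<lambda>t q. (t - a) * (tp F (c t) (fst q + snd q) - tp F (c t) (fst q)) - B * norm (snd q) powr \<alpha>)"
  have "{h :: real \<times> real. r0 \<le> norm h \<and> norm h \<le> 1} = cball 0 1 - ball 0 r0" by auto
  then have Q: "compact Q" unfolding Q_def by (simp add: compact_Times compact_diff)
  obtain y where y: "y \<in> cbox (-pi, -pi) (pi, pi)" "\<And>k. E k y = E k x" using E_reduce[of x] by blast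
  have "G t (y, h) < 0"
  proof (rule first_touch[where G = G and Q = Q and a = a and b = b])
    show "continuous_on ({a..b} \<times> Q) (\<lambda>z. G (fst z) (snd z))"
    proof -
      have "continuous_on Q fst" "continuous_on Q (\<lambda>q. fst q + snd q)" by (intro continuous_intros)+
      note cont_tp[OF this(1)] cont_tp[OF this(2)]
      moreover have "continuous_on ({a..b} \<times> Q) (\<lambda>z. norm (snd (snd z)) powr \<alpha>)"
        using r0 by (intro continuous_on_powr continuous_intros) (auto simp: Q_def)
      ultimately show ?thesis unfolding G_def
        by (intro continuous_on_diff continuous_on_mult continuous_on_const continuous_on_fst[OF continuous_on_id])
    qed
    show "G a q < 0" if q: "q \<in> Q" for q
    proof -
      have "r0 \<le> norm (snd q)" using q unfolding Q_def mem_Times_iff by blast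
      then have "0 < norm (snd q) powr \<alpha>" using r0 powr_gt_zero by fastforce
      then show ?thesis using B unfolding G_def by simp
    qed
    fix t q assume t: "a < t" "t \<le> b" and q: "q \<in> Q" and 0: "G t q = 0" and leQ: "\<And>q'. q' \<in> Q \<Longrightarrow> G t q' \<le> 0"
    obtain x h where xh: "q = (x, h)" by (cases q)
    have t': "t \<in> {a..b}" using t by simp
    define \<tau> where "\<tau> = t - a"
    have tau: "0 < \<tau>" "\<tau> \<le> 1" using t b by (auto simp: \<tau>_def)
    have hr: "r0 \<le> norm h" "norm h \<le> 1" using q unfolding Q_def xh by auto
    have h0: "0 < norm h" "h \<noteq> 0" using hr r0 by auto
    have all: "\<tau> * tp F (sh h' (c t)) z \<le> B * norm h' powr \<alpha>" if h': "r0 \<le> norm h'" "norm h' \<le> 1" for h' z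
    proof -
      obtain z' where z': "z' \<in> cbox (-pi, -pi) (pi, pi)" "\<And>k. E k z' = E k z" using E_reduce[of z] by blast
      have "\<tau> * tp F (sh h' (c t)) z' \<le> B * norm h' powr \<alpha>"
        using leQ[of "(z', h')"] z'(1) h' unfolding G_def Q_def tp_sh \<tau>_def by simp
      then show ?thesis unfolding tp_def z'(2) .
    qed
    define w where "w = sh h (c t)"
    define V where "V = B * norm h powr \<alpha> / \<tau>"
    have V: "0 < V" using B h0 tau by (simp add: V_def)
    have wx: "tp F w x = V" using 0 tau unfolding G_def xh V_def w_def tp_sh \<tau>_def[symmetric] by (simp add: field_simps)
    have wle: "tp F w z \<le> V" for z using all[OF hr, of z] tau unfolding V_def w_def by (simp add: field_simps)
    \<comment> \<open>At |h| = 1 the barrier exceeds 2 M, the largest possible increment; at |h| =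
      r0 the hypothesis \<open>lip\<close> forbids touching. So \<open>h\<close> may be varied in
      all directions.\<close>
    have h1: "norm h < 1"
    proof (rule ccontr)
      assume "\<not> norm h < 1"
      then have "norm h = 1" using hr by simp
      then have "V = B / \<tau>" by (simp add: V_def)
      moreover have "B \<le> B / \<tau>" using tau B by (simp add: pos_le_divide_eq mult_left_le)
      moreover have "V \<le> 2 * M" using M(2)[OF t', of x] M(2)[OF t', of "x + h"] unfolding wx[symmetric] w_def tp_sh by linarith
      ultimately show False using B(3) by linarith
    qed
    have hr0: "r0 < norm h"
    proof (rule ccontr)
      assume "\<not> r0 < norm h"
      then have e: "norm h = r0" using hr by simp
      have "V < B * r0 powr \<alpha>" unfolding wx[symmetric] w_def B_def \<alpha>_def by (rule lip[OF t' e])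
      moreover have "B * r0 powr \<alpha> \<le> B * r0 powr \<alpha> / \<tau>" using tau B by (simp add: pos_le_divide_eq mult_left_le)
      ultimately show False unfolding V_def e by linarith
    qed
    have g0: "tp F (dd p w) x = 0" for p using max_grad[of F w x p] wle wx by simp
    have g1: "tp F (dd p (c t)) (x + h) = tp F (dd p (c t)) x" for p
      using g0[of p] unfolding w_def dd_sh tp_sh by simp
    have P: "tp F (dd p (c t)) x = \<alpha> * V * (ax p h / (norm h)^2)" for p
    proof -
      let ?e = "if p then (1, 0) else (0, 1) :: real \<times> real"
      have ne: "norm ?e = 1" by (simp add: norm_Pair)
      have d1: "((\<lambda>s. tp F (c t) ((x + h) + s *\<^sub>R ?e)) has_real_derivative tp F (dd p (c t)) (x + h)) (at 0)"
        using tp_deriv_line[of F "c t" "x + h" ?e 0] by (cases p) (simp_all flip: zero_prod_def)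
      have "((\<lambda>s. \<tau> * (tp F (c t) ((x + h) + s *\<^sub>R ?e) - tp F (c t) x) - B * norm (h + s *\<^sub>R ?e) powr \<alpha>) has_real_derivative
          \<tau> * (tp F (dd p (c t)) (x + h) - 0) - B * (\<alpha> * norm h powr \<alpha> * (ax p h / (norm h)^2))) (at 0)"
        by (intro DERIV_diff DERIV_cmult DERIV_const d1 norm_powr_deriv h0)
      then have "\<tau> * (tp F (dd p (c t)) (x + h) - 0) - B * (\<alpha> * norm h powr \<alpha> * (ax p h / (norm h)^2)) = 0"
      proof (rule DERIV_local_max)
        show "0 < min (norm h - r0) (1 - norm h)" using h1 hr0 by simp
        show "\<forall>s. \<bar>0 - s\<bar> < min (norm h - r0) (1 - norm h) \<longrightarrow>
          \<tau> * (tp F (c t) ((x + h) + s *\<^sub>R ?e) - tp F (c t) x) - B * norm (h + s *\<^sub>R ?e) powr \<alpha>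
          \<le> \<tau> * (tp F (c t) ((x + h) + 0 *\<^sub>R ?e) - tp F (c t) x) - B * norm (h + 0 *\<^sub>R ?e) powr \<alpha>"
        proof (intro allI impI)
          fix s :: real assume s: "\<bar>0 - s\<bar> < min (norm h - r0) (1 - norm h)"
          have "norm (s *\<^sub>R ?e) = \<bar>s\<bar>" unfolding norm_scaleR ne by simp
          then have "r0 \<le> norm (h + s *\<^sub>R ?e)" "norm (h + s *\<^sub>R ?e) \<le> 1"
            using norm_triangle_ineq[of h "s *\<^sub>R ?e"] norm_diff_ineq[of h "s *\<^sub>R ?e"] s by linarith+
          from all[OF this, of x] have "\<tau> * (tp F (c t) ((x + h) + s *\<^sub>R ?e) - tp F (c t) x) - B * norm (h + s *\<^sub>R ?e) powr \<alpha> \<le> 0"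
            unfolding tp_sh by (simp only: add.assoc)
          moreover have "\<tau> * (tp F (c t) ((x + h) + 0 *\<^sub>R ?e) - tp F (c t) x) - B * norm (h + 0 *\<^sub>R ?e) powr \<alpha> = 0"
            using 0 unfolding G_def xh \<tau>_def by simp
          ultimately show "\<tau> * (tp F (c t) ((x + h) + s *\<^sub>R ?e) - tp F (c t) x) - B * norm (h + s *\<^sub>R ?e) powr \<alpha>
          \<le> \<tau> * (tp F (c t) ((x + h) + 0 *\<^sub>R ?e) - tp F (c t) x) - B * norm (h + 0 *\<^sub>R ?e) powr \<alpha>" by simp
        qed
      qed
      then have "tp F (dd p (c t)) x = (B * (\<alpha> * norm h powr \<alpha> * (ax p h / (norm h)^2))) / \<tau>"
        unfolding g1 diff_zero right_minus_eq using tau by (metis nonzero_mult_div_cancel_left less_irrefl)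
      then show ?thesis unfolding V_def by (simp add: mult_ac)
    qed
    have Pabs: "\<bar>tp F (dd p (c t)) x\<bar> \<le> \<alpha> * V / norm h" for p
    proof -
      have "\<bar>ax p h\<bar> \<le> norm h" unfolding ax_def using norm_fst_le[of "fst h" "snd h"] norm_snd_le[of "snd h" "fst h"] by simp
      then have "\<bar>ax p h\<bar> / (norm h)^2 \<le> norm h / (norm h)^2" by (rule divide_right_mono) simp
      also have "\<dots> = 1 / norm h" using h0 by (simp add: power2_eq_square)
      finally have "\<alpha> * V * (\<bar>ax p h\<bar> / (norm h)^2) \<le> \<alpha> * V * (1 / norm h)"
        using al V by (intro mult_left_mono) auto
      then show ?thesis unfolding P using al V by (simp add: abs_mult)
    qed
    define \<Lambda> where "\<Lambda> = tp F (lam w) x"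
    define H where "H = norm h"
    have H: "0 < H" "H \<le> 1" using h0 hr by (auto simp: H_def)
    have lap: "0 \<le> tp F (lam (lam w)) x" using max_laplacian[OF finite_Bx zero_Bx, of "2 * n" w x] wle wx by simp
    \<comment> \<open>Averages of the increment are at most 6 M |h|/s, hence at most V/2 beyond this
      scale. The dissipation is then quadratic in \<open>V\<close>.\<close>
    have s0: "0 < 12 * M * H / V" using M(1) H V by simp
    have "V / (8 * (12 * M * H / V)) \<le> k0 * \<Lambda>" unfolding \<Lambda>_def
    proof (rule touch_lam[OF finite_Bx zero_Bx wle wx s0 _ less_imp_le[OF V]])
      fix s assume s: "12 * M * H / V \<le> s"
      then have sp: "0 < s" using s0 by linarith
      have "tp F (hc s w) x \<le> 6 * M * H / s" unfolding w_def H_def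
        using hc_shift_bounds(1)[OF finite_Bx zero_Bx M(2)[OF t'] sp, of h x] by simp
      also have "\<dots> \<le> V / 2" using s sp V by (simp add: field_simps)
      finally show "tp F (hc s w) x \<le> V / 2" .
    qed
    then have Lam: "V^2 / (96 * k0 * M * H) \<le> \<Lambda>"
      using k0_pos M(1) H V by (simp add: field_simps power2_eq_square)
    \<comment> \<open>The cut-off for which the small-scale velocity costs exactly half of the
      dissipation. The large scales then contribute a multiple of \<alpha>^2 V^2/H, small because of
      \<alpha>.\<close>
    define \<sigma> where "\<sigma> = H / (4 * hol_A * k0 * \<alpha> * V)"
    have sg: "0 < \<sigma>" using H hol_A_pos k0_pos al V by (simp add: \<sigma>_def)
    have rz: "\<bar>tp F (rz p w) x\<bar> \<le> hol_A / 2 * (2 * k0 * \<sigma> * \<Lambda> + 2 * cI * (36 * M * H) / \<sigma>)" for p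
    proof -
      have "sqrt pi / 2 * \<bar>tp F (rz p w) x\<bar> \<le> 2 * k0 * \<sigma> * \<Lambda> + 2 * cI * (36 * M * H) / \<sigma>"
        unfolding \<Lambda>_def using hc_shift_bounds(2)[OF finite_Bx zero_Bx M(2)[OF t']] unfolding w_def H_def[symmetric]
        by (intro touch_riesz[OF finite_Bx zero_Bx wle[unfolded w_def] wx[unfolded w_def] _ sg]) (simp add: H_def)
      then show ?thesis unfolding hol_A_def by (simp add: field_simps)
    qed
    let ?T = "tp F (rz True w) x * tp F (dd False (c t)) x - tp F (rz False w) x * tp F (dd True (c t)) x"
    have "\<bar>?T\<bar> \<le> \<bar>tp F (rz True w) x\<bar> * \<bar>tp F (dd False (c t)) x\<bar> + \<bar>tp F (rz False w) x\<bar> * \<bar>tp F (dd True (c t)) x\<bar>"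
      unfolding abs_mult[symmetric] by (rule abs_triangle_ineq4)
    also have "\<dots> \<le> hol_A / 2 * (2 * k0 * \<sigma> * \<Lambda> + 2 * cI * (36 * M * H) / \<sigma>) * (\<alpha> * V / H)
        + hol_A / 2 * (2 * k0 * \<sigma> * \<Lambda> + 2 * cI * (36 * M * H) / \<sigma>) * (\<alpha> * V / H)"
      by (intro add_mono mult_mono rz Pabs[folded H_def] abs_ge_zero order_trans[OF abs_ge_zero rz])
    also have "\<dots> = 2 * hol_A * k0 * \<alpha> * V / H * \<sigma> * \<Lambda> + 72 * hol_A * cI * M * \<alpha> * V / \<sigma>"
      using H sg by (simp add: field_simps)
    also have "2 * hol_A * k0 * \<alpha> * V / H * \<sigma> * \<Lambda> = \<Lambda> / 2"
      unfolding \<sigma>_def using H hol_A_pos k0_pos al V by (simp add: field_simps)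
    also have "72 * hol_A * cI * M * \<alpha> * V / \<sigma> = 288 * hol_A^2 * k0 * cI * \<alpha>^2 * M * (V^2 / H)"
      unfolding \<sigma>_def using H hol_A_pos k0_pos al V by (simp add: field_simps power2_eq_square)
    also have "\<dots> \<le> 1 / (384 * k0 * M) * (V^2 / H)" using al(3) H by (intro mult_right_mono) auto
    finally have T: "\<bar>?T\<bar> \<le> \<Lambda> / 2 + V^2 / (384 * k0 * M * H)" by simp
    define D where "D = (\<lambda>x. tp F fh x + tp F (g t) x
      - (tp F (rz True (c t)) x * tp F (dd False (c t)) x - tp F (rz False (c t)) x * tp F (dd True (c t)) x)
      - tp F (lam (c t)) x - \<epsilon> * tp F (lam (lam (c t))) x)"
    have "D (x + h) - D x = (tp F fh (x + h) - tp F fh x) + (tp F (g t) (x + h) - tp F (g t) x) - ?T - \<Lambda> - \<epsilon> * tp F (lam (lam w)) x"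
      unfolding D_def \<Lambda>_def w_def rz_sh lam_sh tp_sh g1 by (simp add: algebra_simps)
    moreover have "0 \<le> \<epsilon> * tp F (lam (lam w)) x" using eps lap by simp
    moreover have "V^2 / (96 * k0 * M * H) = 4 * (V^2 / (384 * k0 * M * H))" by simp
    ultimately have DD: "D (x + h) - D x \<le> 2 * \<Phi> + 2 - V\<^sup>2 / (384 * k0 * M * H)"
      using force[of x] force[of "x + h"] err_tp[OF t', of x] err_tp[OF t', of "x + h"] T Lam by linarith
    \<comment> \<open>Since \<alpha> \<le> 1/2 and H \<le> 1, H is at most H^\<alpha> and at most
      H^(2 \<alpha>). Thus V^2/H, weighted by \<tau>, dominates both B V and B^2, which is what the
      term from the time weight and the force require.\<close>
    have neg: "V + \<tau> * (D (x + h) - D x) < 0"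
    proof -
      have tV: "\<tau> * V = B * H powr \<alpha>" using tau by (simp add: V_def H_def)
      have "H powr 1 \<le> H powr \<alpha>" using H al by (intro powr_mono') auto
      then have Ha: "H \<le> H powr \<alpha>" using H by simp
      have "H powr 1 \<le> H powr (2 * \<alpha>)" using H al by (intro powr_mono') auto
      then have H2a: "H \<le> H powr \<alpha> * H powr \<alpha>" using H by (simp flip: powr_add)
      have "B * V * H \<le> B * V * H powr \<alpha>" using Ha B V by simp
      then have i1: "B * V * H \<le> \<tau> * V * V" unfolding tV by (simp add: mult_ac)
      have "B * B * H \<le> (B * H powr \<alpha>) * (B * H powr \<alpha>)" using H2a B by (simp add: mult_ac)
      also have "\<dots> = (\<tau> * V) * (\<tau> * V)" by (simp only: tV)
      also have "\<dots> \<le> 1 * (\<tau> * V * V)" using tau V by (simp add: mult_left_le_one_le mult_ac)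
      finally have i2: "B * B * H \<le> \<tau> * V * V" by simp
      have "(V + B) * (384 * k0 * M * H) = ((V + B) * H / 2) * (768 * k0 * M)" by simp
      also have "\<dots> \<le> ((V + B) * H / 2) * B" using B V H by (intro mult_left_mono) auto
      also have "\<dots> \<le> \<tau> * V * V" using i1 i2 by (simp add: field_simps)
      finally have "V + B \<le> \<tau> * V^2 / (384 * k0 * M * H)"
        using k0_pos M(1) H by (subst pos_le_divide_eq) (auto simp: power2_eq_square mult.assoc)
      moreover have "\<tau> * (2 * \<Phi> + 2) < B" using tau B(2) phi_nonneg mult_left_le_one_le[of "2 * \<Phi> + 2" \<tau>] by linarith
      moreover have "\<tau> * (D (x + h) - D x) \<le> \<tau> * (2 * \<Phi> + 2 - V\<^sup>2 / (384 * k0 * M * H))"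
        using DD tau by (intro mult_left_mono) auto
      moreover have "\<dots> = \<tau> * (2 * \<Phi> + 2) - \<tau> * V^2 / (384 * k0 * M * H)" by (simp add: right_diff_distrib)
      ultimately show ?thesis by linarith
    qed
    have "((\<lambda>t. G t q) has_real_derivative V + \<tau> * (D (x + h) - D x)) (at t within {a..b})"
      unfolding G_def xh wx[symmetric] w_def tp_sh \<tau>_def fst_conv snd_conv D_def
      by (rule derivative_eq_intros deriv[OF t'] refl)+ (simp add: algebra_simps)
    then show "\<exists>D<0. ((\<lambda>t. G t q) has_real_derivative D) (at t within {a..b})" using neg by blast
  qed (use t y Q h in \<open>auto simp: Q_def\<close>)
  then have "(t - a) * tp F (sh h (c t)) y < B * norm h powr \<alpha>" unfolding G_def tp_sh by simp
  then show ?thesis unfolding tp_def y(2) B_def \<alpha>_def .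
qed

section \<open>The energy estimate\<close>

text \<open>A crude Lipschitz bound that depends on \<open>n\<close>. It only keeps very short
  increments below the barrier and leaves no trace in the Hoelder constant.\<close>

lemma (in evol) tp_gradient_bound:
  assumes "t \<in> {a..b}" shows "\<bar>tp F (dd p (c t)) x\<bar> \<le> (\<Sum>k\<in>F. kabs k) * L"
proof -
  have cL: "cmod (c t k) \<le> L" if k: "k \<in> F" for k
  proof -
    have "(cmod (c t k))^2 \<le> (\<Sum>k\<in>F. (cmod (c t k))^2)" by (rule member_le_sum[OF k]) auto
    then have "(cmod (c t k))^2 \<le> L^2" using l2[OF assms] by linarith
    then show ?thesis using L by (intro power2_le_imp_le[of "cmod (c t k)" L]) auto
  qed
  have "\<bar>tp F (dd p (c t)) x\<bar> \<le> (\<Sum>k\<in>F. cmod (dd p (c t) k))" by (rule tp_bound)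
  also have "\<dots> \<le> (\<Sum>k\<in>F. kabs k * L)"
  proof (rule sum_mono)
    fix k assume "k \<in> F"
    then show "cmod (dd p (c t) k) \<le> kabs k * L"
      unfolding dd_def norm_mult using abs_ks[of p k] cL by (intro mult_mono) auto
  qed
  finally show ?thesis by (simp only: sum_distrib_right)
qed

text \<open>The annulus argument needs h away from 0, where |h|^\<alpha> is not differentiable, and
  at most 1. Shorter increments are handled by the Lipschitz bound, longer ones by the sup
  bound.\<close>

lemma (in evol) holder:
  assumes M: "1 \<le> M" "\<And>t x. t \<in> {a..b} \<Longrightarrow> \<bar>tp F (c t) x\<bar> \<le> M" and b: "b \<le> a + 1" and t: "a < t" "t \<le> b"
  shows "\<bar>tp F (sh h (c t)) x\<bar> \<le> hol_B \<Phi> M / (t - a) * norm h powr hol_alpha M"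
proof -
  define \<alpha> where "\<alpha> = hol_alpha M"
  define B where "B = hol_B \<Phi> M"
  note al = hol_alpha[OF M(1), folded \<alpha>_def]
  have B: "2 * M \<le> B" "0 < B" using k0_pos M(1) phi_nonneg unfolding B_def hol_B_def by (auto simp: add_pos_nonneg add_nonneg_pos)
  define N where "N = 2 * ((\<Sum>k\<in>F. kabs k) * L)"
  have N: "0 \<le> N" unfolding N_def using L by (simp add: sum_nonneg)
  have lip: "\<bar>tp F (sh h (c t)) x\<bar> \<le> N * norm h" if "t \<in> {a..b}" for h t x
    using tp_mean_value[OF tp_gradient_bound[OF that]] unfolding N_def by (simp add: mult.assoc)
  \<comment> \<open>Below this radius the Lipschitz bound lies under the barrier, because r^(1 -
    \<alpha>) \<le> sqrt r \<le> B/(N + 1).\<close>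
  define r0 where "r0 = min (1 / 2) ((B / (N + 1))^2)"
  have r0: "0 < r0" "r0 < 1" "r0 \<le> (B / (N + 1))^2" using B N by (auto simp: r0_def)
  have small: "N * r < B * r powr \<alpha>" if r: "0 < r" "r \<le> r0" for r
  proof -
    have "r = r powr \<alpha> * r powr (1 - \<alpha>)" using r by (simp flip: powr_add)
    also have "r powr (1 - \<alpha>) \<le> r powr (1 / 2)" using r r0 al by (intro powr_mono') auto
    also have "r powr (1 / 2) = sqrt r" using r by (simp add: powr_half_sqrt)
    also have "sqrt r \<le> B / (N + 1)" using r r0(3) B N by (intro real_le_lsqrt) auto
    finally have "r \<le> r powr \<alpha> * (B / (N + 1))" by (simp add: mult_left_mono)
    from mult_left_mono[OF this N] have "N * r \<le> N * (r powr \<alpha> * (B / (N + 1)))" .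
    also have "\<dots> = (N / (N + 1)) * (B * r powr \<alpha>)" by simp
    also have "\<dots> < 1 * (B * r powr \<alpha>)" using N B r by (intro mult_strict_right_mono) auto
    finally show ?thesis by simp
  qed
  have up: "(t - a) * tp F (sh h (c t)) x \<le> B * norm h powr \<alpha>" for h x
  proof -
    have t': "t \<in> {a..b}" "0 < t - a" "t - a \<le> 1" using t b by auto
    consider "h = 0" | "h \<noteq> 0" "norm h \<le> r0" | "r0 \<le> norm h" "norm h \<le> 1" | "1 \<le> norm h" by linarith
    then show ?thesis
    proof cases
      case 1
      then show ?thesis by (simp add: tp_sh)
    next
      case 2
      have "(t - a) * tp F (sh h (c t)) x \<le> (t - a) * (N * norm h)"
        using lip[OF t'(1), of h x] t' by (intro mult_left_mono) auto
      also have "\<dots> \<le> 1 * (N * norm h)" using t' N by (intro mult_right_mono) auto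
      finally show ?thesis using small[of "norm h"] 2 by auto
    next
      case 3
      have "tp F (sh h (c t)) x < hol_B \<Phi> M * r0 powr hol_alpha M" if "t \<in> {a..b}" "norm h = r0" for t x h
        using lip[OF that(1), of h x] small[OF r0(1)] that(2) unfolding B_def \<alpha>_def by simp
      from holder_annulus[OF M b t r0(1,2) this 3, of x] show ?thesis unfolding B_def \<alpha>_def by simp
    next
      case 4
      have d: "\<bar>tp F (sh h (c t)) x\<bar> \<le> 2 * M" using M(2)[OF t'(1), of x] M(2)[OF t'(1), of "x + h"] unfolding tp_sh by linarith
      have "(t - a) * tp F (sh h (c t)) x \<le> (t - a) * (2 * M)" using d t' by (intro mult_left_mono) auto
      also have "\<dots> \<le> 1 * (2 * M)" using t' M(1) by (intro mult_right_mono) auto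
      also have "\<dots> \<le> B * 1" using B by simp
      also have "\<dots> \<le> B * norm h powr \<alpha>" using 4 al B by (intro mult_left_mono ge_one_powr_ge_zero) auto
      finally show ?thesis .
    qed
  qed
  \<comment> \<open>The lower bound is the upper bound for the reversed increment, from
    \<open>x + h\<close> by \<open>- h\<close>.\<close>
  have "(t - a) * tp F (sh (- h) (c t)) (x + h) \<le> B * norm h powr \<alpha>" using up[of "- h" "x + h"] by simp
  moreover have "tp F (sh (- h) (c t)) (x + h) = - tp F (sh h (c t)) x" by (simp add: tp_sh)
  ultimately have "\<bar>(t - a) * tp F (sh h (c t)) x\<bar> \<le> B * norm h powr \<alpha>" using up[of h x] by (simp add: abs_le_iff)
  then show ?thesis using t unfolding B_def \<alpha>_def by (simp add: abs_mult field_simps)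
qed

section \<open>Integration by parts and interpolation\<close>

lemma tp_parseval:
  assumes "symF F" "symc c" shows "(LINT x|TM. (tp F c x)^2) = (2 * pi)^2 * (\<Sum>k\<in>F. (cmod (c k))^2)"
proof -
  have F: "L2_fun (tp F c)" using assms(1) by (intro L2_fun_tp) (simp add: symF_def)
  have "(norm (tpL F c))^2 = (LINT x|TM. tp F c x * tp F c x)"
    unfolding power2_norm_eq_inner tpL_def by (rule inner_abs_L2[OF F F])
  then show ?thesis unfolding norm_tpL[OF assms] by (simp add: power2_eq_square)
qed

text \<open>\<open>TD p f f'\<close>: \<open>f\<close> is a trigonometric polynomial with partial derivative \<open>f'\<close>, tracked
  algebraically so that the integral of \<open>f'\<close> over the torus visibly vanishes.\<close>

inductive TD :: "bool \<Rightarrow> (real \<times> real \<Rightarrow> complex) \<Rightarrow> (real \<times> real \<Rightarrow> complex) \<Rightarrow> bool" for p where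
  TD_E: "TD p (\<lambda>x. z * E k x) (\<lambda>x. (\<i> * of_real (ks p k) * z) * E k x)"
| TD_add: "TD p f f' \<Longrightarrow> TD p g g' \<Longrightarrow> TD p (\<lambda>x. f x + g x) (\<lambda>x. f' x + g' x)"

lemma ks_add: "ks p (k + j) = ks p k + ks p j" by (simp add: ks_def ax_def)

lemma TD_mult: "TD p f f' \<Longrightarrow> TD p g g' \<Longrightarrow> TD p (\<lambda>x. f x * g x) (\<lambda>x. f' x * g x + f x * g' x)"
proof (induction arbitrary: g g' rule: TD.induct)
  case (TD_E z k)
  from TD_E show ?case
  proof (induction rule: TD.induct)
    case (TD_E z' k')
    show ?case using TD.TD_E[of p "z * z'" "k + k'"] by (simp add: E_add ks_add algebra_simps)
  next
    case (TD_add f f' g g')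
    then show ?case using TD.TD_add[OF TD_add.IH] by (simp add: algebra_simps)
  qed
next
  case (TD_add f1 f1' f2 f2')
  then show ?case using TD.TD_add[OF TD_add.IH(1)[OF TD_add.prems] TD_add.IH(2)[OF TD_add.prems]] by (simp add: algebra_simps)
qed

lemma TD_integral: "TD p f f' \<Longrightarrow> (LINT x|TM. f' x) = 0 \<and> continuous_on UNIV f'"
proof (induction rule: TD.induct)
  case (TD_E z k)
  have "(LINT x|TM. (\<i> * of_real (ks p k) * z) * E k x) = 0"
    unfolding integral_mult_right_zero integral_E by (cases "k = 0") auto
  then show ?case by (auto intro!: continuous_intros)
next
  case (TD_add f f' g g')
  then show ?case
    by (auto intro!: continuous_intros simp: Bochner_Integration.integral_add TM_integrable_continuous)
qed

lemma TD_tp: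
  assumes "symF F" "symc c" shows "TD p (\<lambda>x. of_real (tp F c x)) (\<lambda>x. of_real (tp F (dd p c) x))"
proof -
  have "TD p (\<lambda>x. \<Sum>k\<in>G. c k * E k x) (\<lambda>x. \<Sum>k\<in>G. dd p c k * E k x)" if "finite G" for G
    using that
  proof induction
    case empty
    show ?case using TD_E[of p 0 0] by simp
  next
    case (insert k G)
    then show ?case using TD_add[OF TD_E[of p "c k" k] insert.IH] by (simp add: dd_def)
  qed
  then show ?thesis using assms by (simp add: tp_sym symc_dd symF_def)
qed

lemma TM_cont: "continuous_on UNIV f \<Longrightarrow> integrable TM f" for f :: "_ \<Rightarrow> real"
  by (rule TM_integrable_continuous)

text \<open>The derivative of f X^3 integrates to 0, where X is the first and Z the second
  derivative of f; so the integral of X^4 is -3 times that of f X^2 Z, and Young's inequality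
  absorbs half of X^4.\<close>

lemma gagliardo_nirenberg:
  assumes F: "symF F" "symc u" and U: "\<And>x. \<bar>tp F u x\<bar> \<le> U"
  shows "(LINT x|TM. (tp F (dd p u) x) ^ 4) \<le> 9 * U^2 * (LINT x|TM. (tp F (dd p (dd p u)) x)^2)"
proof -
  define f where "f = tp F u"
  define X where "X = tp F (dd p u)"
  define Z where "Z = tp F (dd p (dd p u))"
  have ct: "continuous_on UNIV f" "continuous_on UNIV X" "continuous_on UNIV Z"
    unfolding f_def X_def Z_def by (intro continuous_tp continuous_on_id)+
  have "TD p (\<lambda>x. of_real (f x) * (of_real (X x) * (of_real (X x) * of_real (X x))))
    (\<lambda>x. of_real (X x) * (of_real (X x) * (of_real (X x) * of_real (X x)))
      + of_real (f x) * (of_real (Z x) * (of_real (X x) * of_real (X x)) + of_real (X x) * (of_real (Z x) * of_real (X x) + of_real (X x) * of_real (Z x))))"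
    unfolding f_def X_def Z_def using F by (intro TD_mult TD_tp symc_dd)
  from TD_integral[OF this] have "(LINT x|TM. complex_of_real ((X x)^4 + 3 * (f x * (X x)^2 * Z x))) = 0"
    by (simp add: power4_eq_xxxx power2_eq_square algebra_simps)
  then have "(LINT x|TM. (X x)^4 + 3 * (f x * (X x)^2 * Z x)) = 0" by (simp only: integral_complex_of_real of_real_eq_0_iff)
  then have e: "(LINT x|TM. (X x)^4) + (LINT x|TM. 3 * (f x * (X x)^2 * Z x)) = 0"
    by (subst (asm) Bochner_Integration.integral_add) (intro TM_cont continuous_intros ct | assumption)+
  have "- (LINT x|TM. 3 * (f x * (X x)^2 * Z x)) = (LINT x|TM. - (3 * (f x * (X x)^2 * Z x)))" by simp
  also have "\<dots> \<le> (LINT x|TM. 1 / 2 * (X x)^4 + 9 * U^2 / 2 * (Z x)^2)"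
  proof (rule integral_mono)
    fix x
    have "(f x)^2 \<le> U^2" using U[of x] unfolding f_def by (metis abs_ge_zero power2_abs power_mono)
    then have "(f x)^2 * (Z x)^2 \<le> U^2 * (Z x)^2" by (rule mult_right_mono) simp
    moreover have "0 \<le> ((X x)^2 + 3 * (f x * Z x))^2" by simp
    ultimately show "- (3 * (f x * (X x)^2 * Z x)) \<le> 1 / 2 * (X x)^4 + 9 * U^2 / 2 * (Z x)^2"
      by (simp add: power2_sum power_mult_distrib power4_eq_xxxx power2_eq_square algebra_simps)
  qed (intro TM_cont continuous_intros ct)+
  also have "\<dots> = 1 / 2 * (LINT x|TM. (X x)^4) + 9 * U^2 / 2 * (LINT x|TM. (Z x)^2)"
  proof -
    have "integrable TM (\<lambda>x. 1 / 2 * (X x)^4)" "integrable TM (\<lambda>x. 9 * U^2 / 2 * (Z x)^2)"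
      by (intro TM_cont continuous_intros ct)+
    from Bochner_Integration.integral_add[OF this] show ?thesis by (simp only: integral_mult_right_zero)
  qed
  finally show ?thesis using e unfolding X_def Z_def by simp
qed

lemma symc_of: "symc u \<Longrightarrow> symF F \<Longrightarrow> (LINT x|TM. (tp F (dd p u) x)^2) \<le> (2 * pi)^2 * (\<Sum>k\<in>F. (kabs k * cmod (u k))^2)"
  unfolding tp_parseval[OF _ symc_dd] using abs_ks[of p]
  by (intro mult_left_mono sum_mono) (auto simp: dd_def norm_mult intro!: power_mono mult_right_mono)

text \<open>One derivative of the product falls either on the velocity or on the gradient of
  \<open>c\<close>. The first kind is a product of two functions in L4, each interpolated between a
  sup bound and \<open>D\<close>; in the second the velocity is simply bounded by \<open>U\<close>.
  The last hypothesis says that \<phi> is one order smoother than \<open>c\<close>.\<close>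

lemma high_bilinear:
  assumes s: "supp_in n \<phi>" "supp_in n c" "symc \<phi>" "symc c" and U: "0 < U" "\<And>r x. \<bar>tp (Bx (2 * n)) (dd r \<phi>) x\<bar> \<le> U"
    and M: "0 < M" "\<And>x. \<bar>tp (Bx (2 * n)) c x\<bar> \<le> M" and le: "\<And>k. kabs k * cmod (\<phi> k) \<le> cmod (c k)"
  shows "(\<Sum>k\<in>Bx (2 * n). (kabs k * cmod (nlb (Bx (2 * n)) \<phi> c k))^2) \<le> (144 * U * M + 16 * U^2) * (\<Sum>k\<in>Bx (2 * n). (kabs k)^4 * (cmod (c k))^2)"
proof -
  let ?F = "Bx (2 * n)"
  let ?I = "\<lambda>f. LINT x|TM. f x"
  define D where "D = (\<Sum>k\<in>?F. (kabs k)^4 * (cmod (c k))^2)"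
  have nl: "nlb ?F \<psi> c' (- k) = cnj (nlb ?F \<psi> c' k)" if "symc \<psi>" "symc c'" for \<psi> c' k
  proof -
    have "nlb ?F \<psi> c' (- k) = (\<Sum>j\<in>?F. - of_real (crs (- k) (- j)) * \<psi> (- k - (- j)) * c' (- j))"
      unfolding nlb_def by (rule sum_symF[OF symF_Bx, symmetric])
    also have "\<dots> = cnj (nlb ?F \<psi> c' k)"
      unfolding nlb_def cnj_sum
    proof (intro sum.cong refl)
      fix j
      have "- k - (- j) = - (k - j)" by simp
      then show "- of_real (crs (- k) (- j)) * \<psi> (- k - (- j)) * c' (- j) = cnj (- of_real (crs k j) * \<psi> (k - j) * c' j)"
        by (simp only: symcD[OF that(1)] symcD[OF that(2)]) (simp add: crs_def)
    qed
    finally show ?thesis .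
  qed
  define q where "q = nlb ?F \<phi> c"
  have sq: "symc q" unfolding q_def symc_def using nl[OF s(3,4)] by blast
  have D2: "(LINT x|TM. (tp ?F (dd p (dd r c)) x)^2) \<le> (2 * pi)^2 * D" for p r
  proof -
    have "(kabs k * cmod (dd r c k))^2 \<le> (kabs k)^4 * (cmod (c k))^2" for k
    proof -
      have "kabs k * cmod (dd r c k) \<le> kabs k * (kabs k * cmod (c k))"
        unfolding dd_def norm_mult using abs_ks[of r k] by (intro mult_left_mono) (auto intro: mult_right_mono)
      then have "(kabs k * cmod (dd r c k))^2 \<le> (kabs k * (kabs k * cmod (c k)))^2" by (rule power_mono) simp
      then show ?thesis by (simp add: power2_eq_square power4_eq_xxxx mult_ac)
    qed
    then have "(\<Sum>k\<in>?F. (kabs k * cmod (dd r c k))^2) \<le> D" unfolding D_def by (rule sum_mono)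
    then have "(2 * pi)^2 * (\<Sum>k\<in>?F. (kabs k * cmod (dd r c k))^2) \<le> (2 * pi)^2 * D" by simp
    then show ?thesis by (rule order_trans[OF symc_of[OF symc_dd[OF s(4)] symF_Bx]])
  qed
  have D3: "(LINT x|TM. (tp ?F (dd p (dd p (dd r \<phi>))) x)^2) \<le> (2 * pi)^2 * D" for p r
    unfolding tp_parseval[OF symF_Bx symc_dd[OF symc_dd[OF symc_dd[OF s(3)]]]] D_def
  proof (intro mult_left_mono sum_mono)
    fix k
    have "cmod (dd p (dd p (dd r \<phi>)) k) = \<bar>ks p k\<bar> * \<bar>ks p k\<bar> * (\<bar>ks r k\<bar> * cmod (\<phi> k))" by (simp add: dd_def norm_mult)
    also have "\<dots> \<le> kabs k * kabs k * cmod (c k)"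
      using mult_right_mono[OF abs_ks[of r k] norm_ge_zero[of "\<phi> k"]] le[of k]
      by (intro mult_mono abs_ks) auto
    finally have "(cmod (dd p (dd p (dd r \<phi>)) k))^2 \<le> (kabs k * kabs k * cmod (c k))^2" by (rule power_mono) simp
    then show "(cmod (dd p (dd p (dd r \<phi>)) k))^2 \<le> (kabs k)^4 * (cmod (c k))^2"
      by (simp add: power2_eq_square power4_eq_xxxx mult_ac)
  qed simp
  have ct: "continuous_on UNIV (tp ?F v)" for v by (intro continuous_tp continuous_on_id)
  have XY: "?I (\<lambda>x. (tp ?F (dd p (dd r \<phi>)) x * tp ?F (dd r' c) x)^2) \<le> 9 * U * M * ((2 * pi)^2 * D)" for p r r'
  proof -
    let ?X = "tp ?F (dd p (dd r \<phi>))" and ?Y = "tp ?F (dd r' c)"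
    have X4: "?I (\<lambda>x. (?X x)^4) \<le> 9 * U^2 * ((2 * pi)^2 * D)"
      by (rule order_trans[OF gagliardo_nirenberg[OF symF_Bx symc_dd[OF s(3)] U(2)]]) (intro mult_left_mono D3; simp)
    have Y4: "?I (\<lambda>x. (?Y x)^4) \<le> 9 * M^2 * ((2 * pi)^2 * D)"
      by (rule order_trans[OF gagliardo_nirenberg[OF symF_Bx s(4) M(2)]]) (intro mult_left_mono D2; simp)
    \<comment> \<open>The weights M/U and U/M balance the two fourth powers, which are of size U^2 D
      and M^2 D, and leave a bound linear in \<open>U\<close>.\<close>
    have "?I (\<lambda>x. (?X x * ?Y x)^2) \<le> ?I (\<lambda>x. M / U / 2 * (?X x)^4 + U / M / 2 * (?Y x)^4)"
    proof (rule integral_mono)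
      fix x
      have "0 \<le> (M * (?X x)^2 - U * (?Y x)^2)^2" by simp
      then have "2 * (M * U) * (?X x * ?Y x)^2 \<le> M^2 * (?X x)^4 + U^2 * (?Y x)^4"
        by (simp add: power2_diff power_mult_distrib power4_eq_xxxx power2_eq_square algebra_simps)
      then show "(?X x * ?Y x)^2 \<le> M / U / 2 * (?X x)^4 + U / M / 2 * (?Y x)^4"
        using U(1) M(1) by (simp add: field_simps power2_eq_square)
    qed (intro TM_cont continuous_intros ct)+
    also have "\<dots> = M / U / 2 * ?I (\<lambda>x. (?X x)^4) + U / M / 2 * ?I (\<lambda>x. (?Y x)^4)"
    proof -
      have "integrable TM (\<lambda>x. r * (tp ?F v x)^4)" for r v by (intro TM_cont continuous_intros ct)
      from Bochner_Integration.integral_add[OF this this] show ?thesis by (simp only: integral_mult_right_zero)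
    qed
    also have "\<dots> \<le> M / U / 2 * (9 * U^2 * ((2 * pi)^2 * D)) + U / M / 2 * (9 * M^2 * ((2 * pi)^2 * D))"
      using U(1) M(1) by (intro add_mono mult_left_mono X4 Y4) auto
    also have "\<dots> = 9 * U * M * ((2 * pi)^2 * D)" using U(1) M(1) by (simp add: power2_eq_square)
    finally show ?thesis .
  qed
  have ZW: "?I (\<lambda>x. (tp ?F (dd r \<phi>) x * tp ?F (dd r' (dd p c)) x)^2) \<le> U^2 * ((2 * pi)^2 * D)" for p r r'
  proof -
    have "?I (\<lambda>x. (tp ?F (dd r \<phi>) x * tp ?F (dd r' (dd p c)) x)^2) \<le> ?I (\<lambda>x. U^2 * (tp ?F (dd r' (dd p c)) x)^2)"
      unfolding power_mult_distrib using U
      by (intro integral_mono TM_cont continuous_intros ct mult_right_mono) (auto simp flip: abs_le_square_iff)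
    also have "\<dots> \<le> U^2 * ((2 * pi)^2 * D)" unfolding integral_mult_right_zero by (intro mult_left_mono D2) simp
    finally show ?thesis .
  qed
  have dq: "(LINT x|TM. (tp ?F (dd p q) x)^2) \<le> (72 * U * M + 8 * U^2) * ((2 * pi)^2 * D)" for p
  proof -
    let ?A = "\<lambda>x. tp ?F (dd p (dd True \<phi>)) x * tp ?F (dd False c) x" and ?B = "\<lambda>x. tp ?F (dd p (dd False \<phi>)) x * tp ?F (dd True c) x"
    let ?C = "\<lambda>x. tp ?F (dd True \<phi>) x * tp ?F (dd False (dd p c)) x" and ?D = "\<lambda>x. tp ?F (dd False \<phi>) x * tp ?F (dd True (dd p c)) x"
    have "dd p q = (\<lambda>k. nlb ?F (dd p \<phi>) c k + nlb ?F \<phi> (dd p c) k)"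
    proof
      fix k
      have "ks p k = ks p (k - j) + ks p j" for j by (simp add: ks_def ax_def)
      then show "dd p q k = nlb ?F (dd p \<phi>) c k + nlb ?F \<phi> (dd p c) k"
        unfolding q_def dd_def nlb_def sum_distrib_left sum.distrib[symmetric]
        by (intro sum.cong refl) (simp add: ks_def ax_def algebra_simps)
    qed
    then have "tp ?F (dd p q) x = (?A x - ?B x) + (?C x - ?D x)" for x
      by (simp only: tp_add tp_nlb[OF supp_dd[OF s(1)] s(2) symc_dd[OF s(3)] s(4)] tp_nlb[OF s(1) supp_dd[OF s(2)] s(3) symc_dd[OF s(4)]] dd_dd[of _ p \<phi>])
    then have "?I (\<lambda>x. (tp ?F (dd p q) x)^2) = ?I (\<lambda>x. ((?A x - ?B x) + (?C x - ?D x))^2)" by simp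
    also have "\<dots> \<le> ?I (\<lambda>x. 4 * (?A x)^2 + 4 * (?B x)^2 + (4 * (?C x)^2 + 4 * (?D x)^2))"
    proof (rule integral_mono)
      have "((a - b) + (e - d))^2 \<le> 4 * a^2 + 4 * b^2 + (4 * e^2 + 4 * d^2)" for a b e d :: real
      proof -
        have "0 \<le> (a + b)^2 + (a - e)^2 + (a + d)^2 + (b + e)^2 + (b - d)^2 + (e + d)^2" by simp
        then show ?thesis by (simp add: power2_eq_square algebra_simps)
      qed
      then show "((?A x - ?B x) + (?C x - ?D x))^2 \<le> 4 * (?A x)^2 + 4 * (?B x)^2 + (4 * (?C x)^2 + 4 * (?D x)^2)" for x by blast
    qed (intro TM_cont continuous_intros ct)+
    also have "\<dots> = (4 * ?I (\<lambda>x. (?A x)^2) + 4 * ?I (\<lambda>x. (?B x)^2)) + (4 * ?I (\<lambda>x. (?C x)^2) + 4 * ?I (\<lambda>x. (?D x)^2))"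
    proof -
      have i: "integrable TM (\<lambda>x. 4 * (tp ?F u x * tp ?F v x)^2)" for u v by (intro TM_cont continuous_intros ct)
      show ?thesis
        unfolding Bochner_Integration.integral_add[OF Bochner_Integration.integrable_add[OF i i] Bochner_Integration.integrable_add[OF i i]]
          Bochner_Integration.integral_add[OF i i] integral_mult_right_zero ..
    qed
    also have "\<dots> \<le> (4 * (9 * U * M * ((2 * pi)^2 * D)) + 4 * (9 * U * M * ((2 * pi)^2 * D))) + (4 * (U^2 * ((2 * pi)^2 * D)) + 4 * (U^2 * ((2 * pi)^2 * D)))"
      by (intro add_mono mult_left_mono XY ZW) auto
    also have "\<dots> = (72 * U * M + 8 * U^2) * ((2 * pi)^2 * D)" by (simp add: algebra_simps)
    finally show ?thesis .
  qed
  have "(\<Sum>k\<in>?F. (kabs k * cmod (q k))^2) = (\<Sum>k\<in>?F. (cmod (dd True q k))^2) + (\<Sum>k\<in>?F. (cmod (dd False q k))^2)"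
    unfolding sum.distrib[symmetric]
    by (intro sum.cong refl) (simp add: power_mult_distrib ks_squares[of _ True] dd_def norm_mult distrib_right)
  moreover have "(2 * pi)^2 * (\<Sum>k\<in>?F. (cmod (dd p q k))^2) \<le> (2 * pi)^2 * ((72 * U * M + 8 * U^2) * D)" for p
    using dq[of p] unfolding tp_parseval[OF symF_Bx symc_dd[OF sq]] by (simp only: mult.left_commute)
  then have "(\<Sum>k\<in>?F. (cmod (dd p q k))^2) \<le> (72 * U * M + 8 * U^2) * D" for p by simp
  note this[of True] this[of False]
  ultimately show ?thesis unfolding q_def D_def by (simp add: algebra_simps)
qed

section \<open>Splitting the stream function by scales: \<open>mlt S\<close> keeps those in
  \<open>S\<close>\<close>

definition mlt :: "real set \<Rightarrow> coef \<Rightarrow> coef" where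
  "mlt S c k = of_real (2 / sqrt pi * mS S (kabs k)) * c k"

lemma powr_integral:
  fixes \<alpha> \<sigma> :: real
  assumes "0 < \<alpha>" "0 < \<sigma>"
  shows "has_bochner_integral lborel (\<lambda>s. indicator {0<..\<sigma>} s * s powr (\<alpha> - 1)) (\<sigma> powr \<alpha> / \<alpha>)"
proof (rule has_bochner_integral_nn_integral)
  have "((\<lambda>s. s powr (\<alpha> - 1)) has_integral (\<sigma> powr \<alpha> / \<alpha>)) {0..\<sigma>}"
    using has_integral_powr_from_0[of "\<alpha> - 1" \<sigma>] assms by simp
  then have "(\<integral>\<^sup>+s. ennreal (indicator {0..\<sigma>} s * s powr (\<alpha> - 1)) \<partial>lborel) = ennreal (\<sigma> powr \<alpha> / \<alpha>)"
    by (intro nn_integral_has_integral_lebesgue) auto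
  also have "(\<lambda>s. indicator {0..\<sigma>} s * s powr (\<alpha> - 1)) = (\<lambda>s. indicator {0<..\<sigma>} s * s powr (\<alpha> - 1))"
    by (auto simp: fun_eq_iff indicator_def)
  finally show "(\<integral>\<^sup>+s. ennreal (indicator {0<..\<sigma>} s * s powr (\<alpha> - 1)) \<partial>lborel) = ennreal (\<sigma> powr \<alpha> / \<alpha>)" .
qed (use assms in \<open>auto intro!: AE_I2\<close>)

text \<open>Integrating the gradient bound 2 B s^(\<alpha> - 1) of \<open>hc_holder\<close> over the
  scales up to \<sigma> gives a positive power of \<sigma>; this is where Hoelder regularity becomes
  smallness of the velocity.\<close>

lemma high_velocity:
  assumes F: "finite F" "0 \<notin> F" and h: "\<And>x h. \<bar>tp F (sh h c) x\<bar> \<le> B * norm h powr \<alpha>" and al: "0 < \<alpha>" "\<alpha> \<le> 1" and sg: "0 < \<sigma>"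
  shows "\<bar>tp F (dd p (mlt {0<..\<sigma>} c)) x\<bar> \<le> 4 * B / (sqrt pi * \<alpha>) * \<sigma> powr \<alpha>"
proof -
  have hb: "has_bochner_integral lborel (\<lambda>s. indicator {0<..\<sigma>} s * tp F (hc s (dd p c)) x) (tp F (\<lambda>k. of_real (mS {0<..\<sigma>} (kabs k)) * dd p c k) x)"
    by (rule tp_hc_integral[OF F(2)]) auto
  note hp = powr_integral[OF al(1) sg]
  have "\<bar>tp F (\<lambda>k. of_real (mS {0<..\<sigma>} (kabs k)) * dd p c k) x\<bar> \<le> (LINT s|lborel. \<bar>indicator {0<..\<sigma>} s * tp F (hc s (dd p c)) x\<bar>)"
    using hb integral_abs_bound unfolding has_bochner_integral_iff by metis
  also have "\<dots> \<le> (LINT s|lborel. 2 * B * (indicator {0<..\<sigma>} s * s powr (\<alpha> - 1)))"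
  proof (rule integral_mono)
    fix s :: real
    show "\<bar>indicator {0<..\<sigma>} s * tp F (hc s (dd p c)) x\<bar> \<le> 2 * B * (indicator {0<..\<sigma>} s * s powr (\<alpha> - 1))"
      using hc_holder[OF F h _ al, of s p x] unfolding dd_hc by (cases "s \<in> {0<..\<sigma>}") auto
  qed (use hb hp in \<open>auto simp: has_bochner_integral_iff integrable_abs\<close>)
  also have "\<dots> = 2 * B * (\<sigma> powr \<alpha> / \<alpha>)" using hp by (simp add: has_bochner_integral_iff)
  finally have "2 / sqrt pi * \<bar>tp F (\<lambda>k. of_real (mS {0<..\<sigma>} (kabs k)) * dd p c k) x\<bar> \<le> 2 / sqrt pi * (2 * B * (\<sigma> powr \<alpha> / \<alpha>))"
    by (rule mult_left_mono) simp
  note bound = this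
  have "dd p (mlt {0<..\<sigma>} c) = (\<lambda>k. of_real (2 / sqrt pi) * (of_real (mS {0<..\<sigma>} (kabs k)) * dd p c k))"
    unfolding mlt_def dd_def of_real_mult by (simp only: mult_ac)
  then have "tp F (dd p (mlt {0<..\<sigma>} c)) x = 2 / sqrt pi * tp F (\<lambda>k. of_real (mS {0<..\<sigma>} (kabs k)) * dd p c k) x" by (simp only: tp_scale)
  moreover have "2 / sqrt pi * (2 * B * (\<sigma> powr \<alpha> / \<alpha>)) = 4 * B / (sqrt pi * \<alpha>) * \<sigma> powr \<alpha>" by simp
  ultimately show ?thesis using bound by (simp only: abs_mult abs_divide abs_numeral real_sqrt_abs2 abs_of_nonneg[OF real_sqrt_ge_zero[OF pi_ge_zero]])
qed

lemma mS_nonneg: "0 \<le> mS S r" unfolding mS_def by (rule Bochner_Integration.integral_nonneg) simp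

lemma mS_split:
  assumes "0 < r" "0 < \<sigma>" shows "mS {0<..\<sigma>} r + mS {\<sigma><..} r = sqrt pi / 2 / r"
proof -
  have "has_bochner_integral lborel (\<lambda>s. indicator {0<..\<sigma>} s * exp (- (s * r)\<^sup>2) + indicator {\<sigma><..} s * exp (- (s * r)\<^sup>2)) (mS {0<..\<sigma>} r + mS {\<sigma><..} r)"
    using assms by (intro has_bochner_integral_add mS_integral) auto
  also have "(\<lambda>s. indicator {0<..\<sigma>} s * exp (- (s * r)\<^sup>2) + indicator {\<sigma><..} s * exp (- (s * r)\<^sup>2)) = (\<lambda>s. pos_ind s * exp (- (s * r)\<^sup>2))"
    using assms(2) by (auto simp: fun_eq_iff indicator_def)
  finally show ?thesis using gauss_scale[OF assms(1)] by (simp add: has_bochner_integral_iff)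
qed

text \<open>From exp (- y) \<le> 27/y^3 with y = (s r)^2. Half of the decay in s is spent on making
  the remaining integral convergent by comparison with 1/(\<sigma>^2 + s^2), the rest yields the
  power of 1/\<sigma>.\<close>

lemma mS_low:
  assumes "0 < r" "0 < \<sigma>" shows "mS {\<sigma><..} r \<le> 54 * cI / \<sigma>^5 * (1 / r^6)"
proof -
  have hb: "has_bochner_integral lborel (\<lambda>s. 54 / (r^6 * \<sigma>^4) * (pos_ind s * (1 / (\<sigma>^2 + s^2)))) (54 / (r^6 * \<sigma>^4) * (cI / \<sigma>))"
    by (intro has_bochner_integral_mult_right cauchy_scale assms)
  have "mS {\<sigma><..} r \<le> (LINT s|lborel. 54 / (r^6 * \<sigma>^4) * (pos_ind s * (1 / (\<sigma>^2 + s^2))))"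
    unfolding mS_def
  proof (rule integral_mono)
    show "integrable lborel (\<lambda>s. indicator {\<sigma><..} s * exp (- (s * r)\<^sup>2))"
      using mS_integral[of "{\<sigma><..}" r] assms by (auto simp: has_bochner_integral_iff)
    fix s :: real
    show "indicator {\<sigma><..} s * exp (- (s * r)\<^sup>2) \<le> 54 / (r^6 * \<sigma>^4) * (pos_ind s * (1 / (\<sigma>^2 + s^2)))"
    proof (cases "\<sigma> < s")
      case True
      define y where "y = (s * r)^2"
      have y: "0 < y" using True assms by (simp add: y_def)
      have "y / 3 \<le> exp (y / 3)" using exp_ge_add_one_self[of "y / 3"] by linarith
      then have "(y / 3)^3 \<le> exp (y / 3)^3" using y by (intro power_mono) auto
      also have "\<dots> = exp y" by (simp flip: exp_of_nat_mult)
      finally have "y^3 / 27 \<le> exp y" by (simp add: power_divide)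
      then have "exp (- y) \<le> 27 / y^3" using y by (simp add: exp_minus field_simps)
      also have "27 / y^3 = 27 / (r^6 * s^4) * (1 / s^2)" unfolding y_def by (simp add: power_mult_distrib mult_ac flip: power_mult power_add)
      also have "\<dots> \<le> 27 / (r^6 * \<sigma>^4) * (2 * (1 / (\<sigma>^2 + s^2)))"
      proof (rule mult_mono)
        show "27 / (r^6 * s^4) \<le> 27 / (r^6 * \<sigma>^4)"
          using True assms by (intro divide_left_mono mult_left_mono power_mono mult_pos_pos zero_less_power) auto
        have "\<sigma>^2 \<le> s^2" using True assms by (intro power_mono) auto
        then show "1 / s^2 \<le> 2 * (1 / (\<sigma>^2 + s^2))" using True assms by (simp add: divide_simps add_pos_pos)
      qed (use assms in auto)
      finally show ?thesis using True assms unfolding y_def by simp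
    qed (use assms in simp)
  qed (use hb in \<open>simp add: has_bochner_integral_iff\<close>)
  also have "\<dots> = 54 * cI / \<sigma>^5 * (1 / r^6)" using hb assms by (simp add: has_bochner_integral_iff eval_nat_numeral)
  finally show ?thesis .
qed

lemma mlt_cmod: "cmod (mlt S c k) = 2 / sqrt pi * mS S (kabs k) * cmod (c k)"
proof -
  have "0 \<le> 2 / sqrt pi * mS S (kabs k)" by (simp add: mS_nonneg)
  then show ?thesis unfolding mlt_def norm_mult norm_of_real by (simp only: abs_of_nonneg)
qed

lemma mlt_high_le: "0 < \<sigma> \<Longrightarrow> kabs k * cmod (mlt {0<..\<sigma>} c k) \<le> cmod (c k)"
proof (cases "k = 0")
  case False
  assume s: "0 < \<sigma>"
  have k: "0 < kabs k" using False by (rule kabs_pos)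
  have "kabs k * mS {0<..\<sigma>} (kabs k) \<le> kabs k * (sqrt pi / 2 / kabs k)"
    using mS_split[OF k s] mS_nonneg[of "{\<sigma><..}" "kabs k"] by (intro mult_left_mono) auto
  then have "kabs k * (2 / sqrt pi * mS {0<..\<sigma>} (kabs k)) \<le> 1" using k False by (simp add: field_simps)
  then have "kabs k * (2 / sqrt pi * mS {0<..\<sigma>} (kabs k)) * cmod (c k) \<le> 1 * cmod (c k)" by (rule mult_right_mono) simp
  then show ?thesis unfolding mlt_cmod by (simp only: mult.assoc mult_1_left)
qed simp

text \<open>The symbol of the large scales decays like |k|^-6, so even after two derivatives an l1
  bound follows from the sup of the coefficients.\<close>

lemma mlt_low_sum:
  assumes F: "finite F" "0 \<notin> F" and cL: "\<And>k. k \<in> F \<Longrightarrow> cmod (c k) \<le> L" and sg: "0 < \<sigma>" and L: "0 \<le> L"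
  shows "(\<Sum>k\<in>F. (kabs k)^2 * cmod (mlt {\<sigma><..} c k)) \<le> 108 * cI / (sqrt pi * \<sigma>^5) * L * Z4^2"
proof -
  have "(\<Sum>k\<in>F. (kabs k)^2 * cmod (mlt {\<sigma><..} c k)) \<le> (\<Sum>k\<in>F. 108 * cI / (sqrt pi * \<sigma>^5) * L * kabs k powr (- 4))"
  proof (rule sum_mono)
    fix k assume k: "k \<in> F"
    then have kp: "0 < kabs k" using F by (intro kabs_pos) auto
    have "(kabs k)^2 * cmod (mlt {\<sigma><..} c k) = (kabs k)^2 * (2 / sqrt pi * mS {\<sigma><..} (kabs k)) * cmod (c k)"
      unfolding mlt_cmod by (simp only: mult.assoc)
    also have "\<dots> \<le> (kabs k)^2 * (2 / sqrt pi * (54 * cI / \<sigma>^5 * (1 / (kabs k)^6))) * L"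
      using cI_nonneg sg kp by (intro mult_mono mult_left_mono mS_low cL k mult_nonneg_nonneg) auto
    also have "\<dots> = 108 * cI / (sqrt pi * \<sigma>^5) * L * ((kabs k)^2 * (1 / (kabs k)^6))" by (simp add: mult_ac)
    also have "(kabs k)^2 * (1 / (kabs k)^6) = kabs k powr (- 4)" using kp by (simp add: powr_minus eval_nat_numeral field_simps)
    finally show "(kabs k)^2 * cmod (mlt {\<sigma><..} c k) \<le> 108 * cI / (sqrt pi * \<sigma>^5) * L * kabs k powr (- 4)" .
  qed
  also have "\<dots> \<le> 108 * cI / (sqrt pi * \<sigma>^5) * L * Z4^2"
    unfolding sum_distrib_left[symmetric] using cI_nonneg sg L by (intro mult_left_mono Z4_sum F) auto
  finally show ?thesis .
qed

lemma st_split: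
  assumes "supp_in n c" "0 < \<sigma>" shows "st c k = mlt {0<..\<sigma>} c k + mlt {\<sigma><..} c k"
proof (cases "k = 0")
  case True
  then have "c k = 0" using supp_inD[OF assms(1)] by simp
  then show ?thesis by (simp add: st_def mlt_def)
next
  case False
  have "2 / sqrt pi * mS {0<..\<sigma>} (kabs k) + 2 / sqrt pi * mS {\<sigma><..} (kabs k) = 2 / sqrt pi * (sqrt pi / 2 / kabs k)"
    unfolding mS_split[OF kabs_pos[OF False] assms(2), symmetric] by (rule distrib_left[symmetric])
  also have "\<dots> = 1 / kabs k" by simp
  finally show ?thesis unfolding st_def mlt_def distrib_right[symmetric] of_real_add[symmetric] by simp
qed

text \<open>The trilinear form is antisymmetric in \<open>j\<close> and \<open>k\<close>, so only
  differences of the weight survive. For a constant weight this is conservation of the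
  \<open>L2\<close> norm by transport.\<close>

lemma nlb_antisym:
  assumes "symc \<phi>"
  shows "(\<Sum>k\<in>F. W k * inner (c k) (nlb F \<phi> c k)) = (\<Sum>k\<in>F. \<Sum>j\<in>F. (W k - W j) * (- crs k j * Re (\<phi> (k - j) * c j * cnj (c k)))) / 2"
proof -
  define A where "A = (\<lambda>k j. - crs k j * Re (\<phi> (k - j) * c j * cnj (c k)))"
  have e: "inner (c k) (nlb F \<phi> c k) = (\<Sum>j\<in>F. A k j)" for k
    unfolding nlb_def inner_sum_right A_def
    by (intro sum.cong refl) (simp add: inner_complex_def algebra_simps)
  have as: "A j k = - A k j" for k j
  proof -
    have "\<phi> (j - k) = cnj (\<phi> (k - j))" using symcD[OF assms, of "k - j"] by simp
    then show ?thesis unfolding A_def crs_diff(3)[of j k] by (simp add: algebra_simps)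
  qed
  have "(\<Sum>k\<in>F. \<Sum>j\<in>F. W j * A k j) = (\<Sum>k\<in>F. \<Sum>j\<in>F. W k * A j k)" by (rule sum.swap)
  also have "\<dots> = - (\<Sum>k\<in>F. \<Sum>j\<in>F. W k * A k j)"
    unfolding sum_negf[symmetric] by (intro sum.cong refl) (metis as mult_minus_right)
  finally have "(\<Sum>k\<in>F. \<Sum>j\<in>F. (W k - W j) * A k j) = 2 * (\<Sum>k\<in>F. \<Sum>j\<in>F. W k * A k j)"
    by (simp add: left_diff_distrib sum_subtractf)
  moreover have "(\<Sum>k\<in>F. W k * inner (c k) (nlb F \<phi> c k)) = (\<Sum>k\<in>F. \<Sum>j\<in>F. W k * A k j)" unfolding e sum_distrib_left ..
  ultimately have "(\<Sum>k\<in>F. W k * inner (c k) (nlb F \<phi> c k)) = (\<Sum>k\<in>F. \<Sum>j\<in>F. (W k - W j) * A k j) / 2" by linarith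
  then show ?thesis unfolding A_def .
qed

text \<open>Schur's test for a convolution kernel of l1 norm at most \<open>P\<close>; the parameter
  \<open>l\<close> distributes the cost between the two factors.\<close>

lemma young_sum:
  fixes p u v :: "int \<times> int \<Rightarrow> real"
  assumes p: "\<And>k. 0 \<le> p k" "\<And>k. k \<notin> F \<Longrightarrow> p k = 0" and F: "symF F" and P: "(\<Sum>k\<in>F. p k) \<le> P" and l: "0 < l" and P0: "0 \<le> P"
  shows "(\<Sum>k\<in>F. \<Sum>j\<in>F. p (k - j) * (u k * v j)) \<le> P * (l * (\<Sum>k\<in>F. (u k)^2) + (\<Sum>k\<in>F. (v k)^2) / l) / 2"
proof -
  have fin: "finite F" using F by (simp add: symF_def)
  have 1: "(\<Sum>j\<in>F. p (f j)) \<le> P" if "inj f" for f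
  proof -
    have "(\<Sum>j\<in>F. p (f j)) = (\<Sum>m\<in>f ` F. p m)" using that by (subst sum.reindex) (auto intro: inj_on_subset)
    also have "\<dots> = (\<Sum>m\<in>f ` F \<inter> F. p m)" using fin p(2) by (intro sum.mono_neutral_right) auto
    also have "\<dots> \<le> (\<Sum>m\<in>F. p m)" using fin p(1) by (intro sum_mono2) auto
    finally show ?thesis using P by linarith
  qed
  have "(\<Sum>k\<in>F. \<Sum>j\<in>F. p (k - j) * (u k * v j)) \<le> (\<Sum>k\<in>F. \<Sum>j\<in>F. (l / 2 * (u k)^2) * p (k - j) + ((v j)^2 / (2 * l)) * p (k - j))"
  proof (intro sum_mono)
    fix k j
    have "0 \<le> (l * u k - v j)^2" by simp
    then have "u k * v j \<le> l / 2 * (u k)^2 + (v j)^2 / (2 * l)" using l by (simp add: power2_diff field_simps power2_eq_square)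
    from mult_left_mono[OF this p(1)[of "k - j"]]
    show "p (k - j) * (u k * v j) \<le> (l / 2 * (u k)^2) * p (k - j) + ((v j)^2 / (2 * l)) * p (k - j)" by (simp add: algebra_simps)
  qed
  also have "\<dots> = (\<Sum>k\<in>F. (l / 2 * (u k)^2) * (\<Sum>j\<in>F. p (k - j))) + (\<Sum>j\<in>F. ((v j)^2 / (2 * l)) * (\<Sum>k\<in>F. p (k - j)))"
    unfolding sum.distrib sum_distrib_left by (subst (2) sum.swap) simp
  also have "\<dots> \<le> (\<Sum>k\<in>F. (l / 2 * (u k)^2) * P) + (\<Sum>j\<in>F. ((v j)^2 / (2 * l)) * P)"
    using l by (intro add_mono sum_mono mult_left_mono 1) (auto simp: inj_def)
  also have "\<dots> = P * (l * (\<Sum>k\<in>F. (u k)^2) + (\<Sum>k\<in>F. (v k)^2) / l) / 2"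
    unfolding sum_distrib_right[symmetric] sum_distrib_left[symmetric] sum_divide_distrib[symmetric] using l by (simp add: field_simps)
  finally show ?thesis .
qed

lemma cube_diff:
  fixes x y m :: real
  assumes "0 \<le> x" "0 \<le> y" "\<bar>x - y\<bar> \<le> m"
  shows "\<bar>x^3 - y^3\<bar> \<le> 3 / 2 * m * (x^2 + y^2)"
proof -
  have "x^3 - y^3 = (x - y) * (x^2 + x * y + y^2)" by (simp add: power3_eq_cube power2_eq_square algebra_simps)
  then have "\<bar>x^3 - y^3\<bar> = \<bar>x - y\<bar> * (x^2 + x * y + y^2)" using assms by (simp add: abs_mult)
  also have "\<dots> \<le> m * (3 / 2 * (x^2 + y^2))"
    using assms zero_le_power2[of "x - y"] by (intro mult_mono) (auto simp: power2_diff)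
  finally show ?thesis by (simp add: algebra_simps)
qed

text \<open>The difference of cubes gains one factor |k - j| and the cross product another, so both
  derivatives land on \<phi>. What is left on \<open>c\<close> is |k|^2 on one factor and |j| on the
  other, one power less than the dissipation allows.\<close>

lemma low_bilinear:
  assumes s: "supp_in n \<phi>" "symc \<phi>" and P: "(\<Sum>k\<in>Bx (2 * n). (kabs k)^2 * cmod (\<phi> k)) \<le> P" and l: "0 < l"
  shows "\<bar>\<Sum>k\<in>Bx (2 * n). (kabs k)^3 * inner (c k) (nlb (Bx (2 * n)) \<phi> c k)\<bar>
    \<le> 3 / 4 * P * (l * (\<Sum>k\<in>Bx (2 * n). (kabs k)^4 * (cmod (c k))^2) + (\<Sum>k\<in>Bx (2 * n). (kabs k * cmod (c k))^2) / l)"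
proof -
  let ?F = "Bx (2 * n)"
  define p where "p = (\<lambda>k. (kabs k)^2 * cmod (\<phi> k))"
  define u where "u = (\<lambda>k. (kabs k)^2 * cmod (c k))"
  define v where "v = (\<lambda>k. kabs k * cmod (c k))"
  have p: "0 \<le> p k" "k \<notin> ?F \<Longrightarrow> p k = 0" for k
    using supp_inD[OF s(1), of k] Bx_mono[of n "2 * n"] by (auto simp: p_def)
  have P0: "0 \<le> P" using P by (rule order_trans[rotated]) (simp add: sum_nonneg)
  have sy: "p (j - k) = p (k - j)" for k j
    using symcD[OF s(2), of "k - j"] kabs_uminus[of "k - j"] unfolding p_def by simp
  have tm: "\<bar>((kabs k)^3 - (kabs j)^3) * (- crs k j * Re (\<phi> (k - j) * c j * cnj (c k)))\<bar> \<le> 3 / 2 * (p (k - j) * (u k * v j)) + 3 / 2 * (p (j - k) * (u j * v k))" for k j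
  proof -
    let ?m = "kabs (k - j)"
    have tri: "\<bar>kabs k - kabs j\<bar> \<le> ?m"
      using kabs_triangle[of "k - j" j] kabs_triangle[of "j - k" k] kabs_uminus[of "k - j"] by simp
    have c1: "\<bar>crs k j\<bar> \<le> ?m * kabs j" using abs_crs[of "k - j" j] crs_diff(1)[of k j] by simp
    have c2: "\<bar>crs k j\<bar> \<le> ?m * kabs k" using abs_crs[of k "k - j"] crs_diff(2)[of k j] by (simp add: mult.commute)
    have R: "\<bar>Re (\<phi> (k - j) * c j * cnj (c k))\<bar> \<le> cmod (\<phi> (k - j)) * cmod (c j) * cmod (c k)"
      using abs_Re_le_cmod[of "\<phi> (k - j) * c j * cnj (c k)"] by (simp add: norm_mult)
    have "\<bar>((kabs k)^3 - (kabs j)^3) * (- crs k j * Re (\<phi> (k - j) * c j * cnj (c k)))\<bar>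
       = \<bar>(kabs k)^3 - (kabs j)^3\<bar> * \<bar>crs k j\<bar> * \<bar>Re (\<phi> (k - j) * c j * cnj (c k))\<bar>" by (simp add: abs_mult)
    also have "\<dots> \<le> (3 / 2 * ?m * ((kabs k)^2 + (kabs j)^2)) * \<bar>crs k j\<bar> * (cmod (\<phi> (k - j)) * cmod (c j) * cmod (c k))"
      by (intro mult_mono R cube_diff kabs_nonneg tri order_refl mult_nonneg_nonneg) auto
    also have "\<dots> = (3 / 2 * ?m * cmod (\<phi> (k - j)) * cmod (c j) * cmod (c k)) * ((kabs k)^2 * \<bar>crs k j\<bar> + (kabs j)^2 * \<bar>crs k j\<bar>)"
      by (simp add: algebra_simps)
    also have "\<dots> \<le> (3 / 2 * ?m * cmod (\<phi> (k - j)) * cmod (c j) * cmod (c k)) * ((kabs k)^2 * (?m * kabs j) + (kabs j)^2 * (?m * kabs k))"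
      by (intro mult_left_mono add_mono c1 c2) auto
    also have "\<dots> = 3 / 2 * (p (k - j) * (u k * v j)) + 3 / 2 * (p (k - j) * (u j * v k))"
      unfolding p_def u_def v_def by (simp add: power2_eq_square algebra_simps)
    finally show ?thesis unfolding sy[of j k] .
  qed
  have "\<bar>\<Sum>k\<in>?F. (kabs k)^3 * inner (c k) (nlb ?F \<phi> c k)\<bar>
    = \<bar>\<Sum>k\<in>?F. \<Sum>j\<in>?F. ((kabs k)^3 - (kabs j)^3) * (- crs k j * Re (\<phi> (k - j) * c j * cnj (c k)))\<bar> / 2"
    unfolding nlb_antisym[OF s(2)] by simp
  also have "\<dots> \<le> (\<Sum>k\<in>?F. \<Sum>j\<in>?F. 3 / 2 * (p (k - j) * (u k * v j)) + 3 / 2 * (p (j - k) * (u j * v k))) / 2"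
    by (intro divide_right_mono order_trans[OF sum_abs] sum_mono tm) simp
  also have "(\<Sum>k\<in>?F. \<Sum>j\<in>?F. 3 / 2 * (p (k - j) * (u k * v j)) + 3 / 2 * (p (j - k) * (u j * v k)))
    = 3 * (\<Sum>k\<in>?F. \<Sum>j\<in>?F. p (k - j) * (u k * v j))"
    unfolding sum.distrib sum_distrib_left[symmetric] by (subst (2) sum.swap) simp
  also have "\<dots> / 2 \<le> 3 * (P * (l * (\<Sum>k\<in>?F. (u k)^2) + (\<Sum>k\<in>?F. (v k)^2) / l) / 2) / 2"
    by (intro divide_right_mono mult_left_mono young_sum[OF p symF_Bx P[folded p_def] l P0]) auto
  also have "(\<Sum>k\<in>?F. (u k)^2) = (\<Sum>k\<in>?F. (kabs k)^4 * (cmod (c k))^2)"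
    unfolding u_def by (simp add: power_mult_distrib flip: power_mult)
  finally show ?thesis unfolding v_def by simp
qed

section \<open>Energy balances\<close>

lemma growth_bound:
  fixes y :: "real \<Rightarrow> real"
  assumes d: "\<And>s. s \<in> {a..b} \<Longrightarrow> (y has_real_derivative D s) (at s within {a..b})" and le: "\<And>s. s \<in> {a..b} \<Longrightarrow> D s \<le> C"
    and t: "a \<le> t" "t \<le> b"
  shows "y t \<le> y a + C * (t - a)"
proof -
  have "y t - C * t \<le> y a - C * a"
  proof (rule DERIV_nonpos_imp_decreasing_open[OF t(1)])
    fix s assume s: "a < s" "s < t"
    then have "(y has_real_derivative D s) (at s)" using d[of s] t at_within_Icc_at[of a s b] by simp
    then have "((\<lambda>s. y s - C * s) has_real_derivative D s - C * 1) (at s)"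
      by (intro DERIV_diff DERIV_cmult DERIV_ident)
    then show "\<exists>z. ((\<lambda>s. y s - C * s) has_real_derivative z) (at s) \<and> z \<le> 0" using le[of s] s t by auto
  next
    have "continuous_on {a..b} y" using d by (intro DERIV_continuous_on)
    then have "continuous_on {a..t} y" by (rule continuous_on_subset) (use t in auto)
    then show "continuous_on {a..t} (\<lambda>s. y s - C * s)" by (intro continuous_intros)
  qed
  then show ?thesis by (simp add: algebra_simps)
qed

lemma (in evol_base) energy_deriv:
  assumes t: "t \<in> {a..b}"
  shows "((\<lambda>t. \<Sum>k\<in>F. W k * (cmod (c t k))^2) has_real_derivative
    2 * (\<Sum>k\<in>F. W k * inner (c t k) (fh k)) + 2 * (\<Sum>k\<in>F. W k * inner (c t k) (g t k))
    - 2 * (\<Sum>k\<in>F. W k * inner (c t k) (nlb F (st (c t)) (c t) k))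
    - 2 * (\<Sum>k\<in>F. W k * (kabs k + \<epsilon> * (kabs k)^2) * (cmod (c t k))^2)) (at t within {a..b})"
proof -
  let ?r = "\<lambda>k. fh k + g t k - nlb F (st (c t)) (c t) k - of_real (kabs k + \<epsilon> * (kabs k)^2) * c t k"
  have "((\<lambda>t. \<Sum>k\<in>F. W k * (cmod (c t k))^2) has_real_derivative (\<Sum>k\<in>F. W k * (2 * inner (c t k) (?r k)))) (at t within {a..b})"
    by (intro DERIV_sum DERIV_cmult cmod_square_derivative ode t)
  moreover have "W k * (2 * inner (c t k) (?r k)) = 2 * (W k * inner (c t k) (fh k)) + 2 * (W k * inner (c t k) (g t k))
     - 2 * (W k * inner (c t k) (nlb F (st (c t)) (c t) k)) - 2 * (W k * (kabs k + \<epsilon> * (kabs k)^2) * (cmod (c t k))^2)" for k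
    unfolding inner_diff_right inner_add_right scaleR_conv_of_real[symmetric] inner_scaleR_right power2_norm_eq_inner[symmetric]
    by (simp add: algebra_simps)
  ultimately show ?thesis by (simp only: sum.distrib sum_subtractf sum_distrib_left)
qed

text \<open>With constant weight the transport term vanishes. Because |k| \<ge> 1 the dissipation
  absorbs the term quadratic in \<open>c\<close>, so the growth is linear in time.\<close>

lemma (in evol_base) l2_growth:
  assumes f1: "(\<Sum>k\<in>F. (kabs k * cmod (fh k))^2) \<le> \<Phi>1^2" and gc: "\<And>t. t \<in> {a..b} \<Longrightarrow> (\<Sum>k\<in>F. (kabs k)^3 * (cmod (c t k) * cmod (g t k))) \<le> 1"
    and t: "t \<in> {a..b}"
  shows "(\<Sum>k\<in>F. (cmod (c t k))^2) \<le> (\<Sum>k\<in>F. (cmod (c a k))^2) + (\<Phi>1^2 + 2) * (t - a)"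
proof (rule growth_bound[where b = b and y = "\<lambda>t. \<Sum>k\<in>F. (cmod (c t k))^2"])
  have k1: "1 \<le> kabs k" if "k \<in> F" for k using that by (intro kabs_ge_1) auto
  fix s assume s: "s \<in> {a..b}"
  let ?D = "2 * (\<Sum>k\<in>F. inner (c s k) (fh k)) + 2 * (\<Sum>k\<in>F. inner (c s k) (g s k))
    - 2 * (\<Sum>k\<in>F. inner (c s k) (nlb F (st (c s)) (c s) k)) - 2 * (\<Sum>k\<in>F. (kabs k + \<epsilon> * (kabs k)^2) * (cmod (c s k))^2)"
  show "((\<lambda>t. \<Sum>k\<in>F. (cmod (c t k))^2) has_real_derivative ?D) (at s within {a..b})"
    using energy_deriv[OF s, of "\<lambda>_. 1"] by (simp only: mult_1_left)
  have "(\<Sum>k\<in>F. inner (c s k) (nlb F (st (c s)) (c s) k)) = 0"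
    using nlb_antisym[OF symc_st[OF symc, of s], where W = "\<lambda>_. 1" and F = F and c = "c s"] by simp
  moreover have "2 * (\<Sum>k\<in>F. inner (c s k) (fh k)) \<le> (\<Sum>k\<in>F. (cmod (c s k))^2) + (\<Sum>k\<in>F. (kabs k * cmod (fh k))^2)"
    unfolding sum_distrib_left sum.distrib[symmetric]
  proof (rule sum_mono)
    fix k assume k: "k \<in> F"
    have "inner (c s k) (fh k) \<le> cmod (c s k) * cmod (fh k)" by (rule norm_cauchy_schwarz)
    also have "\<dots> \<le> cmod (c s k) * (kabs k * cmod (fh k))" using k1[OF k] by (intro mult_left_mono) (auto simp: mult_le_cancel_right1)
    also have "2 * \<dots> \<le> (cmod (c s k))^2 + (kabs k * cmod (fh k))^2" using sum_squares_bound[of "cmod (c s k)" "kabs k * cmod (fh k)"] by (simp only: mult.assoc)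
    finally show "2 * inner (c s k) (fh k) \<le> (cmod (c s k))^2 + (kabs k * cmod (fh k))^2" by simp
  qed
  moreover have "(\<Sum>k\<in>F. inner (c s k) (g s k)) \<le> (\<Sum>k\<in>F. (kabs k)^3 * (cmod (c s k) * cmod (g s k)))"
  proof (rule sum_mono)
    fix k assume k: "k \<in> F"
    have "inner (c s k) (g s k) \<le> 1 * (cmod (c s k) * cmod (g s k))" using norm_cauchy_schwarz by simp
    also have "\<dots> \<le> (kabs k)^3 * (cmod (c s k) * cmod (g s k))" using k1[OF k] by (intro mult_right_mono one_le_power) auto
    finally show "inner (c s k) (g s k) \<le> (kabs k)^3 * (cmod (c s k) * cmod (g s k))" .
  qed
  moreover have "(\<Sum>k\<in>F. 1 * (cmod (c s k))^2) \<le> (\<Sum>k\<in>F. (kabs k + \<epsilon> * (kabs k)^2) * (cmod (c s k))^2)"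
    using eps by (intro sum_mono mult_right_mono) (auto intro: add_increasing2 k1)
  moreover have "0 \<le> (\<Sum>k\<in>F. (cmod (c s k))^2)" by (simp add: sum_nonneg)
  ultimately show "?D \<le> \<Phi>1^2 + 2" using f1 gc[OF s] by simp
qed (use t in auto)

text \<open>\<open>hh_sigma\<close> is the cut-off for which the velocity produced by the scales \<open>s \<le> \<sigma>\<close> is at most \<open>1 / (10240 M)\<close>.\<close>

definition hh_sigma :: "real \<Rightarrow> real \<Rightarrow> real \<Rightarrow> real" where
  "hh_sigma M B \<alpha> = (sqrt pi * \<alpha> / (4 * B) * (1 / (10240 * M))) powr (1 / \<alpha>)"
text \<open>The bound of \<open>mlt_low_sum\<close> for the large scales, increased by 1 so that it
  can safely appear in denominators.\<close>

definition hh_P :: "real \<Rightarrow> real \<Rightarrow> real \<Rightarrow> real \<Rightarrow> real" where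
  "hh_P M B \<alpha> L = 108 * cI / (sqrt pi * (hh_sigma M B \<alpha>)^5) * L * Z4^2 + 1"
definition hh_C :: "real \<Rightarrow> real \<Rightarrow> real \<Rightarrow> real \<Rightarrow> real \<Rightarrow> real" where
  "hh_C M B \<alpha> L \<Phi>1 = 648 * (hh_P M B \<alpha> L)^4 * L^2 + 4 * \<Phi>1^2 + 2 + 2048 * L^2"

text \<open>Each of the two velocity parts may use a quarter of \<open>D\<close>. The small scales
  do so by the choice of \<sigma>; the large scales are of lower order and leave a multiple of the
  \<open>L2\<close> norm after interpolation.\<close>

lemma (in evol) transport_bound:
  assumes M: "1 \<le> M" "\<And>x. \<bar>tp F (c t) x\<bar> \<le> M" and B: "0 < B" and al: "0 < \<alpha>" "\<alpha> \<le> 1"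
    and h: "\<And>x h. \<bar>tp F (sh h (c t)) x\<bar> \<le> B * norm h powr \<alpha>" and t: "t \<in> {a..b}"
  shows "2 * \<bar>\<Sum>k\<in>F. (kabs k)^3 * inner (c t k) (nlb F (st (c t)) (c t) k)\<bar>
    \<le> 1 / 2 * (\<Sum>k\<in>F. (kabs k)^4 * (cmod (c t k))^2) + 648 * (hh_P M B \<alpha> L)^4 * L^2"
proof -
  define D where "D = (\<Sum>k\<in>F. (kabs k)^4 * (cmod (c t k))^2)"
  define \<sigma> where "\<sigma> = hh_sigma M B \<alpha>"
  define P where "P = hh_P M B \<alpha> L"
  have D0: "0 \<le> D" unfolding D_def by (simp add: sum_nonneg)
  have q: "0 < sqrt pi * \<alpha> / (4 * B) * (1 / (10240 * M))" using M(1) B al by simp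
  then have sg: "0 < \<sigma>" unfolding \<sigma>_def hh_sigma_def using M(1) B al by simp
  have sa: "\<sigma> powr \<alpha> = sqrt pi * \<alpha> / (4 * B) * (1 / (10240 * M))"
    unfolding \<sigma>_def hh_sigma_def powr_powr using q al M(1) B by simp
  \<comment> \<open>With U M = 1/10240 and U \<le> M, 144 U M + 16 U^2 is at most 160/10240 = 1/64,
    which Young's inequality with weight 8 turns into D/8.\<close>
  define U where "U = 1 / (10240 * M)"
  have U: "0 < U" "U \<le> M" using M(1) mult_mono[of 1 "10240 * M" 1 M] by (auto simp: U_def divide_le_eq mult_ac)
  define \<phi> where "\<phi> = mlt {0<..\<sigma>} (c t)"
  define \<psi> where "\<psi> = mlt {\<sigma><..} (c t)"
  have sy: "symc \<phi>" "symc \<psi>" "supp_in n \<phi>" "supp_in n \<psi>"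
    unfolding \<phi>_def \<psi>_def mlt_def by (intro symc_real supp_mult symc supp; simp)+
  have vel: "\<bar>tp F (dd p \<phi>) x\<bar> \<le> U" for p x
  proof -
    have "\<bar>tp F (dd p \<phi>) x\<bar> \<le> 4 * B / (sqrt pi * \<alpha>) * \<sigma> powr \<alpha>"
      unfolding \<phi>_def by (rule high_velocity[OF finite_Bx zero_Bx h al sg])
    also have "\<dots> = U" unfolding sa U_def using B al by (simp add: field_simps)
    finally show ?thesis .
  qed
  have "(\<Sum>k\<in>F. (kabs k * cmod (nlb F \<phi> (c t) k))^2) \<le> (144 * U * M + 16 * U^2) * D"
    unfolding D_def using M sy symc supp U vel mlt_high_le[OF sg, of _ "c t"]
    by (intro high_bilinear) (auto simp: \<phi>_def)
  also have "\<dots> \<le> 1 / 64 * D"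
  proof (rule mult_right_mono[OF _ D0])
    have "U * U \<le> U * M" using U by (intro mult_left_mono) auto
    moreover have "U * M = 1 / 10240" unfolding U_def using M(1) by simp
    ultimately show "144 * U * M + 16 * U^2 \<le> 1 / 64" by (simp add: power2_eq_square)
  qed
  finally have hb: "(\<Sum>k\<in>F. (kabs k * cmod (nlb F \<phi> (c t) k))^2) \<le> 1 / 64 * D" .
  have TH: "2 * \<bar>\<Sum>k\<in>F. (kabs k)^3 * inner (c t k) (nlb F \<phi> (c t) k)\<bar> \<le> 1 / 4 * D"
  proof -
    have "2 * \<bar>\<Sum>k\<in>F. (kabs k)^3 * inner (c t k) (nlb F \<phi> (c t) k)\<bar> \<le> (\<Sum>k\<in>F. 2 * \<bar>(kabs k)^3 * inner (c t k) (nlb F \<phi> (c t) k)\<bar>)"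
      unfolding sum_distrib_left[symmetric] by (intro mult_left_mono sum_abs) simp
    also have "\<dots> \<le> (\<Sum>k\<in>F. 1 / 8 * ((kabs k)^4 * (cmod (c t k))^2) + 8 * (kabs k * cmod (nlb F \<phi> (c t) k))^2)"
    proof (rule sum_mono)
      fix k
      let ?x = "(kabs k)^2 * cmod (c t k)" and ?y = "kabs k * cmod (nlb F \<phi> (c t) k)"
      have "\<bar>(kabs k)^3 * inner (c t k) (nlb F \<phi> (c t) k)\<bar> \<le> (kabs k)^3 * (cmod (c t k) * cmod (nlb F \<phi> (c t) k))"
        unfolding abs_mult by (intro mult_mono Cauchy_Schwarz_ineq2) auto
      also have "\<dots> = ?x * ?y" by (simp add: power2_eq_square power3_eq_cube mult_ac)
      also have "2 * (?x * ?y) \<le> 1 / 8 * ?x^2 + 8 * ?y^2"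
        using zero_le_power2[of "?x - 8 * ?y"] by (simp add: power2_diff power_mult_distrib)
      also have "?x^2 = (kabs k)^4 * (cmod (c t k))^2" by (simp add: power_mult_distrib flip: power_mult)
      finally show "2 * \<bar>(kabs k)^3 * inner (c t k) (nlb F \<phi> (c t) k)\<bar> \<le> 1 / 8 * ((kabs k)^4 * (cmod (c t k))^2) + 8 * ?y^2" by simp
    qed
    also have "\<dots> = 1 / 8 * D + 8 * (\<Sum>k\<in>F. (kabs k * cmod (nlb F \<phi> (c t) k))^2)"
      unfolding D_def sum.distrib sum_distrib_left ..
    finally show ?thesis using hb by linarith
  qed
  have P: "1 \<le> P" unfolding P_def hh_P_def \<sigma>_def[symmetric] using cI_nonneg sg L by simp
  have cL: "cmod (c t k) \<le> L" if k: "k \<in> F" for k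
  proof -
    have "(cmod (c t k))^2 \<le> (\<Sum>k\<in>F. (cmod (c t k))^2)" by (rule member_le_sum[OF k]) auto
    then have "(cmod (c t k))^2 \<le> L^2" using l2[OF t] by linarith
    then show ?thesis using L by (intro power2_le_imp_le[of "cmod (c t k)" L]) auto
  qed
  have "(\<Sum>k\<in>F. (kabs k)^2 * cmod (\<psi> k)) \<le> 108 * cI / (sqrt pi * \<sigma>^5) * L * Z4^2"
    unfolding \<psi>_def by (rule mlt_low_sum[OF finite_Bx zero_Bx _ sg less_imp_le[OF L]]) (rule cL)
  then have Pb: "(\<Sum>k\<in>F. (kabs k)^2 * cmod (\<psi> k)) \<le> P"
    unfolding P_def hh_P_def \<sigma>_def[symmetric] by linarith
  define H where "H = (\<Sum>k\<in>F. (kabs k * cmod (c t k))^2)"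
  have "H \<le> (\<Sum>k\<in>F. 1 / (144 * P^2) * ((kabs k)^4 * (cmod (c t k))^2) + 36 * P^2 * (cmod (c t k))^2)"
    unfolding H_def
  proof (rule sum_mono)
    fix k
    have "(kabs k)^2 \<le> 1 / (144 * P^2) * (kabs k)^4 + 36 * P^2"
    proof -
      have "0 \<le> ((kabs k)^2 / (12 * P) - 6 * P)^2" by simp
      also have "\<dots> = 1 / (144 * P^2) * (kabs k)^4 - (kabs k)\<^sup>2 + 36 * P^2"
        using P by (simp add: power2_diff power_mult_distrib power_divide flip: power_mult)
      finally show ?thesis by simp
    qed
    from mult_right_mono[OF this zero_le_power2[of "cmod (c t k)"]]
    show "(kabs k * cmod (c t k))^2 \<le> 1 / (144 * P^2) * ((kabs k)^4 * (cmod (c t k))^2) + 36 * P^2 * (cmod (c t k))^2"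
      by (simp only: power_mult_distrib distrib_right mult.assoc)
  qed
  also have "\<dots> = 1 / (144 * P^2) * D + 36 * P^2 * (\<Sum>k\<in>F. (cmod (c t k))^2)"
    unfolding D_def sum.distrib sum_distrib_left ..
  also have "\<dots> \<le> 1 / (144 * P^2) * D + 36 * P^2 * L^2" using l2[OF t] by (intro add_left_mono mult_left_mono) auto
  finally have H: "H \<le> 1 / (144 * P^2) * D + 36 * P^2 * L^2" .
  \<comment> \<open>The value l = 1/(12 P) makes the first term D/16, and the interpolation constant
    in \<open>H\<close> was chosen to make the second contribute D/16 as well.\<close>
  have "\<bar>\<Sum>k\<in>F. (kabs k)^3 * inner (c t k) (nlb F \<psi> (c t) k)\<bar> \<le> 3 / 4 * P * (1 / (12 * P) * D + H / (1 / (12 * P)))"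
    unfolding D_def H_def using P by (intro low_bilinear sy Pb) auto
  also have "\<dots> = D / 16 + 9 * P^2 * H" using P by (simp add: field_simps power2_eq_square)
  also have "\<dots> \<le> D / 16 + 9 * P^2 * (1 / (144 * P^2) * D + 36 * P^2 * L^2)"
    by (intro add_left_mono mult_left_mono H) auto
  also have "\<dots> = D / 8 + 324 * P^4 * L^2" using P by (simp add: field_simps flip: power_add)
  finally have TL: "2 * \<bar>\<Sum>k\<in>F. (kabs k)^3 * inner (c t k) (nlb F \<psi> (c t) k)\<bar> \<le> D / 4 + 648 * P^4 * L^2" by simp
  have "nlb F (st (c t)) (c t) k = nlb F \<phi> (c t) k + nlb F \<psi> (c t) k" for k
    unfolding nlb_def st_split[OF supp sg] \<phi>_def[symmetric] \<psi>_def[symmetric] sum.distrib[symmetric]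
    by (simp add: algebra_simps)
  then have "(\<Sum>k\<in>F. (kabs k)^3 * inner (c t k) (nlb F (st (c t)) (c t) k))
    = (\<Sum>k\<in>F. (kabs k)^3 * inner (c t k) (nlb F \<phi> (c t) k)) + (\<Sum>k\<in>F. (kabs k)^3 * inner (c t k) (nlb F \<psi> (c t) k))"
    by (simp add: inner_add_right distrib_left sum.distrib)
  then show ?thesis using TH TL unfolding D_def P_def by linarith
qed

text \<open>The initial energy is unknown, so it is weighted by (t - a)^4. The derivative of the
  weight is absorbed by interpolating the energy between the dissipation and the \<open>L2\<close>
  norm.\<close>

lemma (in evol) half_bound:
  assumes M: "1 \<le> M" "\<And>t x. t \<in> {a..b} \<Longrightarrow> \<bar>tp F (c t) x\<bar> \<le> M" and B: "0 < B" and al: "0 < \<alpha>" "\<alpha> \<le> 1"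
    and h: "\<And>t x h. t \<in> {a..b} \<Longrightarrow> \<bar>tp F (sh h (c t)) x\<bar> \<le> B * norm h powr \<alpha>" and ba: "b \<le> a + 1"
    and f1: "(\<Sum>k\<in>F. (kabs k * cmod (fh k))^2) \<le> \<Phi>1^2" and gc: "\<And>t. t \<in> {a..b} \<Longrightarrow> (\<Sum>k\<in>F. (kabs k)^3 * (cmod (c t k) * cmod (g t k))) \<le> 1"
  shows "(b - a)^4 * (\<Sum>k\<in>F. (kabs k)^3 * (cmod (c b k))^2) \<le> hh_C M B \<alpha> L \<Phi>1"
proof -
  define C where "C = hh_C M B \<alpha> L \<Phi>1"
  define y where "y = (\<lambda>t. \<Sum>k\<in>F. (kabs k)^3 * (cmod (c t k))^2)"
  define D where "D = (\<lambda>t. \<Sum>k\<in>F. (kabs k)^4 * (cmod (c t k))^2)"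
  define Y where "Y = (\<lambda>t. 2 * (\<Sum>k\<in>F. (kabs k)^3 * inner (c t k) (fh k)) + 2 * (\<Sum>k\<in>F. (kabs k)^3 * inner (c t k) (g t k))
    - 2 * (\<Sum>k\<in>F. (kabs k)^3 * inner (c t k) (nlb F (st (c t)) (c t) k))
    - 2 * (\<Sum>k\<in>F. (kabs k)^3 * (kabs k + \<epsilon> * (kabs k)^2) * (cmod (c t k))^2))"
  have dy: "(y has_real_derivative Y t) (at t within {a..b})" if "t \<in> {a..b}" for t
    unfolding y_def Y_def by (rule energy_deriv[OF that])
  have C0: "0 \<le> C" unfolding C_def hh_C_def by simp
  have Yle: "Y t \<le> - D t + (C - 2048 * L^2)" if t: "t \<in> {a..b}" for t
  proof -
    have 1: "2 * (\<Sum>k\<in>F. (kabs k)^3 * inner (c t k) (fh k)) \<le> 1 / 4 * D t + 4 * \<Phi>1^2"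
    proof -
      have "2 * (\<Sum>k\<in>F. (kabs k)^3 * inner (c t k) (fh k)) \<le> 1 / 4 * D t + 4 * (\<Sum>k\<in>F. (kabs k * cmod (fh k))^2)"
        unfolding D_def sum_distrib_left sum.distrib[symmetric]
      proof (rule sum_mono)
        fix k
        let ?x = "(kabs k)^2 * cmod (c t k)" and ?y = "kabs k * cmod (fh k)"
        have "(kabs k)^3 * inner (c t k) (fh k) \<le> (kabs k)^3 * (cmod (c t k) * cmod (fh k))"
          by (intro mult_left_mono norm_cauchy_schwarz) auto
        also have "\<dots> = ?x * ?y" by (simp add: power2_eq_square power3_eq_cube mult_ac)
        also have "2 * (?x * ?y) \<le> 1 / 4 * ?x^2 + 4 * ?y^2"
          using zero_le_power2[of "?x - 4 * ?y"] by (simp add: power2_diff power_mult_distrib)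
        also have "?x^2 = (kabs k)^4 * (cmod (c t k))^2" by (simp add: power_mult_distrib flip: power_mult)
        finally show "2 * ((kabs k)^3 * inner (c t k) (fh k)) \<le> 1 / 4 * ((kabs k)^4 * (cmod (c t k))^2) + 4 * ?y^2" by simp
      qed
      then show ?thesis using f1 by linarith
    qed
    have "(\<Sum>k\<in>F. (kabs k)^3 * inner (c t k) (g t k)) \<le> (\<Sum>k\<in>F. (kabs k)^3 * (cmod (c t k) * cmod (g t k)))"
      by (intro sum_mono mult_left_mono norm_cauchy_schwarz) auto
    then have 2: "2 * (\<Sum>k\<in>F. (kabs k)^3 * inner (c t k) (g t k)) \<le> 2" using gc[OF t] by linarith
    have "D t \<le> (\<Sum>k\<in>F. (kabs k)^3 * (kabs k + \<epsilon> * (kabs k)^2) * (cmod (c t k))^2)"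
      unfolding D_def using eps by (intro sum_mono mult_right_mono) (auto simp: distrib_left eval_nat_numeral)
    moreover have "0 \<le> D t" unfolding D_def by (simp add: sum_nonneg)
    ultimately show ?thesis
      using 1 2 transport_bound[OF M(1) M(2)[OF t] B al h[OF t] t] D_def[THEN fun_cong, of t]
      unfolding Y_def C_def hh_C_def by linarith
  qed
  have yle: "y t \<le> s * D t + L^2 / s^3" if t: "t \<in> {a..b}" and s: "0 < s" for t s
  proof -
    have "y t \<le> (\<Sum>k\<in>F. s * ((kabs k)^4 * (cmod (c t k))^2) + 1 / s^3 * (cmod (c t k))^2)"
      unfolding y_def
    proof (rule sum_mono)
      fix k
      have "(kabs k)^3 \<le> s * (kabs k)^4 + 1 / s^3"
      proof (cases "1 \<le> s * kabs k")
        case True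
        then have "1 * (kabs k)^3 \<le> (s * kabs k) * (kabs k)^3" by (intro mult_right_mono) auto
        then have "(kabs k)^3 \<le> s * (kabs k)^4" by (simp add: eval_nat_numeral mult_ac)
        moreover have "0 \<le> 1 / s^3" using s by simp
        ultimately show ?thesis by linarith
      next
        case False
        then have "(s * kabs k)^3 \<le> 1" using s by (intro power_le_one) auto
        then have "(kabs k)^3 \<le> 1 / s^3" using s by (simp add: power_mult_distrib field_simps)
        moreover have "0 \<le> s * (kabs k)^4" using s by simp
        ultimately show ?thesis by linarith
      qed
      from mult_right_mono[OF this zero_le_power2[of "cmod (c t k)"]]
      show "(kabs k)^3 * (cmod (c t k))^2 \<le> s * ((kabs k)^4 * (cmod (c t k))^2) + 1 / s^3 * (cmod (c t k))^2"
        by (simp only: distrib_right mult.assoc)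
    qed
    also have "\<dots> = s * D t + 1 / s^3 * (\<Sum>k\<in>F. (cmod (c t k))^2)" unfolding D_def sum.distrib sum_distrib_left ..
    also have "\<dots> \<le> s * D t + 1 / s^3 * L^2" using l2[OF t] s by (intro add_left_mono mult_left_mono) auto
    finally show ?thesis by simp
  qed
  have "(b - a)^4 * y b \<le> (a - a)^4 * y a + C * (b - a)"
  proof (rule growth_bound[where a = a and b = b and y = "\<lambda>t. (t - a)^4 * y t"])
    fix s assume s: "s \<in> {a..b}"
    show "((\<lambda>t. (t - a)^4 * y t) has_real_derivative 4 * (s - a)^3 * y s + (s - a)^4 * Y s) (at s within {a..b})"
      by (rule derivative_eq_intros dy[OF s] refl)+ simp
    show "4 * (s - a)^3 * y s + (s - a)^4 * Y s \<le> C"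
    proof (cases "s = a")
      case False
      define \<tau> where "\<tau> = s - a"
      have tau: "0 < \<tau>" "\<tau> \<le> 1" using s False ba by (auto simp: \<tau>_def)
      have D0: "0 \<le> D s" unfolding D_def by (simp add: sum_nonneg)
      \<comment> \<open>Interpolation with s = \<tau>/8 gives half of the weighted dissipation; in
        the other term \<tau>^3 cancels exactly, which is why the weight is a fourth power.\<close>
      have "4 * \<tau>^3 * y s \<le> 4 * \<tau>^3 * (\<tau> / 8 * D s + L^2 / (\<tau> / 8)^3)"
        using tau by (intro mult_left_mono yle s) auto
      also have "\<dots> = 1 / 2 * (\<tau>^4 * D s) + 2048 * L^2" using tau by (simp add: power_divide field_simps eval_nat_numeral)
      finally have 1: "4 * \<tau>^3 * y s \<le> 1 / 2 * (\<tau>^4 * D s) + 2048 * L^2" .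
      have "\<tau>^4 * Y s \<le> \<tau>^4 * (- D s + (C - 2048 * L^2))" using Yle[OF s] by (intro mult_left_mono) auto
      also have "\<dots> = - (\<tau>^4 * D s) + \<tau>^4 * (C - 2048 * L^2)" by (simp add: algebra_simps)
      also have "\<tau>^4 * (C - 2048 * L^2) \<le> 1 * (C - 2048 * L^2)"
        using tau by (intro mult_right_mono power_le_one) (auto simp: C_def hh_C_def)
      finally have 2: "\<tau>^4 * Y s \<le> - (\<tau>^4 * D s) + (C - 2048 * L^2)" by simp
      have "0 \<le> \<tau>^4 * D s" using D0 by simp
      then show ?thesis using 1 2 unfolding \<tau>_def[symmetric] by linarith
    qed (use C0 in simp)
  qed (use ab in auto)
  also have "\<dots> \<le> C" using ba C0 ab by (simp add: mult_left_le)
  finally show ?thesis unfolding y_def C_def .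
qed

section \<open>Fejer means and the uniform bound\<close>

definition Qn :: "nat \<Rightarrow> (int \<times> int) set" where "Qn n = {0..<int n} \<times> {0..<int n}"
definition dif :: "(int \<times> int) \<times> (int \<times> int) \<Rightarrow> int \<times> int" where "dif p = fst p - snd p"

text \<open>The Fejer weights: \<open>mm n k\<close> counts the representations of \<open>k\<close> as a difference of two
  points of the \<open>n \<times> n\<close> grid, so that the corresponding kernel is a multiple of \<open>\<bar>\<Sum>\<^sub>a E a\<bar>\<^sup>2\<close>.\<close>

definition mm :: "nat \<Rightarrow> int \<times> int \<Rightarrow> real" where
  "mm n k = real (card {p \<in> Qn n \<times> Qn n. dif p = k}) / (real n)^2"

lemma finite_Qn [simp]: "finite (Qn n)" by (simp add: Qn_def)
lemma card_Qn: "card (Qn n) = n * n" by (simp add: Qn_def card_cartesian_product)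

lemma dif_Qn: "p \<in> Qn n \<times> Qn n \<Longrightarrow> dif p \<in> insert 0 (Bx n)"
  unfolding Qn_def dif_def insert_iff mem_Bx by auto

lemma card_dif: "card {p \<in> Qn n \<times> Qn n. dif p = k} = card {b \<in> Qn n. b + k \<in> Qn n}"
proof -
  have "{p \<in> Qn n \<times> Qn n. dif p = k} = (\<lambda>b. (b + k, b)) ` {b \<in> Qn n. b + k \<in> Qn n}"
    unfolding dif_def by (force simp: algebra_simps)
  then show ?thesis by (simp add: card_image inj_on_def)
qed

lemma mm_nonneg: "0 \<le> mm n k" by (simp add: mm_def)

lemma mm_le_1: "mm n k \<le> 1"
proof -
  have "card {b \<in> Qn n. b + k \<in> Qn n} \<le> n * n" unfolding card_Qn[symmetric] by (intro card_mono) auto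
  then have "real (card {b \<in> Qn n. b + k \<in> Qn n}) \<le> (real n)^2" by (metis of_nat_le_iff of_nat_mult power2_eq_square)
  then show ?thesis unfolding mm_def card_dif by (cases "n = 0") simp_all
qed

lemma mm_supp: "k \<notin> insert 0 (Bx n) \<Longrightarrow> mm n k = 0"
proof -
  assume "k \<notin> insert 0 (Bx n)"
  then have "{p \<in> Qn n \<times> Qn n. dif p = k} = {}" using dif_Qn by blast
  then show ?thesis unfolding mm_def by (metis card.empty div_0 of_nat_0)
qed

lemma mm_uminus: "mm n (- k) = mm n k"
proof -
  have "{p \<in> Qn n \<times> Qn n. dif p = - k} = prod.swap ` {p \<in> Qn n \<times> Qn n. dif p = k}"
    unfolding dif_def by (force simp: algebra_simps)
  then show ?thesis unfolding mm_def by (simp add: card_image)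
qed

lemma card_shift_out: "card {z \<in> {0..<int n}. z + i \<notin> {0..<int n}} \<le> nat \<bar>i\<bar>"
proof -
  have "{z \<in> {0..<int n}. z + i \<notin> {0..<int n}} \<subseteq> (if 0 \<le> i then {int n - i..<int n} else {0..<- i})" by auto
  then have "card {z \<in> {0..<int n}. z + i \<notin> {0..<int n}} \<le> card (if 0 \<le> i then {int n - i..<int n} else {0..<- i})"
    by (rule card_mono[rotated]) simp
  also have "\<dots> \<le> nat \<bar>i\<bar>" by simp
  finally show ?thesis .
qed

text \<open>Shifting the n by n grid by \<open>k\<close> pushes at most (|k1| + |k2|) n of its n^2
  points outside.\<close>

lemma mm_ge: "0 < n \<Longrightarrow> 1 - mm n k \<le> 2 * kabs k / real n"
proof -
  assume n: "0 < n"
  let ?A = "{b \<in> Qn n. b + k \<notin> Qn n}"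
  let ?o = "\<lambda>i. {z \<in> {0..<int n}. z + i \<notin> {0..<int n}}"
  have "?A \<subseteq> ?o (fst k) \<times> {0..<int n} \<union> {0..<int n} \<times> ?o (snd k)" unfolding Qn_def by (auto simp: mem_Times_iff)
  note sub = this
  have fo: "finite (?o i)" for i by (rule finite_subset[OF Collect_restrict]) simp
  have "card ?A \<le> card (?o (fst k) \<times> {0..<int n} \<union> {0..<int n} \<times> ?o (snd k))"
    by (rule card_mono[OF finite_UnI[OF finite_cartesian_product[OF fo finite_atLeastLessThan_int] finite_cartesian_product[OF finite_atLeastLessThan_int fo]] sub])
  also have "\<dots> \<le> card (?o (fst k) \<times> {0..<int n}) + card ({0..<int n} \<times> ?o (snd k))" by (rule card_Un_le)
  also have "\<dots> \<le> nat \<bar>fst k\<bar> * n + n * nat \<bar>snd k\<bar>"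
    unfolding card_cartesian_product by (intro add_mono mult_mono card_shift_out) auto
  finally have "real (card ?A) \<le> real (nat \<bar>fst k\<bar> * n + n * nat \<bar>snd k\<bar>)" by (rule of_nat_mono)
  also have "\<dots> = (\<bar>of_int (fst k)\<bar> + \<bar>of_int (snd k)\<bar>) * real n" by (simp add: algebra_simps)
  also have "\<dots> \<le> (kabs k + kabs k) * real n" by (intro mult_right_mono add_mono fst_le_kabs) auto
  finally have 1: "real (card ?A) \<le> 2 * kabs k * real n" by simp
  have "card (Qn n) = card {b \<in> Qn n. b + k \<in> Qn n} + card ?A"
    using card_Int_Diff[OF finite_Qn, of n "{b. b + k \<in> Qn n}"] by (simp add: Int_def set_diff_eq)
  then have "(real n)^2 = real (card {b \<in> Qn n. b + k \<in> Qn n}) + real (card ?A)"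
    unfolding card_Qn power2_eq_square of_nat_mult[symmetric] of_nat_add[symmetric] by (rule arg_cong)
  then have e: "(real n)^2 - real (card {b \<in> Qn n. b + k \<in> Qn n}) = real (card ?A)" by linarith
  have "1 - mm n k = real (card ?A) / (real n)^2"
    unfolding mm_def card_dif e[symmetric] diff_divide_distrib using n by simp
  also have "\<dots> \<le> 2 * kabs k * real n / (real n)^2" by (intro divide_right_mono 1) simp
  also have "\<dots> = 2 * kabs k / real n" using n by (simp add: power2_eq_square)
  finally show ?thesis .
qed

text \<open>The Fejer mean is convolution with a nonnegative kernel whose integral is normalised, so
  it cannot exceed the essential bound of the function.\<close>

lemma fejer_bound:
  assumes ae: "AE x in TM. \<bar>rep_L2 a x\<bar> \<le> \<Phi>" and n: "0 < n"
  shows "\<bar>tp (Bx (2 * n)) (\<lambda>k. of_real (mm n k) * fcoeff a k) x\<bar> \<le> \<Phi>"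
proof -
  let ?Q = "Qn n \<times> Qn n"
  \<comment> \<open>The square of its modulus is the kernel: expanding it counts each frequency as
    often as it is a difference of two grid points.\<close>
  define D where "D = (\<lambda>y. \<Sum>i\<in>Qn n. E i (x - y))"
  have ct: "continuous_on UNIV (\<lambda>y. (cmod (D y))^2)" unfolding D_def by (intro continuous_intros)
  have Ed: "E k (x - y) = E k x * E (- k) y" for k y
    using E_shift[of k x "- y"] by (simp add: E_def)
  have K: "complex_of_real ((cmod (D y))^2) = (\<Sum>p\<in>?Q. E (dif p) x * E (- dif p) y)" for y
  proof -
    have "complex_of_real ((cmod (D y))^2) = (\<Sum>i\<in>Qn n. \<Sum>j\<in>Qn n. E i (x - y) * cnj (E j (x - y)))"
      unfolding complex_norm_square D_def cnj_sum sum_product ..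
    also have "\<dots> = (\<Sum>p\<in>?Q. E (fst p) (x - y) * cnj (E (snd p) (x - y)))" by (simp add: sum.cartesian_product split_def)
    also have "\<dots> = (\<Sum>p\<in>?Q. E (dif p) x * E (- dif p) y)"
      unfolding Ed[symmetric] dif_def by (intro sum.cong refl) (simp add: E_uminus[symmetric] E_add[symmetric])
    finally show ?thesis .
  qed
  have iE: "integrable TM (E k)" for k by (intro TM_integrable_continuous continuous_intros)
  have "complex_of_real (LINT y|TM. (cmod (D y))^2) = (LINT y|TM. (\<Sum>p\<in>?Q. E (dif p) x * E (- dif p) y))"
    unfolding K[symmetric] by (rule integral_complex_of_real[symmetric])
  also have "\<dots> = (\<Sum>p\<in>?Q. E (dif p) x * (if dif p = 0 then (2 * pi)^2 else 0))"
    unfolding Bochner_Integration.integral_sum[OF integrable_mult_right[OF iE]] integral_mult_right_zero integral_E by simp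
  also have "\<dots> = (\<Sum>p\<in>?Q. if p \<in> {p. dif p = 0} then complex_of_real ((2 * pi)^2) else 0)" by (rule sum.cong[OF refl]) simp
  also have "\<dots> = of_nat (card (?Q \<inter> {p. dif p = 0})) * complex_of_real ((2 * pi)^2)"
    by (subst sum.inter_restrict[symmetric]) (simp_all del: of_real_power)
  also have "?Q \<inter> {p. dif p = 0} = {p \<in> ?Q. dif p = 0}" by blast
  also have "card {p \<in> ?Q. dif p = 0} = n * n" unfolding card_dif using card_Qn by simp
  finally have "complex_of_real (LINT y|TM. (cmod (D y))^2) = complex_of_real ((real n)^2 * (2 * pi)^2)"
    by (simp add: power2_eq_square)
  then have ID: "(LINT y|TM. (cmod (D y))^2) = (real n)^2 * (2 * pi)^2" by (simp only: of_real_eq_iff)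
  have ia: "integrable TM (\<lambda>y. of_real (rep_L2 a y) * E k y)" for k by (rule L2_fun_E_integrable[OF L2_fun_rep])
  have "(LINT y|TM. of_real (rep_L2 a y) * complex_of_real ((cmod (D y))^2))
    = (LINT y|TM. (\<Sum>p\<in>?Q. E (dif p) x * (of_real (rep_L2 a y) * E (- dif p) y)))"
    unfolding K sum_distrib_left by (simp only: mult.left_commute)
  also have "\<dots> = (\<Sum>p\<in>?Q. E (dif p) x * (fcoeff a (dif p) * (2 * pi)^2))"
    unfolding Bochner_Integration.integral_sum[OF integrable_mult_right[OF ia]] integral_mult_right_zero fcoeff_fc fc_def by simp
  also have "\<dots> = (2 * pi)^2 * (\<Sum>p\<in>?Q. fcoeff a (dif p) * E (dif p) x)"
    unfolding sum_distrib_left by (simp only: mult_ac)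
  also have "(\<Sum>p\<in>?Q. fcoeff a (dif p) * E (dif p) x) = (\<Sum>k\<in>insert 0 (Bx n). \<Sum>p\<in>{p \<in> ?Q. dif p = k}. fcoeff a (dif p) * E (dif p) x)"
    by (rule sum.group[symmetric]) (use dif_Qn in \<open>auto simp: image_subset_iff\<close>)
  also have "\<dots> = (\<Sum>k\<in>insert 0 (Bx n). (real n)^2 * (of_real (mm n k) * fcoeff a k * E k x))"
  proof (rule sum.cong[OF refl])
    fix k
    have "(\<Sum>p\<in>{p \<in> ?Q. dif p = k}. fcoeff a (dif p) * E (dif p) x) = (\<Sum>p\<in>{p \<in> ?Q. dif p = k}. fcoeff a k * E k x)"
      by (intro sum.cong refl) simp
    then show "(\<Sum>p\<in>{p \<in> ?Q. dif p = k}. fcoeff a (dif p) * E (dif p) x) = (real n)^2 * (of_real (mm n k) * fcoeff a k * E k x)"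
      using n by (simp add: mm_def)
  qed
  also have "\<dots> = (real n)^2 * (\<Sum>k\<in>Bx n. of_real (mm n k) * fcoeff a k * E k x)" by (simp add: sum_distrib_left)
  also have "(\<Sum>k\<in>Bx n. of_real (mm n k) * fcoeff a k * E k x) = (\<Sum>k\<in>Bx (2 * n). of_real (mm n k) * fcoeff a k * E k x)"
  proof (rule sum.mono_neutral_left)
    show "\<forall>k\<in>Bx (2 * n) - Bx n. of_real (mm n k) * fcoeff a k * E k x = 0"
    proof
      fix k assume "k \<in> Bx (2 * n) - Bx n"
      then have "k \<notin> insert 0 (Bx n)" by (metis Diff_iff insert_iff zero_Bx)
      then show "of_real (mm n k) * fcoeff a k * E k x = 0" by (simp add: mm_supp)
    qed
  qed (use Bx_mono[of n "2 * n"] in auto)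
  finally have S: "(LINT y|TM. of_real (rep_L2 a y) * complex_of_real ((cmod (D y))^2)) = (2 * pi)^2 * ((real n)^2 * (\<Sum>k\<in>Bx (2 * n). of_real (mm n k) * fcoeff a k * E k x))" .
  have "cmod (LINT y|TM. of_real (rep_L2 a y) * complex_of_real ((cmod (D y))^2)) \<le> (LINT y|TM. \<Phi> * (cmod (D y))^2)"
  proof (rule order_trans[OF integral_norm_bound integral_mono_AE])
    have "integrable TM (\<lambda>y. rep_L2 a y * (cmod (D y))^2)"
      using TM_mult_integrable[OF L2_fun_integrable[OF L2_fun_rep] ct] by simp
    then have "integrable TM (\<lambda>y. complex_of_real (rep_L2 a y * (cmod (D y))^2))" by (rule integrable_of_real)
    then have "integrable TM (\<lambda>y. of_real (rep_L2 a y) * complex_of_real ((cmod (D y))^2))" by (simp only: of_real_mult)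
    then show "integrable TM (\<lambda>y. cmod (of_real (rep_L2 a y) * complex_of_real ((cmod (D y))^2)))" by (rule integrable_norm)
    show "integrable TM (\<lambda>y. \<Phi> * (cmod (D y))^2)" by (intro integrable_mult_right TM_cont ct)
    show "AE y in TM. cmod (of_real (rep_L2 a y) * complex_of_real ((cmod (D y))^2)) \<le> \<Phi> * (cmod (D y))^2"
      using ae by eventually_elim (simp add: norm_mult norm_power mult_right_mono)
  qed
  also have "\<dots> = \<Phi> * ((real n)^2 * (2 * pi)^2)" unfolding integral_mult_right_zero ID ..
  finally have "((2 * pi)^2 * (real n)^2) * cmod (\<Sum>k\<in>Bx (2 * n). of_real (mm n k) * fcoeff a k * E k x) \<le> ((2 * pi)^2 * (real n)^2) * \<Phi>"
    unfolding S norm_mult by (simp add: norm_power mult_ac)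
  then have "cmod (\<Sum>k\<in>Bx (2 * n). of_real (mm n k) * fcoeff a k * E k x) \<le> \<Phi>" using n by simp
  then show ?thesis unfolding tp_def using abs_Re_le_cmod order_trans by blast
qed

text \<open>The failure of the weights to be multiplicative is at most 1 and, by
  \<open>mm_ge\<close>, at most of order |i| |j|/n. Interpolation trades a small power of 1/n for a
  quarter of a derivative on each factor.\<close>

lemma mm_commutator:
  assumes n: "0 < n" and ij: "i \<noteq> 0" "j \<noteq> 0"
  shows "\<bar>mm n i * mm n j - mm n (i + j)\<bar> \<le> 8 * real n powr (- 1/4) * (kabs i powr (1/4) * kabs j powr (1/4))"
proof -
  note m = mm_nonneg[of n] mm_le_1[of n]
  define X where "X = \<bar>mm n i * mm n j - mm n (i + j)\<bar>"
  have k: "1 \<le> kabs i" "1 \<le> kabs j" using ij by (auto intro: kabs_ge_1)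
  have ps: "0 \<le> (1 - mm n i) * (1 - mm n j)" "0 \<le> mm n i * mm n j" "mm n i * mm n j \<le> 1"
    by (simp_all add: m mult_le_one)
  then have X1: "X \<le> 1" unfolding X_def using m(1)[of "i + j"] m(2)[of "i + j"] by linarith
  have "X \<le> (1 - mm n i) + (1 - mm n j) + (1 - mm n (i + j))"
  proof -
    have "1 - mm n i - mm n j + mm n i * mm n j \<ge> 0" using ps(1) by (simp only: algebra_simps)
    then show ?thesis unfolding X_def using ps(2,3) m(1)[of "i + j"] m(2)[of "i + j"] m(2)[of i] m(2)[of j] by linarith
  qed
  also have "\<dots> \<le> 2 * kabs i / n + 2 * kabs j / n + 2 * (kabs i + kabs j) / n"
  proof (intro add_mono mm_ge[OF n])
    have "2 * kabs (i + j) / n \<le> 2 * (kabs i + kabs j) / n" using kabs_triangle[of i j] by (intro divide_right_mono) auto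
    then show "1 - mm n (i + j) \<le> 2 * (kabs i + kabs j) / n" using mm_ge[OF n, of "i + j"] by linarith
  qed
  also have "\<dots> = 4 * (kabs i + kabs j) / n" by (simp add: add_divide_distrib)
  also have "\<dots> \<le> 4 * (2 * (kabs i * kabs j)) / n"
  proof (intro divide_right_mono mult_left_mono)
    have "0 \<le> (kabs i - 1) * kabs j" "0 \<le> kabs i * (kabs j - 1)" using k by auto
    then show "kabs i + kabs j \<le> 2 * (kabs i * kabs j)" by (simp add: algebra_simps)
  qed auto
  finally have X2: "X \<le> 8 * (kabs i * kabs j) / n" by simp
  \<comment> \<open>The power 1/4 is what the summability of |k|^(5/4) S permits, one full
    derivative being used by \<open>ker\<close>.\<close>
  have "X \<le> X powr (1/4)"
  proof (cases "X = 0")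
    case False
    then have "0 < X" by (simp add: X_def)
    then have "X powr 1 \<le> X powr (1/4)" using X1 by (intro powr_mono') auto
    then show ?thesis using \<open>0 < X\<close> by simp
  qed simp
  also have "\<dots> \<le> (8 * (kabs i * kabs j) / n) powr (1/4)" using X2 by (intro powr_mono2) (auto simp: X_def)
  also have "\<dots> = 8 powr (1/4) * (kabs i powr (1/4) * kabs j powr (1/4)) * real n powr (- 1/4)"
  proof -
    have "real n powr (- 1/4) = inverse (real n powr (1/4))" using powr_minus[of "real n" "1/4"] by simp
    then show ?thesis unfolding powr_divide powr_mult by (simp only: divide_inverse[of _ "real n powr _"])
  qed
  also have "\<dots> \<le> 8 * (kabs i powr (1/4) * kabs j powr (1/4)) * real n powr (- 1/4)"
  proof (intro mult_right_mono)
    have "(8::real) powr (1/4) \<le> 8 powr 1" by (intro powr_mono) auto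
    then show "(8::real) powr (1/4) \<le> 8" by simp
  qed auto
  finally show ?thesis unfolding X_def by (simp only: mult_ac)
qed

lemma has_sum_finite_sum:
  fixes g :: "'a \<Rightarrow> 'b \<Rightarrow> real"
  assumes "finite F" "\<And>k. (g k has_sum h k) UNIV"
  shows "((\<lambda>j. \<Sum>k\<in>F. g k j) has_sum (\<Sum>k\<in>F. h k)) UNIV"
  using assms(1) by induction (auto intro!: has_sum_add assms(2))

section \<open>The equation of the Fejer means\<close>

context visc
begin

definition mc :: "nat \<Rightarrow> real \<Rightarrow> coef" where "mc n t k = of_real (mm n k) * c t k"
definition mf :: "nat \<Rightarrow> coef" where "mf n k = of_real (mm n k) * fcoeff f k"
text \<open>The commutator: nonlinearity of the Fejer mean minus Fejer mean of the
  nonlinearity.\<close>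

definition mg :: "nat \<Rightarrow> real \<Rightarrow> coef" where
  "mg n t k = nlb (Bx (2 * n)) (st (mc n t)) (mc n t) k - of_real (mm n k) * Nl (\<theta> t) k"

lemma mc_sym: "symc (mc n t)" unfolding mc_def by (rule symc_real) (rule symc_fcoeff, rule mm_uminus)

lemma mc_supp: "supp_in n (mc n t)"
  unfolding supp_in_def
proof (intro allI impI)
  fix k assume "k \<notin> Bx n"
  then show "mc n t k = 0" by (cases "k = 0") (simp_all add: mc_def mm_supp)
qed

lemma mg_has_sum: "((\<lambda>j. - of_real (ker k j * (mm n (k - j) * mm n j - mm n k)) * c t j * c t (k - j)) has_sum mg n t k) UNIV"
proof -
  have "((\<lambda>j. - of_real (crs k j) * st (mc n t) (k - j) * mc n t j) has_sum nlb (Bx (2 * n)) (st (mc n t)) (mc n t) k) UNIV"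
    unfolding nlb_def
  proof (rule has_sum_finite_neutralI[OF finite_Bx subset_UNIV _ refl])
    fix j assume "j \<in> UNIV - Bx (2 * n)"
    then have "j \<notin> Bx n" using Bx_mono[of n "2 * n"] by auto
    then show "- of_real (crs k j) * st (mc n t) (k - j) * mc n t j = 0" using supp_inD[OF mc_supp] by simp
  qed
  from has_sum_add[OF this has_sum_cmult_right[OF Nl_has_sum[where a = "\<theta> t" and k = k], of "- of_real (mm n k)"]]
  have "((\<lambda>j. - of_real (crs k j) * st (mc n t) (k - j) * mc n t j + - of_real (mm n k) * (- of_real (ker k j) * c t j * c t (k - j)))
    has_sum nlb (Bx (2 * n)) (st (mc n t)) (mc n t) k + - of_real (mm n k) * Nl (\<theta> t) k) UNIV" .
  moreover have "- of_real (crs k j) * st (mc n t) (k - j) * mc n t j + - of_real (mm n k) * (- of_real (ker k j) * c t j * c t (k - j))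
    = - of_real (ker k j * (mm n (k - j) * mm n j - mm n k)) * c t j * c t (k - j)" for j
    unfolding st_def mc_def ker_def by (simp add: algebra_simps)
  ultimately show ?thesis unfolding mg_def by (simp only: mult_minus_left diff_conv_add_uminus)
qed

text \<open>\<open>ker\<close> costs |j| and \<open>mm_commutator\<close> a quarter power on each
  factor, so the double sum factorises into the square of the sum of |k|^(5/4) S(k).\<close>

lemma mg_sum:
  assumes S: "\<And>k. 0 \<le> S k" "S 0 = 0" "\<And>k. cmod (c t k) \<le> S k" and T: "(\<lambda>k. kabs k powr (5/4) * S k) summable_on UNIV" and n: "0 < n" and F: "finite F"
  shows "(\<Sum>k\<in>F. cmod (mg n t k)) \<le> 8 * real n powr (- 1/4) * (\<Sum>\<^sub>\<infinity>k. kabs k powr (5/4) * S k)^2"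
proof -
  define T where "T = (\<lambda>k. kabs k powr (5/4) * S k)"
  define Z where "Z = infsum T UNIV"
  define N where "N = 8 * real n powr (- 1/4)"
  have N0: "0 \<le> N" by (simp add: N_def)
  have T0: "0 \<le> T k" for k unfolding T_def using S(1) by simp
  have Ts: "T summable_on UNIV" using T unfolding T_def .
  have Tb: "(\<Sum>k\<in>G. T k) \<le> Z" if "finite G" for G
    unfolding Z_def using Ts T0 that by (intro finite_sum_le_infsum) auto
  have T1: "T k \<le> Z" for k using Tb[of "{k}"] by simp
  have Ti: "T (k - j) \<le> Z" for k j by (rule T1)
  have sm: "(\<lambda>j. T (k - j) * T j) summable_on UNIV" for k
  proof (rule summable_on_comparison_test[OF summable_on_cmult_right[OF Ts, of Z]])
    fix j show "T (k - j) * T j \<le> Z * T j" by (intro mult_right_mono T1 T0)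
  qed (simp add: T0)
  have tm: "cmod (- of_real (ker k j * (mm n (k - j) * mm n j - mm n k)) * c t j * c t (k - j)) \<le> N * (T (k - j) * T j)" for k j
  proof (cases "j = 0 \<or> k - j = 0")
    case True
    then have "c t j = 0 \<or> c t (k - j) = 0" by auto
    then have "- of_real (ker k j * (mm n (k - j) * mm n j - mm n k)) * c t j * c t (k - j) = 0" by auto
    then show ?thesis unfolding N_def by (simp only: norm_zero) (intro mult_nonneg_nonneg T0; simp)
  next
    case False
    then have nz: "k - j \<noteq> 0" "j \<noteq> 0" by auto
    have p: "kabs j * kabs j powr (1/4) = kabs j powr (5/4)" "kabs (k - j) powr (1/4) \<le> kabs (k - j) powr (5/4)"
      using kabs_ge_1[OF nz(1)] kabs_pos[OF nz(2)] powr_add[of "kabs j" 1 "1/4"] by (auto intro: powr_mono)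
    have "cmod (- of_real (ker k j * (mm n (k - j) * mm n j - mm n k)) * c t j * c t (k - j))
      = \<bar>ker k j\<bar> * \<bar>mm n (k - j) * mm n j - mm n (k - j + j)\<bar> * cmod (c t j) * cmod (c t (k - j))"
      unfolding norm_mult norm_minus_cancel norm_of_real abs_mult diff_add_cancel ..
    also have "\<dots> \<le> kabs j * (N * (kabs (k - j) powr (1/4) * kabs j powr (1/4))) * S j * S (k - j)"
      unfolding N_def by (intro mult_mono abs_ker mm_commutator[OF n nz] S mult_nonneg_nonneg) auto
    also have "\<dots> = N * (kabs j * kabs j powr (1/4)) * kabs (k - j) powr (1/4) * S j * S (k - j)" by (simp only: mult_ac)
    also have "\<dots> \<le> N * kabs j powr (5/4) * kabs (k - j) powr (5/4) * S j * S (k - j)"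
      unfolding p(1) using N0 S(1) by (intro mult_right_mono mult_left_mono p(2)) auto
    also have "\<dots> = N * (T (k - j) * T j)" unfolding T_def by (simp only: mult_ac)
    finally show ?thesis .
  qed
  have 1: "cmod (mg n t k) \<le> N * (\<Sum>\<^sub>\<infinity>j. T (k - j) * T j)" for k
    by (rule norm_infsum_le[OF mg_has_sum has_sum_cmult_right[OF has_sum_infsum[OF sm]] tm])
  have 2: "(\<Sum>k\<in>F. cmod (mg n t k)) \<le> N * (\<Sum>k\<in>F. \<Sum>\<^sub>\<infinity>j. T (k - j) * T j)"
    unfolding sum_distrib_left by (rule sum_mono) (rule 1)
  have "((\<lambda>j. \<Sum>k\<in>F. T (k - j) * T j) has_sum (\<Sum>k\<in>F. \<Sum>\<^sub>\<infinity>j. T (k - j) * T j)) UNIV"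
    by (rule has_sum_finite_sum[OF F has_sum_infsum[OF sm]])
  note hs = this
  have "(\<Sum>k\<in>F. \<Sum>\<^sub>\<infinity>j. T (k - j) * T j) = (\<Sum>\<^sub>\<infinity>j. \<Sum>k\<in>F. T (k - j) * T j)"
    using infsumI[OF hs] by simp
  also have "\<dots> \<le> (\<Sum>\<^sub>\<infinity>j. Z * T j)"
  proof (rule infsum_mono)
    show "(\<lambda>j. \<Sum>k\<in>F. T (k - j) * T j) summable_on UNIV" using hs by (rule has_sum_imp_summable)
    show "(\<lambda>j. Z * T j) summable_on UNIV" by (rule summable_on_cmult_right[OF Ts])
    fix j
    have "(\<Sum>k\<in>F. T (k - j)) = (\<Sum>m\<in>(\<lambda>k. k - j) ` F. T m)" by (subst sum.reindex) (auto simp: inj_on_def)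
    also have "\<dots> \<le> Z" by (rule Tb) (use F in simp)
    finally show "(\<Sum>k\<in>F. T (k - j) * T j) \<le> Z * T j" unfolding sum_distrib_right[symmetric] by (intro mult_right_mono T0)
  qed
  also have "\<dots> = Z * Z" unfolding infsum_cmult_right' Z_def ..
  finally have "(\<Sum>k\<in>F. cmod (mg n t k)) \<le> N * (Z * Z)" using 2 N0 by (meson mult_left_mono order_trans)
  then show ?thesis unfolding N_def Z_def T_def power2_eq_square .
qed

text \<open>How large \<open>n\<close> must be depends on the solution and on \<epsilon>, through
  \<open>S\<close> and \<open>A\<close>. The conclusion contains only the normalised bound
  1.\<close>

lemma moll:
  assumes a: "0 < a" "a < b" and ae: "AE x in TM. \<bar>rep_L2 f x\<bar> \<le> \<Phi>"
  obtains N where "\<And>n. N \<le> n \<Longrightarrow> 0 < n \<and> evol_base n a b \<epsilon> \<Phi> (mc n) (mg n) (mf n)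
    \<and> (\<forall>t\<in>{a..b}. (\<Sum>k\<in>Bx (2 * n). (kabs k)^3 * (cmod (mc n t k) * cmod (mg n t k))) \<le> 1)"
proof -
  obtain S A where S: "\<And>k. 0 \<le> S k" "S 0 = 0" "\<And>t k. t \<in> {a..b} \<Longrightarrow> cmod (c t k) \<le> S k"
    "\<And>k. S k * (kabs k)^3 \<le> A" "(\<lambda>k. kabs k powr (5/4) * S k) summable_on UNIV"
    using regularity[OF a(1) less_imp_le[OF a(2)]] by blast
  define Z where "Z = (\<Sum>\<^sub>\<infinity>k. kabs k powr (5/4) * S k)"
  have A0: "0 \<le> A" using S(4)[of 0] by simp
  \<comment> \<open>The factor 1 + A treats the plain error and the one weighted with |k|^3 |c| at
    the same time.\<close>
  have "((\<lambda>n. 8 * real n powr (- 1/4) * Z^2 * (1 + A)) \<longlongrightarrow> 0) sequentially" by real_asymp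
  from order_tendstoD(2)[OF this zero_less_one] obtain N where N: "\<And>n. N \<le> n \<Longrightarrow> 8 * real n powr (- 1/4) * Z^2 * (1 + A) < 1"
    unfolding eventually_sequentially by blast
  show ?thesis
  proof (rule that[of "max N 1"])
    fix n assume n: "max N 1 \<le> n"
    then have n0: "0 < n" by simp
    define q where "q = 8 * real n powr (- 1/4) * Z^2"
    have q: "0 \<le> q" "q * (1 + A) \<le> 1" using N[of n] n by (auto simp: q_def)
    have gs: "(\<Sum>k\<in>Bx (2 * n). cmod (mg n t k)) \<le> q" if "t \<in> {a..b}" for t
      unfolding q_def Z_def by (rule mg_sum[OF S(1,2) S(3)[OF that] S(5) n0 finite_Bx])
    have "q \<le> q * (1 + A)" using q A0 by (simp add: mult_le_cancel_left1)
    then have q1: "q \<le> 1" using q by linarith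
    have "evol_base n a b \<epsilon> \<Phi> (mc n) (mg n) (mf n)"
    proof
      fix t k assume t: "t \<in> {a..b}"
      have "((\<lambda>t. mc n t k) has_vector_derivative of_real (mm n k) * rhs t k) (at t within {a..b})"
        unfolding mc_def using t a by (intro has_vector_derivative_mult_right ode_within) auto
      moreover have "of_real (mm n k) * rhs t k = mf n k + mg n t k - nlb (Bx (2 * n)) (st (mc n t)) (mc n t) k - of_real (kabs k + \<epsilon> * (kabs k)^2) * mc n t k"
        unfolding rhs_def mf_def mg_def mc_def by (simp add: algebra_simps)
      ultimately show "((\<lambda>t. mc n t k) has_vector_derivative mf n k + mg n t k - nlb (Bx (2 * n)) (st (mc n t)) (mc n t) k - of_real (kabs k + \<epsilon> * (kabs k)^2) * mc n t k) (at t within {a..b})" by simp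
    next
      show "\<bar>tp (Bx (2 * n)) (mf n) x\<bar> \<le> \<Phi>" for x unfolding mf_def by (rule fejer_bound[OF ae n0])
      show "(\<Sum>k\<in>Bx (2 * n). cmod (mg n t k)) \<le> 1" if "t \<in> {a..b}" for t using gs[OF that] q1 by linarith
    qed (rule a(2), rule less_imp_le[OF eps], rule mc_sym, rule mc_supp)
    moreover have "(\<Sum>k\<in>Bx (2 * n). (kabs k)^3 * (cmod (mc n t k) * cmod (mg n t k))) \<le> 1" if t: "t \<in> {a..b}" for t
    proof -
      have "(\<Sum>k\<in>Bx (2 * n). (kabs k)^3 * (cmod (mc n t k) * cmod (mg n t k))) \<le> (\<Sum>k\<in>Bx (2 * n). A * cmod (mg n t k))"
      proof (rule sum_mono)
        fix k
        have "cmod (mc n t k) \<le> 1 * S k" unfolding mc_def norm_mult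
          using mm_nonneg[of n k] mm_le_1[of n k] by (intro mult_mono S(3) t) auto
        then have "(kabs k)^3 * cmod (mc n t k) \<le> (kabs k)^3 * S k" by (intro mult_left_mono) auto
        then have "(kabs k)^3 * cmod (mc n t k) \<le> A" using S(4)[of k] by (simp add: mult.commute)
        from mult_right_mono[OF this norm_ge_zero[of "mg n t k"]]
        show "(kabs k)^3 * (cmod (mc n t k) * cmod (mg n t k)) \<le> A * cmod (mg n t k)" by (simp only: mult.assoc)
      qed
      also have "\<dots> \<le> A * q" unfolding sum_distrib_left[symmetric] using gs[OF t] A0 by (rule mult_left_mono)
      also have "\<dots> \<le> 1" using q by (simp add: distrib_left mult.commute)
      finally show ?thesis .
    qed
    ultimately show "0 < n \<and> evol_base n a b \<epsilon> \<Phi> (mc n) (mg n) (mf n)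
      \<and> (\<forall>t\<in>{a..b}. (\<Sum>k\<in>Bx (2 * n). (kabs k)^3 * (cmod (mc n t k) * cmod (mg n t k))) \<le> 1)" using n0 by blast
  qed
qed

end

section \<open>The uniform bound at time 1 and the passage to the limit\<close>

definition cL :: "real \<Rightarrow> real \<Rightarrow> real" where "cL R \<Phi>1 = sqrt ((R + 1)^2 + \<Phi>1^2 + 2)"
text \<open>The sup bound at least 1/8 after the starting time, hence the factor 8^2.\<close>

definition cM :: "real \<Rightarrow> real \<Rightarrow> real \<Rightarrow> real" where "cM R \<Phi> \<Phi>1 = 64 * Kinf \<Phi> (cL R \<Phi>1)"
text \<open>The energy gets half a unit of time, whence 2^4 = 16; the Hoelder constant gets a
  quarter, whence the factor 4 on \<open>hol_B\<close>.\<close>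

definition cC :: "real \<Rightarrow> real \<Rightarrow> real \<Rightarrow> real" where
  "cC R \<Phi> \<Phi>1 = 16 * hh_C (cM R \<Phi> \<Phi>1) (4 * hol_B \<Phi> (cM R \<Phi> \<Phi>1)) (hol_alpha (cM R \<Phi> \<Phi>1)) (cL R \<Phi>1) \<Phi>1"

lemma cL_pos: "0 < cL R \<Phi>1" unfolding cL_def by (simp add: add_nonneg_pos)

text \<open>Sup bound from \<open>a\<close> to 1/4, Hoelder bound from 1/4 to 1/2, energy from 1/2
  to 1, each restarting the evolution of the Fejer means. The result does not depend on
  \<open>n\<close>, so the Fejer weights can tend to 1 on a finite set of frequencies.\<close>

lemma (in visc) uniform_bound:
  assumes R: "norm (\<theta> 0) \<le> R" and ae: "AE x in TM. \<bar>rep_L2 f x\<bar> \<le> \<Phi>" and G: "finite G" "0 \<notin> G"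
  shows "(\<Sum>k\<in>G. (kabs k)^3 * (cmod (c 1 k))^2) \<le> cC R \<Phi> (sobolev_norm 1 f)"
proof -
  define \<Phi>1 where "\<Phi>1 = sobolev_norm 1 f"
  define L where "L = cL R \<Phi>1"
  define M where "M = cM R \<Phi> \<Phi>1"
  define B where "B = 4 * hol_B \<Phi> M"
  define \<alpha> where "\<alpha> = hol_alpha M"
  have L: "0 < L" "L^2 = (R + 1)^2 + \<Phi>1^2 + 2" unfolding L_def using cL_pos by (auto simp: cL_def)
  have R0: "0 \<le> R" using R norm_ge_zero[of "\<theta> 0"] by linarith
  have "((\<lambda>t. norm (\<theta> t)) \<longlongrightarrow> norm (\<theta> 0)) (at 0 within {0..1})"
    using cont[of 0 1] by (intro tendsto_norm) (auto simp: continuous_on_def)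
  from order_tendstoD(2)[OF this, of "R + 1"] R obtain d where d: "0 < d" "\<And>t. t \<in> {0..1} \<Longrightarrow> t \<noteq> 0 \<Longrightarrow> dist t 0 < d \<Longrightarrow> norm (\<theta> t) < R + 1"
    unfolding eventually_at by auto
  \<comment> \<open>A positive starting time, because the majorant of \<open>regularity\<close>
    exists only away from time 0. Continuity keeps the norm below \<open>R + 1\<close> there, and a
    \<le> 1/8 leaves room before time 1/4.\<close>
  define a where "a = min (d / 2) (1 / 8)"
  have a: "0 < a" "a \<le> 1 / 8" "norm (\<theta> a) < R + 1" using d(1) d(2)[of a] by (auto simp: a_def min_def)
  obtain N where N: "\<And>n. N \<le> n \<Longrightarrow> 0 < n \<and> evol_base n a 1 \<epsilon> \<Phi> (mc n) (mg n) (mf n)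
    \<and> (\<forall>t\<in>{a..1}. (\<Sum>k\<in>Bx (2 * n). (kabs k)^3 * (cmod (mc n t k) * cmod (mg n t k))) \<le> 1)"
    using moll[OF a(1) _ ae, of 1] a(2) by auto
  have main: "(\<Sum>k\<in>Bx (2 * n). (kabs k)^3 * (cmod (mc n 1 k))^2) \<le> cC R \<Phi> \<Phi>1" if n: "N \<le> n" for n
  proof -
    interpret base: evol_base n a 1 \<epsilon> \<Phi> "mc n" "mg n" "mf n" using N[OF n] by blast
    have gc: "(\<Sum>k\<in>Bx (2 * n). (kabs k)^3 * (cmod (mc n t k) * cmod (mg n t k))) \<le> 1" if "t \<in> {a..1}" for t
      using N[OF n] that by blast
    have mle: "cmod (of_real (mm n k) * z) \<le> cmod z" for k z
      unfolding norm_mult using mm_nonneg[of n k] mm_le_1[of n k] by (simp add: mult_left_le_one_le)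
    have f1': "(\<Sum>k\<in>Bx (2 * n). (kabs k * cmod (mf n k))^2) \<le> \<Phi>1^2"
    proof -
      have "(\<Sum>k\<in>Bx (2 * n). (kabs k * cmod (mf n k))^2) \<le> (\<Sum>k\<in>Bx (2 * n). (kabs k * cmod (fcoeff f k))^2)"
        unfolding mf_def by (intro sum_mono power_mono mult_left_mono mle) auto
      then show ?thesis using sobolev1_sums[OF f1 finite_Bx, of "2 * n"] unfolding \<Phi>1_def by linarith
    qed
    have l2: "(\<Sum>k\<in>Bx (2 * n). (cmod (mc n t k))^2) \<le> L^2" if t: "t \<in> {a..1}" for t
    proof -
      have "(\<Sum>k\<in>Bx (2 * n). (cmod (mc n a k))^2) \<le> (\<Sum>k\<in>Bx (2 * n). (cmod (c a k))^2)"
        unfolding mc_def by (intro sum_mono power_mono mle) auto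
      also have "\<dots> \<le> (norm (\<theta> a))^2 / (2 * pi)^2" by (rule fcoeff_square_bound) simp
      also have "\<dots> \<le> (norm (\<theta> a))^2 / 1" using pi_gt3 one_le_power[of "2 * pi" 2] by (intro divide_left_mono) auto
      also have "\<dots> \<le> (R + 1)^2" using a(3) by (simp add: power_mono)
      finally have "(\<Sum>k\<in>Bx (2 * n). (cmod (mc n a k))^2) \<le> (R + 1)^2" .
      moreover have "(\<Phi>1^2 + 2) * (t - a) \<le> (\<Phi>1^2 + 2) * 1" using t a by (intro mult_left_mono) auto
      ultimately have "(\<Sum>k\<in>Bx (2 * n). (cmod (mc n a k))^2) + (\<Phi>1^2 + 2) * (t - a) \<le> (R + 1)^2 + (\<Phi>1^2 + 2) * 1" by (rule add_mono)
      moreover have "(\<Sum>k\<in>Bx (2 * n). (cmod (mc n t k))^2) \<le> (\<Sum>k\<in>Bx (2 * n). (cmod (mc n a k))^2) + (\<Phi>1^2 + 2) * (t - a)"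
        by (rule base.l2_growth[OF f1' gc t])
      ultimately show ?thesis unfolding L(2) by (simp only: mult_1_right add.assoc)
    qed
    interpret e: evol n a 1 \<epsilon> \<Phi> "mc n" "mg n" "mf n" L by unfold_locales (use l2 L in auto)
    have K1: "1 \<le> Kinf \<Phi> L" unfolding Kinf_def using base.phi_nonneg L(1) Z4_pos by simp
    have M: "1 \<le> M" unfolding M_def cM_def L_def[symmetric] using K1 by simp
    have sup: "\<bar>tp (Bx (2 * n)) (mc n t) x\<bar> \<le> M" if t: "t \<in> {1/4..1}" for t x
    proof -
      have "\<bar>tp (Bx (2 * n)) (mc n t) x\<bar> \<le> Kinf \<Phi> L / (t - a)^2" using t a by (intro e.linf) auto
      also have "\<dots> \<le> Kinf \<Phi> L / (1 / 8)^2"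
        using t a K1 by (intro divide_left_mono power_mono mult_pos_pos zero_less_power) auto
      finally show ?thesis unfolding M_def cM_def L_def[symmetric] by (simp add: power2_eq_square)
    qed
    interpret e4: evol n "1/4" 1 \<epsilon> \<Phi> "mc n" "mg n" "mf n" L by (rule e.evol_sub) (use a in auto)
    have B0: "0 < hol_B \<Phi> M" unfolding hol_B_def using base.phi_nonneg M k0_pos by (simp add: add_nonneg_pos add_pos_nonneg)
    have hol: "\<bar>tp (Bx (2 * n)) (sh h (mc n t)) x\<bar> \<le> B * norm h powr \<alpha>" if t: "t \<in> {1/2..1}" for t x h
    proof -
      have "\<bar>tp (Bx (2 * n)) (sh h (mc n t)) x\<bar> \<le> hol_B \<Phi> M / (t - 1 / 4) * norm h powr \<alpha>"
        unfolding \<alpha>_def using t by (intro e4.holder M sup) auto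
      also have "\<dots> \<le> hol_B \<Phi> M / (1 / 4) * norm h powr \<alpha>"
        using t B0 by (intro mult_right_mono divide_left_mono) auto
      finally show ?thesis unfolding B_def by (simp add: mult.commute)
    qed
    interpret e2: evol n "1/2" 1 \<epsilon> \<Phi> "mc n" "mg n" "mf n" L by (rule e.evol_sub) (use a in auto)
    have "(1 - 1 / 2)^4 * (\<Sum>k\<in>Bx (2 * n). (kabs k)^3 * (cmod (mc n 1 k))^2) \<le> hh_C M B \<alpha> L \<Phi>1"
    proof (rule e2.half_bound[OF M])
      show "0 < B" unfolding B_def using B0 by simp
      show "0 < \<alpha>" "\<alpha> \<le> 1" unfolding \<alpha>_def using hol_alpha[OF M] by auto
      show "(\<Sum>k\<in>Bx (2 * n). (kabs k)^3 * (cmod (mc n t k) * cmod (mg n t k))) \<le> 1" if "t \<in> {1/2..1}" for t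
        using gc[of t] that a by auto
    qed (use sup hol f1' in auto)
    then show ?thesis unfolding cC_def M_def B_def \<alpha>_def L_def by (simp add: eval_nat_numeral)
  qed
  obtain m where m: "G \<subseteq> Bx m" using finite_subset_Bx[OF G] by blast
  have lim: "(\<lambda>n. mm n k) \<longlonglongrightarrow> 1" for k
  proof (rule tendsto_sandwich[where f = "\<lambda>n. 1 - 2 * kabs k / real n" and h = "\<lambda>_. 1"])
    show "\<forall>\<^sub>F n in sequentially. 1 - 2 * kabs k / real n \<le> mm n k"
      using eventually_gt_at_top[of 0] by eventually_elim (use mm_ge[of _ k] in \<open>simp add: algebra_simps\<close>)
    show "\<forall>\<^sub>F n in sequentially. mm n k \<le> 1" by (simp add: mm_le_1)
    show "(\<lambda>n. 1 - 2 * kabs k / real n) \<longlonglongrightarrow> 1" by real_asymp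
  qed simp
  have "(\<lambda>n. \<Sum>k\<in>G. (kabs k)^3 * (cmod (of_real (mm n k) * c 1 k))^2) \<longlonglongrightarrow> (\<Sum>k\<in>G. (kabs k)^3 * (cmod (of_real 1 * c 1 k))^2)"
    by (intro tendsto_intros lim)
  then have "(\<Sum>k\<in>G. (kabs k)^3 * (cmod (of_real 1 * c 1 k))^2) \<le> cC R \<Phi> \<Phi>1"
  proof (rule tendsto_upperbound)
    show "\<forall>\<^sub>F n in sequentially. (\<Sum>k\<in>G. (kabs k)^3 * (cmod (of_real (mm n k) * c 1 k))^2) \<le> cC R \<Phi> \<Phi>1"
      using eventually_ge_at_top[of "max N m"]
    proof eventually_elim
      fix n assume n: "max N m \<le> n"
      have "(\<Sum>k\<in>G. (kabs k)^3 * (cmod (mc n 1 k))^2) \<le> (\<Sum>k\<in>Bx (2 * n). (kabs k)^3 * (cmod (mc n 1 k))^2)"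
        using m Bx_mono[of m "2 * n"] n by (intro sum_mono2) auto
      then show "(\<Sum>k\<in>G. (kabs k)^3 * (cmod (of_real (mm n k) * c 1 k))^2) \<le> cC R \<Phi> \<Phi>1"
        using main[of n] n unfolding mc_def by simp
    qed
  qed simp
  then show ?thesis unfolding \<Phi>1_def by simp
qed

text \<open>Expresses a coefficient by two inner products, so that weak convergence implies
  convergence of each coefficient.\<close>

lemma fcoeff_inner:
  assumes "k \<noteq> 0"
  shows "fcoeff a k = Complex (inner a (tpL {k} (\<lambda>_. 1)) / (2 * pi)^2) (inner a (tpL {k} (\<lambda>_. \<i>)) / (2 * pi)^2)"
  using assms by (simp add: inner_tpL complex_eq_iff)

lemma sobolev_norm_le:
  assumes "\<And>G. finite G \<Longrightarrow> 0 \<notin> G \<Longrightarrow> (\<Sum>k\<in>G. (kabs k)^3 * (cmod (fcoeff a k))^2) \<le> C"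
  shows "a \<in> sobolev (3/2)" "sobolev_norm (3/2) a \<le> sqrt C"
proof -
  have p: "kabs k powr (2 * (3/2)) = (kabs k)^3" if "k \<noteq> 0" for k
    using kabs_pos[OF that] by simp
  have b: "(\<Sum>k\<in>G. kabs k powr (2 * (3/2)) * (cmod (fcoeff a k))^2) \<le> C" if "finite G" "G \<subseteq> UNIV - {0}" for G
  proof -
    have "(\<Sum>k\<in>G. kabs k powr (2 * (3/2)) * (cmod (fcoeff a k))^2) = (\<Sum>k\<in>G. (kabs k)^3 * (cmod (fcoeff a k))^2)"
      using that(2) by (intro sum.cong refl arg_cong2[where f = "(*)"] p) auto
    then show ?thesis using assms[OF that(1)] that(2) by auto
  qed
  have s: "(\<lambda>k. kabs k powr (2 * (3/2)) * (cmod (fcoeff a k))^2) summable_on (UNIV - {0})"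
    by (rule nonneg_bdd_above_summable_on) (use b in \<open>auto intro!: bdd_aboveI2\<close>)
  show "a \<in> sobolev (3/2)" unfolding sobolev_def using s by blast
  have "(\<Sum>\<^sub>\<infinity>k\<in>UNIV - {0}. kabs k powr (2 * (3/2)) * (cmod (fcoeff a k))^2) \<le> C"
    using s b by (rule infsum_le_finite_sums)
  then show "sobolev_norm (3/2) a \<le> sqrt C" unfolding sobolev_norm_def by (rule real_sqrt_le_mono)
qed

theorem corollary1p3:
  fixes f :: L2 and A :: "L2 set"
  assumes "f \<in> Linfty \<inter> sobolev 1"
    and "global_attractor (SQG_flow f) A"
  shows "sobolev_bounded (3/2) A"
proof -
  have f1: "f \<in> sobolev 1" using assms(1) by simp
  obtain \<Phi> where \<Phi>: "AE x in TM. \<bar>rep_L2 f x\<bar> \<le> \<Phi>" using assms(1) unfolding Linfty_def by blast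
  have "compact A" and inv: "SQG_flow f 1 A = A" using assms(2) by (auto simp: global_attractor_def)
  then obtain R where R: "\<And>a. a \<in> A \<Longrightarrow> norm a \<le> R" using compact_imp_bounded bounded_iff by metis
  \<comment> \<open>\<open>R + 1\<close> instead of \<open>R\<close>, since the approximating
    initial values only converge to a point of \<open>A\<close>.\<close>
  define C where "C = cC (R + 1) \<Phi> (sobolev_norm 1 f)"
  have main: "(\<Sum>k\<in>G. (kabs k)^3 * (cmod (fcoeff a k))^2) \<le> C" if a: "a \<in> A" and G: "finite G" "0 \<notin> G" for a G
  proof -
    \<comment> \<open>Invariance lets every point of the attractor be reached after one unit of time
      from another point of it, which is the time the smoothing needs.\<close>
    have "a \<in> SQG_flow f 1 A" using a inv by simp
    then obtain \<theta> where th: "a = \<theta> 1" "vanishing_viscosity_solution f (\<theta> 0) \<theta>" "\<theta> 0 \<in> A" unfolding SQG_flow_def by blast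
    then obtain \<epsilon> \<theta>s where vv: "\<And>n. 0 < \<epsilon> n" "\<And>n. viscous_solution (\<epsilon> n) f (\<theta>s n)" "\<And>T. 0 < T \<Longrightarrow> weakly_uniform_limit {0..T} \<theta>s \<theta>"
      "(\<lambda>n. \<theta>s n 0) \<longlonglongrightarrow> \<theta> 0" unfolding vanishing_viscosity_solution_def by blast
    have w: "(\<lambda>n. inner (\<theta>s n 1) g) \<longlonglongrightarrow> inner a g" for g
    proof -
      have "uniform_limit {0..1} (\<lambda>n t. inner (\<theta>s n t) g) (\<lambda>t. inner (\<theta> t) g) sequentially"
        using vv(3)[of 1] unfolding weakly_uniform_limit_def by simp
      from tendsto_uniform_limitI[OF this, of 1] show ?thesis unfolding th(1) by simp
    qed
    have lim: "(\<lambda>n. fcoeff (\<theta>s n 1) k) \<longlonglongrightarrow> fcoeff a k" if "k \<in> G" for k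
    proof -
      have k: "k \<noteq> 0" using that G by blast
      show ?thesis unfolding fcoeff_inner[OF k] by (intro tendsto_Complex tendsto_divide tendsto_const w) simp_all
    qed
    have ev: "\<forall>\<^sub>F n in sequentially. (\<Sum>k\<in>G. (kabs k)^3 * (cmod (fcoeff (\<theta>s n 1) k))^2) \<le> C"
    proof -
      have "norm (\<theta> 0) < R + 1" using R[OF th(3)] by simp
      from order_tendstoD(2)[OF tendsto_norm[OF vv(4)] this] show ?thesis
      proof (rule eventually_mono)
        fix n assume n: "norm (\<theta>s n 0) < R + 1"
        interpret visc "\<epsilon> n" f "\<theta>s n" by unfold_locales (rule vv f1)+
        show "(\<Sum>k\<in>G. (kabs k)^3 * (cmod (fcoeff (\<theta>s n 1) k))^2) \<le> C"
          unfolding C_def by (rule uniform_bound[OF less_imp_le[OF n] \<Phi> G])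
      qed
    qed
    have "(\<lambda>n. \<Sum>k\<in>G. (kabs k)^3 * (cmod (fcoeff (\<theta>s n 1) k))^2) \<longlonglongrightarrow> (\<Sum>k\<in>G. (kabs k)^3 * (cmod (fcoeff a k))^2)"
      by (intro tendsto_sum tendsto_mult tendsto_const tendsto_power tendsto_norm lim)
    from tendsto_upperbound[OF this ev] show ?thesis by simp
  qed
  show ?thesis unfolding sobolev_bounded_def
    using sobolev_norm_le[OF main] by blast
qed

end
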